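(* Let $f\in W_2^{1/2}(\mathbb{T})\cap W_1^1(\mathbb{T})$, and assume that $f$ has only finitely many zeros $t_1,t_2,\dots,t_m$ in $\mathbb{T}$. Assume further that there exists $\delta>0$ satisfying the following for each $1\le j\le m$: (1) $f'(t)$ exists for every $t\in[t_j-\delta,t_j+\delta]\setminus\{t_j\}$. (2) There exists $g_j\in C^1[t_j-\delta,t_j+\delta]$ satisfying $$\frac{f'(t)}{f(t)}=\frac{g_j(t)}{t-t_j},\qquad \forall t\in[t_j-\delta,t_j+\delta]\setminus\{t_j\}.$$ (3) There exist $\beta_j>0$ and $h_j\in C^1[t_j-\delta,t_j+\delta]$ such that $|f(t)|^2=|t-t_j|^{\beta_j}h_j(t)$ and $h_j(t)>0$ for all $t\in[t_j-\delta,t_j+\delta]$. Then the Witten index $\operatorname{ind}_W T_f$ exists and it is given by the principal value integral $$\operatorname{ind}_W T_f=\frac{-1}{2\pi i}\;\mathrm{p.v.}\int_{\mathbb{T}}\frac{f'(t)}{f(t)}\,dt .$$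
   Context: $\mathbb{T}=\mathbb{R}/2\pi\mathbb{Z}$, identified with the unit circle via $t\mapsto e^{it}$; functions are complex-valued and $\int_{\mathbb{T}}\cdots dt$ is integration over a period of length $2\pi$. For $f\in L^1(\mathbb{T})$, $\hat f(n)=\frac1{2\pi}\int_{\mathbb{T}}f(t)e^{-int}dt$. $L^2(\mathbb{T})$ is taken with respect to $dt/2\pi$. $W_2^{1/2}(\mathbb{T})=\{f\in L^2(\mathbb{T}):\sum_{n\in\mathbb{Z}}(1+|n|)|\hat f(n)|^2<\infty\}$, and $W_1^1(\mathbb{T})$ is the set of absolutely continuous functions on $\mathbb{T}$. The Hardy space is $H^2=\{f\in L^2(\mathbb{T}):\hat f(n)=0\ \forall n<0\}$, $P_+$ is the orthogonal projection of $L^2(\mathbb{T})$ onto $H^2$, and for $f\in L^\infty(\mathbb{T})$ the Toeplitz operator $T_f\in B(H^2)$ is $T_fh=P_+(fh)$. For $f\in W_2^{1/2}(\mathbb{T})\cap L^\infty(\mathbb{T})$ the self-commutator $[T_f^*,T_f]=T_f^*T_f-T_fT_f^*$ is trace class. For a bounded operator $T$ on a Hilbert space with trace class self-commutator $[T^*,T]=T^*T-TT^*$, the Witten index is $$\operatorname{ind}_W T=\lim_{s\to+\infty}\operatorname{Tr}(e^{-sT^*T}-e^{-sTT^*}),$$ if the limit exists. The principal value integral is $\mathrm{p.v.}\int_{\mathbb{T}}\frac{f'(t)}{f(t)}dt=\lim_{\varepsilon\to+0}\int_{\mathbb{T}\setminus I_\varepsilon}\frac{f'(t)}{f(t)}dt$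 with $I_\varepsilon=\bigcup_{j=1}^m(t_j-\varepsilon,t_j+\varepsilon)$. The neighborhoods $[t_j-\delta,t_j+\delta]$ in $\mathbb{T}$ are regarded as real intervals (with $\delta<\pi$) when writing $t-t_j$. *)

theory Defs
  imports "HOL-Analysis.Analysis"
begin

section \<open>Complex Hilbert spaces, traces and the Witten index\<close>

text \<open>The inner product is conjugate-linear in the first and linear in the second argument.
  Positive definiteness is inherited from \<^class>\<open>real_inner\<close>.\<close>

class chilbert_space = real_inner + banach +
  fixes scaleC :: "complex \<Rightarrow> 'a \<Rightarrow> 'a" (infixr "*\<^sub>C" 75)
    and cinner :: "'a \<Rightarrow> 'a \<Rightarrow> complex"
  assumes scaleC_add_right: "c *\<^sub>C (x + y) = c *\<^sub>C x + c *\<^sub>C y"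
    and scaleC_add_left: "(c + d) *\<^sub>C x = c *\<^sub>C x + d *\<^sub>C x"
    and scaleC_scaleC: "c *\<^sub>C d *\<^sub>C x = (c * d) *\<^sub>C x"
    and scaleC_of_real: "complex_of_real r *\<^sub>C x = r *\<^sub>R x"
    and cinner_commute: "cinner y x = cnj (cinner x y)"
    and cinner_add_right: "cinner x (y + z) = cinner x y + cinner x z"
    and cinner_scaleC_right: "cinner x (c *\<^sub>C y) = c * cinner x y"
    and inner_eq_Re_cinner: "inner x y = Re (cinner x y)"

definition bounded_clinear :: "('a::chilbert_space \<Rightarrow> 'b::chilbert_space) \<Rightarrow> bool" where
  "bounded_clinear T \<longleftrightarrow> bounded_linear T \<and> (\<forall>c x. T (c *\<^sub>C x) = c *\<^sub>C T x)"

definition cadjoint :: "('a::chilbert_space \<Rightarrow> 'b::chilbert_space) \<Rightarrow> 'b \<Rightarrow> 'a" where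
  "cadjoint T = (THE S. \<forall>x y. cinner (S x) y = cinner x (T y))"

definition self_commutator :: "('a::chilbert_space \<Rightarrow> 'a) \<Rightarrow> 'a \<Rightarrow> 'a" where
  "self_commutator T = (\<lambda>x. cadjoint T (T x) - T (cadjoint T x))"

definition positive_op :: "('a::chilbert_space \<Rightarrow> 'a) \<Rightarrow> bool" where
  "positive_op P \<longleftrightarrow>
     bounded_clinear P \<and> (\<forall>x. Im (cinner x (P x)) = 0 \<and> 0 \<le> Re (cinner x (P x)))"

text \<open>The absolute value \<open>(A\<^sup>* A)\<^sup>1\<^sup>/\<^sup>2\<close>.\<close>

definition abs_op :: "('a::chilbert_space \<Rightarrow> 'a) \<Rightarrow> 'a \<Rightarrow> 'a" where
  "abs_op A = (THE P. positive_op P \<and> P \<circ> P = cadjoint A \<circ> A)"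

text \<open>Orthonormal bases in the sense of maximal orthonormal sets.\<close>

definition is_onb :: "'a::chilbert_space set \<Rightarrow> bool" where
  "is_onb E \<longleftrightarrow>
     (\<forall>e\<in>E. \<forall>e'\<in>E. cinner e e' = (if e = e' then 1 else 0)) \<and>
     (\<forall>x. (\<forall>e\<in>E. cinner e x = 0) \<longrightarrow> x = 0)"

definition trace_class :: "('a::chilbert_space \<Rightarrow> 'a) \<Rightarrow> bool" where
  "trace_class A \<longleftrightarrow> bounded_clinear A \<and>
     (\<exists>E. is_onb E \<and> (\<lambda>e. cinner e (abs_op A e)) summable_on E)"

text \<open>For trace class operators the value does not depend on the basis that is chosen.\<close>

definition trace_op :: "('a::chilbert_space \<Rightarrow> 'a) \<Rightarrow> complex" where
  "trace_op A = infsum (\<lambda>e. cinner e (A e)) (SOME E. is_onb E)"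

definition exp_op :: "('a::chilbert_space \<Rightarrow> 'a) \<Rightarrow> 'a \<Rightarrow> 'a" where
  "exp_op A = (\<lambda>x. \<Sum>n. (A ^^ n) x /\<^sub>R fact n)"

definition heat_difference :: "('a::chilbert_space \<Rightarrow> 'a) \<Rightarrow> real \<Rightarrow> 'a \<Rightarrow> 'a" where
  "heat_difference T s = (\<lambda>x. exp_op (\<lambda>y. (- s) *\<^sub>R cadjoint T (T y)) x
                            - exp_op (\<lambda>y. (- s) *\<^sub>R T (cadjoint T y)) x)"

text \<open>The trace class condition on the heat difference is a consequence of the one on the
  self-commutator; it is stated so that every trace under the limit is visibly meaningful.\<close>

definition has_witten_index :: "('a::chilbert_space \<Rightarrow> 'a) \<Rightarrow> complex \<Rightarrow> bool" where
  "has_witten_index T w \<longleftrightarrow>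
     bounded_clinear T \<and> trace_class (self_commutator T) \<and>
     (\<forall>s>0. trace_class (heat_difference T s)) \<and>
     ((\<lambda>s. trace_op (heat_difference T s)) \<longlongrightarrow> w) at_top"


section \<open>The space \<open>L\<^sup>2\<close> of the circle\<close>

text \<open>Functions on the circle are functions on the real line of period \<open>2\<pi>\<close>. The measure is
  \<open>dt/2\<pi>\<close> on the fundamental domain \<open>[0, 2\<pi>)\<close>, so that, up to null functions, only the values
  there matter for integration.\<close>

definition circle_measure :: "real measure" where
  "circle_measure = uniform_measure lborel {0..<2*pi}"

lemma sets_circle_measure [simp, measurable_cong]: "sets circle_measure = sets borel"
  and space_circle_measure [simp]: "space circle_measure = UNIV"
  by (simp_all add: circle_measure_def)

lemma emeasure_circle_measure_UNIV: "emeasure circle_measure UNIV = 1"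
  unfolding circle_measure_def
  by (subst emeasure_uniform_measure) (auto simp: ennreal_divide_self)

definition sq_integrable :: "(real \<Rightarrow> complex) \<Rightarrow> bool" where
  "sq_integrable f \<longleftrightarrow> f \<in> borel_measurable circle_measure \<and>
     integrable circle_measure (\<lambda>t. (norm (f t))\<^sup>2)"

lemma sq_integrable_measurable: "sq_integrable f \<Longrightarrow> f \<in> borel_measurable borel"
  by (simp add: sq_integrable_def measurable_def)

lemma sq_integrable_mult:
  assumes "sq_integrable f" "sq_integrable g"
  shows "integrable circle_measure (\<lambda>t. cnj (f t) * g t)"
proof (rule Bochner_Integration.integrable_bound)
  show "integrable circle_measure (\<lambda>t. (norm (f t))\<^sup>2 + (norm (g t))\<^sup>2)"
    using assms by (simp add: sq_integrable_def)
  note [measurable] = assms[THEN sq_integrable_measurable]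
  have "(\<lambda>t. cnj (f t)) \<in> borel_measurable borel"
    by (rule borel_measurable_continuous_on) (auto intro!: continuous_intros)
  then show "(\<lambda>t. cnj (f t) * g t) \<in> borel_measurable circle_measure"
    by measurable
  have "a * b \<le> a\<^sup>2 + b\<^sup>2" if "0 \<le> a" "0 \<le> b" for a b :: real
    using sum_squares_bound[of a b] mult_nonneg_nonneg[OF that] by linarith
  then show "AE t in circle_measure. norm (cnj (f t) * g t)
      \<le> norm ((norm (f t))\<^sup>2 + (norm (g t))\<^sup>2)"
    by (auto simp: norm_mult)
qed

lemma sq_integrable_add:
  assumes "sq_integrable f" "sq_integrable g"
  shows "sq_integrable (\<lambda>t. f t + g t)"
  unfolding sq_integrable_def
proof
  note [measurable] = assms[THEN sq_integrable_measurable]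
  show "(\<lambda>t. f t + g t) \<in> borel_measurable circle_measure" by measurable
  show "integrable circle_measure (\<lambda>t. (norm (f t + g t))\<^sup>2)"
  proof (rule Bochner_Integration.integrable_bound)
    show "integrable circle_measure (\<lambda>t. 2 * (norm (f t))\<^sup>2 + 2 * (norm (g t))\<^sup>2)"
      using assms by (simp add: sq_integrable_def)
    show "(\<lambda>t. (norm (f t + g t))\<^sup>2) \<in> borel_measurable circle_measure" by measurable
    have "(norm (f t + g t))\<^sup>2 \<le> 2 * (norm (f t))\<^sup>2 + 2 * (norm (g t))\<^sup>2" for t
    proof -
      have "(norm (f t + g t))\<^sup>2 \<le> (norm (f t) + norm (g t))\<^sup>2"
        by (intro power_mono norm_triangle_ineq) auto
      also have "\<dots> \<le> 2 * (norm (f t))\<^sup>2 + 2 * (norm (g t))\<^sup>2"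
        using sum_squares_bound[of "norm (f t)" "norm (g t)"] by (simp add: power2_sum)
      finally show ?thesis .
    qed
    then show "AE t in circle_measure. norm ((norm (f t + g t))\<^sup>2)
        \<le> norm (2 * (norm (f t))\<^sup>2 + 2 * (norm (g t))\<^sup>2)"
      by auto
  qed
qed

lemma sq_integrable_cmult: "sq_integrable f \<Longrightarrow> sq_integrable (\<lambda>t. c * f t)"
  unfolding sq_integrable_def by (auto simp: norm_mult power_mult_distrib)

lemma sq_integrable_uminus: "sq_integrable f \<Longrightarrow> sq_integrable (\<lambda>t. - f t)"
  unfolding sq_integrable_def by auto

lemma sq_integrable_zero: "sq_integrable (\<lambda>t. 0)"
  unfolding sq_integrable_def by auto

quotient_type circle_L2 = "real \<Rightarrow> complex" /
  partial: "\<lambda>f g. sq_integrable f \<and> sq_integrable g \<and> (AE t in circle_measure. f t = g t)"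
proof (rule part_equivpI)
  show "\<exists>f. sq_integrable f \<and> sq_integrable f \<and> (AE t in circle_measure. f t = f t)"
    using sq_integrable_zero by auto
qed (auto intro!: sympI transpI elim: AE_mp)

lemma integral_cong_AE_cinner:
  assumes "sq_integrable f" "sq_integrable f'" "AE t in circle_measure. f t = f' t"
    and "sq_integrable g" "sq_integrable g'" "AE t in circle_measure. g t = g' t"
  shows "(\<integral>t. cnj (f t) * g t \<partial>circle_measure) = (\<integral>t. cnj (f' t) * g' t \<partial>circle_measure)"
proof (rule integral_cong_AE)
  show "(\<lambda>t. cnj (f t) * g t) \<in> borel_measurable circle_measure"
    using sq_integrable_mult[OF assms(1,4)] by auto
  show "(\<lambda>t. cnj (f' t) * g' t) \<in> borel_measurable circle_measure"
    using sq_integrable_mult[OF assms(2,5)] by auto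
  show "AE t in circle_measure. cnj (f t) * g t = cnj (f' t) * g' t"
    using assms(3,6) by eventually_elim simp
qed

lift_definition cinner_L2 :: "circle_L2 \<Rightarrow> circle_L2 \<Rightarrow> complex"
  is "\<lambda>f g. \<integral>t. cnj (f t) * g t \<partial>circle_measure"
  using integral_cong_AE_cinner by blast

lift_definition scaleC_L2 :: "complex \<Rightarrow> circle_L2 \<Rightarrow> circle_L2"
  is "\<lambda>c f t. c * f t"
  by (auto intro: sq_integrable_cmult elim: AE_mp)

instantiation circle_L2 :: real_vector
begin

lift_definition zero_circle_L2 :: circle_L2 is "\<lambda>t. 0"
  by (auto intro: sq_integrable_zero)

lift_definition plus_circle_L2 :: "circle_L2 \<Rightarrow> circle_L2 \<Rightarrow> circle_L2" is "\<lambda>f g t. f t + g t"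
  by (auto intro: sq_integrable_add)

lift_definition uminus_circle_L2 :: "circle_L2 \<Rightarrow> circle_L2" is "\<lambda>f t. - f t"
  by (auto intro: sq_integrable_uminus)

definition minus_circle_L2 :: "circle_L2 \<Rightarrow> circle_L2 \<Rightarrow> circle_L2" where
  "minus_circle_L2 x y = x + (- y)"

definition scaleR_circle_L2 :: "real \<Rightarrow> circle_L2 \<Rightarrow> circle_L2" where
  "scaleR_circle_L2 r x = scaleC_L2 (complex_of_real r) x"

instance
proof
  fix x y z :: circle_L2 and r s :: real
  show "x + y + z = x + (y + z)"
    by transfer (auto intro!: sq_integrable_add simp: add.assoc)
  show "x + y = y + x"
    by transfer (auto intro!: sq_integrable_add simp: add.commute)
  show "0 + x = x"
    by transfer auto
  show "- x + x = 0"
    by transfer (auto intro!: sq_integrable_zero)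
  show "x - y = x + - y"
    by (rule minus_circle_L2_def)
  show "r *\<^sub>R (x + y) = r *\<^sub>R x + r *\<^sub>R y"
    unfolding scaleR_circle_L2_def
    by transfer (auto intro!: sq_integrable_add sq_integrable_cmult simp: distrib_left)
  show "(r + s) *\<^sub>R x = r *\<^sub>R x + s *\<^sub>R x"
    unfolding scaleR_circle_L2_def
    by transfer
       (auto intro!: sq_integrable_add sq_integrable_cmult simp: distrib_right[symmetric])
  show "r *\<^sub>R s *\<^sub>R x = (r * s) *\<^sub>R x"
    unfolding scaleR_circle_L2_def
    by transfer (auto intro!: sq_integrable_cmult simp: mult.assoc)
  show "1 *\<^sub>R x = x"
    unfolding scaleR_circle_L2_def by transfer auto
qed

end

lemma cinner_L2_commute: "cinner_L2 y x = cnj (cinner_L2 x y)"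
proof transfer
  fix f g :: "real \<Rightarrow> complex"
  have "cnj (\<integral>t. cnj (f t) * g t \<partial>circle_measure) = (\<integral>t. cnj (cnj (f t) * g t) \<partial>circle_measure)"
    by (rule Bochner_Integration.integral_cnj[symmetric])
  then show "(\<integral>t. cnj (g t) * f t \<partial>circle_measure) = cnj (\<integral>t. cnj (f t) * g t \<partial>circle_measure)"
    by (simp add: mult.commute)
qed

lemma cinner_L2_add_right: "cinner_L2 x (y + z) = cinner_L2 x y + cinner_L2 x z"
  by transfer (simp add: distrib_left sq_integrable_mult)

lemma cinner_L2_scaleC_right: "cinner_L2 x (scaleC_L2 c y) = c * cinner_L2 x y"
  by transfer (simp add: mult.left_commute)

lemma cinner_L2_self_transfer:
  "(\<integral>t. cnj (f t) * f t \<partial>circle_measure)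
     = complex_of_real (\<integral>t. (norm (f t))\<^sup>2 \<partial>circle_measure)"
proof -
  have "(\<lambda>t. cnj (f t) * f t) = (\<lambda>t. complex_of_real ((norm (f t))\<^sup>2))"
    by (rule ext) (metis complex_norm_square mult.commute)
  then show ?thesis by (simp only: integral_complex_of_real)
qed

instantiation circle_L2 :: real_inner
begin

definition inner_circle_L2 :: "circle_L2 \<Rightarrow> circle_L2 \<Rightarrow> real" where
  "inner_circle_L2 x y = Re (cinner_L2 x y)"

definition norm_circle_L2 :: "circle_L2 \<Rightarrow> real" where
  "norm_circle_L2 x = sqrt (inner x x)"

definition sgn_circle_L2 :: "circle_L2 \<Rightarrow> circle_L2" where
  "sgn_circle_L2 x = x /\<^sub>R norm x"

definition dist_circle_L2 :: "circle_L2 \<Rightarrow> circle_L2 \<Rightarrow> real" where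
  "dist_circle_L2 x y = norm (x - y)"

definition uniformity_circle_L2 :: "(circle_L2 \<times> circle_L2) filter" where
  "uniformity_circle_L2 = (INF e\<in>{0<..}. principal {(x, y). dist x y < e})"

definition open_circle_L2 :: "circle_L2 set \<Rightarrow> bool" where
  "open_circle_L2 S \<longleftrightarrow> (\<forall>x\<in>S. \<forall>\<^sub>F (x', y) in uniformity. x' = x \<longrightarrow> y \<in> S)"

instance
proof
  fix x y z :: circle_L2 and r s :: real
  show "sgn x = x /\<^sub>R norm x" by (rule sgn_circle_L2_def)
  show "dist x y = norm (x - y)" by (rule dist_circle_L2_def)
  show "uniformity = (INF e\<in>{0 <..}. principal {(x, y::circle_L2). dist x y < e})"
    by (rule uniformity_circle_L2_def)
  show "open S \<longleftrightarrow> (\<forall>x\<in>S. \<forall>\<^sub>F (x', y) in uniformity. x' = x \<longrightarrow> y \<in> S)"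
    for S :: "circle_L2 set"
    by (rule open_circle_L2_def)
  show comm: "inner x y = inner y x" for x y :: circle_L2
    unfolding inner_circle_L2_def by (subst cinner_L2_commute) simp
  have "inner z (x + y) = inner z x + inner z y"
    by (simp add: inner_circle_L2_def cinner_L2_add_right)
  then show "inner (x + y) z = inner x z + inner y z"
    using comm by metis
  have "inner y (r *\<^sub>R x) = r * inner y x"
    by (simp add: inner_circle_L2_def scaleR_circle_L2_def cinner_L2_scaleC_right)
  then show "inner (r *\<^sub>R x) y = r * inner x y"
    using comm by metis
  show "0 \<le> inner x x"
    unfolding inner_circle_L2_def
    by transfer (simp add: cinner_L2_self_transfer)
  show "inner x x = 0 \<longleftrightarrow> x = 0"
    unfolding inner_circle_L2_def
  proof transfer
    fix f assume f: "sq_integrable f \<and> sq_integrable f \<and> (AE t in circle_measure. f t = f t)"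
    then have "integrable circle_measure (\<lambda>t. (norm (f t))\<^sup>2)"
      by (simp add: sq_integrable_def)
    then have "(\<integral>t. (norm (f t))\<^sup>2 \<partial>circle_measure) = 0 \<longleftrightarrow>
        (AE t in circle_measure. (norm (f t))\<^sup>2 = 0)"
      by (intro integral_nonneg_eq_0_iff_AE) auto
    then show "Re (\<integral>t. cnj (f t) * f t \<partial>circle_measure) = 0 \<longleftrightarrow>
        sq_integrable f \<and> sq_integrable (\<lambda>t. 0) \<and> (AE t in circle_measure. f t = 0)"
      using f by (simp add: cinner_L2_self_transfer sq_integrable_zero)
  qed
  show "norm x = sqrt (inner x x)" by (rule norm_circle_L2_def)
qed

end

lemma norm_abs_circle_L2:
  assumes "sq_integrable f"
  shows "(norm (abs_circle_L2 f))\<^sup>2 = (\<integral>t. (norm (f t))\<^sup>2 \<partial>circle_measure)"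
proof -
  have "inner (abs_circle_L2 f) (abs_circle_L2 f) = (\<integral>t. (norm (f t))\<^sup>2 \<partial>circle_measure)"
    unfolding inner_circle_L2_def using assms
    by (subst cinner_L2.abs_eq) (simp_all add: eq_onp_def cinner_L2_self_transfer)
  then show ?thesis by (simp add: power2_norm_eq_inner)
qed

lemma nn_norm_abs_circle_L2:
  assumes "sq_integrable f"
  shows "(\<integral>\<^sup>+t. ennreal ((norm (f t))\<^sup>2) \<partial>circle_measure) = ennreal ((norm (abs_circle_L2 f))\<^sup>2)"
  using assms by (subst norm_abs_circle_L2) (auto simp: sq_integrable_def nn_integral_eq_integral)

lemma abs_circle_L2_diff:
  assumes "sq_integrable f" "sq_integrable g"
  shows "abs_circle_L2 f - abs_circle_L2 g = abs_circle_L2 (\<lambda>t. f t - g t)"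
proof -
  have "abs_circle_L2 f - abs_circle_L2 g = abs_circle_L2 f + abs_circle_L2 (\<lambda>t. - g t)"
    using assms by (simp add: minus_circle_L2_def uminus_circle_L2.abs_eq eq_onp_def)
  also have "\<dots> = abs_circle_L2 (\<lambda>t. f t + - g t)"
    using assms by (subst plus_circle_L2.abs_eq) (auto simp: eq_onp_def intro: sq_integrable_uminus)
  finally show ?thesis by simp
qed

lemma sq_integrable_diff:
  "sq_integrable f \<Longrightarrow> sq_integrable g \<Longrightarrow> sq_integrable (\<lambda>t. f t - g t)"
  using sq_integrable_add[of f "\<lambda>t. - g t"] sq_integrable_uminus[of g] by simp

lemma circle_L2_L1_bound:
  assumes f: "sq_integrable f" and "norm (abs_circle_L2 f) < a"
  shows "(\<integral>\<^sup>+t. ennreal (norm (f t)) \<partial>circle_measure) \<le> ennreal a"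
proof -
  have a: "a > 0" using assms(2) norm_ge_zero[of "abs_circle_L2 f"] by linarith
  note [measurable] = sq_integrable_measurable[OF f]
  have "norm (f t) \<le> a / 2 + 1 / (2 * a) * (norm (f t))\<^sup>2" for t
    using sum_squares_bound[of a "norm (f t)"] a by (simp add: field_simps power2_eq_square)
  then have "(\<integral>\<^sup>+t. ennreal (norm (f t)) \<partial>circle_measure)
      \<le> (\<integral>\<^sup>+t. ennreal (a / 2 + 1 / (2 * a) * (norm (f t))\<^sup>2) \<partial>circle_measure)"
    by (intro nn_integral_mono ennreal_leI) auto
  also have "\<dots> = (\<integral>\<^sup>+t. ennreal (a / 2) + ennreal (1 / (2 * a)) * ennreal ((norm (f t))\<^sup>2) \<partial>circle_measure)"
    using a by (intro nn_integral_cong) (simp add: ennreal_mult[symmetric])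
  also have "\<dots> = ennreal (a / 2) + ennreal (1 / (2 * a)) * ennreal ((norm (abs_circle_L2 f))\<^sup>2)"
    using nn_norm_abs_circle_L2[OF f]
    by (subst nn_integral_add) (auto simp: nn_integral_cmult emeasure_circle_measure_UNIV)
  also have "\<dots> \<le> ennreal (a / 2) + ennreal (1 / (2 * a)) * ennreal (a\<^sup>2)"
    using assms(2) a by (intro add_left_mono mult_left_mono ennreal_leI power_mono) auto
  also have "\<dots> = ennreal a"
    using a by (simp add: ennreal_mult[symmetric] ennreal_plus[symmetric] power2_eq_square
        del: ennreal_plus)
  finally show ?thesis .
qed

lemma circle_L2_rep: "\<exists>f. sq_integrable f \<and> x = abs_circle_L2 f"
  using Quotient3_abs_rep[OF Quotient3_circle_L2, of x]
    Quotient3_rep_reflp[OF Quotient3_circle_L2, of x]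
  by (intro exI[of _ "rep_circle_L2 x"]) simp

lemma ennreal_summable:
  fixes f :: "nat \<Rightarrow> real"
  assumes "\<And>n. f n \<ge> 0" "(\<Sum>n. ennreal (f n)) \<noteq> \<infinity>"
  shows "summable f"
  using assms summable_suminf_not_top by (metis infinity_ennreal_def)

instance circle_L2 :: banach
proof
  fix X :: "nat \<Rightarrow> circle_L2"
  assume C: "Cauchy X"
  have "\<exists>M. \<forall>m\<ge>M. \<forall>n\<ge>M. norm (X m - X n) < (1/2)^k" for k
    using CauchyD[OF C, of "(1/2)^k"] by auto
  then obtain M where M: "\<And>k m n. m \<ge> M k \<Longrightarrow> n \<ge> M k \<Longrightarrow> norm (X m - X n) < (1/2)^k"
    by metis
  define r where "r k = (\<Sum>i\<le>k. M i) + k" for k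
  have rM: "r n \<ge> M k" if "k \<le> n" for k n
  proof -
    have "M k \<le> (\<Sum>i\<le>n. M i)" using that by (intro member_le_sum) auto
    then show ?thesis by (simp add: r_def)
  qed
  have r: "strict_mono r"
    by (rule strict_monoI_Suc) (simp add: r_def)
  have close: "norm (X (r m) - X (r n)) < (1/2)^k" if "k \<le> m" "k \<le> n" for k m n
    using M rM that by blast
  obtain y where y: "\<And>k. sq_integrable (y k)" "\<And>k. X (r k) = abs_circle_L2 (y k)"
  proof -
    have "\<forall>k. \<exists>f. sq_integrable f \<and> X (r k) = abs_circle_L2 f"
      using circle_L2_rep by blast
    then show ?thesis using that by metis
  qed
  note [measurable] = y(1)[THEN sq_integrable_measurable]
  have "(\<integral>\<^sup>+t. (\<Sum>k. ennreal (norm (y (Suc k) t - y k t))) \<partial>circle_measure)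
      = (\<Sum>k. \<integral>\<^sup>+t. ennreal (norm (y (Suc k) t - y k t)) \<partial>circle_measure)"
    by (rule nn_integral_suminf) measurable
  also have "\<dots> \<le> (\<Sum>k. ennreal ((1/2)^k))"
  proof (rule suminf_le)
    fix k
    show "(\<integral>\<^sup>+t. ennreal (norm (y (Suc k) t - y k t)) \<partial>circle_measure) \<le> ennreal ((1/2)^k)"
      using close[of k "Suc k" k] y
      by (intro circle_L2_L1_bound sq_integrable_diff) (auto simp: abs_circle_L2_diff)
  qed auto
  also have "\<dots> = ennreal (\<Sum>k. (1/2)^k)"
    by (rule suminf_ennreal2) (auto intro: summable_geometric)
  finally have fin: "(\<integral>\<^sup>+t. (\<Sum>k. ennreal (norm (y (Suc k) t - y k t))) \<partial>circle_measure) \<noteq> \<infinity>"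
    by (auto simp: top_unique)
  have "AE t in circle_measure. (\<Sum>k. ennreal (norm (y (Suc k) t - y k t))) \<noteq> \<infinity>"
    by (rule nn_integral_PInf_AE[OF _ fin]) measurable
  then have conv: "AE t in circle_measure. convergent (\<lambda>k. y k t)"
  proof eventually_elim
    case (elim t)
    then have "summable (\<lambda>k. norm (y (Suc k) t - y k t))"
      by (intro ennreal_summable) auto
    then have "summable (\<lambda>k. y (Suc k) t - y k t)"
      by (rule summable_norm_cancel)
    then have "convergent (\<lambda>n. \<Sum>k<n. y (Suc k) t - y k t)"
      by (simp add: summable_iff_convergent)
    then have "convergent (\<lambda>n. (y n t - y 0 t) + y 0 t)"
      by (intro convergent_add convergent_const) (simp add: sum_lessThan_telescope[of "\<lambda>k. y k t"])
    then show ?case by simp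
  qed
  define z where "z t = lim (\<lambda>k. y k t)" for t
  have [measurable]: "z \<in> borel_measurable borel"
    unfolding z_def by (rule borel_measurable_lim_metric) measurable
  have lim: "AE t in circle_measure. (\<lambda>k. y k t) \<longlonglongrightarrow> z t"
    using conv by eventually_elim (simp add: z_def convergent_LIMSEQ_iff)
  have bound: "(\<integral>\<^sup>+t. ennreal ((norm (z t - y n t))\<^sup>2) \<partial>circle_measure) \<le> ennreal (((1/2)^n)\<^sup>2)" for n
  proof -
    have "(\<integral>\<^sup>+t. ennreal ((norm (z t - y n t))\<^sup>2) \<partial>circle_measure)
        = (\<integral>\<^sup>+t. liminf (\<lambda>m. ennreal ((norm (y m t - y n t))\<^sup>2)) \<partial>circle_measure)"
    proof (rule nn_integral_cong_AE)
      show "AE t in circle_measure. ennreal ((norm (z t - y n t))\<^sup>2)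
          = liminf (\<lambda>m. ennreal ((norm (y m t - y n t))\<^sup>2))"
        using lim
      proof eventually_elim
        case (elim t)
        then have "(\<lambda>m. ennreal ((norm (y m t - y n t))\<^sup>2)) \<longlonglongrightarrow> ennreal ((norm (z t - y n t))\<^sup>2)"
          by (intro tendsto_ennrealI tendsto_intros)
        from lim_imp_Liminf[OF trivial_limit_sequentially this] show ?case by (rule sym)
      qed
    qed
    also have "\<dots> \<le> liminf (\<lambda>m. \<integral>\<^sup>+t. ennreal ((norm (y m t - y n t))\<^sup>2) \<partial>circle_measure)"
      by (rule nn_integral_liminf) measurable
    also have "\<dots> \<le> liminf (\<lambda>m::nat. ennreal (((1/2)^n)\<^sup>2))"
    proof (rule Liminf_mono, rule eventually_sequentiallyI)
      fix m assume "n \<le> m"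
      then have "norm (X (r m) - X (r n)) \<le> (1/2)^n"
        using close[of n m n] by simp
      then show "(\<integral>\<^sup>+t. ennreal ((norm (y m t - y n t))\<^sup>2) \<partial>circle_measure) \<le> ennreal (((1/2)^n)\<^sup>2)"
        using y by (subst nn_norm_abs_circle_L2)
          (auto intro!: sq_integrable_diff ennreal_leI power_mono simp: abs_circle_L2_diff)
    qed
    also have "\<dots> = ennreal (((1/2)^n)\<^sup>2)" by (simp add: Liminf_const)
    finally show ?thesis .
  qed
  have zy: "sq_integrable (\<lambda>t. z t - y n t)" for n
    unfolding sq_integrable_def
  proof
    show "(\<lambda>t. z t - y n t) \<in> borel_measurable circle_measure" by measurable
    show "integrable circle_measure (\<lambda>t. (norm (z t - y n t))\<^sup>2)"
    proof (rule integrableI_bounded)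
      show "(\<lambda>t. (norm (z t - y n t))\<^sup>2) \<in> borel_measurable circle_measure" by measurable
      show "(\<integral>\<^sup>+t. ennreal (norm ((norm (z t - y n t))\<^sup>2)) \<partial>circle_measure) < \<infinity>"
        using bound[of n] by (simp add: le_less_trans[OF _ ennreal_less_top])
    qed
  qed
  have z: "sq_integrable z"
    using sq_integrable_add[OF zy[of 0] y(1)[of 0]] by simp
  have "norm (X (r n) - abs_circle_L2 z) \<le> (1/2)^n" for n
  proof -
    have "ennreal ((norm (abs_circle_L2 z - abs_circle_L2 (y n)))\<^sup>2) \<le> ennreal (((1/2)^n)\<^sup>2)"
      using bound[of n] zy[of n] z y(1) by (simp add: nn_norm_abs_circle_L2 abs_circle_L2_diff)
    then have "(norm (abs_circle_L2 z - abs_circle_L2 (y n)))\<^sup>2 \<le> ((1/2)^n)\<^sup>2"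
      by (subst (asm) ennreal_le_iff) auto
    then have "norm (abs_circle_L2 z - abs_circle_L2 (y n)) \<le> (1/2)^n"
      by (rule power2_le_imp_le) auto
    then show ?thesis using y(2) by (simp add: norm_minus_commute)
  qed
  then have "\<forall>\<^sub>F n in sequentially. norm (X (r n) - abs_circle_L2 z) \<le> (1/2)^n"
    by (rule always_eventually[OF allI])
  moreover have "(\<lambda>n. (1/2::real)^n) \<longlonglongrightarrow> 0"
    by (rule LIMSEQ_realpow_zero) auto
  ultimately have "(\<lambda>n. X (r n) - abs_circle_L2 z) \<longlonglongrightarrow> 0"
    by (rule Lim_null_comparison)
  then have "(X \<circ> r) \<longlonglongrightarrow> abs_circle_L2 z"
    by (simp add: o_def LIM_zero_iff)
  then have "X \<longlonglongrightarrow> abs_circle_L2 z"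
    by (rule Cauchy_converges_subseq[OF C r])
  then show "convergent X" by (auto simp: convergent_def)
qed

instantiation circle_L2 :: chilbert_space
begin

definition scaleC_circle_L2 :: "complex \<Rightarrow> circle_L2 \<Rightarrow> circle_L2" where
  "scaleC_circle_L2 = scaleC_L2"

definition cinner_circle_L2 :: "circle_L2 \<Rightarrow> circle_L2 \<Rightarrow> complex" where
  "cinner_circle_L2 = cinner_L2"

instance
proof
  fix x y z :: circle_L2 and c d :: complex and r :: real
  show "c *\<^sub>C (x + y) = c *\<^sub>C x + c *\<^sub>C y"
    unfolding scaleC_circle_L2_def
    by transfer (auto intro!: sq_integrable_add sq_integrable_cmult simp: distrib_left)
  show "(c + d) *\<^sub>C x = c *\<^sub>C x + d *\<^sub>C x"
    unfolding scaleC_circle_L2_def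
    by transfer
       (auto intro!: sq_integrable_add sq_integrable_cmult simp: distrib_right[symmetric])
  show "c *\<^sub>C d *\<^sub>C x = (c * d) *\<^sub>C x"
    unfolding scaleC_circle_L2_def
    by transfer (auto intro!: sq_integrable_cmult simp: mult.assoc)
  show "complex_of_real r *\<^sub>C x = r *\<^sub>R x"
    by (simp add: scaleC_circle_L2_def scaleR_circle_L2_def)
  show "cinner y x = cnj (cinner x y)"
    unfolding cinner_circle_L2_def by (rule cinner_L2_commute)
  show "cinner x (y + z) = cinner x y + cinner x z"
    unfolding cinner_circle_L2_def by (rule cinner_L2_add_right)
  show "cinner x (c *\<^sub>C y) = c * cinner x y"
    unfolding cinner_circle_L2_def scaleC_circle_L2_def by (rule cinner_L2_scaleC_right)
  show "inner x y = Re (cinner x y)"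
    unfolding cinner_circle_L2_def by (rule inner_circle_L2_def)
qed

end


section \<open>Fourier coefficients, Hardy space and Toeplitz operators\<close>

definition fourier_coeff :: "(real \<Rightarrow> complex) \<Rightarrow> int \<Rightarrow> complex" where
  "fourier_coeff f n = (\<integral>t. f t * exp (- (\<i> * of_int n * of_real t)) \<partial>circle_measure)"

definition fourier_mode :: "int \<Rightarrow> real \<Rightarrow> complex" where
  "fourier_mode n t = exp (\<i> * of_int n * of_real t)"

lemma sq_integrable_fourier_mode: "sq_integrable (fourier_mode n)"
proof -
  have "continuous_on UNIV (fourier_mode n)"
    unfolding fourier_mode_def by (intro continuous_intros)
  then have [measurable]: "fourier_mode n \<in> borel_measurable borel"
    by (rule borel_measurable_continuous_onI)
  have "norm (fourier_mode n t) = 1" for t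
    by (simp add: fourier_mode_def)
  then show ?thesis
    unfolding sq_integrable_def
    by (auto intro!: integrableI_bounded simp: emeasure_circle_measure_UNIV)
qed

lemma fourier_coeff_eq_integral:
  "fourier_coeff f n = (\<integral>t. cnj (fourier_mode n t) * f t \<partial>circle_measure)"
  by (simp add: fourier_coeff_def fourier_mode_def exp_cnj mult.commute)

lift_definition fourier_coeff_L2 :: "circle_L2 \<Rightarrow> int \<Rightarrow> complex" is fourier_coeff
proof (rule ext)
  fix f g n
  assume "sq_integrable f \<and> sq_integrable g \<and> (AE t in circle_measure. f t = g t)"
  then show "fourier_coeff f n = fourier_coeff g n"
    unfolding fourier_coeff_eq_integral
    using sq_integrable_fourier_mode by (intro integral_cong_AE_cinner) auto
qed

lemma fourier_coeff_L2_cinner: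
  "fourier_coeff_L2 x n = cinner (abs_circle_L2 (fourier_mode n)) x"
proof -
  obtain f where f: "sq_integrable f" "x = abs_circle_L2 f"
    using circle_L2_rep by blast
  then show ?thesis
    using sq_integrable_fourier_mode[of n]
    by (simp add: cinner_circle_L2_def fourier_coeff_L2.abs_eq cinner_L2.abs_eq
        eq_onp_def fourier_coeff_eq_integral)
qed

definition hardy_space :: "circle_L2 set" where
  "hardy_space = {x. \<forall>n<0. fourier_coeff_L2 x n = 0}"

lemma cinner_zero_right [simp]: "cinner x 0 = 0"
  using cinner_add_right[of x 0 0] by simp

lemma cinner_scaleR_right: "cinner x (r *\<^sub>R y) = complex_of_real r * cinner x y"
  by (simp add: cinner_scaleC_right flip: scaleC_of_real)

lemma cinner_uminus_right: "cinner x (- y) = - cinner x y"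
  using cinner_scaleR_right[of x "-1" y] by simp

lemma cinner_diff_right: "cinner x (y - z) = cinner x y - cinner x z"
  using cinner_add_right[of x y "- z"] by (simp add: cinner_uminus_right)

lemma Im_cinner: "Im (cinner x y) = - inner x (\<i> *\<^sub>C y)"
  by (simp add: inner_eq_Re_cinner cinner_scaleC_right)

lemma norm_scaleC: "norm (c *\<^sub>C x) = norm c * norm x"
proof -
  have "cinner (c *\<^sub>C x) (c *\<^sub>C x) = c * cnj (c * cinner x x)"
    by (subst cinner_scaleC_right, subst cinner_commute) (simp only: cinner_scaleC_right)
  also have "\<dots> = of_real ((norm c)\<^sup>2) * cinner x x"
    by (simp only: complex_cnj_mult complex_norm_square cinner_commute[symmetric] mult.assoc)
  finally have "inner (c *\<^sub>C x) (c *\<^sub>C x) = (norm c)\<^sup>2 * inner x x"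
    by (simp add: inner_eq_Re_cinner del: of_real_power)
  then show ?thesis
    by (simp add: norm_eq_sqrt_inner real_sqrt_mult)
qed

lemma tendsto_cinner_right:
  fixes x l :: "'a::chilbert_space"
  assumes "(f \<longlongrightarrow> l) F"
  shows "((\<lambda>t. cinner x (f t)) \<longlongrightarrow> cinner x l) F"
proof -
  have bl: "bounded_linear (\<lambda>y::'a. \<i> *\<^sub>C y)"
  proof (rule bounded_linear_intro)
    show "\<i> *\<^sub>C (r *\<^sub>R y) = r *\<^sub>R (\<i> *\<^sub>C y)" for r and y :: 'a
      by (simp add: scaleC_scaleC mult.commute flip: scaleC_of_real)
    show "norm (\<i> *\<^sub>C y) \<le> norm y * 1" for y :: 'a
      by (simp add: norm_scaleC)
  qed (rule scaleC_add_right)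
  have "((\<lambda>t. \<i> *\<^sub>C f t) \<longlongrightarrow> \<i> *\<^sub>C l) F"
    by (rule bounded_linear.tendsto[OF bl assms])
  then have "((\<lambda>t. Complex (inner x (f t)) (- inner x (\<i> *\<^sub>C f t)))
      \<longlongrightarrow> Complex (inner x l) (- inner x (\<i> *\<^sub>C l))) F"
    by (intro tendsto_Complex tendsto_minus tendsto_inner tendsto_const assms)
  moreover have "Complex (inner x y) (- inner x (\<i> *\<^sub>C y)) = cinner x y" for y
    by (simp add: complex_eq_iff Im_cinner flip: inner_eq_Re_cinner)
  ultimately show ?thesis by simp
qed

lemma closed_hardy_space: "closed hardy_space"
  unfolding closed_sequential_limits
proof (intro allI impI, elim conjE)
  fix X and l :: circle_L2
  assume X: "\<forall>n. X n \<in> hardy_space" "X \<longlonglongrightarrow> l"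
  show "l \<in> hardy_space"
    unfolding hardy_space_def
  proof (rule CollectI, intro allI impI)
    fix n :: int
    assume "n < 0"
    then have "(\<lambda>k. fourier_coeff_L2 (X k) n) = (\<lambda>k. 0)"
      using X(1) by (auto simp: hardy_space_def)
    moreover have "(\<lambda>k. fourier_coeff_L2 (X k) n) \<longlonglongrightarrow> fourier_coeff_L2 l n"
      unfolding fourier_coeff_L2_cinner by (rule tendsto_cinner_right[OF X(2)])
    ultimately show "fourier_coeff_L2 l n = 0"
      by (simp add: LIMSEQ_const_iff)
  qed
qed

typedef circle_H2 = hardy_space
  by (rule exI[of _ 0]) (simp add: hardy_space_def fourier_coeff_L2_cinner)

setup_lifting type_definition_circle_H2

instantiation circle_H2 :: real_vector
begin

lift_definition zero_circle_H2 :: circle_H2 is 0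
  by (simp add: hardy_space_def fourier_coeff_L2_cinner)

lift_definition plus_circle_H2 :: "circle_H2 \<Rightarrow> circle_H2 \<Rightarrow> circle_H2" is "(+)"
  by (simp add: hardy_space_def fourier_coeff_L2_cinner cinner_add_right)

lift_definition minus_circle_H2 :: "circle_H2 \<Rightarrow> circle_H2 \<Rightarrow> circle_H2" is "(-)"
  by (simp add: hardy_space_def fourier_coeff_L2_cinner cinner_diff_right)

lift_definition uminus_circle_H2 :: "circle_H2 \<Rightarrow> circle_H2" is uminus
  by (simp add: hardy_space_def fourier_coeff_L2_cinner cinner_uminus_right)

lift_definition scaleR_circle_H2 :: "real \<Rightarrow> circle_H2 \<Rightarrow> circle_H2" is scaleR
  by (simp add: hardy_space_def fourier_coeff_L2_cinner cinner_scaleR_right)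

instance
proof
  fix x y z :: circle_H2 and r s :: real
  show "x + y + z = x + (y + z)" by transfer (rule add.assoc)
  show "x + y = y + x" by transfer (rule add.commute)
  show "0 + x = x" by transfer (rule add_0_left)
  show "- x + x = 0" by transfer (rule left_minus)
  show "x - y = x + - y" by transfer (rule diff_conv_add_uminus)
  show "r *\<^sub>R (x + y) = r *\<^sub>R x + r *\<^sub>R y" by transfer (rule scaleR_add_right)
  show "(r + s) *\<^sub>R x = r *\<^sub>R x + s *\<^sub>R x" by transfer (rule scaleR_add_left)
  show "r *\<^sub>R s *\<^sub>R x = (r * s) *\<^sub>R x" by transfer (rule scaleR_scaleR)
  show "1 *\<^sub>R x = x" by transfer (rule scaleR_one)
qed

end

instantiation circle_H2 :: real_inner
begin

lift_definition inner_circle_H2 :: "circle_H2 \<Rightarrow> circle_H2 \<Rightarrow> real" is inner .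

lift_definition norm_circle_H2 :: "circle_H2 \<Rightarrow> real" is norm .

definition sgn_circle_H2 :: "circle_H2 \<Rightarrow> circle_H2" where
  "sgn_circle_H2 x = x /\<^sub>R norm x"

lift_definition dist_circle_H2 :: "circle_H2 \<Rightarrow> circle_H2 \<Rightarrow> real" is dist .

definition uniformity_circle_H2 :: "(circle_H2 \<times> circle_H2) filter" where
  "uniformity_circle_H2 = (INF e\<in>{0<..}. principal {(x, y). dist x y < e})"

definition open_circle_H2 :: "circle_H2 set \<Rightarrow> bool" where
  "open_circle_H2 S \<longleftrightarrow> (\<forall>x\<in>S. \<forall>\<^sub>F (x', y) in uniformity. x' = x \<longrightarrow> y \<in> S)"

instance
proof
  fix x y z :: circle_H2 and r :: real
  show "sgn x = x /\<^sub>R norm x" by (rule sgn_circle_H2_def)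
  show "dist x y = norm (x - y)" by transfer (rule dist_norm)
  show "uniformity = (INF e\<in>{0 <..}. principal {(x, y::circle_H2). dist x y < e})"
    by (rule uniformity_circle_H2_def)
  show "open S \<longleftrightarrow> (\<forall>x\<in>S. \<forall>\<^sub>F (x', y) in uniformity. x' = x \<longrightarrow> y \<in> S)"
    for S :: "circle_H2 set"
    by (rule open_circle_H2_def)
  show "inner x y = inner y x" by transfer (rule inner_commute)
  show "inner (x + y) z = inner x z + inner y z" by transfer (rule inner_add_left)
  show "inner (r *\<^sub>R x) y = r * inner x y" by transfer simp
  show "0 \<le> inner x x" by transfer simp
  show "inner x x = 0 \<longleftrightarrow> x = 0" by transfer simp
  show "norm x = sqrt (inner x x)" by transfer (rule norm_eq_sqrt_inner)
qed

end

instance circle_H2 :: banach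
proof
  fix X :: "nat \<Rightarrow> circle_H2"
  assume C: "Cauchy X"
  then have "Cauchy (\<lambda>n. Rep_circle_H2 (X n))"
    by (simp add: Cauchy_def dist_circle_H2.rep_eq)
  then have "convergent (\<lambda>n. Rep_circle_H2 (X n))"
    by (rule Cauchy_convergent)
  then obtain l where l: "(\<lambda>n. Rep_circle_H2 (X n)) \<longlonglongrightarrow> l"
    unfolding convergent_def by blast
  have "l \<in> hardy_space"
    by (rule closed_sequentially[OF closed_hardy_space Rep_circle_H2 l])
  then have "Rep_circle_H2 (Abs_circle_H2 l) = l"
    by (rule Abs_circle_H2_inverse)
  then have "X \<longlonglongrightarrow> Abs_circle_H2 l"
    using l by (simp add: tendsto_iff dist_circle_H2.rep_eq)
  then show "convergent X" by (auto simp: convergent_def)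
qed

instantiation circle_H2 :: chilbert_space
begin

lift_definition scaleC_circle_H2 :: "complex \<Rightarrow> circle_H2 \<Rightarrow> circle_H2" is scaleC
  by (simp add: hardy_space_def fourier_coeff_L2_cinner cinner_scaleC_right)

lift_definition cinner_circle_H2 :: "circle_H2 \<Rightarrow> circle_H2 \<Rightarrow> complex" is cinner .

instance
proof
  fix x y z :: circle_H2 and c d :: complex and r :: real
  show "c *\<^sub>C (x + y) = c *\<^sub>C x + c *\<^sub>C y" by transfer (rule scaleC_add_right)
  show "(c + d) *\<^sub>C x = c *\<^sub>C x + d *\<^sub>C x" by transfer (rule scaleC_add_left)
  show "c *\<^sub>C d *\<^sub>C x = (c * d) *\<^sub>C x" by transfer (rule scaleC_scaleC)
  show "complex_of_real r *\<^sub>C x = r *\<^sub>R x" by transfer (rule scaleC_of_real)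
  show "cinner y x = cnj (cinner x y)" by transfer (rule cinner_commute)
  show "cinner x (y + z) = cinner x y + cinner x z" by transfer (rule cinner_add_right)
  show "cinner x (c *\<^sub>C y) = c * cinner x y" by transfer (rule cinner_scaleC_right)
  show "inner x y = Re (cinner x y)" by transfer (rule inner_eq_Re_cinner)
qed

end

definition orth_proj :: "'a::chilbert_space set \<Rightarrow> 'a \<Rightarrow> 'a" where
  "orth_proj S x = (THE p. p \<in> S \<and> (\<forall>y\<in>S. cinner y (x - p) = 0))"

text \<open>Multiplication by a function; it is independent of the chosen representatives and stays in
  \<open>L\<^sup>2\<close> whenever the function is measurable and essentially bounded.\<close>

definition mult_L2 :: "(real \<Rightarrow> complex) \<Rightarrow> circle_L2 \<Rightarrow> circle_L2" where
  "mult_L2 f x = abs_circle_L2 (\<lambda>t. f t * rep_circle_L2 x t)"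

definition toeplitz :: "(real \<Rightarrow> complex) \<Rightarrow> circle_H2 \<Rightarrow> circle_H2" where
  "toeplitz f h = Abs_circle_H2 (orth_proj hardy_space (mult_L2 f (Rep_circle_H2 h)))"


section \<open>Function classes and principal values\<close>

definition periodic_2pi :: "(real \<Rightarrow> complex) \<Rightarrow> bool" where
  "periodic_2pi f \<longleftrightarrow> (\<forall>t. f (t + 2 * pi) = f t)"

definition absolutely_continuous_on :: "real \<Rightarrow> real \<Rightarrow> (real \<Rightarrow> complex) \<Rightarrow> bool" where
  "absolutely_continuous_on a b f \<longleftrightarrow>
     (\<forall>\<epsilon>>0. \<exists>\<eta>>0. \<forall>(n::nat) u v.
        (\<forall>i<n. a \<le> u i \<and> u i \<le> v i \<and> v i \<le> b) \<longrightarrow>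
        (\<forall>i<n. \<forall>j<n. i \<noteq> j \<longrightarrow> {u i<..<v i} \<inter> {u j<..<v j} = {}) \<longrightarrow>
        (\<Sum>i<n. v i - u i) < \<eta> \<longrightarrow>
        (\<Sum>i<n. norm (f (v i) - f (u i))) < \<epsilon>)"

definition sobolev_half_2 :: "(real \<Rightarrow> complex) set" where
  "sobolev_half_2 = {f. periodic_2pi f \<and> sq_integrable f \<and>
     (\<lambda>n::int. (1 + \<bar>real_of_int n\<bar>) * (norm (fourier_coeff f n))\<^sup>2) summable_on UNIV}"

definition sobolev_1_1 :: "(real \<Rightarrow> complex) set" where
  "sobolev_1_1 = {f. periodic_2pi f \<and> absolutely_continuous_on 0 (2 * pi) f}"

text \<open>Unlike \<^const>\<open>C1_differentiable_on\<close>, only one-sided derivatives are required at the end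
  points of a closed interval.\<close>

definition C1_within :: "(real \<Rightarrow> 'a::real_normed_vector) \<Rightarrow> real set \<Rightarrow> bool" where
  "C1_within g S \<longleftrightarrow>
     (\<exists>g'. continuous_on S g' \<and> (\<forall>t\<in>S. (g has_vector_derivative g' t) (at t within S)))"

definition circle_zeros :: "(real \<Rightarrow> complex) \<Rightarrow> real set" where
  "circle_zeros f = {t \<in> {0..<2*pi}. f t = 0}"

text \<open>The union of the arcs \<open>(z - \<epsilon>, z + \<epsilon>)\<close> of the circle, \<open>z \<in> Z\<close>, as a periodic subset of the
  line.\<close>

definition arcs_around :: "real set \<Rightarrow> real \<Rightarrow> real set" where
  "arcs_around Z \<epsilon> = {t. \<exists>z\<in>Z. \<exists>k::int. \<bar>t - z - 2 * pi * of_int k\<bar> < \<epsilon>}"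

definition has_pv_integral :: "(real \<Rightarrow> complex) \<Rightarrow> real set \<Rightarrow> complex \<Rightarrow> bool" where
  "has_pv_integral F Z I \<longleftrightarrow>
     (\<forall>\<^sub>F \<epsilon> in at_right 0. set_integrable lebesgue ({0..<2*pi} - arcs_around Z \<epsilon>) F) \<and>
     ((\<lambda>\<epsilon>. LINT t:{0..<2*pi} - arcs_around Z \<epsilon>|lebesgue. F t) \<longlongrightarrow> I) (at_right 0)"

end

theory Submission
  imports Defs
begin

text \<open>
  Let \<open>T\<close> be the Toeplitz operator with symbol \<open>f\<close> and \<open>S\<close> its adjoint. The heat trace
  \<open>Tr (exp (- s S T) - exp (- s T S))\<close> is computed exactly for each \<open>s\<close>; afterwards \<open>s\<close> tends to
  infinity.

  Expanding the exponentials gives the differences \<open>(S T)^(n+1) - (T S)^(n+1)\<close>. Each of them is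
  the commutator of \<open>R = S (T S)^n\<close> with \<open>T\<close>. Up to a nuclear operator \<open>R\<close> is the Toeplitz
  operator with symbol \<open>b = cnj f \<bar>f\<bar>^(2n)\<close>, and the commutator of a nuclear operator with a
  bounded one has trace \<open>0\<close>. What remains is the trace of a commutator of two Toeplitz operators.
  The defect \<open>T\<^sub>a\<^sub>b - T\<^sub>a T\<^sub>b\<close> factors into two Hilbert-Schmidt Hankel operators, which turns this
  trace into the sum of \<open>k f^(k) b^(-k)\<close> over all \<open>k\<close>, where \<open>f^\<close> and \<open>b^\<close> are Fourier
  coefficients (\<open>toeplitz_commutator_trace\<close>, \<open>toeplitz_heat_trace\<close>). Since \<open>f\<close> is absolutely
  continuous, the sum is \<open>1/(2\<pi>\<i>) \<integral> f' b\<close> (\<open>fourier_derivative_pairing\<close>); as \<open>b\<close> is merely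
  continuous and \<open>f'\<close> merely integrable, this needs an approximation argument. Summing over \<open>n\<close>
  yields (\<open>heat_trace_integral\<close>)
  \<open>Tr (exp (- s S T) - exp (- s T S)) = - 1/(2\<pi>\<i>) \<integral> (1 - exp (- s \<bar>f\<bar>\<^sup>2)) f'/f\<close>.

  The factor \<open>1 - exp (- s \<bar>f\<bar>\<^sup>2)\<close> is a smooth cut-off of \<open>f'/f\<close> near the zeros of \<open>f\<close>, and it
  tends to \<open>1\<close> elsewhere. Near a zero \<open>z\<close> the values at \<open>z + u\<close> and \<open>z - u\<close> are added. The simple
  pole then cancels, because the numerator is Lipschitz; and the two values of the cut-off are so
  close that the sum stays bounded uniformly in \<open>s\<close>, because \<open>\<bar>f (z + u)\<bar>\<^sup>2\<close> is \<open>\<bar>u\<bar> powr \<beta>\<close> times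
  a positive Lipschitz function. Hence dominated convergence applies, and the limit is that of the
  symmetric truncations, which is the principal value (\<open>symmetric_cutoff_limit\<close>,
  \<open>regularized_log_derivative_limit\<close>).

  Two theories are developed on the way: the fundamental theorem of calculus for absolutely
  continuous functions, and nuclear operators. A nuclear operator is handled through an explicit
  expansion into operators of rank one, from which the trace can be read off; for self-adjoint ones
  a spectral decomposition shows that they are trace class in the sense of the absolute value.
\<close>

section \<open>Absolutely continuous functions\<close>

text \<open>Around a point where the derivative fails there are arbitrarily short intervals on which the
  Riemann sum with one tag misses the integral by at least a fixed fraction of the length.
  By Vitali's covering theorem disjoint intervals of this kind cover almost all such points, and
  Henstock's lemma bounds their total length by an arbitrarily small number.\<close>

lemma indefinite_integral_differentiable_AE:
  fixes g :: "real \<Rightarrow> 'a::euclidean_space"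
  assumes g: "g integrable_on {a..b}"
  shows "negligible {x \<in> {a<..<b}.
    \<not> ((\<lambda>y. integral {a..y} g) has_vector_derivative g x) (at x)}"
proof -
  define F where "F = (\<lambda>y. integral {a..y} g)"
  \<comment> \<open>points with an error of at least \<open>1 / (n + 1)\<close> times the length at arbitrarily small scales\<close>
  define E where "E n = {x \<in> {a<..<b}. \<forall>d>0. \<exists>y\<in>{a<..<b}. y \<noteq> x \<and> \<bar>y - x\<bar> < d \<and>
      norm (F y - F x - (y - x) *\<^sub>R g x) > \<bar>y - x\<bar> / Suc n}" for n :: nat
  have Fdiff: "F y - F x = integral {x..y} g" if "a \<le> x" "x \<le> y" "y \<le> b" for x y
  proof -
    have "integral {a..x} g + integral {x..y} g = integral {a..y} g"
      using that by (intro Henstock_Kurzweil_Integration.integral_combine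
          integrable_on_subinterval[OF g]) auto
    then show ?thesis unfolding F_def by (metis add_diff_cancel_left')
  qed
  have "negligible (E n)" for n
    unfolding negligible_outer_le
  proof (intro allI impI)
    fix e :: real assume "e > 0"
    then have "e / Suc n > 0" by simp
    from Henstock_lemma[OF g[folded cbox_interval] this] obtain \<gamma> where \<gamma>: "gauge \<gamma>"
      and hen: "\<And>p. \<lbrakk>p tagged_partial_division_of (cbox a b); \<gamma> fine p\<rbrakk> \<Longrightarrow>
             sum (\<lambda>(x,k). norm (measure lborel k *\<^sub>R g x - integral k g)) p < e / Suc n" by blast
    \<comment> \<open>the Vitali cover: intervals with end points \<open>x\<close> and \<open>y\<close>, tagged at \<open>x\<close>, fine and with a large error\<close>
    define K where "K = {(x, y). x \<in> E n \<and> y \<in> {a<..<b} \<and> y \<noteq> x \<and> {min x y..max x y} \<subseteq> \<gamma> x \<and>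
        norm (F y - F x - (y - x) *\<^sub>R g x) > \<bar>y - x\<bar> / Suc n}"
    define c where "c = (\<lambda>(x, y). (x + y) / 2 :: real)"
    define r where "r = (\<lambda>(x, y). \<bar>y - x\<bar> / 2 :: real)"
    have cb: "cball (c (x, y)) (r (x, y)) = {min x y..max x y}" for x y
      by (auto simp: cball_eq_atLeastAtMost c_def r_def min_def max_def abs_if field_simps)
    have r0: "r i > 0" if "i \<in> K" for i
      using that by (auto simp: K_def r_def)
    have "\<exists>i. i \<in> K \<and> x \<in> cball (c i) (r i) \<and> r i < d" if x: "x \<in> E n" and "0 < d" for x d
    proof -
      from \<gamma> have "open (\<gamma> x)" "x \<in> \<gamma> x" by (auto simp: gauge_def)
      then obtain d' where d': "d' > 0" "ball x d' \<subseteq> \<gamma> x" using openE by blast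
      from x \<open>0 < d\<close> d' obtain y where y: "y \<in> {a<..<b}" "y \<noteq> x" "\<bar>y - x\<bar> < min d d'"
        "norm (F y - F x - (y - x) *\<^sub>R g x) > \<bar>y - x\<bar> / Suc n"
        unfolding E_def by (fastforce dest: spec[of _ "min d d'"])
      have "{min x y..max x y} \<subseteq> ball x d'"
        using y by (auto simp: dist_real_def)
      then have "(x, y) \<in> K" using x y d' by (auto simp: K_def)
      moreover have "r (x, y) < d" using y \<open>0 < d\<close> by (auto simp: r_def)
      moreover have "x \<in> cball (c (x, y)) (r (x, y))" unfolding cb by auto
      ultimately show ?thesis by blast
    qed
    from Vitali_covering_theorem_cballs[of K r "E n" c, OF r0 this] obtain C where
      C: "countable C" "C \<subseteq> K"
      "pairwise (\<lambda>i j. disjnt (cball (c i) (r i)) (cball (c j) (r j))) C"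
      and neg: "negligible (E n - (\<Union>i \<in> C. cball (c i) (r i)))" by blast
    have fin_bound: "measure lebesgue (\<Union>i\<in>D. cball (c i) (r i)) \<le> e"
      if D: "D \<subseteq> C" "finite D" for D
    proof -
      let ?h = "\<lambda>i. (fst i, cball (c i) (r i))"
      have disj: "cball (c i) (r i) \<inter> cball (c j) (r j) = {}" if "i \<in> D" "j \<in> D" "i \<noteq> j" for i j
        using C(3) D that by (auto simp: pairwise_def disjnt_def)
      have inj: "inj_on ?h D"
      proof (rule inj_onI)
        fix i j assume ij: "i \<in> D" "j \<in> D" "?h i = ?h j"
        moreover have "c i \<in> cball (c i) (r i)"
          using ij(1) r0[of i] subsetD[OF C(2), of i] subsetD[OF D(1), of i] by (simp add: less_imp_le)
        ultimately have "c i \<in> cball (c i) (r i) \<inter> cball (c j) (r j)"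
          by (metis Int_iff prod.inject)
        then show "i = j" using disj ij by blast
      qed
      have KD: "i \<in> K" if "i \<in> D" for i using that C D by auto
      have "?h ` D tagged_partial_division_of cbox a b"
        unfolding tagged_partial_division_of_def
      proof (intro conjI allI impI)
        fix x L assume "(x, L) \<in> ?h ` D"
        then obtain y where y: "(x, y) \<in> D" "L = {min x y..max x y}" using cb by force
        with KD have "x \<in> {a<..<b}" "y \<in> {a<..<b}" by (auto simp: K_def E_def)
        with y show "x \<in> L" "L \<subseteq> cbox a b" "\<exists>u v. L = cbox u v" by auto
      next
        fix x1 K1 x2 K2 assume "(x1, K1) \<in> ?h ` D \<and> (x2, K2) \<in> ?h ` D \<and> (x1, K1) \<noteq> (x2, K2)"
        then obtain i j where "i \<in> D" "j \<in> D" "i \<noteq> j" "K1 = cball (c i) (r i)" "K2 = cball (c j) (r j)"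
          by auto
        with disj[of i j] show "interior K1 \<inter> interior K2 = {}"
          using interior_subset by blast
      qed (use D in auto)
      moreover have "\<gamma> fine (?h ` D)"
        unfolding fine_def using KD cb by (fastforce simp: K_def)
      ultimately have "sum (\<lambda>(x,k). norm (measure lborel k *\<^sub>R g x - integral k g)) (?h ` D) < e / Suc n"
        by (rule hen)
      then have sum_less: "(\<Sum>i\<in>D. norm (measure lborel (cball (c i) (r i)) *\<^sub>R g (fst i) - integral (cball (c i) (r i)) g)) < e / Suc n"
        by (subst (asm) sum.reindex[OF inj]) (simp add: o_def case_prod_unfold)
      have tm: "measure lebesgue (cball (c i) (r i)) / Suc n \<le>
          norm (measure lborel (cball (c i) (r i)) *\<^sub>R g (fst i) - integral (cball (c i) (r i)) g)" if "i \<in> D" for i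
      proof -
        obtain x y where i: "i = (x, y)" by fastforce
        have xy: "x \<in> {a<..<b}" "y \<in> {a<..<b}" "norm (F y - F x - (y - x) *\<^sub>R g x) > \<bar>y - x\<bar> / Suc n"
          using KD[OF that] i by (auto simp: K_def E_def)
        have m: "measure lebesgue {min x y..max x y} = \<bar>y - x\<bar>" "measure lborel {min x y..max x y} = \<bar>y - x\<bar>"
          by (auto simp: min_def max_def)
        have "norm (\<bar>y - x\<bar> *\<^sub>R g x - integral {min x y..max x y} g) = norm (F y - F x - (y - x) *\<^sub>R g x)"
        proof (cases "x \<le> y")
          case True
          then show ?thesis using Fdiff[of x y] xy by (simp add: norm_minus_commute)
        next
          case False
          then have "F x - F y = integral {y..x} g" using Fdiff[of y x] xy by auto
          then have "(x - y) *\<^sub>R g x - integral {y..x} g = F y - F x - (y - x) *\<^sub>R g x"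
            by (simp add: algebra_simps)
          then show ?thesis using False by (simp add: min_def max_def)
        qed
        then show ?thesis using xy m unfolding i cb fst_conv by simp
      qed
      have "measure lebesgue (\<Union>i\<in>D. cball (c i) (r i)) \<le> (\<Sum>i\<in>D. measure lebesgue (cball (c i) (r i)))"
        using D by (intro measure_UNION_le) auto
      also have "\<dots> = Suc n * (\<Sum>i\<in>D. measure lebesgue (cball (c i) (r i)) / Suc n)"
        by (simp add: sum_divide_distrib[symmetric])
      also have "\<dots> \<le> Suc n * (e / Suc n)"
        using order_trans[OF sum_mono less_imp_le[OF sum_less], OF tm] by (intro mult_left_mono) auto
      finally show ?thesis by simp
    qed
    let ?U = "\<Union>i \<in> C. cball (c i) (r i)"
    have U: "?U \<in> lmeasurable" "measure lebesgue ?U \<le> e"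
      using fmeasurable_UN_bound[OF C(1) _ fin_bound] measure_UN_bound[OF C(1) _ fin_bound] by auto
    let ?N = "E n - ?U"
    have N: "?N \<in> lmeasurable" "measure lebesgue ?N = 0"
      using neg negligible_iff_measure by auto
    have "measure lebesgue (?N \<union> ?U) \<le> measure lebesgue ?N + measure lebesgue ?U"
      by (rule measure_Un_le) (use N U in auto)
    then have le: "measure lebesgue (?N \<union> ?U) \<le> e" using N U by linarith
    have mem: "?N \<union> ?U \<in> lmeasurable" by (rule fmeasurable.Un[OF N(1) U(1)])
    show "\<exists>T. E n \<subseteq> T \<and> T \<in> lmeasurable \<and> measure lebesgue T \<le> e"
      by (rule exI[of _ "?N \<union> ?U"], intro conjI, blast, rule mem, rule le)
  qed
  then have neg: "negligible (\<Union>n. E n)" by (rule negligible_Union_nat)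
  show ?thesis
  proof (rule negligible_subset[OF neg], rule subsetI, rule ccontr)
    fix x assume x: "x \<in> {x \<in> {a<..<b}. \<not> ((\<lambda>y. integral {a..y} g) has_vector_derivative g x) (at x)}"
      "x \<notin> (\<Union>n. E n)"
    have "(F has_vector_derivative g x) (at x)"
      unfolding has_vector_derivative_def has_derivative_at_alt
    proof (intro conjI allI impI)
      fix e :: real assume "e > 0"
      then obtain n where n: "1 / Suc n < e" using nat_approx_posE by blast
      from x have "x \<in> {a<..<b}" "x \<notin> E n" by auto
      then have "\<exists>d>0. \<forall>y\<in>{a<..<b}. y \<noteq> x \<longrightarrow> \<bar>y - x\<bar> < d \<longrightarrow>
          norm (F y - F x - (y - x) *\<^sub>R g x) \<le> \<bar>y - x\<bar> / Suc n"
        unfolding E_def mem_Collect_eq by (meson not_le_imp_less)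
      then obtain d where d: "d > 0" and dd: "\<And>y. \<lbrakk>y \<in> {a<..<b}; y \<noteq> x; \<bar>y - x\<bar> < d\<rbrakk> \<Longrightarrow>
          norm (F y - F x - (y - x) *\<^sub>R g x) \<le> \<bar>y - x\<bar> / Suc n"
        by blast
      let ?d = "min d (min (x - a) (b - x))"
      have "norm (F y - F x - (y - x) *\<^sub>R g x) \<le> e * norm (y - x)" if "norm (y - x) < ?d" for y
      proof (cases "y = x")
        case False
        have "y \<in> {a<..<b}" "\<bar>y - x\<bar> < d" using that by auto
        from dd[OF this(1) False this(2)] have "norm (F y - F x - (y - x) *\<^sub>R g x) \<le> (1 / Suc n) * \<bar>y - x\<bar>"
          by simp
        also have "\<dots> \<le> e * \<bar>y - x\<bar>" using n by (intro mult_right_mono) auto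
        finally show ?thesis by simp
      qed auto
      then show "\<exists>d>0. \<forall>y. norm (y - x) < d \<longrightarrow> norm (F y - F x - (y - x) *\<^sub>R g x) \<le> e * norm (y - x)"
        using d \<open>x \<in> {a<..<b}\<close> by (intro exI[of _ ?d]) auto
    qed (rule bounded_linear_scaleR_left)
    with x show False by (simp add: F_def)
  qed
qed

text \<open>The definition speaks of families indexed by \<open>{..<n}\<close>. Arbitrary finite index sets are
  convenient when the intervals are selected from a given collection.\<close>

lemma absolutely_continuous_on_family:
  assumes "absolutely_continuous_on a b f" "\<epsilon> > 0"
  obtains \<eta> where "\<eta> > 0"
    "\<forall>(I :: 'i set) u v. finite I \<longrightarrow> (\<forall>i\<in>I. a \<le> u i \<and> u i \<le> v i \<and> v i \<le> b) \<longrightarrow>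
       (\<forall>i\<in>I. \<forall>j\<in>I. i \<noteq> j \<longrightarrow> {u i<..<v i} \<inter> {u j<..<v j} = {}) \<longrightarrow>
       (\<Sum>i\<in>I. v i - u i) < \<eta> \<longrightarrow> (\<Sum>i\<in>I. norm (f (v i) - f (u i))) < \<epsilon>"
proof -
  define P where "P \<eta> \<longleftrightarrow> (\<forall>(n::nat) u v.
        (\<forall>i<n. a \<le> u i \<and> u i \<le> v i \<and> v i \<le> b) \<longrightarrow>
        (\<forall>i<n. \<forall>j<n. i \<noteq> j \<longrightarrow> {u i<..<v i} \<inter> {u j<..<v j} = {}) \<longrightarrow>
        (\<Sum>i<n. v i - u i) < \<eta> \<longrightarrow>
        (\<Sum>i<n. norm (f (v i) - f (u i))) < \<epsilon>)" for \<eta>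
  have "\<exists>\<eta>>0. P \<eta>"
    unfolding P_def by (rule assms(1)[unfolded absolutely_continuous_on_def, THEN spec, THEN mp, OF assms(2)])
  then obtain \<eta> where "\<eta> > 0" and "P \<eta>" by blast
  note \<eta> = \<open>P \<eta>\<close>[unfolded P_def]
  show thesis
  proof (rule that[OF \<open>\<eta> > 0\<close>], intro allI impI)
    fix I :: "'i set" and u v
    assume I: "finite I" "\<forall>i\<in>I. a \<le> u i \<and> u i \<le> v i \<and> v i \<le> b"
      "\<forall>i\<in>I. \<forall>j\<in>I. i \<noteq> j \<longrightarrow> {u i<..<v i} \<inter> {u j<..<v j} = {}"
      "(\<Sum>i\<in>I. v i - u i) < \<eta>"
    from ex_bij_betw_nat_finite[OF I(1)] obtain h where h: "bij_betw h {..<card I} I"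
      by (auto simp: atLeast0LessThan)
    then have hI: "h i \<in> I" if "i < card I" for i using that by (auto simp: bij_betw_def)
    have hinj: "h i \<noteq> h j" if "i < card I" "j < card I" "i \<noteq> j" for i j
      using h that by (auto simp: bij_betw_def inj_on_def)
    have "(\<Sum>i<card I. norm (f ((v \<circ> h) i) - f ((u \<circ> h) i))) < \<epsilon>"
    proof (rule \<eta>[THEN spec, THEN spec, THEN spec, THEN mp, THEN mp, THEN mp])
      show "(\<Sum>i<card I. (v \<circ> h) i - (u \<circ> h) i) < \<eta>"
        using I(4) sum.reindex_bij_betw[OF h, of "\<lambda>i. v i - u i"] by simp
      show "\<forall>i<card I. \<forall>j<card I. i \<noteq> j \<longrightarrow>
          {(u \<circ> h) i<..<(v \<circ> h) i} \<inter> {(u \<circ> h) j<..<(v \<circ> h) j} = {}"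
        using I(3) hI hinj unfolding o_def by blast
    qed (use I hI in auto)
    then show "(\<Sum>i\<in>I. norm (f (v i) - f (u i))) < \<epsilon>"
      using sum.reindex_bij_betw[OF h, of "\<lambda>i. norm (f (v i) - f (u i))"] by simp
  qed
qed

lemma absolutely_continuous_on_imp_continuous_on:
  assumes "absolutely_continuous_on a b f"
  shows "continuous_on {a..b} f"
  unfolding continuous_on_iff
proof (intro ballI allI impI)
  fix x \<epsilon> :: real assume x: "x \<in> {a..b}" "\<epsilon> > 0"
  obtain \<eta> where \<eta>: "\<eta> > 0"
    "\<forall>(I :: unit set) u v. finite I \<longrightarrow> (\<forall>i\<in>I. a \<le> u i \<and> u i \<le> v i \<and> v i \<le> b) \<longrightarrow>
       (\<forall>i\<in>I. \<forall>j\<in>I. i \<noteq> j \<longrightarrow> {u i<..<v i} \<inter> {u j<..<v j} = {}) \<longrightarrow>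
       (\<Sum>i\<in>I. v i - u i) < \<eta> \<longrightarrow> (\<Sum>i\<in>I. norm (f (v i) - f (u i))) < \<epsilon>"
    by (rule absolutely_continuous_on_family[OF assms x(2), where 'i = unit]) (rule that)
  have *: "norm (f v - f u) < \<epsilon>" if "a \<le> u" "u \<le> v" "v \<le> b" "v - u < \<eta>" for u v
    using \<eta>(2)[rule_format, of UNIV "\<lambda>_. u" "\<lambda>_. v"] that by simp
  have "dist (f y) (f x) < \<epsilon>" if "y \<in> {a..b}" "dist y x < \<eta>" for y
    using *[of x y] *[of y x] that x(1)
    by (cases "x \<le> y") (simp_all add: dist_norm dist_real_def norm_minus_commute)
  then show "\<exists>d>0. \<forall>x'\<in>{a..b}. dist x' x < d \<longrightarrow> dist (f x') (f x) < \<epsilon>" using \<eta>(1) by blast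
qed

text \<open>Absolute continuity of \<open>G\<close> says that its Lebesgue-Stieltjes measure is absolutely continuous
  with respect to Lebesgue measure: a null set lies in an open set of small measure, and a
  countable cover of it by non-overlapping intervals inside the open set has small variation.
  The density is then provided by the Radon-Nikodym theorem.\<close>

lemma mono_absolutely_continuous_density:
  fixes G :: "real \<Rightarrow> real"
  assumes "a < b" and mono: "\<And>x y. \<lbrakk>a \<le> x; x \<le> y; y \<le> b\<rbrakk> \<Longrightarrow> G x \<le> G y"
    and ac: "absolutely_continuous_on a b (\<lambda>t. complex_of_real (G t))"
  shows "\<exists>g. g absolutely_integrable_on {a..b} \<and> (\<forall>x\<in>{a..b}. (g has_integral (G x - G a)) {a..x})"
proof -
  \<comment> \<open>clamping to \<open>[a, b]\<close> extends \<open>G\<close> to a continuous monotone function on the line\<close>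
  define cl where "cl x = max a (min b x)" for x
  define F where "F x = G (cl x)" for x
  define \<mu> where "\<mu> = interval_measure F"
  have cl: "a \<le> cl x" "cl x \<le> b" for x using \<open>a < b\<close> by (auto simp: cl_def)
  have clmono: "cl x \<le> cl y" if "x \<le> y" for x y using that by (auto simp: cl_def)
  have monoF: "F x \<le> F y" if "x \<le> y" for x y
    unfolding F_def using that cl clmono by (intro mono) auto
  have "continuous_on {a..b} G"
    using continuous_on_Re[OF absolutely_continuous_on_imp_continuous_on[OF ac]] by simp
  then have contF: "continuous_on UNIV F"
    unfolding F_def
  proof (rule continuous_on_compose2)
    show "continuous_on UNIV cl" unfolding cl_def[abs_def] by (intro continuous_intros)
  qed (use cl in auto)
  have rc: "continuous (at_right x) F" for x
    using contF by (simp add: continuous_on_eq_continuous_within continuous_at_imp_continuous_within)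
  have Icc: "emeasure \<mu> {x..y} = ennreal (F y - F x)" if "x \<le> y" for x y
    unfolding \<mu>_def by (rule emeasure_interval_measure_Icc) (use that monoF contF in auto)
  have Ioc: "emeasure \<mu> {x<..y} = ennreal (F y - F x)" if "x \<le> y" for x y
    unfolding \<mu>_def by (rule emeasure_interval_measure_Ioc) (use that monoF rc in auto)
  have sets\<mu>: "sets \<mu> = sets borel" by (simp add: \<mu>_def)
  have null: "emeasure \<mu> (N \<inter> {-real k..k}) = 0" if N: "N \<in> null_sets lborel" for N k
  proof -
    let ?N = "N \<inter> {-real k..k}"
    have N0: "?N \<in> null_sets lborel" using N by (rule null_set_Int2) auto
    then have N1: "?N \<in> null_sets lebesgue" by (rule null_sets_completionI)
    have "emeasure \<mu> ?N \<le> ennreal \<epsilon>" if e0: "\<epsilon> > 0" for \<epsilon>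
    proof -
      obtain \<eta> where "\<eta> > 0" and \<eta>:
    "\<forall>(I :: real set set) u v. finite I \<longrightarrow> (\<forall>i\<in>I. a \<le> u i \<and> u i \<le> v i \<and> v i \<le> b) \<longrightarrow>
       (\<forall>i\<in>I. \<forall>j\<in>I. i \<noteq> j \<longrightarrow> {u i<..<v i} \<inter> {u j<..<v j} = {}) \<longrightarrow>
       (\<Sum>i\<in>I. v i - u i) < \<eta> \<longrightarrow> (\<Sum>i\<in>I. norm (complex_of_real (G (v i)) - complex_of_real (G (u i)))) < \<epsilon>"
        by (rule absolutely_continuous_on_family[OF ac e0, where 'i = "real set"]) (rule that)
      obtain U where U: "open U" "?N \<subseteq> U" "U - ?N \<in> lmeasurable" "emeasure lebesgue (U - ?N) < ennreal \<eta>"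
        using sets_lebesgue_outer_open[of ?N \<eta>] N1 \<open>\<eta> > 0\<close> by (auto simp: null_sets_def)
      have "emeasure lebesgue U < ennreal \<eta>"
        using U(4) emeasure_Diff_null_set[OF N1, of U] U(1) by auto
      then have "emeasure lebesgue U < \<infinity>" by (rule order.strict_trans) simp
      then have Um1: "U \<in> lmeasurable" using U(1) by (simp add: fmeasurable_def)
      have "ennreal (measure lebesgue U) < ennreal \<eta>"
        using \<open>emeasure lebesgue U < ennreal \<eta>\<close> emeasure_eq_measure2[OF Um1] by simp
      then have Um: "U \<in> lmeasurable" "measure lebesgue U < \<eta>"
        using Um1 by (simp_all add: ennreal_less_iff)
      have g: "gauge (\<lambda>x. if x \<in> U then U else UNIV)" using U(1) by (auto simp: gauge_def)
      have s: "?N \<subseteq> cbox (- real k - 1) (real k + 1)" "box (- real k - 1) (real k + 1) \<noteq> {}"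
        by (auto simp: box_real)
      have "\<exists>D. countable D \<and> (\<forall>K\<in>D. interior K \<noteq> {} \<and> (\<exists>c d. K = cbox c d)) \<and>
          pairwise (\<lambda>A B. interior A \<inter> interior B = {}) D \<and> (\<forall>K\<in>D. K \<subseteq> U) \<and> ?N \<subseteq> \<Union>D"
      proof (rule covering_lemma[OF s g])
        fix D :: "real set set"
        assume D: "countable D"
          "\<And>K. K \<in> D \<Longrightarrow> interior K \<noteq> {} \<and> (\<exists>c d. K = cbox c d)"
          "pairwise (\<lambda>A B. interior A \<inter> interior B = {}) D"
          "\<And>K. K \<in> D \<Longrightarrow> \<exists>x\<in>?N \<inter> K. K \<subseteq> (if x \<in> U then U else UNIV)"
          "?N \<subseteq> \<Union>D"
        have "K \<subseteq> U" if K: "K \<in> D" for K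
        proof -
          obtain x where "x \<in> ?N" "K \<subseteq> (if x \<in> U then U else UNIV)" using D(4)[OF K] by blast
          then show ?thesis using U(2) by (simp add: subset_iff)
        qed
        with D show ?thesis by (intro exI[of _ D]) simp
      qed
      then obtain D where D: "countable D"
        "\<And>K. K \<in> D \<Longrightarrow> interior K \<noteq> {} \<and> (\<exists>c d. K = cbox c d)"
        "pairwise (\<lambda>A B. interior A \<inter> interior B = {}) D"
        "\<And>K. K \<in> D \<Longrightarrow> K \<subseteq> U" "?N \<subseteq> \<Union>D" by metis
      note DU = D(4)
      have DI: "K = {Inf K..Sup K}" "Inf K < Sup K" "interior K = {Inf K<..<Sup K}" if "K \<in> D" for K
      proof -
        from D(2)[OF that] obtain c d where "K = {c..d}" "{c<..<d} \<noteq> {}" by auto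
        then show "K = {Inf K..Sup K}" "Inf K < Sup K" "interior K = {Inf K<..<Sup K}" by auto
      qed
      have iD: "interior K \<in> lmeasurable" if "K \<in> D" for K
        using DI(3)[OF that] by (metis bounded_set_imp_lmeasurable bounded_box box_real(1) sets_completionI_sets
            sets_lborel greaterThanLessThan_borel)
      have sD: "K \<in> sets \<mu>" if "K \<in> D" for K using DI(1)[OF that] sets\<mu> by (metis atLeastAtMost_borel)
      have mD: "measure \<mu> K = F (Sup K) - F (Inf K)" "emeasure \<mu> K \<noteq> \<infinity>" if "K \<in> D" for K
        using DI(1,2)[OF that] Icc[of "Inf K" "Sup K"] monoF[of "Inf K" "Sup K"]
        by (auto simp: measure_def)
      have fD: "K \<in> fmeasurable \<mu>" if "K \<in> D" for K
        using sD mD that by (auto simp: fmeasurable_def top.not_eq_extremum)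
      have bound: "measure \<mu> (\<Union>K\<in>D'. K) \<le> \<epsilon>" if D': "D' \<subseteq> D" "finite D'" for D'
      proof -
        have "measure \<mu> (\<Union>K\<in>D'. K) \<le> (\<Sum>K\<in>D'. measure \<mu> K)"
          using D' sD by (intro measure_UNION_le) auto
        also have "\<dots> = (\<Sum>K\<in>D'. norm (complex_of_real (G (cl (Sup K))) - complex_of_real (G (cl (Inf K)))))"
        proof (rule sum.cong)
          fix K assume "K \<in> D'"
          then have "K \<in> D" using D' by auto
          then show "measure \<mu> K = norm (complex_of_real (G (cl (Sup K))) - complex_of_real (G (cl (Inf K))))"
            using mD[of K] DI(2)[of K] monoF[of "Inf K" "Sup K"]
            by (simp add: F_def norm_of_real flip: of_real_diff)
        qed simp
        also have "\<dots> < \<epsilon>"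
        proof (rule \<eta>[rule_format])
          have "(\<Sum>K\<in>D'. cl (Sup K) - cl (Inf K)) \<le> (\<Sum>K\<in>D'. measure lebesgue (interior K))"
          proof (rule sum_mono)
            fix K assume "K \<in> D'"
            then show "cl (Sup K) - cl (Inf K) \<le> measure lebesgue (interior K)"
              using DI[of K] D' by (auto simp: cl_def)
          qed
          also have "\<dots> = measure lebesgue (\<Union>K\<in>D'. interior K)"
          proof (rule measure_finite_Union[symmetric])
            show "disjoint_family_on interior D'"
              using D(3) D' by (auto simp: disjoint_family_on_def pairwise_def)
            show "emeasure lebesgue (interior K) \<noteq> \<infinity>" if "K \<in> D'" for K
              using fmeasurableD2[OF iD, of K] that D' by (auto simp: top_ennreal_def infinity_ennreal_def)
          qed (use D' in auto)
          also have "\<dots> \<le> measure lebesgue U"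
          proof (rule measure_mono_fmeasurable)
            show "(\<Union>K\<in>D'. interior K) \<subseteq> U"
              using DU D' interior_subset by (meson UN_least subset_trans subsetD)
          qed (use Um D' in auto)
          finally show "(\<Sum>K\<in>D'. cl (Sup K) - cl (Inf K)) < \<eta>" using Um by simp
          fix K assume "K \<in> D'"
          then show "a \<le> cl (Inf K) \<and> cl (Inf K) \<le> cl (Sup K) \<and> cl (Sup K) \<le> b"
            using cl clmono DI(2)[of K] D' by auto
        next
          fix K L assume KL: "K \<in> D'" "L \<in> D'" "K \<noteq> L"
          have sub: "{cl x<..<cl y} \<subseteq> {x<..<y}" for x y by (auto simp: cl_def)
          have "interior K \<inter> interior L = {}" using D(3) KL D' by (auto simp: pairwise_def)
          moreover have "{cl (Inf K)<..<cl (Sup K)} \<subseteq> interior K" "{cl (Inf L)<..<cl (Sup L)} \<subseteq> interior L"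
            using KL D' sub by (subst DI(3); auto)+
          ultimately show "{cl (Inf K)<..<cl (Sup K)} \<inter> {cl (Inf L)<..<cl (Sup L)} = {}"
            by (metis Int_mono subset_empty)
        qed (use D' in auto)
        finally show ?thesis by simp
      qed
      have "emeasure \<mu> ?N \<le> emeasure \<mu> (\<Union>K\<in>D. K)"
        using D(5) D(1) sD by (intro emeasure_mono) auto
      also have "\<dots> = ennreal (measure \<mu> (\<Union>K\<in>D. K))"
        by (rule emeasure_eq_measure2, rule fmeasurable_UN_bound[where I = D and A = "\<lambda>K. K" and B = \<epsilon>, OF D(1) fD bound])
      also have "\<dots> \<le> ennreal \<epsilon>"
        by (rule ennreal_leI, rule measure_UN_bound[where I = D and A = "\<lambda>K. K" and B = \<epsilon>, OF D(1) fD bound])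
      finally show ?thesis .
    qed
    then have "emeasure \<mu> ?N \<le> 0" by (intro ennreal_le_epsilon[of 0]) (simp only: add_0)
    then show ?thesis by simp
  qed
  have "absolutely_continuous lborel \<mu>"
    unfolding absolutely_continuous_def
  proof
    fix N :: "real set" assume N: "N \<in> null_sets lborel"
    have [measurable]: "N \<in> sets borel" using N by auto
    have "N = (\<Union>k. N \<inter> {-real k..k})"
    proof -
      have "\<exists>k. x \<in> {-real k..k}" for x
        using real_arch_simple[of "\<bar>x\<bar>"] by (auto simp: abs_le_iff) (metis minus_le_iff)
      then show ?thesis by blast
    qed
    moreover have "(\<Union>k. N \<inter> {-real k..k}) \<in> null_sets \<mu>"
      using null[OF N] by (intro null_sets_UN) (auto simp: null_sets_def sets\<mu>)
    ultimately show "N \<in> null_sets \<mu>" by simp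
  qed
  from sigma_finite_measure.Radon_Nikodym[OF sigma_finite_lborel this] sets\<mu> obtain g0 where [measurable]: "g0 \<in> borel_measurable borel"
    and g0: "density lborel g0 = \<mu>" by auto
  define g where "g x = enn2real (g0 x)" for x
  have [measurable]: "g \<in> borel_measurable borel" unfolding g_def[abs_def] by measurable
  have dens: "(\<integral>\<^sup>+t. g0 t * indicator {x..y} t \<partial>lborel) = ennreal (F y - F x)" if "x \<le> y" for x y
    using Icc[OF that] unfolding g0[symmetric] by (subst (asm) emeasure_density) auto
  have fin: "AE t in lborel. g0 t * indicator {a..b} t \<noteq> \<infinity>"
    using dens[of a b] \<open>a < b\<close> by (intro nn_integral_PInf_AE) auto
  have key: "(g has_integral (G x - G a)) {a..x}" if x: "x \<in> {a..b}" for x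
  proof -
    have "(\<integral>\<^sup>+t. ennreal (indicator {a..x} t * g t) \<partial>lborel) = (\<integral>\<^sup>+t. g0 t * indicator {a..x} t \<partial>lborel)"
    proof (rule nn_integral_cong_AE, use fin in eventually_elim)
      fix t assume "g0 t * indicator {a..b} t \<noteq> \<infinity>"
      then show "ennreal (indicator {a..x} t * g t) = g0 t * indicator {a..x} t"
        using x by (auto simp: indicator_def g_def top.not_eq_extremum split: if_splits)
    qed
    also have "\<dots> = ennreal (F x - F a)" using x by (intro dens) auto
    also have "F x - F a = G x - G a" using x by (auto simp: F_def cl_def min_def max_def)
    finally have "((\<lambda>t. indicator {a..x} t * g t) has_integral (G x - G a)) UNIV"
      using mono[of a x] x by (intro nn_integral_has_integral) (auto simp: g_def)
    then show ?thesis
      by (simp add: indicator_times_eq_if(1) flip: has_integral_restrict_UNIV[of "{a..x}"])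
  qed
  have "g absolutely_integrable_on {a..b}"
    by (rule nonnegative_absolutely_integrable_1) (use key[of b] \<open>a < b\<close> in \<open>auto simp: g_def has_integral_integrable\<close>)
  then show ?thesis using key by blast
qed

text \<open>\<open>V x\<close> is the variation of \<open>f\<close> on \<open>[0, x]\<close> measured on dyadic grids only. These grids are
  nested, so the variations increase with the level and \<open>V\<close> is a monotone limit; by continuity
  of \<open>f\<close> the grid points suffice to dominate all increments.\<close>

lemma absolutely_continuous_on_variation:
  fixes f :: "real \<Rightarrow> complex"
  assumes b: "b > 0" and ac: "absolutely_continuous_on 0 b f"
  shows "\<exists>V. (\<forall>x y. 0 \<le> x \<longrightarrow> x \<le> y \<longrightarrow> y \<le> b \<longrightarrow> norm (f y - f x) \<le> V y - V x) \<and>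
    absolutely_continuous_on 0 b (\<lambda>t. complex_of_real (V t))"
proof -
  \<comment> \<open>\<open>p n j\<close> is a grid point of level \<open>n\<close>, and \<open>k n x\<close> the index of the last one not beyond \<open>x\<close>\<close>
  define p where "p n j = b * real j / 2 ^ n" for n j :: nat
  define k where "k n x = nat \<lfloor>x * 2 ^ n / b\<rfloor>" for n :: nat and x
  define c where "c n j = norm (f (p n (Suc j)) - f (p n j))" for n j
  define W where "W n x = (\<Sum>j<k n x. c n j)" for n x
  define V where "V x = (SUP n. W n x)" for x
  have c0: "c n j \<ge> 0" for n j by (simp add: c_def)
  have pSuc: "p n (Suc j) = p n j + b / 2 ^ n" for n j
    by (simp add: p_def field_simps)
  have pmono: "p n i \<le> p n j" if "i \<le> j" for n i j
    using that b by (simp add: p_def divide_right_mono)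
  have kle: "p n (k n x) \<le> x" "x < p n (k n x) + b / 2 ^ n" if "0 \<le> x" for n x
  proof -
    have nn: "0 \<le> x * 2 ^ n / b" using that b by simp
    have "real (k n x) \<le> x * 2 ^ n / b" "x * 2 ^ n / b < real (k n x) + 1"
      using nn by (simp_all add: k_def)
    then show "p n (k n x) \<le> x" "x < p n (k n x) + b / 2 ^ n"
      using b by (simp_all add: p_def field_simps)
  qed
  have kmono: "k n x \<le> k n y" if "x \<le> y" for n x y
    unfolding k_def using that b by (intro nat_mono floor_mono divide_right_mono mult_right_mono) auto
  have kb: "k n b = 2 ^ n" for n
  proof -
    have "b * 2 ^ n / b = of_int (2 ^ n)" using b by simp
    then show ?thesis unfolding k_def by (simp only: floor_of_int) (simp add: nat_power_eq)
  qed
  have k2: "2 * k n x \<le> k (Suc n) x" if "0 \<le> x" for n x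
  proof -
    have "2 * \<lfloor>x * 2 ^ n / b\<rfloor> \<le> \<lfloor>x * 2 ^ Suc n / b\<rfloor>"
    proof -
      have "x * 2 ^ Suc n / b = 2 * (x * 2 ^ n / b)" by simp
      moreover have "of_int (2 * \<lfloor>x * 2 ^ n / b\<rfloor>) \<le> 2 * (x * 2 ^ n / b)"
        using of_int_floor_le[of "x * 2 ^ n / b"] by linarith
      ultimately show ?thesis unfolding le_floor_iff by (simp only:)
    qed
    moreover have "0 \<le> \<lfloor>x * 2 ^ n / b\<rfloor>" using that b by simp
    ultimately show ?thesis unfolding k_def by linarith
  qed
  have tele: "norm (f (p n m') - f (p n m)) \<le> (\<Sum>j=m..<m'. c n j)" if "m \<le> m'" for n m m'
    using that
  proof (induction m' rule: dec_induct)
    case (step i)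
    have "norm (f (p n (Suc i)) - f (p n m)) \<le> norm (f (p n i) - f (p n m)) + c n i"
      unfolding c_def by (metis add.commute diff_add_cancel norm_triangle_ineq add_diff_eq)
    then show ?case using step by simp
  qed simp
  have refine: "(\<Sum>j<m. c n j) \<le> (\<Sum>j<2 * m. c (Suc n) j)" for n m
  proof (induction m)
    case (Suc m)
    have p2: "p n j = p (Suc n) (2 * j)" for j by (simp add: p_def)
    have "c n m = norm (f (p (Suc n) (Suc (Suc (2 * m)))) - f (p (Suc n) (2 * m)))"
      unfolding c_def p2 by simp
    also have "\<dots> \<le> (\<Sum>j=2 * m..<Suc (Suc (2 * m)). c (Suc n) j)" by (rule tele) simp
    finally show ?case using Suc by simp
  qed simp
  have Wdiff: "W n y - W n x = (\<Sum>j=k n x..<k n y. c n j)" if "x \<le> y" for n x y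
    unfolding W_def using sum.atLeastLessThan_concat[of 0 "k n x" "k n y" "c n"] kmono[OF that]
    by (simp add: atLeast0LessThan)
  have Wmono: "W n x \<le> W n y" if "x \<le> y" for n x y
    using Wdiff[OF that, of n] sum_nonneg[of "{k n x..<k n y}" "c n"] c0 by simp
  have Winc: "incseq (\<lambda>n. W n x)" if "0 \<le> x" for x
  proof (rule incseq_SucI)
    fix n
    have "W n x \<le> (\<Sum>j<2 * k n x. c (Suc n) j)" unfolding W_def by (rule refine)
    also have "\<dots> \<le> W (Suc n) x" unfolding W_def using k2[OF that] c0 by (intro sum_mono2) auto
    finally show "W n x \<le> W (Suc n) x" .
  qed
  \<comment> \<open>absolute continuity, in terms of sets of cells of a grid\<close>
  have blocks: "\<exists>\<eta>>0. \<forall>n J. J \<subseteq> {..<2 ^ n} \<longrightarrow> card J * (b / 2 ^ n) < \<eta> \<longrightarrow> (\<Sum>j\<in>J. c n j) < \<epsilon>"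
    if \<epsilon>: "\<epsilon> > 0" for \<epsilon>
  proof -
    obtain \<eta> where \<eta>: "\<eta> > 0" "\<forall>(I :: nat set) u v. finite I \<longrightarrow> (\<forall>i\<in>I. 0 \<le> u i \<and> u i \<le> v i \<and> v i \<le> b) \<longrightarrow>
       (\<forall>i\<in>I. \<forall>j\<in>I. i \<noteq> j \<longrightarrow> {u i<..<v i} \<inter> {u j<..<v j} = {}) \<longrightarrow>
       (\<Sum>i\<in>I. v i - u i) < \<eta> \<longrightarrow> (\<Sum>i\<in>I. norm (f (v i) - f (u i))) < \<epsilon>"
      by (rule absolutely_continuous_on_family[OF ac \<epsilon>, where 'i = nat]) (rule that)
    have "(\<Sum>j\<in>J. c n j) < \<epsilon>" if J: "J \<subseteq> {..<2 ^ n}" "card J * (b / 2 ^ n) < \<eta>" for n J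
      unfolding c_def
    proof (rule \<eta>(2)[rule_format])
      show "finite J" using J finite_subset by blast
      show "(\<Sum>j\<in>J. p n (Suc j) - p n j) < \<eta>" using J by (simp add: pSuc)
    next
      fix i assume "i \<in> J"
      then have "Suc i \<le> 2 ^ n" using J by auto
      from pmono[OF this, of n] have "p n (Suc i) \<le> b" by (simp add: p_def)
      then show "0 \<le> p n i \<and> p n i \<le> p n (Suc i) \<and> p n (Suc i) \<le> b"
        using pmono[of 0 i n] pmono[of i "Suc i" n] by (simp add: p_def)
    next
      fix i j :: nat assume "i \<noteq> j"
      then have "p n (Suc i) \<le> p n j \<or> p n (Suc j) \<le> p n i"
        using pmono[of "Suc i" j n] pmono[of "Suc j" i n] by linarith
      then show "{p n i<..<p n (Suc i)} \<inter> {p n j<..<p n (Suc j)} = {}" by auto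
    qed
    with \<eta>(1) show ?thesis by blast
  qed
  have small: "(\<lambda>n. K * (b / 2 ^ n)) \<longlonglongrightarrow> 0" for K
  proof -
    have "(\<lambda>n. (1 / 2 :: real) ^ n) \<longlonglongrightarrow> 0" by (rule LIMSEQ_realpow_zero) auto
    moreover have "(\<lambda>n. K * (b / 2 ^ n)) = (\<lambda>n. K * b * (1 / 2) ^ n)"
      by (rule ext) (simp add: power_one_over)
    ultimately show ?thesis using tendsto_mult_left[of "\<lambda>n. (1 / 2) ^ n" 0 sequentially "K * b"] by simp
  qed
  \<comment> \<open>the variation over each of \<open>2 ^ n0\<close> blocks is below \<open>1\<close>, whatever the level\<close>
  have Wbound: "\<exists>B. \<forall>n. W n b \<le> B"
  proof -
    obtain \<eta> where \<eta>: "\<eta> > 0" "\<And>n J. J \<subseteq> {..<2 ^ n} \<Longrightarrow> card J * (b / 2 ^ n) < \<eta> \<Longrightarrow> (\<Sum>j\<in>J. c n j) < 1"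
      using blocks[of 1] by auto
    obtain n0 where n0: "b / 2 ^ n0 < \<eta>"
      using order_tendstoD(2)[OF small[of 1] \<eta>(1)] by (auto simp: eventually_sequentially)
    have "W n b \<le> 2 ^ n0" for n
    proof -
      have "W n b \<le> W (n0 + n) b" using Winc[of b] b by (simp add: incseq_def)
      also have "\<dots> = (\<Sum>j<2 ^ n0 * 2 ^ n. c (n0 + n) j)" by (simp add: W_def kb power_add)
      also have "\<dots> = (\<Sum>m<2 ^ n0. \<Sum>j=m * 2 ^ n..<m * 2 ^ n + 2 ^ n. c (n0 + n) j)"
        by (rule sum.nat_group[symmetric])
      also have "\<dots> \<le> (\<Sum>m<(2::nat) ^ n0. 1)"
      proof (rule sum_mono, rule less_imp_le, rule \<eta>(2))
        fix m :: nat assume "m \<in> {..<2 ^ n0}"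
        then have "Suc m * 2 ^ n \<le> 2 ^ n0 * 2 ^ n" by (intro mult_right_mono) auto
        then show "{m * 2 ^ n..<m * 2 ^ n + 2 ^ n} \<subseteq> {..<2 ^ (n0 + n)}"
          by (auto simp: power_add)
        show "real (card {m * 2 ^ n..<m * 2 ^ n + 2 ^ n}) * (b / 2 ^ (n0 + n)) < \<eta>"
          using n0 by (simp add: power_add)
      qed
      finally show ?thesis by simp
    qed
    then show ?thesis by blast
  qed
  then obtain B where B: "\<And>n. W n b \<le> B" by blast
  have WV: "(\<lambda>n. W n x) \<longlonglongrightarrow> V x" if "0 \<le> x" "x \<le> b" for x
    unfolding V_def using that B Wmono[of x b] by (intro LIMSEQ_incseq_SUP Winc bdd_aboveI2[of _ _ B]) (auto intro: order_trans)
  have pk: "(\<lambda>n. p n (k n x)) \<longlonglongrightarrow> x" if "0 \<le> x" for x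
  proof (rule LIM_zero_cancel, rule Lim_null_comparison)
    show "\<forall>\<^sub>F n in sequentially. norm (p n (k n x) - x) \<le> 1 * (b / 2 ^ n)"
      using kle[OF that] by (intro always_eventually allI) (simp add: abs_le_iff less_imp_le, smt (verit))
  qed (rule small)
  have fp: "(\<lambda>n. f (p n (k n x))) \<longlonglongrightarrow> f x" if "0 \<le> x" "x \<le> b" for x
  proof (rule continuous_on_tendsto_compose[OF absolutely_continuous_on_imp_continuous_on[OF ac] pk])
    show "\<forall>\<^sub>F n in sequentially. p n (k n x) \<in> {0..b}"
      using kle(1)[OF that(1)] that b by (intro always_eventually allI) (auto simp: p_def intro: order_trans)
  qed (use that in auto)
  have main: "norm (f y - f x) \<le> V y - V x" if "0 \<le> x" "x \<le> y" "y \<le> b" for x y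
  proof (rule tendsto_le[OF trivial_limit_sequentially])
    show "(\<lambda>n. W n y - W n x) \<longlonglongrightarrow> V y - V x" using that by (intro tendsto_diff WV) auto
    show "(\<lambda>n. norm (f (p n (k n y)) - f (p n (k n x)))) \<longlonglongrightarrow> norm (f y - f x)"
      using that by (intro tendsto_norm tendsto_diff fp) auto
    show "\<forall>\<^sub>F n in sequentially. norm (f (p n (k n y)) - f (p n (k n x))) \<le> W n y - W n x"
      using tele kmono Wdiff that by (intro always_eventually allI) simp
  qed
  have "absolutely_continuous_on 0 b (\<lambda>t. complex_of_real (V t))"
    unfolding absolutely_continuous_on_def
  proof (intro allI impI)
    fix \<epsilon> :: real assume "\<epsilon> > 0"
    then obtain \<eta> where \<eta>: "\<eta> > 0"
      "\<And>n J. J \<subseteq> {..<2 ^ n} \<Longrightarrow> card J * (b / 2 ^ n) < \<eta> \<Longrightarrow> (\<Sum>j\<in>J. c n j) < \<epsilon> / 2"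
      using blocks[of "\<epsilon> / 2"] by auto
    have "(\<Sum>i<m. norm (complex_of_real (V (v i)) - complex_of_real (V (u i)))) < \<epsilon>"
      if uv: "\<forall>i<m. 0 \<le> u i \<and> u i \<le> v i \<and> v i \<le> b"
        and disj: "\<forall>i<m. \<forall>j<m. i \<noteq> j \<longrightarrow> {u i<..<v i} \<inter> {u j<..<v j} = {}"
        and len: "(\<Sum>i<m. v i - u i) < \<eta>" for m :: nat and u v
    proof -
      have "(\<lambda>n. (\<Sum>i<m. v i - u i) + real m * (b / 2 ^ n)) \<longlonglongrightarrow> (\<Sum>i<m. v i - u i) + 0"
        by (intro tendsto_add tendsto_const small)
      then have ev: "\<forall>\<^sub>F n in sequentially. (\<Sum>i<m. v i - u i) + real m * (b / 2 ^ n) < \<eta>"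
        using len by (intro order_tendstoD) auto
      have "(\<Sum>i<m. V (v i) - V (u i)) \<le> \<epsilon> / 2"
      proof (rule tendsto_upperbound[OF _ _ trivial_limit_sequentially])
        show "(\<lambda>n. \<Sum>i<m. W n (v i) - W n (u i)) \<longlonglongrightarrow> (\<Sum>i<m. V (v i) - V (u i))"
          using uv by (intro tendsto_sum tendsto_diff WV) (auto intro: order_trans)
        show "\<forall>\<^sub>F n in sequentially. (\<Sum>i<m. W n (v i) - W n (u i)) \<le> \<epsilon> / 2"
          using ev
        proof eventually_elim
          case (elim n)
          \<comment> \<open>the cells belonging to \<open>(u i, v i)\<close> exceed its length by at most one cell\<close>
          define A where "A i = {k n (u i)..<k n (v i)}" for i
          have disjA: "A i \<inter> A j = {}" if "i < m" "j < m" "i \<noteq> j" for i j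
          proof -
            have "u i = v i \<or> u j = v j \<or> v i \<le> u j \<or> v j \<le> u i"
            proof (rule ccontr)
              assume neg: "\<not> ?thesis"
              then have "u i < v i" "u j < v j" "u j < v i" "u i < v j" using uv that by force+
              then have "(max (u i) (u j) + min (v i) (v j)) / 2 \<in> {u i<..<v i} \<inter> {u j<..<v j}"
                by (auto simp: max_def min_def)
              then show False using disj that by blast
            qed
            then show ?thesis unfolding A_def
              using kmono[of "v i" "u j" n] kmono[of "v j" "u i" n] by auto
          qed
          have "card (\<Union>i<m. A i) = (\<Sum>i<m. card (A i))"
          proof (rule card_UN_disjoint)
            show "\<forall>i\<in>{..<m}. \<forall>j\<in>{..<m}. i \<noteq> j \<longrightarrow> A i \<inter> A j = {}" using disjA by blast
          qed (simp_all add: A_def)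
          then have "card (\<Union>i<m. A i) * (b / 2 ^ n) = (\<Sum>i<m. card (A i) * (b / 2 ^ n))"
            by (simp only: of_nat_sum sum_distrib_right)
          also have "\<dots> \<le> (\<Sum>i<m. v i - u i + b / 2 ^ n)"
          proof (rule sum_mono)
            fix i assume i: "i \<in> {..<m}"
            then have "real (card (A i)) = real (k n (v i)) - real (k n (u i))"
              using kmono[of "u i" "v i" n] uv by (auto simp: A_def of_nat_diff)
            then have "real (card (A i)) * (b / 2 ^ n) = (real (k n (v i)) - real (k n (u i))) * (b / 2 ^ n)"
              by simp
            also have "\<dots> = p n (k n (v i)) - p n (k n (u i))"
              by (simp add: p_def field_simps)
            also have "\<dots> \<le> v i - u i + b / 2 ^ n"
              using kle[of "v i" n] kle[of "u i" n] uv i by (smt (verit) lessThan_iff)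
            finally show "real (card (A i)) * (b / 2 ^ n) \<le> v i - u i + b / 2 ^ n" .
          qed
          also have "\<dots> < \<eta>" using elim by (simp add: sum.distrib)
          finally have "(\<Sum>j\<in>(\<Union>i<m. A i). c n j) < \<epsilon> / 2"
          proof (rule \<eta>(2)[rotated])
            show "(\<Union>i<m. A i) \<subseteq> {..<2 ^ n}"
              using kmono[of _ b n] uv unfolding A_def kb[symmetric] by (fastforce intro: less_le_trans)
          qed
          also have "(\<Sum>j\<in>(\<Union>i<m. A i). c n j) = (\<Sum>i<m. \<Sum>j\<in>A i. c n j)"
          proof (rule sum.UNION_disjoint)
            show "\<forall>i\<in>{..<m}. \<forall>j\<in>{..<m}. i \<noteq> j \<longrightarrow> A i \<inter> A j = {}" using disjA by blast
          qed (simp_all add: A_def)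
          also have "\<dots> = (\<Sum>i<m. W n (v i) - W n (u i))"
            using uv by (intro sum.cong[OF refl]) (simp add: Wdiff A_def)
          finally show ?case by simp
        qed
      qed
      moreover have "norm (complex_of_real (V (v i)) - complex_of_real (V (u i))) = V (v i) - V (u i)"
        if "i < m" for i
      proof -
        have "0 \<le> V (v i) - V (u i)"
          using uv that by (intro order_trans[OF norm_ge_zero main]) auto
        then show ?thesis by (simp flip: of_real_diff add: norm_of_real)
      qed
      ultimately show ?thesis using \<open>\<epsilon> > 0\<close> by simp
    qed
    with \<eta>(1) show "\<exists>\<eta>>0. \<forall>(n::nat) u v. (\<forall>i<n. 0 \<le> u i \<and> u i \<le> v i \<and> v i \<le> b) \<longrightarrow>
        (\<forall>i<n. \<forall>j<n. i \<noteq> j \<longrightarrow> {u i<..<v i} \<inter> {u j<..<v j} = {}) \<longrightarrow>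
        (\<Sum>i<n. v i - u i) < \<eta> \<longrightarrow>
        (\<Sum>i<n. norm (complex_of_real (V (v i)) - complex_of_real (V (u i)))) < \<epsilon>"
      by (intro exI[of _ \<eta>]) simp
  qed
  with main show ?thesis by blast
qed

lemma absolutely_continuous_on_dominated:
  assumes f: "absolutely_continuous_on a b f" and k: "absolutely_continuous_on a b k"
    and h: "\<And>x y. \<lbrakk>a \<le> x; x \<le> y; y \<le> b\<rbrakk> \<Longrightarrow> norm (h y - h x) \<le> norm (f y - f x) + norm (k y - k x)"
  shows "absolutely_continuous_on a b h"
  unfolding absolutely_continuous_on_def
proof (intro allI impI)
  fix \<epsilon> :: real assume "\<epsilon> > 0"
  then have "\<epsilon> / 2 > 0" by simp
  obtain \<eta>1 where \<eta>1: "\<eta>1 > 0"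
    "\<forall>(I :: nat set) u v. finite I \<longrightarrow> (\<forall>i\<in>I. a \<le> u i \<and> u i \<le> v i \<and> v i \<le> b) \<longrightarrow>
       (\<forall>i\<in>I. \<forall>j\<in>I. i \<noteq> j \<longrightarrow> {u i<..<v i} \<inter> {u j<..<v j} = {}) \<longrightarrow>
       (\<Sum>i\<in>I. v i - u i) < \<eta>1 \<longrightarrow> (\<Sum>i\<in>I. norm (f (v i) - f (u i))) < \<epsilon> / 2"
    by (rule absolutely_continuous_on_family[OF f \<open>\<epsilon> / 2 > 0\<close>, where 'i = nat]) (rule that)
  obtain \<eta>2 where \<eta>2: "\<eta>2 > 0"
    "\<forall>(I :: nat set) u v. finite I \<longrightarrow> (\<forall>i\<in>I. a \<le> u i \<and> u i \<le> v i \<and> v i \<le> b) \<longrightarrow>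
       (\<forall>i\<in>I. \<forall>j\<in>I. i \<noteq> j \<longrightarrow> {u i<..<v i} \<inter> {u j<..<v j} = {}) \<longrightarrow>
       (\<Sum>i\<in>I. v i - u i) < \<eta>2 \<longrightarrow> (\<Sum>i\<in>I. norm (k (v i) - k (u i))) < \<epsilon> / 2"
    by (rule absolutely_continuous_on_family[OF k \<open>\<epsilon> / 2 > 0\<close>, where 'i = nat]) (rule that)
  have "(\<Sum>i<n. norm (h (v i) - h (u i))) < \<epsilon>"
    if uv: "\<forall>i<n. a \<le> u i \<and> u i \<le> v i \<and> v i \<le> b"
      "\<forall>i<n. \<forall>j<n. i \<noteq> j \<longrightarrow> {u i<..<v i} \<inter> {u j<..<v j} = {}"
      "(\<Sum>i<n. v i - u i) < min \<eta>1 \<eta>2" for n :: nat and u v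
  proof -
    have "(\<Sum>i<n. norm (h (v i) - h (u i))) \<le> (\<Sum>i<n. norm (f (v i) - f (u i)) + norm (k (v i) - k (u i)))"
      using uv h by (intro sum_mono) auto
    also have "\<dots> = (\<Sum>i<n. norm (f (v i) - f (u i))) + (\<Sum>i<n. norm (k (v i) - k (u i)))"
      by (rule sum.distrib)
    also have "\<dots> < \<epsilon> / 2 + \<epsilon> / 2"
      using uv \<eta>1(2)[THEN spec[of _ "{..<n}"], THEN spec[of _ u], THEN spec[of _ v]]
        \<eta>2(2)[THEN spec[of _ "{..<n}"], THEN spec[of _ u], THEN spec[of _ v]]
      by (intro add_strict_mono) simp_all
    finally show ?thesis by simp
  qed
  with \<eta>1(1) \<eta>2(1) show "\<exists>\<eta>>0. \<forall>(n::nat) u v. (\<forall>i<n. a \<le> u i \<and> u i \<le> v i \<and> v i \<le> b) \<longrightarrow>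
        (\<forall>i<n. \<forall>j<n. i \<noteq> j \<longrightarrow> {u i<..<v i} \<inter> {u j<..<v j} = {}) \<longrightarrow>
        (\<Sum>i<n. v i - u i) < \<eta> \<longrightarrow> (\<Sum>i<n. norm (h (v i) - h (u i))) < \<epsilon>"
    by (intro exI[of _ "min \<eta>1 \<eta>2"]) simp
qed

text \<open>With the variation \<open>V\<close> the functions \<open>V\<close>, \<open>V + Re f\<close> and \<open>V + Im f\<close> are monotone and absolutely
  continuous, so they have densities, and a density of \<open>f\<close> is a combination of these.\<close>

theorem absolutely_continuous_on_FTC:
  fixes f :: "real \<Rightarrow> complex"
  assumes b: "b > 0" and ac: "absolutely_continuous_on 0 b f"
  shows "\<exists>g. g absolutely_integrable_on {0..b} \<and> (\<forall>x\<in>{0..b}. (g has_integral (f x - f 0)) {0..x}) \<and>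
    negligible {x \<in> {0<..<b}. \<not> (f has_vector_derivative g x) (at x)}"
proof -
  obtain V where V: "\<And>x y. 0 \<le> x \<Longrightarrow> x \<le> y \<Longrightarrow> y \<le> b \<Longrightarrow> norm (f y - f x) \<le> V y - V x"
    and acV: "absolutely_continuous_on 0 b (\<lambda>t. complex_of_real (V t))"
    using absolutely_continuous_on_variation[OF b ac] by blast
  have density: "\<exists>g. g absolutely_integrable_on {0..b} \<and>
      (\<forall>x\<in>{0..b}. (g has_integral ((V x + r (f x)) - (V 0 + r (f 0)))) {0..x})"
    if r: "\<And>z. \<bar>r z\<bar> \<le> norm z" "\<And>z w. r (z - w) = r z - r w" for r :: "complex \<Rightarrow> real"
  proof (rule mono_absolutely_continuous_density[OF b])
    fix x y assume xy: "0 \<le> x" "x \<le> y" "y \<le> b"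
    show "V x + r (f x) \<le> V y + r (f y)"
      using V[OF xy] r(1)[of "f y - f x"] r(2)[of "f y" "f x"] by linarith
  next
    show "absolutely_continuous_on 0 b (\<lambda>t. complex_of_real (V t + r (f t)))"
    proof (rule absolutely_continuous_on_dominated[OF acV ac])
      fix x y :: real
      have "norm (complex_of_real (V y + r (f y)) - complex_of_real (V x + r (f x)))
          = \<bar>(V y - V x) + r (f y - f x)\<bar>"
        by (simp only: of_real_diff[symmetric] norm_of_real r(2) add_diff_add)
      also have "\<dots> \<le> \<bar>V y - V x\<bar> + norm (f y - f x)"
        using r(1)[of "f y - f x"] by linarith
      finally show "norm (complex_of_real (V y + r (f y)) - complex_of_real (V x + r (f x)))
          \<le> norm (complex_of_real (V y) - complex_of_real (V x)) + norm (f y - f x)"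
        by (simp only: of_real_diff[symmetric] norm_of_real)
    qed
  qed
  obtain g1 where g1: "g1 absolutely_integrable_on {0..b}"
    "\<And>x. x \<in> {0..b} \<Longrightarrow> (g1 has_integral (V x - V 0)) {0..x}"
    using density[of "\<lambda>_. 0"] by auto
  obtain g2 where g2: "g2 absolutely_integrable_on {0..b}"
    "\<And>x. x \<in> {0..b} \<Longrightarrow> (g2 has_integral ((V x + Re (f x)) - (V 0 + Re (f 0)))) {0..x}"
    using density[of Re] abs_Re_le_cmod by (metis minus_complex.sel(1))
  obtain g3 where g3: "g3 absolutely_integrable_on {0..b}"
    "\<And>x. x \<in> {0..b} \<Longrightarrow> (g3 has_integral ((V x + Im (f x)) - (V 0 + Im (f 0)))) {0..x}"
    using density[of Im] abs_Im_le_cmod by (metis minus_complex.sel(2))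
  define g where "g x = complex_of_real (g2 x - g1 x) + complex_of_real (g3 x - g1 x) * \<i>" for x
  have bl: "bounded_linear (\<lambda>r. complex_of_real r * \<i>)" "bounded_linear complex_of_real"
    by (auto intro: bounded_linear_mult_const bounded_linear_of_real)
  have gi: "g absolutely_integrable_on {0..b}"
    unfolding g_def
    using absolutely_integrable_linear[OF set_integral_diff(1)[OF g2(1) g1(1)] bl(2)]
      absolutely_integrable_linear[OF set_integral_diff(1)[OF g3(1) g1(1)] bl(1)]
    by (intro set_integral_add(1)) (simp_all add: o_def)
  have gf: "(g has_integral (f x - f 0)) {0..x}" if x: "x \<in> {0..b}" for x
  proof -
    have "(g has_integral (complex_of_real ((V x + Re (f x)) - (V 0 + Re (f 0)) - (V x - V 0)) +
        complex_of_real ((V x + Im (f x)) - (V 0 + Im (f 0)) - (V x - V 0)) * \<i>)) {0..x}"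
      unfolding g_def
      using has_integral_linear[OF has_integral_diff[OF g2(2)[OF x] g1(2)[OF x]] bl(2)]
        has_integral_linear[OF has_integral_diff[OF g3(2)[OF x] g1(2)[OF x]] bl(1)]
      by (intro has_integral_add) (simp_all only: o_def)
    also have "complex_of_real ((V x + Re (f x)) - (V 0 + Re (f 0)) - (V x - V 0)) +
        complex_of_real ((V x + Im (f x)) - (V 0 + Im (f 0)) - (V x - V 0)) * \<i> = f x - f 0"
      by (simp add: complex_eq_iff)
    finally show ?thesis .
  qed
  have "negligible {x \<in> {0<..<b}. \<not> (f has_vector_derivative g x) (at x)}"
  proof (rule negligible_subset[OF indefinite_integral_differentiable_AE[of g 0 b]])
    show "g integrable_on {0..b}" using gi by (simp add: absolutely_integrable_on_def)
    show "{x \<in> {0<..<b}. \<not> (f has_vector_derivative g x) (at x)}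
        \<subseteq> {x \<in> {0<..<b}. \<not> ((\<lambda>y. integral {0..y} g) has_vector_derivative g x) (at x)}"
    proof (rule Collect_mono, intro impI conjI notI; elim conjE)
      fix x assume x: "x \<in> {0<..<b}" "((\<lambda>y. integral {0..y} g) has_vector_derivative g x) (at x)"
        and "\<not> (f has_vector_derivative g x) (at x)"
      from has_vector_derivative_add[OF has_vector_derivative_const[of "f 0"] this(2)]
      have "((\<lambda>y. f 0 + integral {0..y} g) has_vector_derivative g x) (at x)" by simp
      then have "(f has_vector_derivative g x) (at x)"
      proof (rule has_vector_derivative_transform_within_open[of _ _ _ "{0<..<b}"])
        fix y assume "y \<in> {0<..<b}"
        then have "integral {0..y} g = f y - f 0" by (intro integral_unique gf) auto
        then show "f 0 + integral {0..y} g = f y" by simp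
      qed (use x in auto)
      with \<open>\<not> _\<close> show False by contradiction
    qed
  qed
  with gi gf show ?thesis by blast
qed

section \<open>Complex inner products\<close>

lemma cinner_add_left: "cinner (x + y) z = cinner x z + cinner y z"
  by (subst (1 2 3) cinner_commute) (simp add: cinner_add_right)

lemma cinner_scaleC_left: "cinner (c *\<^sub>C x) y = cnj c * cinner x y"
  by (subst (1 2) cinner_commute) (simp add: cinner_scaleC_right)

lemma cinner_zero_left [simp]: "cinner 0 x = 0"
  by (subst cinner_commute) simp

lemma cinner_diff_left: "cinner (x - y) z = cinner x z - cinner y z"
  by (subst (1 2 3) cinner_commute) (simp add: cinner_diff_right)

lemma cinner_scaleR_left: "cinner (r *\<^sub>R x) y = complex_of_real r * cinner x y"
  by (simp add: cinner_scaleC_left flip: scaleC_of_real)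

lemma cinner_sum_right: "cinner x (\<Sum>i\<in>A. f i) = (\<Sum>i\<in>A. cinner x (f i))"
  by (induction A rule: infinite_finite_induct) (simp_all add: cinner_add_right)

lemma cinner_sum_left: "cinner (\<Sum>i\<in>A. f i) x = (\<Sum>i\<in>A. cinner (f i) x)"
  by (induction A rule: infinite_finite_induct) (simp_all add: cinner_add_left)

lemma cinner_self: "cinner x x = complex_of_real ((norm x)\<^sup>2)"
proof -
  have "cinner x x = cnj (cinner x x)" by (rule cinner_commute)
  then have "Im (cinner x x) = 0" by (simp add: complex_eq_iff)
  moreover have "Re (cinner x x) = (norm x)\<^sup>2"
    by (simp add: power2_norm_eq_inner inner_eq_Re_cinner)
  ultimately show ?thesis by (simp add: complex_eq_iff)
qed

lemma norm_cinner_le: "norm (cinner x y) \<le> norm x * norm y"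
proof (cases "cinner x y = 0")
  case False
  \<comment> \<open>a phase that makes the inner product real, reducing the claim to the real inner product\<close>
  define u where "u = cnj (cinner x y) / complex_of_real (norm (cinner x y))"
  have nu: "norm u = 1" using False by (simp add: u_def norm_divide)
  have "u * cinner x y = complex_of_real (norm (cinner x y))"
  proof -
    have "cnj (cinner x y) * cinner x y = complex_of_real (norm (cinner x y)) * complex_of_real (norm (cinner x y))"
      using complex_norm_square[of "cinner x y"] by (simp add: power2_eq_square mult.commute)
    then show ?thesis using False by (simp add: u_def)
  qed
  then have "norm (cinner x y) = inner x (u *\<^sub>C y)"
    by (simp add: inner_eq_Re_cinner cinner_scaleC_right)
  also have "\<dots> \<le> norm x * norm (u *\<^sub>C y)" by (rule norm_cauchy_schwarz)
  finally show ?thesis by (simp add: norm_scaleC nu)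
qed simp

lemma cinner_eqI: "(\<And>z. cinner z x = cinner z y) \<Longrightarrow> x = y"
proof -
  assume "\<And>z. cinner z x = cinner z y"
  then have "cinner (x - y) (x - y) = 0" by (simp add: cinner_diff_right)
  then show "x = y" by (simp add: cinner_self)
qed

lemma bounded_linear_cinner_right: "bounded_linear (cinner x)"
  by (rule bounded_linear_intro[where K = "norm x"])
    (auto simp: cinner_add_right cinner_scaleR_right scaleR_conv_of_real norm_cinner_le mult.commute[of _ "norm x"])

lemma bounded_linear_scaleC_left: "bounded_linear (\<lambda>c. c *\<^sub>C x)"
proof (rule bounded_linear_intro[where K = "norm x"])
  show "(r *\<^sub>R c) *\<^sub>C x = r *\<^sub>R c *\<^sub>C x" for r c
    by (simp only: scaleC_of_real[symmetric] scaleC_scaleC scaleR_conv_of_real)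
qed (auto simp: scaleC_add_left norm_scaleC)

lemma scaleC_zero_left [simp]: "0 *\<^sub>C x = 0"
  using scaleC_of_real[of 0 x] by simp

lemma scaleC_zero_right [simp]: "c *\<^sub>C (0 :: 'a::chilbert_space) = 0"
proof -
  have "norm (c *\<^sub>C (0 :: 'a)) = 0" by (simp only: norm_scaleC norm_zero mult_zero_right)
  then show ?thesis by (simp only: norm_eq_zero)
qed

lemma bounded_linear_scaleC_right: "bounded_linear (\<lambda>x::'a::chilbert_space. c *\<^sub>C x)"
proof (rule bounded_linear_intro[where K = "norm c"])
  show "c *\<^sub>C r *\<^sub>R x = r *\<^sub>R c *\<^sub>C x" for r and x :: 'a
    by (simp only: scaleC_of_real[symmetric] scaleC_scaleC mult.commute)
qed (auto simp: scaleC_add_right norm_scaleC mult.commute)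

lemma has_sum_cinner_right: "(f has_sum s) A \<Longrightarrow> ((\<lambda>i. cinner x (f i)) has_sum cinner x s) A"
  by (rule has_sum_bounded_linear[OF bounded_linear_cinner_right])

lemma has_sum_cinner_left: "(f has_sum s) A \<Longrightarrow> ((\<lambda>i. cinner (f i) x) has_sum cinner s x) A"
  by (subst (1 2) cinner_commute) (simp only: has_sum_cnj_iff has_sum_cinner_right)

lemma summable_on_mult_of_squares: "(\<lambda>i. (norm (f i :: complex))\<^sup>2) summable_on A \<Longrightarrow> (\<lambda>i. (norm (g i :: complex))\<^sup>2) summable_on A \<Longrightarrow>
   (\<lambda>i. norm (f i) * norm (g i)) summable_on A"
proof (rule summable_on_comparison_test[where f = "\<lambda>i. (norm (f i))\<^sup>2 + (norm (g i))\<^sup>2"])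
  show "norm (f i) * norm (g i) \<le> (norm (f i))\<^sup>2 + (norm (g i))\<^sup>2" for i
  proof -
    have "2 * (norm (f i) * norm (g i)) \<le> (norm (f i))\<^sup>2 + (norm (g i))\<^sup>2"
      using sum_squares_bound[of "norm (f i)" "norm (g i)"] by simp
    then show ?thesis using mult_nonneg_nonneg[OF norm_ge_zero[of "f i"] norm_ge_zero[of "g i"]] by linarith
  qed
qed (auto intro: summable_on_add)

section \<open>Orthonormal families\<close>

definition orthonormal_set :: "'a::chilbert_space set \<Rightarrow> bool" where
  "orthonormal_set E \<longleftrightarrow> (\<forall>e\<in>E. \<forall>e'\<in>E. cinner e e' = (if e = e' then 1 else 0))"

lemma is_onb_iff: "is_onb E \<longleftrightarrow> orthonormal_set E \<and> (\<forall>x. (\<forall>e\<in>E. cinner e x = 0) \<longrightarrow> x = 0)"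
  by (simp add: is_onb_def orthonormal_set_def)

lemma orthonormal_set_subset: "orthonormal_set E \<Longrightarrow> F \<subseteq> E \<Longrightarrow> orthonormal_set F"
  unfolding orthonormal_set_def by blast

lemma orthonormal_setD: "orthonormal_set E \<Longrightarrow> e \<in> E \<Longrightarrow> e' \<in> E \<Longrightarrow> cinner e e' = (if e = e' then 1 else 0)"
  by (simp add: orthonormal_set_def)

lemma norm_orthonormal: "orthonormal_set E \<Longrightarrow> e \<in> E \<Longrightarrow> norm e = 1"
  using orthonormal_setD[of E e e] cinner_self[of e]
  by (metis norm_ge_zero of_real_eq_1_iff power2_eq_1_iff zero_le_one abs_norm_cancel power2_eq_iff_nonneg one_power2)

lemma cinner_orthonormal_sum:
  assumes "orthonormal_set F" "finite F" "e \<in> F"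
  shows "cinner e (\<Sum>e'\<in>F. c e' *\<^sub>C e') = c e"
proof -
  have "cinner e (\<Sum>e'\<in>F. c e' *\<^sub>C e') = (\<Sum>e'\<in>F. if e' = e then c e' else 0)"
    unfolding cinner_sum_right
    by (rule sum.cong) (use assms in \<open>auto simp: cinner_scaleC_right orthonormal_setD\<close>)
  then show ?thesis using assms by simp
qed

lemma norm_orthonormal_sum:
  assumes "orthonormal_set F" "finite F"
  shows "(norm (\<Sum>e\<in>F. c e *\<^sub>C e))\<^sup>2 = (\<Sum>e\<in>F. (norm (c e))\<^sup>2)"
proof -
  have "complex_of_real ((norm (\<Sum>e\<in>F. c e *\<^sub>C e))\<^sup>2) = (\<Sum>e\<in>F. cnj (c e) * cinner e (\<Sum>e\<in>F. c e *\<^sub>C e))"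
    by (simp only: cinner_self[symmetric] cinner_sum_left cinner_scaleC_left)
  also have "\<dots> = (\<Sum>e\<in>F. cnj (c e) * c e)"
    using cinner_orthonormal_sum[OF assms] by (intro sum.cong) auto
  also have "\<dots> = complex_of_real (\<Sum>e\<in>F. (norm (c e))\<^sup>2)"
    by (simp add: complex_norm_square mult.commute del: of_real_power)
  finally show ?thesis by (simp only: of_real_eq_iff)
qed

lemma Bessel_finite:
  assumes "orthonormal_set F" "finite F"
  shows "(\<Sum>e\<in>F. (norm (cinner e x))\<^sup>2) \<le> (norm x)\<^sup>2"
proof -
  define p where "p = (\<Sum>e\<in>F. cinner e x *\<^sub>C e)"
  define S where "S = (\<Sum>e\<in>F. (norm (cinner e x))\<^sup>2)"
  have "cinner p x = (\<Sum>e\<in>F. cnj (cinner e x) * cinner e x)"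
    by (simp add: p_def cinner_sum_left cinner_scaleC_left)
  also have "\<dots> = complex_of_real S"
    by (simp add: S_def complex_norm_square mult.commute del: of_real_power)
  finally have px: "cinner p x = complex_of_real S" .
  then have xp: "cinner x p = complex_of_real S" by (subst cinner_commute) simp
  have pp: "cinner p p = complex_of_real S"
    by (simp only: cinner_self p_def norm_orthonormal_sum[OF assms] S_def)
  have "complex_of_real ((norm (x - p))\<^sup>2) = complex_of_real ((norm x)\<^sup>2 - S)"
    by (simp only: cinner_self[symmetric] cinner_diff_left cinner_diff_right px xp pp of_real_diff) (simp add: cinner_self)
  then have "(norm x)\<^sup>2 - S = (norm (x - p))\<^sup>2" by (simp only: of_real_eq_iff)
  then show ?thesis using zero_le_power2[of "norm (x - p)"] unfolding S_def by linarith
qed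

lemma Bessel:
  assumes "orthonormal_set E"
  shows "(\<lambda>e. (norm (cinner e x))\<^sup>2) summable_on E" "(\<Sum>\<^sub>\<infinity>e\<in>E. (norm (cinner e x))\<^sup>2) \<le> (norm x)\<^sup>2"
proof -
  have *: "(\<Sum>e\<in>F. (norm (cinner e x))\<^sup>2) \<le> (norm x)\<^sup>2" if "finite F" "F \<subseteq> E" for F
    using Bessel_finite orthonormal_set_subset[OF assms] that by blast
  show s: "(\<lambda>e. (norm (cinner e x))\<^sup>2) summable_on E"
    by (rule nonneg_bounded_partial_sums_imp_summable_on[of _ _ "(norm x)\<^sup>2"])
      (use * in \<open>auto intro!: eventually_finite_subsets_at_top_weakI\<close>)
  show "(\<Sum>\<^sub>\<infinity>e\<in>E. (norm (cinner e x))\<^sup>2) \<le> (norm x)\<^sup>2"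
    by (rule infsum_le_finite_sums[OF s *])
qed

text \<open>By Pythagoras the distance of two partial sums is controlled by a tail of the numerical series,
  so that the net of partial sums is Cauchy.\<close>

lemma orthonormal_summable:
  assumes E: "orthonormal_set E" and c: "(\<lambda>e. (norm (c e))\<^sup>2) summable_on E"
  shows "(\<lambda>e. c e *\<^sub>C e) summable_on E"
proof -
  let ?f = "\<lambda>e. c e *\<^sub>C e"
  have "\<exists>P. eventually P (finite_subsets_at_top E) \<and>
              (\<forall>F F'. P F \<and> P F' \<longrightarrow> dist (sum ?f F) (sum ?f F') < \<epsilon>)" if "\<epsilon> > 0" for \<epsilon>
  proof -
    define S where "S = (\<Sum>\<^sub>\<infinity>e\<in>E. (norm (c e))\<^sup>2)"
    have "(sum (\<lambda>e. (norm (c e))\<^sup>2) \<longlongrightarrow> S) (finite_subsets_at_top E)"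
      using c unfolding S_def by (rule infsum_tendsto)
    moreover have "S - (\<epsilon> / 2)\<^sup>2 < S" using that by simp
    ultimately have "eventually (\<lambda>F. (\<Sum>e\<in>F. (norm (c e))\<^sup>2) > S - (\<epsilon> / 2)\<^sup>2) (finite_subsets_at_top E)"
      by (rule order_tendstoD(1))
    then have "\<exists>X. finite X \<and> X \<subseteq> E \<and> (\<forall>Y. finite Y \<and> X \<subseteq> Y \<and> Y \<subseteq> E \<longrightarrow>
        (\<Sum>e\<in>Y. (norm (c e))\<^sup>2) > S - (\<epsilon> / 2)\<^sup>2)"
      by (simp only: eventually_finite_subsets_at_top)
    then obtain F0 where "finite F0 \<and> F0 \<subseteq> E \<and> (\<forall>Y. finite Y \<and> F0 \<subseteq> Y \<and> Y \<subseteq> E \<longrightarrow>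
        (\<Sum>e\<in>Y. (norm (c e))\<^sup>2) > S - (\<epsilon> / 2)\<^sup>2)" ..
    then have F0: "finite F0" "F0 \<subseteq> E"
      "\<And>F. finite F \<Longrightarrow> F0 \<subseteq> F \<Longrightarrow> F \<subseteq> E \<Longrightarrow> (\<Sum>e\<in>F. (norm (c e))\<^sup>2) > S - (\<epsilon> / 2)\<^sup>2"
      by simp_all
    define P where "P F \<longleftrightarrow> finite F \<and> F0 \<subseteq> F \<and> F \<subseteq> E" for F
    have near: "dist (sum ?f F) (sum ?f F0) < \<epsilon> / 2" if "P F" for F
    proof -
      have F: "finite F" "F0 \<subseteq> F" "F \<subseteq> E" using that by (auto simp: P_def)
      have "sum ?f F - sum ?f F0 = (\<Sum>e\<in>F - F0. c e *\<^sub>C e)"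
        using F by (simp add: sum_diff)
      then have "(dist (sum ?f F) (sum ?f F0))\<^sup>2 = (\<Sum>e\<in>F - F0. (norm (c e))\<^sup>2)"
        using norm_orthonormal_sum[OF orthonormal_set_subset[OF E], of "F - F0" c] F
        by (simp add: dist_norm subset_iff)
      also have "\<dots> = (\<Sum>e\<in>F. (norm (c e))\<^sup>2) - (\<Sum>e\<in>F0. (norm (c e))\<^sup>2)"
        using F by (simp add: sum_diff)
      also have "\<dots> < (\<epsilon> / 2)\<^sup>2"
      proof -
        have "(\<Sum>e\<in>F. (norm (c e))\<^sup>2) \<le> S"
          unfolding S_def using F by (intro finite_sum_le_infsum c) auto
        moreover have "(\<Sum>e\<in>F0. (norm (c e))\<^sup>2) > S - (\<epsilon> / 2)\<^sup>2" using F0 by blast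
        ultimately show ?thesis by linarith
      qed
      finally show ?thesis by (rule power2_less_imp_less) (use \<open>\<epsilon> > 0\<close> in simp)
    qed
    have "dist (sum ?f F) (sum ?f F') < \<epsilon>" if "P F" "P F'" for F F'
      using dist_triangle2[of "sum ?f F" "sum ?f F'" "sum ?f F0"] near[OF that(1)] near[OF that(2)] by linarith
    moreover have "eventually P (finite_subsets_at_top E)"
      unfolding eventually_finite_subsets_at_top P_def using F0 by blast
    ultimately show ?thesis by blast
  qed
  then have "cauchy_filter (filtermap (sum ?f) (finite_subsets_at_top E))"
    by (simp add: cauchy_filter_metric_filtermap)
  moreover have "complete (UNIV :: 'a set)"
    by (meson Cauchy_convergent UNIV_I complete_def convergent_def)
  ultimately obtain L' where "(sum ?f \<longlongrightarrow> L') (finite_subsets_at_top E)"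
    using complete_uniform[where S = UNIV] by (force simp add: filterlim_def)
  then show ?thesis using summable_on_def has_sum_def by blast
qed

lemma orthonormal_infsum_coeff:
  assumes E: "orthonormal_set E" and c: "(\<lambda>e. (norm (c e))\<^sup>2) summable_on E" and "e \<in> E"
  shows "cinner e (\<Sum>\<^sub>\<infinity>e\<in>E. c e *\<^sub>C e) = c e"
proof -
  have "((\<lambda>e'. cinner e (c e' *\<^sub>C e')) has_sum cinner e (\<Sum>\<^sub>\<infinity>e\<in>E. c e *\<^sub>C e)) E"
    using orthonormal_summable[OF E c] by (intro has_sum_cinner_right) simp
  moreover have "((\<lambda>e'. cinner e (c e' *\<^sub>C e')) has_sum c e) E"
    by (rule has_sum_finite_neutralI[of "{e}"])
      (use assms in \<open>auto simp: cinner_scaleC_right orthonormal_setD split: if_splits\<close>)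
  ultimately show ?thesis by (rule has_sum_unique)
qed

lemma orthonormal_expansion_orthogonal:
  assumes E: "orthonormal_set E" and "e \<in> E"
  shows "cinner e (x - (\<Sum>\<^sub>\<infinity>e\<in>E. cinner e x *\<^sub>C e)) = 0"
  using orthonormal_infsum_coeff[OF E Bessel(1)[OF E] \<open>e \<in> E\<close>] by (simp add: cinner_diff_right)

lemma onb_expansion:
  assumes "is_onb E"
  shows "((\<lambda>e. cinner e x *\<^sub>C e) has_sum x) E"
proof -
  have E: "orthonormal_set E" using assms by (simp add: is_onb_iff)
  have "x - (\<Sum>\<^sub>\<infinity>e\<in>E. cinner e x *\<^sub>C e) = 0"
    using assms orthonormal_expansion_orthogonal[OF E] unfolding is_onb_iff by blast
  then show ?thesis
    using has_sum_infsum[OF orthonormal_summable[OF E Bessel(1)[OF E]], of x] by simp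
qed

lemma Parseval:
  assumes "is_onb E"
  shows "((\<lambda>e. cinner x e * cinner e y) has_sum cinner x y) E"
  using has_sum_cinner_right[OF onb_expansion[OF assms, of y], of x]
  by (simp add: cinner_scaleC_right mult.commute)

lemma norm_cinner_commute: "norm (cinner x y) = norm (cinner y x)"
  by (subst cinner_commute) (rule complex_mod_cnj)

lemma Parseval_norm:
  assumes "is_onb E"
  shows "((\<lambda>e. (norm (cinner e x))\<^sup>2) has_sum (norm x)\<^sup>2) E"
proof -
  have "((\<lambda>e. complex_of_real ((norm (cinner e x))\<^sup>2)) has_sum complex_of_real ((norm x)\<^sup>2)) E"
    using Parseval[OF assms, of x x] unfolding cinner_self
    by (subst (asm) cinner_commute) (simp only: complex_norm_square mult.commute)
  then show ?thesis by (simp only: has_sum_of_real_iff)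
qed

text \<open>This bounds the trace of a rank one operator in absolute value, along any orthonormal set.\<close>

lemma Cauchy_Schwarz_orthonormal:
  assumes E: "orthonormal_set E"
  shows "(\<lambda>e. norm (cinner y e) * norm (cinner e x)) summable_on E"
    "(\<Sum>\<^sub>\<infinity>e\<in>E. norm (cinner y e) * norm (cinner e x)) \<le> norm y * norm x"
proof -
  have *: "(\<Sum>e\<in>F. norm (cinner y e) * norm (cinner e x)) \<le> norm y * norm x" if "finite F" "F \<subseteq> E" for F
  proof -
    have F: "orthonormal_set F" using E orthonormal_set_subset that by blast
    have "(\<Sum>e\<in>F. norm (cinner y e) * norm (cinner e x)) = (\<Sum>e\<in>F. \<bar>norm (cinner e y)\<bar> * \<bar>norm (cinner e x)\<bar>)"
      by (simp add: norm_cinner_commute[of y])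
    also have "\<dots> \<le> L2_set (\<lambda>e. norm (cinner e y)) F * L2_set (\<lambda>e. norm (cinner e x)) F"
      by (rule L2_set_mult_ineq)
    also have "\<dots> \<le> norm y * norm x"
      unfolding L2_set_def using Bessel_finite[OF F that(1)]
      by (intro mult_mono real_le_lsqrt real_sqrt_ge_zero sum_nonneg) auto
    finally show ?thesis .
  qed
  show s: "(\<lambda>e. norm (cinner y e) * norm (cinner e x)) summable_on E"
    by (rule nonneg_bounded_partial_sums_imp_summable_on[of _ _ "norm y * norm x"])
      (use * in \<open>auto intro!: eventually_finite_subsets_at_top_weakI\<close>)
  show "(\<Sum>\<^sub>\<infinity>e\<in>E. norm (cinner y e) * norm (cinner e x)) \<le> norm y * norm x"
    by (rule infsum_le_finite_sums[OF s *])
qed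

section \<open>Operators given with an adjoint\<close>

text \<open>The adjoint and a common bound are carried along explicitly, so that the existence of
  adjoints never has to be established in general; linearity is a consequence.\<close>

definition adjoint_pair :: "('a::chilbert_space \<Rightarrow> 'a) \<Rightarrow> ('a \<Rightarrow> 'a) \<Rightarrow> real \<Rightarrow> bool" where
  "adjoint_pair L L' K \<longleftrightarrow> (\<forall>x y. cinner (L' x) y = cinner x (L y)) \<and> 0 \<le> K \<and>
     (\<forall>x. norm (L x) \<le> K * norm x) \<and> (\<forall>x. norm (L' x) \<le> K * norm x)"

lemma adjoint_pair_sym: "adjoint_pair L L' K \<Longrightarrow> adjoint_pair L' L K"
  unfolding adjoint_pair_def by (metis cinner_commute)

lemma adjoint_pair_clinear:
  assumes "adjoint_pair L L' K"
  shows "L (x + y) = L x + L y" "L (c *\<^sub>C x) = c *\<^sub>C L x" "L (r *\<^sub>R x) = r *\<^sub>R L x" "L (x - y) = L x - L y" "L 0 = 0"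
proof -
  have *: "cinner z (L w) = cinner (L' z) w" for z w using assms by (simp add: adjoint_pair_def)
  show "L (x + y) = L x + L y" "L (c *\<^sub>C x) = c *\<^sub>C L x" "L (r *\<^sub>R x) = r *\<^sub>R L x" "L (x - y) = L x - L y" "L 0 = 0"
    by (rule cinner_eqI; simp add: * cinner_add_right cinner_scaleC_right cinner_scaleR_right cinner_diff_right)+
qed

lemma adjoint_pair_bounded_linear:
  assumes "adjoint_pair L L' K"
  shows "bounded_linear L"
  using assms by (intro bounded_linear_intro[where K = K])
    (simp_all add: adjoint_pair_clinear[OF assms] adjoint_pair_def mult.commute)

lemma adjoint_pair_bounded_clinear: "adjoint_pair L L' K \<Longrightarrow> bounded_clinear L"
  by (simp add: bounded_clinear_def adjoint_pair_bounded_linear adjoint_pair_clinear(2))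

lemma cadjoint_eqI:
  assumes "\<And>x y. cinner (S x) y = cinner x (T y)"
  shows "cadjoint T = S"
  unfolding cadjoint_def
proof (rule the_equality)
  fix S' assume S': "\<forall>x y. cinner (S' x) y = cinner x (T y)"
  show "S' = S"
  proof
    fix x
    show "S' x = S x"
    proof (rule cinner_eqI)
      fix z
      have "cinner (S' x) z = cinner (S x) z" using S' assms by simp
      then show "cinner z (S' x) = cinner z (S x)"
        using cinner_commute[of "S' x" z] cinner_commute[of "S x" z] by simp
    qed
  qed
qed (use assms in simp)

lemma adjoint_pair_cadjoint: "adjoint_pair L L' K \<Longrightarrow> cadjoint L = L'"
  by (rule cadjoint_eqI) (simp add: adjoint_pair_def)

lemma adjoint_pair_compose:
  assumes "adjoint_pair L L' K" "adjoint_pair M M' J"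
  shows "adjoint_pair (\<lambda>x. L (M x)) (\<lambda>x. M' (L' x)) (K * J)"
  unfolding adjoint_pair_def
proof (intro conjI allI)
  fix x
  have K: "0 \<le> K" "0 \<le> J" using assms by (auto simp: adjoint_pair_def)
  have "norm (L (M x)) \<le> K * norm (M x)" using assms by (simp add: adjoint_pair_def)
  also have "\<dots> \<le> K * (J * norm x)" using assms K by (intro mult_left_mono) (auto simp: adjoint_pair_def)
  finally show "norm (L (M x)) \<le> K * J * norm x" by simp
  have "norm (M' (L' x)) \<le> J * norm (L' x)" using assms by (simp add: adjoint_pair_def)
  also have "\<dots> \<le> J * (K * norm x)" using assms K by (intro mult_left_mono) (auto simp: adjoint_pair_def)
  finally show "norm (M' (L' x)) \<le> K * J * norm x" by (simp add: mult.left_commute mult.assoc)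
qed (use assms in \<open>auto simp: adjoint_pair_def\<close>)

lemma adjoint_pair_diff:
  assumes "adjoint_pair L L' K" "adjoint_pair M M' J"
  shows "adjoint_pair (\<lambda>x. L x - M x) (\<lambda>x. L' x - M' x) (K + J)"
  unfolding adjoint_pair_def
proof (intro conjI allI)
  fix x
  show "norm (L x - M x) \<le> (K + J) * norm x" "norm (L' x - M' x) \<le> (K + J) * norm x"
    using assms norm_triangle_ineq4[of "L x" "M x"] norm_triangle_ineq4[of "L' x" "M' x"]
    unfolding adjoint_pair_def distrib_right by (smt (verit))+
qed (use assms in \<open>auto simp: adjoint_pair_def cinner_diff_left cinner_diff_right\<close>)

lemma adjoint_pair_funpow:
  assumes "adjoint_pair L L' K"
  shows "adjoint_pair (L ^^ n) (L' ^^ n) (K ^ n)"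
proof (induction n)
  case (Suc n)
  have "adjoint_pair (\<lambda>x. (L ^^ n) (L x)) (\<lambda>x. L' ((L' ^^ n) x)) (K ^ n * K)"
    by (rule adjoint_pair_compose[OF Suc assms])
  then show ?case by (simp only: funpow_Suc_right[of n L] funpow.simps(2)[of n L'] comp_def power_Suc2)
qed (simp add: adjoint_pair_def)

lemma norm_cinner_le_swap: "norm (cinner y x) \<le> norm x * norm y"
  by (subst mult.commute) (rule norm_cinner_le)

section \<open>Nuclear operators and their trace\<close>

text \<open>\<open>A\<close> is the sum of the rank one operators \<open>v \<mapsto> \<langle>y i, v\<rangle> x i\<close>; the nuclear norm of this
  expansion is at most \<open>c\<close>, and its trace is \<open>t\<close>. The bound is part of the
  definition because series of nuclear operators are summed in nuclear norm.\<close>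

definition nuclear_with :: "('a::chilbert_space \<Rightarrow> 'a) \<Rightarrow> real \<Rightarrow> complex \<Rightarrow> bool" where
  "nuclear_with A c t \<longleftrightarrow> (\<exists>(x :: nat \<Rightarrow> 'a) y.
     (\<lambda>i. norm (x i) * norm (y i)) summable_on UNIV \<and> (\<Sum>\<^sub>\<infinity>i. norm (x i) * norm (y i)) \<le> c \<and>
     (\<forall>v. ((\<lambda>i. cinner (y i) v *\<^sub>C x i) has_sum A v) UNIV) \<and>
     ((\<lambda>i. cinner (y i) (x i)) has_sum t) UNIV)"

lemma has_sum_countable_to_nat:
  fixes h :: "'i::countable \<Rightarrow> 'b::{comm_monoid_add,topological_space}"
  assumes "(h has_sum s) UNIV"
  shows "((\<lambda>n. if n \<in> range (to_nat :: 'i \<Rightarrow> nat) then h (from_nat n) else 0) has_sum s) UNIV"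
proof -
  have "((\<lambda>n. if n \<in> range (to_nat :: 'i \<Rightarrow> nat) then h (from_nat n) else 0) has_sum s) (range (to_nat :: 'i \<Rightarrow> nat))"
    by (subst has_sum_reindex) (use assms in \<open>simp_all add: o_def\<close>)
  then show ?thesis
    by (rule iffD1[OF has_sum_cong_neutral, rotated -1]) auto
qed

text \<open>Other countable index sets may be used for the expansion, in particular pairs of numbers;
  the codes that do not occur are filled with zero terms.\<close>

lemma nuclear_withI:
  fixes x y :: "'i::countable \<Rightarrow> 'a::chilbert_space"
  assumes "(\<lambda>i. norm (x i) * norm (y i)) summable_on UNIV" "(\<Sum>\<^sub>\<infinity>i. norm (x i) * norm (y i)) \<le> c"
    and "\<And>v. ((\<lambda>i. cinner (y i) v *\<^sub>C x i) has_sum A v) UNIV"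
    and "((\<lambda>i. cinner (y i) (x i)) has_sum t) UNIV"
  shows "nuclear_with A c t"
proof -
  define x' where "x' n = (if n \<in> range (to_nat :: 'i \<Rightarrow> nat) then x (from_nat n) else 0)" for n
  define y' where "y' n = y (from_nat n)" for n
  let ?R = "range (to_nat :: 'i \<Rightarrow> nat)"
  have "(\<lambda>n. norm (x' n) * norm (y' n)) = (\<lambda>n. if n \<in> ?R then norm (x (from_nat n)) * norm (y (from_nat n)) else 0)"
    by (auto simp: x'_def y'_def)
  then have 1: "((\<lambda>n. norm (x' n) * norm (y' n)) has_sum (\<Sum>\<^sub>\<infinity>i. norm (x i) * norm (y i))) UNIV"
    using has_sum_countable_to_nat[of "\<lambda>i. norm (x i) * norm (y i)"] assms(1) by simp
  have "(\<lambda>n. cinner (y' n) v *\<^sub>C x' n) = (\<lambda>n. if n \<in> ?R then cinner (y (from_nat n)) v *\<^sub>C x (from_nat n) else 0)" for v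
    by (auto simp: x'_def y'_def)
  then have 2: "((\<lambda>n. cinner (y' n) v *\<^sub>C x' n) has_sum A v) UNIV" for v
    using has_sum_countable_to_nat[of "\<lambda>i. cinner (y i) v *\<^sub>C x i"] assms(3)[of v] by simp
  have "(\<lambda>n. cinner (y' n) (x' n)) = (\<lambda>n. if n \<in> ?R then cinner (y (from_nat n)) (x (from_nat n)) else 0)"
    by (auto simp: x'_def y'_def)
  then have 3: "((\<lambda>n. cinner (y' n) (x' n)) has_sum t) UNIV"
    using has_sum_countable_to_nat[of "\<lambda>i. cinner (y i) (x i)"] assms(4) by simp
  show ?thesis
    unfolding nuclear_with_def
    using 1 2 3 assms(2) by (intro exI[of _ x'] exI[of _ y']) (auto simp: has_sum_iff)
qed

text \<open>The double family \<open>\<langle>y i, e\<rangle> \<langle>e, x i\<rangle>\<close> is absolutely summable, and summing it in the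
  two possible orders gives \<open>t\<close> and the trace along \<open>E\<close>. In particular the trace depends neither on the
  expansion nor on the basis.\<close>

lemma nuclear_with_trace:
  assumes A: "nuclear_with A c t" and E: "is_onb E"
  shows "(\<lambda>e. norm (cinner e (A e))) summable_on E" "((\<lambda>e. cinner e (A e)) has_sum t) E"
proof -
  from A obtain x y :: "nat \<Rightarrow> 'a" where xy:
    "(\<lambda>i. norm (x i) * norm (y i)) summable_on UNIV"
    "\<And>v. ((\<lambda>i. cinner (y i) v *\<^sub>C x i) has_sum A v) UNIV"
    "((\<lambda>i. cinner (y i) (x i)) has_sum t) UNIV" unfolding nuclear_with_def by blast
  have oE: "orthonormal_set E" using E by (simp add: is_onb_iff)
  define F where "F = (\<lambda>(i, e). cinner (y i) e * cinner e (x i))"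
  have abs: "(\<lambda>p. norm (F p)) summable_on (UNIV \<times> E)"
  proof (rule summable_on_SigmaI)
    show "((\<lambda>e. norm (F (i, e))) has_sum (\<Sum>\<^sub>\<infinity>e\<in>E. norm (cinner (y i) e) * norm (cinner e (x i)))) E" for i
      using Cauchy_Schwarz_orthonormal(1)[OF oE, of "y i" "x i"] by (simp add: F_def norm_mult)
    show "(\<lambda>i. \<Sum>\<^sub>\<infinity>e\<in>E. norm (cinner (y i) e) * norm (cinner e (x i))) summable_on UNIV"
      by (rule summable_on_comparison_test[OF xy(1)])
        (use Cauchy_Schwarz_orthonormal(2)[OF oE] in \<open>auto simp: mult.commute[of "norm (x _)"] intro!: infsum_nonneg\<close>)
  qed simp
  then have "F summable_on (UNIV \<times> E)" by (rule abs_summable_summable)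
  then obtain S where S: "(F has_sum S) (UNIV \<times> E)" by (auto simp: summable_on_def)
  have "((\<lambda>i. cinner (y i) (x i)) has_sum S) UNIV"
    by (rule has_sum_Sigma'[OF S]) (use Parseval[OF E] in \<open>simp add: F_def\<close>)
  then have [simp]: "S = t" using xy(3) has_sum_unique by blast
  have S': "((\<lambda>(e, i). F (i, e)) has_sum t) (E \<times> UNIV)" using S has_sum_swap[of F] by simp
  have row: "((\<lambda>i. F (i, e)) has_sum cinner e (A e)) UNIV" for e
    using has_sum_cinner_right[OF xy(2)[of e], of e] by (simp add: F_def cinner_scaleC_right)
  show "((\<lambda>e. cinner e (A e)) has_sum t) E"
    by (rule has_sum_Sigma'[OF S']) (use row in simp)
  have "(\<lambda>p. norm ((\<lambda>(e, i). F (i, e)) p)) summable_on (E \<times> UNIV)"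
    using abs summable_on_swap[of "\<lambda>p. norm (F p)" UNIV E] by (simp add: case_prod_unfold)
  then have "(\<forall>e\<in>E. (\<lambda>i. norm (F (i, e))) summable_on UNIV) \<and>
      (\<lambda>e. norm (\<Sum>\<^sub>\<infinity>i. norm (F (i, e)))) summable_on E"
    unfolding Infinite_Sum.abs_summable_on_Sigma_iff split .
  then have *: "\<And>e. e \<in> E \<Longrightarrow> (\<lambda>i. norm (F (i, e))) summable_on UNIV" "(\<lambda>e. \<Sum>\<^sub>\<infinity>i. norm (F (i, e))) summable_on E"
    by (simp_all add: infsum_nonneg)
  show "(\<lambda>e. norm (cinner e (A e))) summable_on E"
  proof (rule Infinite_Sum.abs_summable_on_comparison_test'[OF *(2)])
    fix e assume "e \<in> E"
    then show "norm (cinner e (A e)) \<le> (\<Sum>\<^sub>\<infinity>i. norm (F (i, e)))"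
      using norm_infsum_bound[OF *(1)] row[of e] by (metis infsumI)
  qed
qed

lemma trace_op_nuclear:
  assumes A: "nuclear_with A c t" and "is_onb (E0 :: 'a::chilbert_space set)"
  shows "trace_op (A :: 'a \<Rightarrow> 'a) = t"
proof -
  have "is_onb (SOME E :: 'a set. is_onb E)" using assms(2) by (rule someI)
  from nuclear_with_trace(2)[OF A this] show ?thesis unfolding trace_op_def by (rule infsumI)
qed

lemma nuclear_with_series:
  fixes A :: "nat \<Rightarrow> 'a::chilbert_space \<Rightarrow> 'a"
  assumes A: "\<And>n. nuclear_with (A n) (c n) (t n)" and c: "c summable_on UNIV"
    and S: "\<And>v. ((\<lambda>n. A n v) has_sum S v) UNIV"
  shows "\<exists>T. nuclear_with S (infsum c UNIV) T \<and> (t has_sum T) UNIV"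
proof -
  define R where "R n x y \<longleftrightarrow> (\<lambda>i. norm (x i) * norm (y i)) summable_on UNIV \<and> (\<Sum>\<^sub>\<infinity>i. norm (x i) * norm (y i)) \<le> c n \<and>
     (\<forall>v. ((\<lambda>i. cinner (y i) v *\<^sub>C x i) has_sum A n v) UNIV) \<and>
     ((\<lambda>i. cinner (y i) (x i)) has_sum t n) UNIV" for n and x y :: "nat \<Rightarrow> 'a"
  have "\<forall>n. \<exists>x y. R n x y" using A by (simp add: nuclear_with_def R_def)
  then obtain x y where "\<And>n. R n (x n) (y n)" by metis
  then have xy:
    "\<And>n. (\<lambda>i. norm (x n i) * norm (y n i)) summable_on UNIV"
    "\<And>n. (\<Sum>\<^sub>\<infinity>i. norm (x n i) * norm (y n i)) \<le> c n"
    "\<And>n v. ((\<lambda>i. cinner (y n i) v *\<^sub>C x n i) has_sum A n v) UNIV"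
    "\<And>n. ((\<lambda>i. cinner (y n i) (x n i)) has_sum t n) UNIV" by (simp_all add: R_def)
  define X where "X = (\<lambda>(n, i). x n i)"
  define Y where "Y = (\<lambda>(n, i). y n i)"
  have rows: "(\<lambda>n. \<Sum>\<^sub>\<infinity>i. norm (x n i) * norm (y n i)) summable_on UNIV"
    by (rule summable_on_comparison_test[OF c]) (auto intro!: xy infsum_nonneg)
  have XY: "(\<lambda>p. norm (X p) * norm (Y p)) summable_on UNIV \<times> UNIV"
    by (rule summable_on_SigmaI[OF _ rows]) (use xy(1) in \<open>auto simp: X_def Y_def\<close>)
  have bound: "(\<Sum>\<^sub>\<infinity>p\<in>UNIV \<times> UNIV. norm (X p) * norm (Y p)) \<le> infsum c UNIV"
    using infsum_Sigma_banach[OF XY] infsum_mono[OF rows c] xy(2) by (simp add: X_def Y_def)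
  have vec: "((\<lambda>p. cinner (Y p) v *\<^sub>C X p) has_sum S v) (UNIV \<times> UNIV)" for v
  proof (rule has_sum_SigmaI[OF _ S])
    show "((\<lambda>i. cinner (Y (n, i)) v *\<^sub>C X (n, i)) has_sum A n v) UNIV" for n
      using xy(3) by (simp add: X_def Y_def)
    show "(\<lambda>p. cinner (Y p) v *\<^sub>C X p) summable_on UNIV \<times> UNIV"
    proof (rule abs_summable_summable, rule Infinite_Sum.abs_summable_on_comparison_test'[OF summable_on_cmult_right[OF XY]])
      fix p
      have "norm (cinner (Y p) v *\<^sub>C X p) \<le> (norm (Y p) * norm v) * norm (X p)"
        unfolding norm_scaleC by (intro mult_right_mono norm_cinner_le) auto
      then show "norm (cinner (Y p) v *\<^sub>C X p) \<le> norm v * (norm (X p) * norm (Y p))"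
        by (simp add: algebra_simps)
    qed
  qed
  have "(\<lambda>p. cinner (Y p) (X p)) summable_on UNIV \<times> UNIV"
    by (rule abs_summable_summable, rule Infinite_Sum.abs_summable_on_comparison_test'[OF XY])
      (rule norm_cinner_le_swap)
  then obtain T where T: "((\<lambda>p. cinner (Y p) (X p)) has_sum T) (UNIV \<times> UNIV)"
    by (auto simp: summable_on_def)
  have "(t has_sum T) UNIV"
    by (rule has_sum_Sigma'[OF T]) (use xy(4) in \<open>simp add: X_def Y_def\<close>)
  moreover have "nuclear_with S (infsum c UNIV) T"
    by (rule nuclear_withI[of X Y]) (use XY bound vec T in simp_all)
  ultimately show ?thesis by blast
qed

lemma nuclear_with_0: "nuclear_with (\<lambda>v. 0) 0 0"
  unfolding nuclear_with_def by (intro exI[of _ "\<lambda>_. 0"]) simp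

lemma nuclear_with_mono: "nuclear_with A c t \<Longrightarrow> c \<le> d \<Longrightarrow> nuclear_with A d t"
  unfolding nuclear_with_def by (meson order_trans)

lemma nuclear_with_nonneg: "nuclear_with A c t \<Longrightarrow> 0 \<le> c"
  unfolding nuclear_with_def by (auto elim!: order_trans[rotated] intro!: infsum_nonneg)

lemma has_sum_two:
  fixes a b :: "'b::topological_comm_monoid_add"
  shows "((\<lambda>n::nat. if n = 0 then a else if n = Suc 0 then b else 0) has_sum a + b) UNIV"
  by (rule has_sum_finite_neutralI[of "{0, Suc 0}"]) auto

lemma nuclear_with_add:
  assumes A: "nuclear_with A c s" and B: "nuclear_with B d t"
  shows "nuclear_with (\<lambda>v. A v + B v) (c + d) (s + t)"
proof -
  let ?A = "\<lambda>n. if n = 0 then A else if n = Suc 0 then B else (\<lambda>v. 0)"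
  let ?c = "\<lambda>n. if n = 0 then c else if n = Suc 0 then d else 0"
  let ?t = "\<lambda>n. if n = 0 then s else if n = Suc 0 then t else 0"
  have c: "?c summable_on UNIV" "infsum ?c UNIV = c + d"
    using has_sum_two[of c d] by (simp_all only: has_sum_iff)
  have "((\<lambda>n. ?A n v) has_sum A v + B v) UNIV" for v
  proof -
    have "(\<lambda>n. ?A n v) = (\<lambda>n. if n = 0 then A v else if n = Suc 0 then B v else 0)" by auto
    then show ?thesis using has_sum_two[of "A v" "B v"] by (simp only:)
  qed
  moreover have "nuclear_with (?A n) (?c n) (?t n)" for n
    by (simp add: assms nuclear_with_0)
  ultimately obtain T where T: "nuclear_with (\<lambda>v. A v + B v) (infsum ?c UNIV) T" "(?t has_sum T) UNIV"
    using nuclear_with_series[of ?A ?c ?t "\<lambda>v. A v + B v"] c(1) by blast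
  from T(2) has_sum_two[of s t] have "T = s + t" using has_sum_unique by blast
  with T(1) show ?thesis unfolding c(2) by simp
qed

lemma nuclear_with_scaleC:
  assumes "nuclear_with A c t"
  shows "nuclear_with (\<lambda>v. a *\<^sub>C A v) (norm a * c) (a * t)"
proof -
  from assms obtain x y :: "nat \<Rightarrow> 'a" where xy:
    "(\<lambda>i. norm (x i) * norm (y i)) summable_on UNIV"
    "(\<Sum>\<^sub>\<infinity>i. norm (x i) * norm (y i)) \<le> c"
    "\<And>v. ((\<lambda>i. cinner (y i) v *\<^sub>C x i) has_sum A v) UNIV"
    "((\<lambda>i. cinner (y i) (x i)) has_sum t) UNIV" unfolding nuclear_with_def by blast
  show ?thesis
  proof (rule nuclear_withI[of "\<lambda>i. a *\<^sub>C x i" y])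
    show "(\<lambda>i. norm (a *\<^sub>C x i) * norm (y i)) summable_on UNIV"
      using summable_on_cmult_right[OF xy(1), of "norm a"] by (simp add: norm_scaleC mult.assoc)
    show "(\<Sum>\<^sub>\<infinity>i. norm (a *\<^sub>C x i) * norm (y i)) \<le> norm a * c"
      using mult_left_mono[OF xy(2), of "norm a"] by (simp add: norm_scaleC mult.assoc infsum_cmult_right')
    show "((\<lambda>i. cinner (y i) v *\<^sub>C a *\<^sub>C x i) has_sum a *\<^sub>C A v) UNIV" for v
      using has_sum_bounded_linear[OF bounded_linear_scaleC_right xy(3)[of v], of a]
      by (simp add: scaleC_scaleC mult.commute)
    show "((\<lambda>i. cinner (y i) (a *\<^sub>C x i)) has_sum a * t) UNIV"
      using has_sum_cmult_right[OF xy(4), of a] by (simp add: cinner_scaleC_right)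
  qed
qed

text \<open>Both products have the same trace, since \<open>L\<close> can be moved from \<open>x i\<close> to \<open>y i\<close> as its
  adjoint. This is the source of the vanishing trace of commutators with nuclear operators.\<close>

lemma nuclear_with_compose:
  assumes A: "nuclear_with A c t" and L: "adjoint_pair L L' K"
  shows "\<exists>t'. nuclear_with (\<lambda>v. L (A v)) (K * c) t' \<and> nuclear_with (\<lambda>v. A (L v)) (K * c) t'"
proof -
  from assms obtain x y :: "nat \<Rightarrow> 'a" where xy:
    "(\<lambda>i. norm (x i) * norm (y i)) summable_on UNIV"
    "(\<Sum>\<^sub>\<infinity>i. norm (x i) * norm (y i)) \<le> c"
    "\<And>v. ((\<lambda>i. cinner (y i) v *\<^sub>C x i) has_sum A v) UNIV"
    unfolding nuclear_with_def by blast
  have K: "0 \<le> K" "norm (L v) \<le> K * norm v" "norm (L' v) \<le> K * norm v" "cinner (L' v) w = cinner v (L w)" for v w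
    using L by (auto simp: adjoint_pair_def)
  have b1: "norm (L (x i)) * norm (y i) \<le> K * (norm (x i) * norm (y i))" for i
    using mult_right_mono[OF K(2)[of "x i"], of "norm (y i)"] by (simp add: mult.assoc)
  have b2: "norm (x i) * norm (L' (y i)) \<le> K * (norm (x i) * norm (y i))" for i
    using mult_left_mono[OF K(3)[of "y i"], of "norm (x i)"] by (simp add: mult.left_commute)
  have Kxy: "(\<lambda>i. K * (norm (x i) * norm (y i))) summable_on UNIV" by (rule summable_on_cmult_right[OF xy(1)])
  have s1: "(\<lambda>i. norm (L (x i)) * norm (y i)) summable_on UNIV"
    by (rule summable_on_comparison_test[OF Kxy b1]) auto
  have s2: "(\<lambda>i. norm (x i) * norm (L' (y i))) summable_on UNIV"
    by (rule summable_on_comparison_test[OF Kxy b2]) auto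
  have Kc: "(\<Sum>\<^sub>\<infinity>i. K * (norm (x i) * norm (y i))) \<le> K * c"
    using mult_left_mono[OF xy(2) K(1)] by (simp add: infsum_cmult_right')
  have "(\<lambda>i. cinner (y i) (L (x i))) summable_on UNIV"
    by (rule abs_summable_summable, rule Infinite_Sum.abs_summable_on_comparison_test'[OF s1])
      (rule norm_cinner_le_swap)
  then obtain t' where t': "((\<lambda>i. cinner (y i) (L (x i))) has_sum t') UNIV" by (auto simp: summable_on_def)
  have "nuclear_with (\<lambda>v. L (A v)) (K * c) t'"
  proof (rule nuclear_withI[of "\<lambda>i. L (x i)" y])
    show "(\<Sum>\<^sub>\<infinity>i. norm (L (x i)) * norm (y i)) \<le> K * c"
      using infsum_mono[OF s1 Kxy b1] Kc by linarith
    show "((\<lambda>i. cinner (y i) v *\<^sub>C L (x i)) has_sum L (A v)) UNIV" for v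
      using has_sum_bounded_linear[OF adjoint_pair_bounded_linear[OF L] xy(3)[of v]]
      by (simp add: adjoint_pair_clinear(2)[OF L])
  qed (use s1 t' in auto)
  moreover have "nuclear_with (\<lambda>v. A (L v)) (K * c) t'"
  proof (rule nuclear_withI[of x "\<lambda>i. L' (y i)"])
    show "(\<Sum>\<^sub>\<infinity>i. norm (x i) * norm (L' (y i))) \<le> K * c"
      using infsum_mono[OF s2 Kxy b2] Kc by linarith
    show "((\<lambda>i. cinner (L' (y i)) v *\<^sub>C x i) has_sum A (L v)) UNIV" for v
      using xy(3)[of "L v"] by (simp add: K(4))
  qed (use s2 t' K(4) in auto)
  ultimately show ?thesis by blast
qed

section \<open>Self-adjoint nuclear operators\<close>

lemma norm_has_sum_le_infsum:
  fixes f :: "'i \<Rightarrow> 'b::banach"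
  assumes "(f has_sum s) A" "g summable_on A" "\<And>i. i \<in> A \<Longrightarrow> norm (f i) \<le> g i"
  shows "norm s \<le> infsum g A"
proof -
  have *: "(\<lambda>i. norm (f i)) summable_on A"
    by (rule Infinite_Sum.abs_summable_on_comparison_test'[OF assms(2,3)])
  have "norm s \<le> (\<Sum>\<^sub>\<infinity>i\<in>A. norm (f i))"
    by (rule norm_has_sum_bound[OF has_sum_infsum[OF *] assms(1)])
  also have "\<dots> \<le> infsum g A" by (rule infsum_mono[OF * assms(2,3)])
  finally show ?thesis .
qed

text \<open>The image of a ball is totally bounded: on the ball \<open>A\<close> is uniformly approximated by the finite
  partial sums of its expansion, which have relatively compact images.\<close>

lemma nuclear_image_compact_closure:
  fixes A :: "'a::chilbert_space \<Rightarrow> 'a"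
  assumes A: "nuclear_with A c t"
  shows "compact (closure (A ` cball 0 R))"
proof -
  from A obtain x y :: "nat \<Rightarrow> 'a" where xy:
    "(\<lambda>i. norm (x i) * norm (y i)) summable_on UNIV"
    "\<And>v. ((\<lambda>i. cinner (y i) v *\<^sub>C x i) has_sum A v) UNIV"
    unfolding nuclear_with_def by blast
  have fin: "\<exists>K. compact K \<and> (\<forall>v\<in>cball 0 R. (\<Sum>i\<in>F. cinner (y i) v *\<^sub>C x i) \<in> K)" if "finite F" for F
    using that
  proof (induction F)
    case empty
    show ?case by (intro exI[of _ "{0}"]) simp
  next
    case (insert i F)
    then obtain K where K: "compact K" "\<And>v. v \<in> cball 0 R \<Longrightarrow> (\<Sum>i\<in>F. cinner (y i) v *\<^sub>C x i) \<in> K" by blast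
    let ?g = "\<lambda>(c, w). c *\<^sub>C x i + w"
    have "continuous_on UNIV ?g"
      unfolding case_prod_unfold
      by (intro continuous_intros bounded_linear.continuous_on[OF bounded_linear_scaleC_left])
    then have "compact (?g ` (cball 0 (norm (y i) * R) \<times> K))"
      using K(1) by (intro compact_continuous_image compact_Times compact_cball) (auto intro: continuous_on_subset)
    moreover have "(\<Sum>j\<in>insert i F. cinner (y j) v *\<^sub>C x j) \<in> ?g ` (cball 0 (norm (y i) * R) \<times> K)" if "v \<in> cball 0 R" for v
    proof (rule image_eqI)
      show "(\<Sum>j\<in>insert i F. cinner (y j) v *\<^sub>C x j) = ?g (cinner (y i) v, \<Sum>j\<in>F. cinner (y j) v *\<^sub>C x j)"
        using insert by simp
      have "norm (cinner (y i) v) \<le> norm (y i) * R"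
        using norm_cinner_le[of "y i" v] mult_left_mono[of "norm v" R "norm (y i)"] that by simp
      then show "(cinner (y i) v, \<Sum>j\<in>F. cinner (y j) v *\<^sub>C x j) \<in> cball 0 (norm (y i) * R) \<times> K"
        using K(2)[OF that] by simp
    qed
    ultimately show ?case by blast
  qed
  have tb: "\<exists>k. finite k \<and> A ` cball 0 R \<subseteq> (\<Union>x\<in>k. ball x e)" if "e > 0" for e
  proof -
    define S where "S = (\<Sum>\<^sub>\<infinity>i. norm (x i) * norm (y i))"
    define d where "d = e / 2 / (\<bar>R\<bar> + 1)"
    have "d > 0" using that by (simp add: d_def)
    have "((\<lambda>F. \<Sum>i\<in>F. norm (x i) * norm (y i)) \<longlongrightarrow> S) (finite_subsets_at_top UNIV)"
      unfolding S_def by (rule infsum_tendsto[OF xy(1)])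
    then have "eventually (\<lambda>F. (\<Sum>i\<in>F. norm (x i) * norm (y i)) > S - d) (finite_subsets_at_top UNIV)"
      using \<open>d > 0\<close> by (intro order_tendstoD(1)) auto
    then obtain F where F: "finite F" "(\<Sum>i\<in>F. norm (x i) * norm (y i)) > S - d"
      by (auto simp: eventually_finite_subsets_at_top)
    obtain K where K: "compact K" "\<And>v. v \<in> cball 0 R \<Longrightarrow> (\<Sum>i\<in>F. cinner (y i) v *\<^sub>C x i) \<in> K"
      using fin[OF F(1)] by blast
    have "e / 2 > 0" using that by simp
    then obtain k where k: "finite k" "K \<subseteq> (\<Union>x\<in>k. ball x (e / 2))"
      using K(1)[unfolded compact_eq_totally_bounded, THEN conjunct2, rule_format, of "e / 2"] by blast
    have "A v \<in> (\<Union>x\<in>k. ball x e)" if v: "v \<in> cball 0 R" for v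
    proof -
      have tail: "(\<lambda>i. norm (x i) * norm (y i)) summable_on (- F)"
        by (rule summable_on_subset_banach[OF xy(1)]) auto
      have "((\<lambda>i. cinner (y i) v *\<^sub>C x i) has_sum (A v - (\<Sum>i\<in>F. cinner (y i) v *\<^sub>C x i))) (UNIV - F)"
        by (rule has_sum_Diff[OF xy(2)]) (use F in \<open>auto intro: has_sum_finite\<close>)
      then have hs: "((\<lambda>i. cinner (y i) v *\<^sub>C x i) has_sum (A v - (\<Sum>i\<in>F. cinner (y i) v *\<^sub>C x i))) (- F)"
        by (simp add: Compl_eq_Diff_UNIV)
      have "S = (\<Sum>i\<in>F. norm (x i) * norm (y i)) + (\<Sum>\<^sub>\<infinity>i\<in>-F. norm (x i) * norm (y i))"
        using infsum_Un_disjoint[of "\<lambda>i. norm (x i) * norm (y i)" F "- F"] tail F(1) by (simp add: S_def)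
      then have less: "(\<Sum>\<^sub>\<infinity>i\<in>-F. norm (x i) * norm (y i)) < d" using F(2) by linarith
      have "norm (A v - (\<Sum>i\<in>F. cinner (y i) v *\<^sub>C x i)) \<le> (\<Sum>\<^sub>\<infinity>i\<in>-F. \<bar>R\<bar> * (norm (x i) * norm (y i)))"
      proof (rule norm_has_sum_le_infsum[OF hs summable_on_cmult_right[OF tail]])
        fix i
        have "norm (cinner (y i) v) \<le> norm (y i) * \<bar>R\<bar>"
        proof -
          have "norm (y i) * norm v \<le> norm (y i) * \<bar>R\<bar>" using v by (intro mult_left_mono) auto
          then show ?thesis using norm_cinner_le[of "y i" v] by linarith
        qed
        then have "norm (cinner (y i) v) * norm (x i) \<le> norm (y i) * \<bar>R\<bar> * norm (x i)" by (rule mult_right_mono) simp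
        then show "norm (cinner (y i) v *\<^sub>C x i) \<le> \<bar>R\<bar> * (norm (x i) * norm (y i))"
          by (simp add: norm_scaleC algebra_simps)
      qed
      also have "\<dots> \<le> (\<bar>R\<bar> + 1) * (\<Sum>\<^sub>\<infinity>i\<in>-F. norm (x i) * norm (y i))"
        by (simp add: infsum_cmult_right' distrib_right infsum_nonneg)
      also have "\<dots> < (\<bar>R\<bar> + 1) * d" using less by (intro mult_strict_left_mono) auto
      also have "\<dots> = e / 2"
      proof -
        have "\<bar>R\<bar> + 1 \<noteq> 0" by linarith
        then show ?thesis by (metis d_def nonzero_mult_div_cancel_left times_divide_eq_right)
      qed
      finally have near: "dist (\<Sum>i\<in>F. cinner (y i) v *\<^sub>C x i) (A v) < e / 2" by (simp add: dist_norm norm_minus_commute)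
      obtain w where "w \<in> k" "dist w (\<Sum>i\<in>F. cinner (y i) v *\<^sub>C x i) < e / 2"
        using k(2) K(2)[OF v] by auto
      then have "dist w (A v) < e" using near dist_triangle[of w "A v" "\<Sum>i\<in>F. cinner (y i) v *\<^sub>C x i"] by linarith
      with \<open>w \<in> k\<close> show ?thesis by auto
    qed
    with k(1) show ?thesis by blast
  qed
  have "\<exists>k. finite k \<and> closure (A ` cball 0 R) \<subseteq> (\<Union>x\<in>k. ball x e)" if "e > 0" for e
  proof -
    from tb[of "e / 2"] that obtain k where k: "finite k" "A ` cball 0 R \<subseteq> (\<Union>x\<in>k. ball x (e / 2))" by auto
    have "(\<Union>x\<in>k. ball x (e / 2)) \<subseteq> (\<Union>x\<in>k. cball x (e / 2))"
      by (rule UN_mono) (rule order_refl, rule ball_subset_cball)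
    then have sub: "A ` cball 0 R \<subseteq> (\<Union>x\<in>k. cball x (e / 2))" using k(2) by (rule order_trans[rotated])
    have "closed (\<Union>x\<in>k. cball x (e / 2))" by (rule closed_UN[OF k(1)]) (rule ballI, rule closed_cball)
    with sub have "closure (A ` cball 0 R) \<subseteq> (\<Union>x\<in>k. cball x (e / 2))" by (rule closure_minimal)
    also have "\<dots> \<subseteq> (\<Union>x\<in>k. ball x e)"
      by (rule UN_mono) (use that in \<open>auto simp: subset_iff\<close>)
    finally show ?thesis using k(1) by blast
  qed
  then show ?thesis
    unfolding compact_eq_totally_bounded by (simp add: complete_eq_closed)
qed

text \<open>Let \<open>c\<close> be the norm of \<open>A\<close> on \<open>M\<close>. A maximizing sequence of unit vectors consists of
  approximate eigenvectors of \<open>A\<^sup>2\<close> for \<open>c\<^sup>2\<close>, so compactness provides a true one, \<open>v\<close>. As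
  \<open>A\<^sup>2 - c\<^sup>2 = (A - c)(A + c)\<close>, either \<open>v\<close> or \<open>A v + c v\<close> is an eigenvector of \<open>A\<close>.\<close>

lemma selfadjoint_compact_eigenvector:
  fixes A :: "'a::chilbert_space \<Rightarrow> 'a"
  assumes A: "adjoint_pair A A K" and cpt: "compact (closure (A ` cball 0 K))"
    and M: "closed M" "\<And>x y. x \<in> M \<Longrightarrow> y \<in> M \<Longrightarrow> x + y \<in> M" "\<And>c x. x \<in> M \<Longrightarrow> c *\<^sub>C x \<in> M"
      "\<And>x. x \<in> M \<Longrightarrow> A x \<in> M"
    and nz: "x0 \<in> M" "A x0 \<noteq> 0"
  shows "\<exists>v\<in>M. norm v = 1 \<and> (\<exists>r::real. A v = r *\<^sub>R v)"
proof -
  note lin = adjoint_pair_clinear[OF A]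
  have bl: "bounded_linear A" by (rule adjoint_pair_bounded_linear[OF A])
  have sa: "cinner (A x) y = cinner x (A y)" for x y using A by (simp add: adjoint_pair_def)
  have bd: "norm (A x) \<le> K * norm x" for x using A by (simp add: adjoint_pair_def)
  have MR: "r *\<^sub>R x \<in> M" if "x \<in> M" for r x using M(3)[OF that, of "complex_of_real r"] by (simp add: scaleC_of_real)
  define N where "N = (\<lambda>x. norm (A x)) ` {x \<in> M. norm x = 1}"
  have bdd: "bdd_above N"
  proof (rule bdd_aboveI[of _ K])
    fix z assume "z \<in> N"
    then obtain x where "z = norm (A x)" "norm x = 1" by (auto simp: N_def)
    then show "z \<le> K" using bd[of x] by simp
  qed
  have "x0 \<noteq> 0" using nz lin(5) by auto
  define x1 where "x1 = x0 /\<^sub>R norm x0"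
  have x1: "x1 \<in> M" "norm x1 = 1" "A x1 \<noteq> 0"
    using nz \<open>x0 \<noteq> 0\<close> MR by (auto simp: x1_def lin)
  define c where "c = Sup N"
  have cN: "norm (A x) \<le> c" if "x \<in> M" "norm x = 1" for x
    unfolding c_def using that bdd by (intro cSup_upper) (auto simp: N_def)
  have c0: "c > 0"
  proof -
    have "0 < norm (A x1)" using x1(3) by simp
    with cN[OF x1(1,2)] show ?thesis by linarith
  qed
  have cle: "norm (A x) \<le> c * norm x" if "x \<in> M" for x
  proof (cases "x = 0")
    case False
    then have "norm (A (x /\<^sub>R norm x)) \<le> c" using that by (intro cN MR) auto
    then show ?thesis using False by (simp add: lin divide_simps mult.commute)
  qed (simp add: lin)
  have "\<exists>x. x \<in> M \<and> norm x = 1 \<and> norm (A x) > c - 1 / Suc n" for n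
  proof -
    have "\<exists>z\<in>N. c - 1 / Suc n < z"
      unfolding c_def using x1 bdd by (subst less_cSup_iff[symmetric]) (auto simp: N_def)
    then show ?thesis by (auto simp: N_def)
  qed
  then obtain X where X: "\<And>n. X n \<in> M" "\<And>n. norm (X n) = 1" "\<And>n. norm (A (X n)) > c - 1 / Suc n"
    by metis
  have lim: "(\<lambda>n. norm (A (X n))) \<longlonglongrightarrow> c"
  proof (rule tendsto_sandwich)
    show "(\<lambda>n. c - 1 / Suc n) \<longlonglongrightarrow> c"
      using tendsto_diff[OF tendsto_const[of c] LIMSEQ_Suc[OF lim_1_over_n]] by simp
    show "\<forall>\<^sub>F n in sequentially. c - 1 / Suc n \<le> norm (A (X n))" using X(3) by (simp add: less_imp_le)
    show "\<forall>\<^sub>F n in sequentially. norm (A (X n)) \<le> c" using cN X by simp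
  qed simp
  have "(\<lambda>n. (norm (A (A (X n)) - (c\<^sup>2) *\<^sub>R X n))\<^sup>2) \<longlonglongrightarrow> 0"
  proof (rule tendsto_sandwich[OF _ _ tendsto_const])
    have "(norm (A (A x) - (c\<^sup>2) *\<^sub>R x))\<^sup>2 \<le> c\<^sup>2 * (c\<^sup>2 - (norm (A x))\<^sup>2)" if "x \<in> M" "norm x = 1" for x
    proof -
      have "inner (A (A x)) x = (norm (A x))\<^sup>2"
        by (simp add: inner_eq_Re_cinner sa cinner_self)
      then have "(norm (A (A x) - (c\<^sup>2) *\<^sub>R x))\<^sup>2 = (norm (A (A x)))\<^sup>2 - 2 * c\<^sup>2 * (norm (A x))\<^sup>2 + (c\<^sup>2)\<^sup>2"
        using that by (simp add: power2_norm_eq_inner inner_diff_left inner_diff_right inner_commute algebra_simps)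
          (simp add: power2_eq_square power2_norm_eq_inner[symmetric])
      also have "(norm (A (A x)))\<^sup>2 \<le> (c * norm (A x))\<^sup>2"
        using cle[OF M(4)[OF that(1)]] by (intro power_mono) auto
      finally show ?thesis by (simp add: algebra_simps power2_eq_square)
    qed
    then show "\<forall>\<^sub>F n in sequentially. (norm (A (A (X n)) - (c\<^sup>2) *\<^sub>R X n))\<^sup>2 \<le> c\<^sup>2 * (c\<^sup>2 - (norm (A (X n)))\<^sup>2)"
      using X by simp
    have "(\<lambda>n. c\<^sup>2 * (c\<^sup>2 - (norm (A (X n)))\<^sup>2)) \<longlonglongrightarrow> c\<^sup>2 * (c\<^sup>2 - c\<^sup>2)"
      by (intro tendsto_intros lim)
    then show "(\<lambda>n. c\<^sup>2 * (c\<^sup>2 - (norm (A (X n)))\<^sup>2)) \<longlonglongrightarrow> 0" by simp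
  qed simp
  then have "(\<lambda>n. norm (A (A (X n)) - (c\<^sup>2) *\<^sub>R X n)) \<longlonglongrightarrow> 0"
    using tendsto_real_sqrt by fastforce
  then have diff0: "(\<lambda>n. A (A (X n)) - (c\<^sup>2) *\<^sub>R X n) \<longlonglongrightarrow> 0" by (rule tendsto_norm_zero_cancel)
  have "A (A (X n)) \<in> closure (A ` cball 0 K)" for n
    using closure_subset bd[of "X n"] X(2)[of n] by (auto intro!: subsetD[OF closure_subset])
  then have mem: "\<forall>n. A (A (X n)) \<in> closure (A ` cball 0 K)" by blast
  have "\<exists>l\<in>closure (A ` cball 0 K). \<exists>r. strict_mono r \<and> ((\<lambda>n. A (A (X n))) \<circ> r) \<longlonglongrightarrow> l"
    by (rule cpt[unfolded compact_eq_seq_compact_metric seq_compact_def, THEN spec, THEN mp, OF mem])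
  then obtain w r where r: "strict_mono r" "(\<lambda>n. A (A (X (r n)))) \<longlonglongrightarrow> w"
    by (auto simp: o_def)
  define v where "v = w /\<^sub>R c\<^sup>2"
  have "(\<lambda>n. (c\<^sup>2) *\<^sub>R X (r n)) \<longlonglongrightarrow> w"
    using tendsto_diff[OF r(2) LIMSEQ_subseq_LIMSEQ[OF diff0 r(1)]] by (simp add: o_def)
  from tendsto_scaleR[OF tendsto_const[of "inverse (c\<^sup>2)"] this]
  have Xv: "(\<lambda>n. X (r n)) \<longlonglongrightarrow> v" using c0 by (simp add: v_def)
  have vM: "v \<in> M" using closed_sequentially[OF M(1) _ Xv] X(1) by blast
  have v1: "norm v = 1" using tendsto_norm[OF Xv] X(2) by (simp add: LIMSEQ_const_iff)
  have "(\<lambda>n. A (A (X (r n)))) \<longlonglongrightarrow> A (A v)"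
    by (intro bounded_linear.tendsto[OF bl] Xv)
  then have "w = A (A v)" using r(2) LIMSEQ_unique by blast
  then have AAv: "A (A v) = c\<^sup>2 *\<^sub>R v" using c0 by (simp add: v_def)
  show ?thesis
  proof (cases "A v + c *\<^sub>R v = 0")
    case True
    then have "A v = (- c) *\<^sub>R v" by (simp add: add_eq_0_iff)
    then show ?thesis using vM v1 by blast
  next
    case False
    define u where "u = A v + c *\<^sub>R v"
    have "A u = c *\<^sub>R u" unfolding u_def by (simp add: lin AAv algebra_simps power2_eq_square)
    then have "A (u /\<^sub>R norm u) = c *\<^sub>R (u /\<^sub>R norm u)" by (simp add: lin mult.commute)
    moreover have "u /\<^sub>R norm u \<in> M" unfolding u_def using vM by (intro MR M(2) M(4)) auto
    moreover have "norm (u /\<^sub>R norm u) = 1" using False by (simp add: u_def)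
    ultimately show ?thesis by blast
  qed
qed

text \<open>A maximal orthonormal set of eigenvectors, found by Zorn's lemma, is a basis: its
  orthogonal complement is invariant and would otherwise contain another eigenvector.\<close>

lemma selfadjoint_nuclear_eigenbasis:
  fixes A :: "'a::chilbert_space \<Rightarrow> 'a"
  assumes A: "adjoint_pair A A K" and nuc: "nuclear_with A c t"
  shows "\<exists>E. is_onb E \<and> (\<forall>e\<in>E. \<exists>r::real. A e = r *\<^sub>R e)"
proof -
  note lin = adjoint_pair_clinear[OF A]
  have sa: "cinner (A x) y = cinner x (A y)" for x y using A by (simp add: adjoint_pair_def)
  define \<A> where "\<A> = {E. orthonormal_set E \<and> (\<forall>e\<in>E. \<exists>r::real. A e = r *\<^sub>R e)}"
  have "\<Union>C \<in> \<A>" if C: "subset.chain \<A> C" for C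
  proof -
    have "orthonormal_set (\<Union>C)"
      unfolding orthonormal_set_def
    proof (intro ballI)
      fix e e' assume "e \<in> \<Union>C" "e' \<in> \<Union>C"
      then obtain S1 S2 where S12: "S1 \<in> C" "e \<in> S1" "S2 \<in> C" "e' \<in> S2" by blast
      have "S1 \<subseteq> S2 \<or> S2 \<subseteq> S1" using C S12 by (auto simp: subset.chain_def)
      then obtain S where "S \<in> C" "e \<in> S" "e' \<in> S" using S12 by blast
      moreover have "orthonormal_set S" using C \<open>S \<in> C\<close> by (auto simp: subset.chain_def \<A>_def)
      ultimately show "cinner e e' = (if e = e' then 1 else 0)" by (simp add: orthonormal_setD)
    qed
    then show ?thesis using C by (auto simp: \<A>_def subset.chain_def)
  qed
  then obtain E where E: "E \<in> \<A>" and max: "\<And>F. F \<in> \<A> \<Longrightarrow> E \<subseteq> F \<Longrightarrow> F = E"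
    using subset_Zorn'[of \<A>] by blast
  define M where "M = {x. \<forall>e\<in>E. cinner e x = 0}"
  have oE: "orthonormal_set E" and eE: "\<And>e. e \<in> E \<Longrightarrow> \<exists>r::real. A e = r *\<^sub>R e" using E by (auto simp: \<A>_def)
  \<comment> \<open>by maximality the complement contains no eigenvector\<close>
  have no: False if "v \<in> M" "norm v = 1" "A v = r *\<^sub>R v" for v and r :: real
  proof -
    have vv: "cinner v v = 1" using that by (simp add: cinner_self)
    have ve: "cinner e v = 0" "cinner v e = 0" if "e \<in> E" for e
      using \<open>v \<in> M\<close> that cinner_commute[of v e] by (auto simp: M_def)
    have "v \<notin> E" using vv ve by auto
    moreover have "insert v E \<in> \<A>"
      using oE eE that vv ve \<open>v \<notin> E\<close> unfolding \<A>_def orthonormal_set_def by auto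
    ultimately show False using max[of "insert v E"] by blast
  qed
  have "x = 0" if "x \<in> M" for x
  proof (rule ccontr)
    assume "x \<noteq> 0"
    show False
    proof (cases "A x = 0")
      case True
      have "norm (x /\<^sub>R norm x) = 1" "A (x /\<^sub>R norm x) = 0 *\<^sub>R (x /\<^sub>R norm x)"
        using \<open>x \<noteq> 0\<close> True by (simp_all add: lin)
      moreover have "x /\<^sub>R norm x \<in> M" using that by (simp add: M_def cinner_scaleR_right)
      ultimately show False using no by blast
    next
      case False
      have "\<exists>v\<in>M. norm v = 1 \<and> (\<exists>r::real. A v = r *\<^sub>R v)"
      proof (rule selfadjoint_compact_eigenvector[OF A nuclear_image_compact_closure[OF nuc] _ _ _ _ that False])
        have "M = (\<Inter>e\<in>E. cinner e -` {0})" by (auto simp: M_def)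
        then show "closed M"
          using closed_vimage[OF closed_singleton linear_continuous_on[OF bounded_linear_cinner_right]]
          by (auto intro!: closed_INT)
        show "A z \<in> M" if "z \<in> M" for z
          unfolding M_def
        proof (rule CollectI, rule ballI)
          fix e assume "e \<in> E"
          with eE obtain r where "A e = r *\<^sub>R e" by blast
          then have "cinner e (A z) = complex_of_real r * cinner e z"
            using sa[of e z] by (simp add: cinner_scaleR_left)
          then show "cinner e (A z) = 0" using that \<open>e \<in> E\<close> by (simp add: M_def)
        qed
      qed (auto simp: M_def cinner_add_right cinner_scaleC_right)
      then show False using no by blast
    qed
  qed
  then have "is_onb E" using oE by (auto simp: is_onb_iff M_def)
  with eE show ?thesis by blast
qed

lemma bounded_linear_eq_on_onb:
  fixes P Q :: "'a::chilbert_space \<Rightarrow> 'a"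
  assumes E: "is_onb E" and P: "bounded_clinear P" and Q: "bounded_clinear Q"
    and eq: "\<And>e. e \<in> E \<Longrightarrow> P e = Q e"
  shows "P = Q"
proof
  fix x
  have "((\<lambda>e. P (cinner e x *\<^sub>C e)) has_sum P x) E"
    by (rule has_sum_bounded_linear[OF _ onb_expansion[OF E]]) (use P in \<open>simp add: bounded_clinear_def\<close>)
  moreover have "((\<lambda>e. Q (cinner e x *\<^sub>C e)) has_sum Q x) E"
    by (rule has_sum_bounded_linear[OF _ onb_expansion[OF E]]) (use Q in \<open>simp add: bounded_clinear_def\<close>)
  moreover have "P (cinner e x *\<^sub>C e) = Q (cinner e x *\<^sub>C e)" if "e \<in> E" for e
    using P Q eq[OF that] by (simp add: bounded_clinear_def)
  ultimately show "P x = Q x" by (metis (no_types, lifting) has_sum_cong has_sum_unique)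
qed

text \<open>Polarization: the quadratic form of \<open>P\<close> is real, also on \<open>x + y\<close> and \<open>x + \<i> y\<close>.\<close>

lemma positive_op_selfadjoint:
  assumes "positive_op P"
  shows "cinner (P x) y = cinner x (P y)"
proof -
  have re: "Im (cinner z (P z)) = 0" for z using assms by (simp add: positive_op_def)
  have bP: "bounded_linear P" and PC: "P (c *\<^sub>C z) = c *\<^sub>C P z" for c z
    using assms by (auto simp: positive_op_def bounded_clinear_def)
  note Padd = linear_add[OF bounded_linear.linear[OF bP]]
  have "Im (cinner x (P y) + cinner y (P x)) = 0"
    using re[of "x + y"] re[of x] re[of y] by (simp add: Padd cinner_add_left cinner_add_right)
  moreover have "Im (\<i> * cinner x (P y) - \<i> * cinner y (P x)) = 0"
    using re[of "x + \<i> *\<^sub>C y"] re[of x] re[of y]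
    by (simp add: Padd PC cinner_add_left cinner_add_right cinner_scaleC_left cinner_scaleC_right)
  ultimately have "cinner x (P y) = cnj (cinner y (P x))" by (simp add: complex_eq_iff)
  then show ?thesis using cinner_commute[of "P x" y] by simp
qed

text \<open>This makes the positive square root unique. The vector \<open>P e - \<bar>r\<bar> e\<close> satisfies
  \<open>P v = - \<bar>r\<bar> v\<close>, which is impossible for a positive operator unless it vanishes.\<close>

lemma positive_op_eigenvector:
  assumes P: "positive_op P" and PP: "P (P e) = (r * r) *\<^sub>R e"
  shows "P e = \<bar>r\<bar> *\<^sub>R e"
proof (cases "r = 0")
  case True
  have "cinner (P e) (P e) = cinner e (P (P e))" by (rule positive_op_selfadjoint[OF P])
  then have "cinner (P e) (P e) = 0" using True PP by simp
  then show ?thesis using True by (simp add: cinner_self)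
next
  case False
  have bP: "bounded_linear P" and pos: "\<And>x. 0 \<le> Re (cinner x (P x))"
    using P by (auto simp: positive_op_def bounded_clinear_def)
  note lin = linear_diff[OF bounded_linear.linear[OF bP]] linear_scale[OF bounded_linear.linear[OF bP]]
  define v where "v = P e - \<bar>r\<bar> *\<^sub>R e"
  have "P v = (- \<bar>r\<bar>) *\<^sub>R v"
    by (simp add: v_def lin PP scaleR_diff_right)
  then have eq: "cinner v (P v) = - complex_of_real (\<bar>r\<bar> * (norm v)\<^sup>2)"
    by (simp only: cinner_scaleR_right cinner_self) simp
  have "\<bar>r\<bar> * (norm v)\<^sup>2 \<le> 0" using pos[of v] unfolding eq by simp
  then have "v = 0" using False by (simp add: mult_le_0_iff)
  then show ?thesis by (simp add: v_def)
qed

text \<open>In an eigenbasis with eigenvalues \<open>l e\<close> the absolute value of \<open>A\<close> is diagonal with entries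
  \<open>\<bar>l e\<bar>\<close>, and these are the absolute values of the diagonal entries of \<open>A\<close>, which are
  summable. As the absolute value is specified by a definite description, the diagonal operator also
  has to be the only positive square root of \<open>A\<^sup>2\<close>.\<close>

lemma selfadjoint_nuclear_trace_class:
  fixes A :: "'a::chilbert_space \<Rightarrow> 'a"
  assumes A: "adjoint_pair A A K" and nuc: "nuclear_with A c t"
  shows "trace_class A"
proof -
  obtain E where E: "is_onb E" and eig: "\<And>e. e \<in> E \<Longrightarrow> \<exists>r::real. A e = r *\<^sub>R e"
    using selfadjoint_nuclear_eigenbasis[OF assms] by blast
  have oE: "orthonormal_set E" using E by (simp add: is_onb_iff)
  define l where "l e = (SOME r::real. A e = r *\<^sub>R e)" for e
  have Ae: "A e = l e *\<^sub>R e" if "e \<in> E" for e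
    unfolding l_def using eig[OF that] by (rule someI_ex)
  have lsum: "(\<lambda>e. \<bar>l e\<bar>) summable_on E"
    using nuclear_with_trace(1)[OF nuc E]
    by (rule summable_on_cong[THEN iffD1, rotated])
      (simp add: Ae cinner_scaleR_right norm_mult orthonormal_setD[OF oE])
  have term_bound: "norm ((complex_of_real \<bar>l e\<bar> * cinner e v) *\<^sub>C e) \<le> norm v * \<bar>l e\<bar>" if "e \<in> E" for e v
    using mult_left_mono[OF norm_cinner_le[of e v], of "\<bar>l e\<bar>"] norm_orthonormal[OF oE that]
    by (simp add: norm_scaleC norm_mult mult.commute)
  define P where "P v = (\<Sum>\<^sub>\<infinity>e\<in>E. (complex_of_real \<bar>l e\<bar> * cinner e v) *\<^sub>C e)" for v
  have sv: "(\<lambda>e. norm v * \<bar>l e\<bar>) summable_on E" for v :: 'a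
    by (rule summable_on_cmult_right[OF lsum])
  have Psum: "((\<lambda>e. (complex_of_real \<bar>l e\<bar> * cinner e v) *\<^sub>C e) has_sum P v) E" for v
    unfolding P_def
    by (rule has_sum_infsum, rule abs_summable_summable, rule Infinite_Sum.abs_summable_on_comparison_test'[OF sv term_bound])
  have Padd: "P (v + w) = P v + P w" for v w
  proof (rule has_sum_unique[OF Psum])
    show "((\<lambda>e. (complex_of_real \<bar>l e\<bar> * cinner e (v + w)) *\<^sub>C e) has_sum (P v + P w)) E"
      using has_sum_add[OF Psum[of v] Psum[of w]]
      by (simp only: cinner_add_right distrib_left scaleC_add_left)
  qed
  have Pscale: "P (c *\<^sub>C v) = c *\<^sub>C P v" for c v
  proof (rule has_sum_unique[OF Psum])
    show "((\<lambda>e. (complex_of_real \<bar>l e\<bar> * cinner e (c *\<^sub>C v)) *\<^sub>C e) has_sum (c *\<^sub>C P v)) E"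
      using has_sum_bounded_linear[OF bounded_linear_scaleC_right Psum[of v], of c]
      by (simp add: cinner_scaleC_right scaleC_scaleC mult.left_commute)
  qed
  have Pbound: "norm (P v) \<le> norm v * (\<Sum>\<^sub>\<infinity>e\<in>E. \<bar>l e\<bar>)" for v
    using norm_has_sum_le_infsum[OF Psum sv term_bound, of v] by (simp add: infsum_cmult_right')
  have Pb: "bounded_clinear P"
    unfolding bounded_clinear_def using Padd Pscale Pbound
    by (auto intro!: bounded_linear_intro[where K = "\<Sum>\<^sub>\<infinity>e\<in>E. \<bar>l e\<bar>"] simp flip: scaleC_of_real)
  have Pe: "P e = \<bar>l e\<bar> *\<^sub>R e" if "e \<in> E" for e
  proof -
    have "((\<lambda>e'. (complex_of_real \<bar>l e'\<bar> * cinner e' e) *\<^sub>C e') has_sum (complex_of_real \<bar>l e\<bar> *\<^sub>C e)) E"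
      by (rule has_sum_finite_neutralI[of "{e}"])
        (use that in \<open>auto simp: orthonormal_setD[OF oE] split: if_splits\<close>)
    then show ?thesis using has_sum_unique[OF Psum] by (metis scaleC_of_real)
  qed
  have pos: "positive_op P"
    unfolding positive_op_def
  proof (intro conjI allI Pb)
    fix v
    have "((\<lambda>e. cinner v ((complex_of_real \<bar>l e\<bar> * cinner e v) *\<^sub>C e)) has_sum cinner v (P v)) E"
      by (rule has_sum_cinner_right[OF Psum])
    moreover have "cinner v ((complex_of_real \<bar>l e\<bar> * cinner e v) *\<^sub>C e) = complex_of_real (\<bar>l e\<bar> * (norm (cinner e v))\<^sup>2)" for e
      using cinner_commute[of v e]
      by (simp add: cinner_scaleC_right complex_norm_square mult.assoc del: of_real_power)
    ultimately have hs: "((\<lambda>e. complex_of_real (\<bar>l e\<bar> * (norm (cinner e v))\<^sup>2)) has_sum cinner v (P v)) E" by simp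
    from has_sum_Im[OF this] show "Im (cinner v (P v)) = 0"
      using has_sum_unique[OF _ has_sum_0] by fastforce
    from has_sum_Re[OF hs] show "0 \<le> Re (cinner v (P v))"
      by (rule has_sum_nonneg) simp
  qed
  have cad: "cadjoint A = A" by (rule adjoint_pair_cadjoint[OF A])
  have bA: "bounded_linear A" "\<And>c x. A (c *\<^sub>C x) = c *\<^sub>C A x"
    using adjoint_pair_bounded_clinear[OF A] by (auto simp: bounded_clinear_def)
  have bAA: "bounded_clinear (A \<circ> A)" and bPP: "bounded_clinear (P \<circ> P)"
    using bA Pb by (auto simp: bounded_clinear_def o_def intro: bounded_linear_compose)
  have AAe: "(A \<circ> A) e = (l e * l e) *\<^sub>R e" if "e \<in> E" for e
    using Ae[OF that] by (simp add: adjoint_pair_clinear(3)[OF A])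
  have PPe: "(P \<circ> P) e = (l e * l e) *\<^sub>R e" if "e \<in> E" for e
    using Pe[OF that] linear_scale[OF bounded_linear.linear, of P] Pb by (simp add: bounded_clinear_def)
  have sq: "P \<circ> P = cadjoint A \<circ> A"
    unfolding cad by (rule bounded_linear_eq_on_onb[OF E bPP bAA]) (simp only: AAe PPe)
  have absP: "abs_op A = P"
    unfolding abs_op_def
  proof (rule the_equality)
    show "positive_op P \<and> P \<circ> P = cadjoint A \<circ> A" using pos sq by simp
    fix Q assume Q: "positive_op Q \<and> Q \<circ> Q = cadjoint A \<circ> A"
    show "Q = P"
    proof (rule bounded_linear_eq_on_onb[OF E _ Pb])
      show "bounded_clinear Q" using Q by (simp add: positive_op_def)
      fix e assume "e \<in> E"
      then have "Q (Q e) = (l e * l e) *\<^sub>R e"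
        using Q AAe[of e] unfolding cad by (metis comp_apply)
      then show "Q e = P e" using positive_op_eigenvector[of Q e "l e"] Q Pe[OF \<open>e \<in> E\<close>] by simp
    qed
  qed
  have "(\<lambda>e. cinner e (abs_op A e)) summable_on E"
  proof -
    have "(\<lambda>e. complex_of_real \<bar>l e\<bar>) summable_on E" by (rule summable_on_of_real[OF lsum])
    moreover have "complex_of_real \<bar>l e\<bar> = cinner e (abs_op A e)" if "e \<in> E" for e
      using that absP by (simp add: Pe cinner_scaleR_right orthonormal_setD[OF oE])
    ultimately show ?thesis by (metis (no_types, lifting) summable_on_cong)
  qed
  then show ?thesis
    unfolding trace_class_def using E adjoint_pair_bounded_clinear[OF A] by blast
qed

section \<open>Commutators with nuclear operators\<close>

lemma nuclear_with_bound:
  assumes "nuclear_with A c t"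
  shows "norm (A v) \<le> c * norm v"
proof -
  from assms obtain x y :: "nat \<Rightarrow> 'a" where xy:
    "(\<lambda>i. norm (x i) * norm (y i)) summable_on UNIV" "(\<Sum>\<^sub>\<infinity>i. norm (x i) * norm (y i)) \<le> c"
    "\<And>v. ((\<lambda>i. cinner (y i) v *\<^sub>C x i) has_sum A v) UNIV"
    unfolding nuclear_with_def by blast
  have "norm (A v) \<le> (\<Sum>\<^sub>\<infinity>i. norm v * (norm (x i) * norm (y i)))"
  proof (rule norm_has_sum_le_infsum[OF xy(3) summable_on_cmult_right[OF xy(1)]])
    fix i
    show "norm (cinner (y i) v *\<^sub>C x i) \<le> norm v * (norm (x i) * norm (y i))"
      using mult_right_mono[OF norm_cinner_le[of "y i" v] norm_ge_zero[of "x i"]]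
      by (simp add: norm_scaleC mult_ac)
  qed
  also have "\<dots> = norm v * (\<Sum>\<^sub>\<infinity>i. norm (x i) * norm (y i))" by (rule infsum_cmult_right')
  also have "\<dots> \<le> norm v * c" by (rule mult_left_mono[OF xy(2) norm_ge_zero])
  finally show ?thesis by (simp add: mult.commute)
qed

lemma nuclear_with_diff:
  assumes "nuclear_with A c s" "nuclear_with B d t"
  shows "nuclear_with (\<lambda>v. A v - B v) (c + d) (s - t)"
proof -
  have "(- 1) *\<^sub>C x = - x" for x :: 'a using scaleC_of_real[of "-1" x] by simp
  then show ?thesis
    using nuclear_with_add[OF assms(1) nuclear_with_scaleC[OF assms(2), of "- 1"]] by simp
qed

lemma nuclear_with_commutator:
  assumes N: "nuclear_with N c t" and T: "adjoint_pair T S M"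
  shows "\<exists>c'. nuclear_with (\<lambda>x. N (T x) - T (N x)) c' 0"
proof -
  obtain t' where "nuclear_with (\<lambda>x. T (N x)) (M * c) t'" "nuclear_with (\<lambda>x. N (T x)) (M * c) t'"
    using nuclear_with_compose[OF N T] by blast
  from nuclear_with_diff[OF this(2,1)] show ?thesis by auto
qed

definition nuclear :: "('a::chilbert_space \<Rightarrow> 'a) \<Rightarrow> bool" where
  "nuclear A \<longleftrightarrow> (\<exists>c t. nuclear_with A c t)"

lemma nuclear_zero: "nuclear (\<lambda>x. 0)"
  using nuclear_with_0 by (auto simp: nuclear_def)

lemma nuclear_add: "nuclear A \<Longrightarrow> nuclear B \<Longrightarrow> nuclear (\<lambda>x. A x + B x)"
  unfolding nuclear_def using nuclear_with_add by blast

lemma nuclear_compose_right: "nuclear A \<Longrightarrow> adjoint_pair L L' K \<Longrightarrow> nuclear (\<lambda>x. A (L x))"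
  unfolding nuclear_def using nuclear_with_compose by blast

lemma adjoint_pair_mono: "adjoint_pair L L' K \<Longrightarrow> K \<le> J \<Longrightarrow> adjoint_pair L L' J"
  unfolding adjoint_pair_def by (meson mult_right_mono norm_ge_zero order_trans)

section \<open>The heat difference\<close>

text \<open>\<open>T\<close> has a nuclear self-commutator with trace \<open>t0\<close>, and \<open>S\<close> is its adjoint. Some orthonormal basis is
  provided because traces are taken along a chosen one.\<close>

locale almost_normal =
  fixes T S :: "'a::chilbert_space \<Rightarrow> 'a" and M c :: real and t0 :: complex and E0 :: "'a set"
  assumes T: "adjoint_pair T S M"
    and commutator: "nuclear_with (\<lambda>x. S (T x) - T (S x)) c t0"
    and E0: "is_onb E0"
begin

text \<open>
  \<open>A\<close> and \<open>B\<close> are the two products whose heat operators are compared. The bound \<open>J\<close> is at least \<open>1\<close>,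
  so that its powers increase.
\<close>

definition A where "A = (\<lambda>x. S (T x))"
definition B where "B = (\<lambda>x. T (S x))"
definition J where "J = max 1 (M * M)"

lemma S: "adjoint_pair S T M" by (rule adjoint_pair_sym[OF T])

lemma A: "adjoint_pair A A J" and B: "adjoint_pair B B J" and J: "1 \<le> J"
  unfolding A_def B_def J_def
  by (auto intro: adjoint_pair_mono[OF adjoint_pair_compose[OF S T]] adjoint_pair_mono[OF adjoint_pair_compose[OF T S]])

definition D where "D n x = (A ^^ n) x - (B ^^ n) x" for n x

text \<open>\<open>A^(n+1) - B^(n+1) = A (A^n - B^n) + (A - B) B^n\<close>. The nuclear norm grows only geometrically up to
  the factor \<open>n\<close>, which is what the exponential series can absorb.\<close>

lemma nuclear_D: "\<exists>t. nuclear_with (D n) (n * J ^ n * c) t"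
proof (induction n)
  case 0
  show ?case using nuclear_with_0 by (auto simp: D_def[abs_def])
next
  case (Suc n)
  then obtain t where t: "nuclear_with (D n) (n * J ^ n * c) t" by blast
  obtain t1 where t1: "nuclear_with (\<lambda>x. A (D n x)) (J * (n * J ^ n * c)) t1"
    using nuclear_with_compose[OF t A] by blast
  obtain t2 where t2: "nuclear_with (\<lambda>x. A ((B ^^ n) x) - B ((B ^^ n) x)) (J ^ n * c) t2"
    using nuclear_with_compose[OF commutator adjoint_pair_funpow[OF B, of n]] by (auto simp: A_def B_def)
  have "nuclear_with (D (Suc n)) (J * (n * J ^ n * c) + J ^ n * c) (t1 + t2)"
    using nuclear_with_add[OF t1 t2] by (simp add: D_def[abs_def] adjoint_pair_clinear(4)[OF A])
  moreover have "J ^ n * c \<le> J ^ Suc n * c"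
    using J nuclear_with_nonneg[OF commutator] by (intro mult_right_mono power_increasing) auto
  then have "J * (n * J ^ n * c) + J ^ n * c \<le> real (Suc n) * J ^ Suc n * c"
    by (simp add: algebra_simps)
  ultimately show ?case using nuclear_with_mono by blast
qed

lemma D_selfadjoint: "cinner (D n x) y = cinner x (D n y)"
  using adjoint_pair_diff[OF adjoint_pair_funpow[OF A] adjoint_pair_funpow[OF B], of n n]
  by (simp add: adjoint_pair_def D_def)

lemma trace_class_self_commutator: "trace_class (self_commutator T)"
proof -
  have eq: "self_commutator T = (\<lambda>x. A x - B x)"
    unfolding self_commutator_def adjoint_pair_cadjoint[OF T] A_def B_def ..
  show ?thesis
    unfolding eq
    by (rule selfadjoint_nuclear_trace_class[OF adjoint_pair_diff[OF A B]]) (use commutator in \<open>simp add: A_def B_def\<close>)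
qed

lemma exp_op_sums:
  assumes P: "adjoint_pair P P J"
  shows "summable (\<lambda>n. norm (((- s) ^ n / fact n) *\<^sub>R (P ^^ n) x))"
    "exp_op (\<lambda>y. (- s) *\<^sub>R P y) x = (\<Sum>n. ((- s) ^ n / fact n) *\<^sub>R (P ^^ n) x)"
proof -
  have "summable (\<lambda>n. (\<bar>s\<bar> * J) ^ n /\<^sub>R fact n * norm x)"
    by (intro summable_mult2 summable_exp_generic)
  then show "summable (\<lambda>n. norm (((- s) ^ n / fact n) *\<^sub>R (P ^^ n) x))"
  proof (rule summable_comparison_test'[of _ 0])
    fix n
    have "norm ((P ^^ n) x) \<le> J ^ n * norm x"
      using adjoint_pair_funpow[OF P, of n] by (simp add: adjoint_pair_def)
    then have m: "\<bar>s\<bar> ^ n / fact n * norm ((P ^^ n) x) \<le> \<bar>s\<bar> ^ n / fact n * (J ^ n * norm x)"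
      by (rule mult_left_mono) simp
    show "norm (norm (((- s) ^ n / fact n) *\<^sub>R (P ^^ n) x)) \<le> (\<bar>s\<bar> * J) ^ n /\<^sub>R fact n * norm x"
    proof -
      have "norm (norm (((- s) ^ n / fact n) *\<^sub>R (P ^^ n) x)) = \<bar>s\<bar> ^ n / fact n * norm ((P ^^ n) x)"
        by (simp add: power_abs)
      moreover have "(\<bar>s\<bar> * J) ^ n /\<^sub>R fact n * norm x = \<bar>s\<bar> ^ n / fact n * (J ^ n * norm x)"
        by (simp add: power_mult_distrib divide_inverse)
      ultimately show ?thesis
        using m by (simp only:)
    qed
  qed
  have "((\<lambda>y. (- s) *\<^sub>R P y) ^^ n) x = (- s) ^ n *\<^sub>R (P ^^ n) x" for n
    by (induction n) (simp_all add: adjoint_pair_clinear(3)[OF P])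
  then show "exp_op (\<lambda>y. (- s) *\<^sub>R P y) x = (\<Sum>n. ((- s) ^ n / fact n) *\<^sub>R (P ^^ n) x)"
    unfolding exp_op_def by (simp add: divide_inverse mult.commute)
qed

lemma heat_difference_has_sum:
  "((\<lambda>n. ((- s) ^ n / fact n) *\<^sub>R D n x) has_sum heat_difference T s x) UNIV"
proof (rule norm_summable_imp_has_sum)
  note sA = exp_op_sums[OF A, of s x] and sB = exp_op_sums[OF B, of s x]
  have eq: "((- s) ^ n / fact n) *\<^sub>R D n x = ((- s) ^ n / fact n) *\<^sub>R (A ^^ n) x - ((- s) ^ n / fact n) *\<^sub>R (B ^^ n) x" for n
    by (simp add: D_def scaleR_diff_right)
  show "summable (\<lambda>n. norm (((- s) ^ n / fact n) *\<^sub>R D n x))"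
    unfolding eq
    by (rule summable_comparison_test'[OF summable_add[OF sA(1) sB(1)], of 0]) (simp add: norm_triangle_ineq4 del: norm_scaleR)
  have "heat_difference T s x = exp_op (\<lambda>y. (- s) *\<^sub>R A y) x - exp_op (\<lambda>y. (- s) *\<^sub>R B y) x"
    by (simp add: heat_difference_def adjoint_pair_cadjoint[OF T] A_def B_def)
  then show "(\<lambda>n. ((- s) ^ n / fact n) *\<^sub>R D n x) sums heat_difference T s x"
    unfolding eq sA(2) sB(2)
    using sums_diff[OF summable_sums[OF summable_norm_cancel[OF sA(1)]] summable_sums[OF summable_norm_cancel[OF sB(1)]]]
    by simp
qed

text \<open>The exponential series of the heat difference converges in nuclear norm, so the trace may be
  taken term by term. The term of order zero vanishes, which explains the shift of the index.\<close>

lemma heat_difference_trace: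
  assumes d: "\<And>n. \<exists>c. nuclear_with (D (Suc n)) c (d n)"
  shows "trace_class (heat_difference T s)"
    "((\<lambda>n. complex_of_real ((- s) ^ Suc n / fact (Suc n)) * d n) has_sum trace_op (heat_difference T s)) UNIV"
proof -
  define a where "a n = (- s) ^ n / fact n" for n
  \<comment> \<open>traces of all \<open>D n\<close>, including \<open>D 0 = 0\<close>\<close>
  define dd where "dd n = (case n of 0 \<Rightarrow> 0 | Suc k \<Rightarrow> d k)" for n
  define b where "b n = norm (complex_of_real (a n)) * (n * J ^ n * c)" for n :: nat
  have Dn: "nuclear_with (D n) (n * J ^ n * c) (dd n)" for n
  proof -
    obtain t where t: "nuclear_with (D n) (n * J ^ n * c) t" using nuclear_D by blast
    obtain c' where c': "nuclear_with (D n) c' (dd n)"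
    proof (cases n)
      case 0
      then have "nuclear_with (D n) 0 (dd n)" by (simp add: nuclear_with_0 D_def[abs_def] dd_def)
      then show ?thesis by (rule that)
    qed (use d that in \<open>auto simp: dd_def\<close>)
    have "t = dd n"
      using nuclear_with_trace(2)[OF t E0] nuclear_with_trace(2)[OF c' E0] has_sum_unique by blast
    with t show ?thesis by simp
  qed
  have c0: "0 \<le> c" by (rule nuclear_with_nonneg[OF commutator])
  have b0: "0 \<le> b n" for n unfolding b_def using c0 J by (intro mult_nonneg_nonneg) auto
  have "summable (\<lambda>n. (2 * \<bar>s\<bar> * J) ^ n /\<^sub>R fact n * c)"
    by (intro summable_mult2 summable_exp_generic)
  then have "summable b"
  proof (rule summable_comparison_test'[of _ 0])
    fix n
    have "real n \<le> 2 ^ n" by (rule less_imp_le[OF of_nat_less_two_power])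
    then have "\<bar>s\<bar> ^ n / fact n * (real n * J ^ n * c) \<le> \<bar>s\<bar> ^ n / fact n * (2 ^ n * J ^ n * c)"
      using c0 J by (intro mult_left_mono mult_right_mono) auto
    moreover have "norm (b n) = \<bar>s\<bar> ^ n / fact n * (real n * J ^ n * c)"
    proof -
      have "norm (complex_of_real (a n)) = \<bar>s\<bar> ^ n / fact n"
        unfolding norm_of_real by (simp add: a_def power_abs)
      moreover have "norm (b n) = b n" using b0[of n] by simp
      ultimately show ?thesis by (simp only: b_def)
    qed
    moreover have "(2 * \<bar>s\<bar> * J) ^ n /\<^sub>R fact n * c = \<bar>s\<bar> ^ n / fact n * (2 ^ n * J ^ n * c)"
      by (simp add: power_mult_distrib divide_inverse)
    ultimately show "norm (b n) \<le> (2 * \<bar>s\<bar> * J) ^ n /\<^sub>R fact n * c" by (simp only:)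
  qed
  then have bs: "b summable_on UNIV" using b0 by (intro summable_nonneg_imp_summable_on) auto
  have nuc: "nuclear_with (\<lambda>x. complex_of_real (a n) *\<^sub>C D n x) (b n) (complex_of_real (a n) * dd n)" for n
    unfolding b_def by (rule nuclear_with_scaleC[OF Dn])
  have hs: "((\<lambda>n. complex_of_real (a n) *\<^sub>C D n x) has_sum heat_difference T s x) UNIV" for x
    unfolding scaleC_of_real a_def by (rule heat_difference_has_sum)
  obtain t where t: "nuclear_with (heat_difference T s) (infsum b UNIV) t"
    "((\<lambda>n. complex_of_real (a n) * dd n) has_sum t) UNIV"
    using nuclear_with_series[OF nuc bs hs] by blast
  have "adjoint_pair (heat_difference T s) (heat_difference T s) (infsum b UNIV)"
    unfolding adjoint_pair_def
  proof (intro conjI allI)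
    fix x y
    have "((\<lambda>n. cinner (complex_of_real (a n) *\<^sub>C D n x) y) has_sum cinner (heat_difference T s x) y) UNIV"
      by (rule has_sum_cinner_left[OF hs])
    moreover have "((\<lambda>n. cinner x (complex_of_real (a n) *\<^sub>C D n y)) has_sum cinner x (heat_difference T s y)) UNIV"
      by (rule has_sum_cinner_right[OF hs])
    ultimately show "cinner (heat_difference T s x) y = cinner x (heat_difference T s y)"
      by (simp add: cinner_scaleC_left cinner_scaleC_right D_selfadjoint has_sum_unique)
  qed (use nuclear_with_bound[OF t(1)] b0 in \<open>auto intro: infsum_nonneg\<close>)
  then show "trace_class (heat_difference T s)" by (rule selfadjoint_nuclear_trace_class[OF _ t(1)])
  have tr: "trace_op (heat_difference T s) = t" by (rule trace_op_nuclear[OF t(1) E0])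
  have "((\<lambda>n. complex_of_real (a n) * dd n) has_sum t) (range Suc)"
    by (rule has_sum_cong_neutral[THEN iffD1, OF _ _ _ t(2)])
      (auto simp: dd_def image_iff split: nat.splits dest: not0_implies_Suc)
  then have "((\<lambda>n. complex_of_real (a (Suc n)) * dd (Suc n)) has_sum t) UNIV"
    by (subst (asm) has_sum_reindex) (simp_all add: o_def)
  then show "((\<lambda>n. complex_of_real ((- s) ^ Suc n / fact (Suc n)) * d n) has_sum trace_op (heat_difference T s)) UNIV"
    unfolding tr by (simp add: a_def dd_def)
qed

lemma A_funpow_S: "(A ^^ n) (S x) = S ((B ^^ n) x)"
  by (induction n) (simp_all add: A_def B_def)

text \<open>With \<open>R = S B^n\<close> one has \<open>R T = A^(n+1)\<close> and \<open>T R = B^(n+1)\<close>. If \<open>R = L + N\<close> with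
  nuclear \<open>N\<close>, then \<open>[N, T]\<close> does not contribute to the trace.\<close>

lemma nuclear_D_trace:
  assumes R: "nuclear (\<lambda>x. S ((B ^^ n) x) - L x)"
    and L: "nuclear_with (\<lambda>x. L (T x) - T (L x)) k d"
  shows "\<exists>k. nuclear_with (D (Suc n)) k d"
proof -
  define N where "N x = S ((B ^^ n) x) - L x" for x
  obtain k0 s where "nuclear_with N k0 s" using R by (auto simp: nuclear_def N_def[abs_def])
  from nuclear_with_commutator[OF this T] obtain k' where k': "nuclear_with (\<lambda>x. N (T x) - T (N x)) k' 0" by blast
  have "D (Suc n) x = (L (T x) - T (L x)) + (N (T x) - T (N x))" for x
  proof -
    have "(A ^^ Suc n) x = S ((B ^^ n) (T x))"
      using A_funpow_S[of n "T x"] by (simp only: funpow_Suc_right comp_def) (simp add: A_def)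
    moreover have "(B ^^ Suc n) x = T (S ((B ^^ n) x))" by (simp add: B_def)
    ultimately show ?thesis
      by (simp add: D_def N_def adjoint_pair_clinear(4)[OF T])
  qed
  then have "D (Suc n) = (\<lambda>x. (L (T x) - T (L x)) + (N (T x) - T (N x)))" by blast
  with nuclear_with_add[OF L k'] show ?thesis by auto
qed

end

section \<open>The trigonometric basis\<close>

lemma circle_measure_density: "circle_measure = density lborel (\<lambda>t. ennreal (indicator {0..<2*pi} t / (2 * pi)))"
  unfolding circle_measure_def uniform_measure_def
proof (intro arg_cong[where f = "density lborel"] ext)
  fix t :: real
  have "(1::ennreal) / ennreal (2 * pi) = ennreal (1 / (2 * pi))"
    using divide_ennreal[of 1 "2 * pi"] pi_gt_zero by simp
  then show "indicator {0..<2*pi} t / emeasure lborel {0..<2*pi} = ennreal (indicator {0..<2*pi} t / (2 * pi))"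
    by (cases "t \<in> {0..<2*pi}") auto
qed

lemma AE_circle_measure: "(AE t in circle_measure. P t) \<longleftrightarrow> (AE t in lborel. t \<in> {0..<2*pi} \<longrightarrow> P t)"
  unfolding circle_measure_def by (rule AE_uniform_measure) auto

lemma integrable_circle_measure:
  fixes g :: "real \<Rightarrow> 'b::{banach, second_countable_topology}"
  assumes [measurable]: "g \<in> borel_measurable borel"
  shows "integrable circle_measure g \<longleftrightarrow> set_integrable lborel {0..<2*pi} g"
proof -
  let ?g = "\<lambda>t. indicator {0..<2*pi} t *\<^sub>R g t"
  have "integrable circle_measure g \<longleftrightarrow> integrable lborel (\<lambda>t. (indicator {0..<2*pi} t / (2 * pi)) *\<^sub>R g t)"
    unfolding circle_measure_density by (subst integrable_density) auto
  also have "(\<lambda>t. (indicator {0..<2*pi} t / (2 * pi)) *\<^sub>R g t) = (\<lambda>t. (1 / (2 * pi)) *\<^sub>R ?g t)" by auto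
  also have "integrable lborel (\<lambda>t. (1 / (2 * pi)) *\<^sub>R ?g t) \<longleftrightarrow> integrable lborel ?g"
  proof
    assume "integrable lborel (\<lambda>t. (1 / (2 * pi)) *\<^sub>R ?g t)"
    from integrable_scaleR_right[OF this, of "2 * pi"] show "integrable lborel ?g" by simp
  qed (rule integrable_scaleR_right)
  finally show ?thesis by (simp only: set_integrable_def)
qed

lemma integral_circle_measure:
  fixes g :: "real \<Rightarrow> 'b::{banach, second_countable_topology}"
  assumes [measurable]: "g \<in> borel_measurable borel"
  shows "(\<integral>t. g t \<partial>circle_measure) = (1 / (2 * pi)) *\<^sub>R (LINT t:{0..<2*pi}|lborel. g t)"
proof -
  have "(\<integral>t. g t \<partial>circle_measure) = (\<integral>t. (indicator {0..<2*pi} t / (2 * pi)) *\<^sub>R g t \<partial>lborel)"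
    unfolding circle_measure_density by (subst integral_density) auto
  also have "\<dots> = (\<integral>t. (1 / (2 * pi)) *\<^sub>R (indicator {0..<2*pi} t *\<^sub>R g t) \<partial>lborel)"
    by (rule arg_cong[where f = "integral\<^sup>L lborel"]) auto
  finally show ?thesis by (simp only: set_lebesgue_integral_def integral_scaleR_right)
qed

lemma continuous_fourier_mode: "continuous_on A (fourier_mode n)"
  unfolding fourier_mode_def by (intro continuous_intros)

lemma fourier_mode_measurable [measurable]: "fourier_mode n \<in> borel_measurable borel"
  by (rule borel_measurable_continuous_onI[OF continuous_fourier_mode])

lemma norm_fourier_mode [simp]: "norm (fourier_mode n t) = 1"
  by (simp add: fourier_mode_def)

lemma fourier_mode_mult: "fourier_mode m t * fourier_mode n t = fourier_mode (m + n) t"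
  by (simp add: fourier_mode_def exp_add[symmetric] algebra_simps)

lemma cnj_fourier_mode: "cnj (fourier_mode n t) = fourier_mode (- n) t"
  by (simp add: fourier_mode_def exp_cnj)

lemma set_integral_Ico_Icc:
  fixes g :: "real \<Rightarrow> 'b::{banach, second_countable_topology}"
  assumes [measurable]: "g \<in> borel_measurable borel"
  shows "(LINT t:{a..<b}|lborel. g t) = (LINT t:{a..b}|lborel. g t)"
    "set_integrable lborel {a..<b} g \<longleftrightarrow> set_integrable lborel {a..b} g"
proof -
  have *: "AE t in lborel. indicator {a..<b} t *\<^sub>R g t = indicator {a..b} t *\<^sub>R g t"
    using AE_lborel_singleton[of b] by eventually_elim (auto simp: indicator_def)
  show "(LINT t:{a..<b}|lborel. g t) = (LINT t:{a..b}|lborel. g t)"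
    unfolding set_lebesgue_integral_def by (rule integral_cong_AE) (use * in auto)
  show "set_integrable lborel {a..<b} g \<longleftrightarrow> set_integrable lborel {a..b} g"
    unfolding set_integrable_def by (rule integrable_cong_AE) (use * in auto)
qed

lemma integral_fourier_mode: "(\<integral>t. fourier_mode n t \<partial>circle_measure) = (if n = 0 then 1 else 0)"
proof (cases "n = 0")
  case True
  then have "fourier_mode n = (\<lambda>t. 1)" by (auto simp: fourier_mode_def)
  then show ?thesis using True emeasure_circle_measure_UNIV by (simp add: measure_def)
next
  case False
  let ?F = "\<lambda>t. exp (\<i> * of_int n * complex_of_real t) / (\<i> * of_int n)"
  have "((\<lambda>t. fourier_mode n t) has_integral (?F (2 * pi) - ?F 0)) {0..2 * pi}"
  proof (rule fundamental_theorem_of_calculus)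
    fix t assume "t \<in> {0..2 * pi}"
    show "(?F has_vector_derivative fourier_mode n t) (at t within {0..2 * pi})"
      unfolding fourier_mode_def
      by (rule has_vector_derivative_real_field[where f = "\<lambda>z. exp (\<i> * of_int n * z) / (\<i> * of_int n)"])
        (use False in \<open>auto intro!: derivative_eq_intros\<close>)
  qed simp
  moreover have "exp (\<i> * of_int n * complex_of_real (2 * pi)) = 1"
    using exp_integer_2pi[of "of_int n"] by (simp add: mult_ac)
  ultimately have "integral {0..2 * pi} (fourier_mode n) = 0"
    by (auto dest!: integral_unique)
  moreover have "set_integrable lborel {0..2*pi} (fourier_mode n)"
    by (rule borel_integrable_atLeastAtMost'[OF continuous_fourier_mode])
  ultimately show ?thesis
    using False set_borel_integral_eq_integral(2)[of "{0..2*pi}" "fourier_mode n"]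
    by (simp add: integral_circle_measure set_integral_Ico_Icc)
qed

definition fourier_basis :: "int \<Rightarrow> circle_L2" where
  "fourier_basis n = abs_circle_L2 (fourier_mode n)"

lemma cinner_abs_circle_L2:
  assumes "sq_integrable f" "sq_integrable g"
  shows "cinner (abs_circle_L2 f) (abs_circle_L2 g) = (\<integral>t. cnj (f t) * g t \<partial>circle_measure)"
  unfolding cinner_circle_L2_def using assms by (subst cinner_L2.abs_eq) (auto simp: eq_onp_def)

lemma cinner_fourier_basis: "cinner (fourier_basis j) (fourier_basis k) = (if j = k then 1 else 0)"
  unfolding fourier_basis_def
  using integral_fourier_mode[of "k - j"]
  by (simp add: cinner_abs_circle_L2 sq_integrable_fourier_mode cnj_fourier_mode fourier_mode_mult)

lemma fourier_basis_inj: "fourier_basis j = fourier_basis k \<longleftrightarrow> j = k"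
  using cinner_fourier_basis[of j k] cinner_fourier_basis[of j j] by (metis zero_neq_one)

lemma fourier_coeff_L2_basis: "fourier_coeff_L2 x n = cinner (fourier_basis n) x"
  by (simp add: fourier_coeff_L2_cinner fourier_basis_def)

lemma sq_integrable_imp_integrable:
  assumes "sq_integrable f"
  shows "integrable circle_measure f"
  using sq_integrable_mult[OF sq_integrable_fourier_mode[of 0] assms] by (simp add: fourier_mode_def)

text \<open>The functions orthogonal to all trigonometric monomials are closed under multiplication by
  \<open>cos\<close> and \<open>sin\<close>, which are combinations of the monomials of degree \<open>1\<close> and \<open>-1\<close>. Hence
  they are closed under multiplication by every real polynomial in the coordinates.\<close>

lemma trig_annihilator_real_polynomial:
  assumes g: "real_polynomial_function (g :: complex \<Rightarrow> real)"
    and h: "integrable circle_measure h" "\<And>n. (\<integral>t. fourier_mode n t * h t \<partial>circle_measure) = 0"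
  shows "integrable circle_measure (\<lambda>t. complex_of_real (g (cis t)) * h t) \<and>
    (\<forall>n. (\<integral>t. fourier_mode n t * (complex_of_real (g (cis t)) * h t) \<partial>circle_measure) = 0)"
proof -
  define V where "V h \<longleftrightarrow> integrable circle_measure h \<and> (\<forall>n. (\<integral>t. fourier_mode n t * h t \<partial>circle_measure) = 0)" for h
  have int_mode: "integrable circle_measure (\<lambda>t. fourier_mode n t * h t)" if "integrable circle_measure h" for h n
  proof (rule Bochner_Integration.integrable_bound[OF that])
    have [measurable]: "h \<in> borel_measurable borel" using that by (auto dest: borel_measurable_integrable)
    show "(\<lambda>t. fourier_mode n t * h t) \<in> borel_measurable circle_measure" by measurable
  qed (simp add: norm_mult)
  have mode: "V (\<lambda>t. fourier_mode m t * h t)" if "V h" for m h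
    using that int_mode unfolding V_def by (auto simp: mult.assoc[symmetric] fourier_mode_mult)
  have scale: "V (\<lambda>t. c * h t)" if "V h" for c h
    using that unfolding V_def by (auto simp: mult.left_commute[of _ c])
  have add: "V (\<lambda>t. h1 t + h2 t)" if "V h1" "V h2" for h1 h2
    using that int_mode unfolding V_def by (auto simp: distrib_left)
  have "V h \<Longrightarrow> V (\<lambda>t. complex_of_real (g (cis t)) * h t)" for h
    using g
  proof (induction g arbitrary: h rule: real_polynomial_function.induct)
    case (linear l)
    have c1: "fourier_mode 1 t = cis t" "fourier_mode (- 1) t = cnj (cis t)" for t
      by (simp_all add: fourier_mode_def cis_conv_exp exp_cnj)
    have "complex_of_real (l (cis t)) * h t =
        complex_of_real (l 1) / 2 * (fourier_mode 1 t * h t) + complex_of_real (l 1) / 2 * (fourier_mode (- 1) t * h t)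
       + (complex_of_real (l \<i>) / (2 * \<i>) * (fourier_mode 1 t * h t) + (- complex_of_real (l \<i>) / (2 * \<i>)) * (fourier_mode (- 1) t * h t))" for t
    proof -
      have "cis t = cos t *\<^sub>R 1 + sin t *\<^sub>R \<i>" by (simp add: complex_eq_iff)
      then have "l (cis t) = cos t * l 1 + sin t * l \<i>"
        using linear by (simp only: linear_add[OF bounded_linear.linear] linear_scale[OF bounded_linear.linear]) simp
      moreover have "complex_of_real (cos t) = (cis t + cnj (cis t)) / 2" "complex_of_real (sin t) = (cis t - cnj (cis t)) / (2 * \<i>)"
        by (simp_all add: complex_eq_iff)
      ultimately show ?thesis unfolding c1 by (simp only: of_real_add of_real_mult) (simp add: field_simps)
    qed
    then have "(\<lambda>t. complex_of_real (l (cis t)) * h t) = (\<lambda>t.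
        complex_of_real (l 1) / 2 * (fourier_mode 1 t * h t) + complex_of_real (l 1) / 2 * (fourier_mode (- 1) t * h t)
       + (complex_of_real (l \<i>) / (2 * \<i>) * (fourier_mode 1 t * h t) + (- complex_of_real (l \<i>) / (2 * \<i>)) * (fourier_mode (- 1) t * h t)))"
      by (rule ext)
    then show ?case using linear.prems by (simp only:) (intro add scale mode)
  next
    case (const c)
    then show ?case by (rule scale)
  next
    case (add p q)
    then show ?case using \<open>\<And>h1 h2. V h1 \<Longrightarrow> V h2 \<Longrightarrow> V (\<lambda>t. h1 t + h2 t)\<close>
      by (simp add: distrib_right)
  next
    case (mult p q)
    then have "V (\<lambda>t. complex_of_real (p (cis t)) * (complex_of_real (q (cis t)) * h t))" by blast
    then show ?case by (simp add: mult.assoc)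
  qed
  with h show ?thesis unfolding V_def by blast
qed

text \<open>Polynomials in the coordinates are uniformly dense, by Stone and Weierstrass.\<close>

lemma trig_annihilator_continuous:
  fixes \<phi> :: "complex \<Rightarrow> real"
  assumes \<phi>: "continuous_on (sphere 0 1) \<phi>" and [measurable]: "(\<lambda>t. \<phi> (cis t)) \<in> borel_measurable borel"
    and h: "integrable circle_measure h" "\<And>n. (\<integral>t. fourier_mode n t * h t \<partial>circle_measure) = 0"
  shows "(\<integral>t. complex_of_real (\<phi> (cis t)) * h t \<partial>circle_measure) = 0"
proof -
  have [measurable]: "h \<in> borel_measurable borel" using h(1) by (auto dest: borel_measurable_integrable)
  define I where "I = (\<integral>t. norm (h t) \<partial>circle_measure)"
  have I0: "I \<ge> 0" unfolding I_def by (rule integral_nonneg_AE) auto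
  have "norm (\<integral>t. complex_of_real (\<phi> (cis t)) * h t \<partial>circle_measure) \<le> e * I" if e: "e > 0" for e
  proof -
    obtain g where g: "real_polynomial_function g" "\<And>x. x \<in> sphere 0 1 \<Longrightarrow> \<bar>\<phi> x - g x\<bar> < e"
      using Stone_Weierstrass_real_polynomial_function[OF compact_sphere \<phi> e] by blast
    have gi: "integrable circle_measure (\<lambda>t. complex_of_real (g (cis t)) * h t)"
      and g0: "(\<integral>t. complex_of_real (g (cis t)) * h t \<partial>circle_measure) = 0"
      using trig_annihilator_real_polynomial[OF g(1) h] by (auto dest: spec[of _ 0] simp: fourier_mode_def)
    have bound: "norm (complex_of_real (\<phi> (cis t)) * h t - complex_of_real (g (cis t)) * h t) \<le> e * norm (h t)" for t
    proof -
      have "complex_of_real (\<phi> (cis t)) * h t - complex_of_real (g (cis t)) * h t = complex_of_real (\<phi> (cis t) - g (cis t)) * h t"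
        by (simp add: algebra_simps)
      then show ?thesis using g(2)[of "cis t"] by (simp add: norm_mult mult_right_mono del: of_real_diff)
    qed
    have di: "integrable circle_measure (\<lambda>t. complex_of_real (\<phi> (cis t)) * h t - complex_of_real (g (cis t)) * h t)"
    proof (rule Bochner_Integration.integrable_bound)
      show "integrable circle_measure (\<lambda>t. e * norm (h t))" using h(1) by auto
      show "(\<lambda>t. complex_of_real (\<phi> (cis t)) * h t - complex_of_real (g (cis t)) * h t) \<in> borel_measurable circle_measure"
        using gi by (intro borel_measurable_diff) (auto dest: borel_measurable_integrable)
      show "AE t in circle_measure. norm (complex_of_real (\<phi> (cis t)) * h t - complex_of_real (g (cis t)) * h t) \<le> norm (e * norm (h t))"
        using bound e by (simp add: abs_of_nonneg)
    qed
    have "(\<integral>t. complex_of_real (\<phi> (cis t)) * h t \<partial>circle_measure)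
        = (\<integral>t. (complex_of_real (\<phi> (cis t)) * h t - complex_of_real (g (cis t)) * h t) + complex_of_real (g (cis t)) * h t \<partial>circle_measure)"
      by simp
    also have "\<dots> = (\<integral>t. complex_of_real (\<phi> (cis t)) * h t - complex_of_real (g (cis t)) * h t \<partial>circle_measure)"
      by (subst Bochner_Integration.integral_add[OF di gi]) (simp add: g0)
    also have "norm \<dots> \<le> (\<integral>t. e * norm (h t) \<partial>circle_measure)"
      by (rule Bochner_Integration.integral_norm_bound_integral[OF di]) (use h(1) bound in auto)
    also have "\<dots> = e * I" by (simp add: I_def)
    finally show ?thesis .
  qed
  note small = this
  have "norm (\<integral>t. complex_of_real (\<phi> (cis t)) * h t \<partial>circle_measure) \<le> e" if "e > 0" for e
  proof -
    have "norm (\<integral>t. complex_of_real (\<phi> (cis t)) * h t \<partial>circle_measure) \<le> e / (I + 1) * I"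
      using small[of "e / (I + 1)"] that I0 by simp
    also have "\<dots> \<le> e" using that I0 by (simp add: divide_simps)
    finally show ?thesis .
  qed
  then have small': "\<And>e. e > 0 \<Longrightarrow> norm (\<integral>t. complex_of_real (\<phi> (cis t)) * h t \<partial>circle_measure) \<le> 0 + e"
    by simp
  have "norm (\<integral>t. complex_of_real (\<phi> (cis t)) * h t \<partial>circle_measure) \<le> 0"
    by (rule field_le_epsilon[OF small'])
  then show ?thesis by simp
qed

text \<open>The indicator function of an arc is the limit of the continuous functions
  \<open>min 1 (j * infdist z C)\<close>, with \<open>C\<close> the complementary arc.\<close>

lemma trig_annihilator_interval:
  assumes h: "integrable circle_measure h" "\<And>n. (\<integral>t. fourier_mode n t * h t \<partial>circle_measure) = 0"
    and b: "0 \<le> b" "b \<le> 2 * pi"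
  shows "(LINT t:{0..b}|lborel. h t) = 0"
proof -
  have [measurable]: "h \<in> borel_measurable borel" using h(1) by (auto dest: borel_measurable_integrable)
  define C where "C = cis ` ({0} \<union> {b..2*pi})"
  have contcis: "continuous_on A cis" for A by (intro continuous_intros)
  have C: "closed C" "C \<noteq> {}"
    unfolding C_def by (intro compact_imp_closed compact_continuous_image contcis compact_Un compact_Icc compact_sing) simp
  have inC: "cis t \<in> C \<longleftrightarrow> t \<notin> {0<..<b}" if "t \<in> {0..<2*pi}" for t
  proof
    assume "cis t \<in> C"
    then obtain s where s: "s \<in> {0} \<union> {b..2*pi}" "cis t = cis s" unfolding C_def by blast
    then have "sin t = sin s \<and> cos t = cos s" by (simp add: complex_eq_iff)
    then obtain n :: int where n: "t = s + 2 * pi * n" using sin_cos_eq_iff by blast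
    show "t \<notin> {0<..<b}"
    proof
      assume t: "t \<in> {0<..<b}"
      consider "n = 0" | "n \<ge> 1" | "n \<le> - 1" by linarith
      then show False
      proof cases
        case 2
        then have "2 * pi * 1 \<le> 2 * pi * of_int n" by (intro mult_left_mono) auto
        moreover have "0 \<le> s" "t < b" using s b t by auto
        ultimately show ?thesis using n b by linarith
      next
        case 3
        then have "2 * pi * of_int n \<le> 2 * pi * of_int (- 1)"
          by (intro mult_left_mono) (simp_all only: of_int_le_iff, simp)
        then show ?thesis using t s n b by auto
      qed (use t s n in auto)
    qed
  qed (use that b in \<open>auto simp: C_def\<close>)
  define \<phi> where "\<phi> j z = min 1 (real j * infdist z C)" for j z
  have \<phi>cont: "continuous_on A (\<phi> j)" for A j
    unfolding \<phi>_def by (intro continuous_intros)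
  have \<phi>m [measurable]: "(\<lambda>t. \<phi> j (cis t)) \<in> borel_measurable borel" for j
    by (rule borel_measurable_continuous_onI, rule continuous_on_compose2[OF \<phi>cont contcis]) auto
  have \<phi>lim: "(\<lambda>j. \<phi> j (cis t)) \<longlonglongrightarrow> indicator {0<..<b} t" if t: "t \<in> {0..<2*pi}" for t
  proof (cases "t \<in> {0<..<b}")
    case True
    then have pos: "infdist (cis t) C > 0" using inC[OF t] C by (simp add: infdist_pos_not_in_closed)
    obtain N :: nat where N: "1 / infdist (cis t) C < N" using reals_Archimedean2 by blast
    have "\<phi> j (cis t) = 1" if "j \<ge> N" for j
    proof -
      have "1 / infdist (cis t) C \<le> real j" using N that by linarith
      then show ?thesis using pos by (simp add: \<phi>_def divide_simps split: if_splits)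
    qed
    then show ?thesis using True by (intro tendsto_eventually) (auto simp: eventually_sequentially)
  next
    case False
    then have "infdist (cis t) C = 0" using inC[OF t] C in_closed_iff_infdist_zero by blast
    then show ?thesis using False by (simp add: \<phi>_def)
  qed
  have \<phi>1: "norm (\<phi> j z) \<le> 1" for j z using infdist_nonneg[of z C] by (auto simp: \<phi>_def min_def)
  have "(\<lambda>j. \<integral>t. complex_of_real (\<phi> j (cis t)) * h t \<partial>circle_measure) \<longlonglongrightarrow> (\<integral>t. complex_of_real (indicator {0<..<b} t) * h t \<partial>circle_measure)"
  proof (rule integral_dominated_convergence[where w = "\<lambda>t. norm (h t)"])
    have "AE t in circle_measure. t \<in> {0..<2*pi}" by (simp add: AE_circle_measure)
    then show "AE t in circle_measure. (\<lambda>j. complex_of_real (\<phi> j (cis t)) * h t) \<longlonglongrightarrow> complex_of_real (indicator {0<..<b} t) * h t"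
      by eventually_elim (intro tendsto_intros \<phi>lim)
    show "AE t in circle_measure. norm (complex_of_real (\<phi> j (cis t)) * h t) \<le> norm (h t)" for j
      using \<phi>1 by (auto simp: norm_mult intro!: mult_left_le_one_le)
  qed (use h(1) in auto)
  moreover have "(\<integral>t. complex_of_real (\<phi> j (cis t)) * h t \<partial>circle_measure) = 0" for j
    by (rule trig_annihilator_continuous[OF \<phi>cont \<phi>m h])
  ultimately have "(\<integral>t. complex_of_real (indicator {0<..<b} t) * h t \<partial>circle_measure) = 0"
    by (simp add: LIMSEQ_const_iff)
  then have "(LINT t:{0..<2*pi}|lborel. complex_of_real (indicator {0<..<b} t) * h t) = 0"
    by (subst (asm) integral_circle_measure) auto
  also have "(LINT t:{0..<2*pi}|lborel. complex_of_real (indicator {0<..<b} t) * h t) = (LINT t:{0..b}|lborel. h t)"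
    unfolding set_lebesgue_integral_def
  proof (rule integral_cong_AE)
    show "AE t in lborel. indicat_real {0..<2 * pi} t *\<^sub>R (complex_of_real (indicat_real {0<..<b} t) * h t) = indicat_real {0..b} t *\<^sub>R h t"
      using AE_lborel_singleton[of b] AE_lborel_singleton[of 0]
      by eventually_elim (use b in \<open>auto simp: indicator_def\<close>)
  qed auto
  finally show ?thesis .
qed

text \<open>If \<open>h\<close> is orthogonal to all monomials, its integral over \<open>[0, b]\<close> vanishes for every \<open>b\<close>, and
  differentiating with respect to \<open>b\<close> shows that \<open>h\<close> vanishes almost everywhere.\<close>

theorem is_onb_fourier_basis: "is_onb (range fourier_basis)"
  unfolding is_onb_def
proof (intro conjI allI impI)
  show "\<forall>e\<in>range fourier_basis. \<forall>e'\<in>range fourier_basis. cinner e e' = (if e = e' then 1 else 0)"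
    by (auto simp: cinner_fourier_basis fourier_basis_inj)
  fix x assume x: "\<forall>e\<in>range fourier_basis. cinner e x = 0"
  obtain h where h: "sq_integrable h" "x = abs_circle_L2 h" using circle_L2_rep by blast
  have hi: "integrable circle_measure h" by (rule sq_integrable_imp_integrable[OF h(1)])
  have [measurable]: "h \<in> borel_measurable borel" by (rule sq_integrable_measurable[OF h(1)])
  have "(\<integral>t. fourier_mode n t * h t \<partial>circle_measure) = 0" for n
  proof -
    have "cinner (fourier_basis (- n)) x = 0" using x by blast
    then show ?thesis
      by (simp add: h(2) fourier_basis_def cinner_abs_circle_L2 sq_integrable_fourier_mode h(1) cnj_fourier_mode)
  qed
  from trig_annihilator_interval[OF hi this]
  have z: "(LINT t:{0..b}|lborel. h t) = 0" if "0 \<le> b" "b \<le> 2 * pi" for b using that by blast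
  have si: "set_integrable lborel {0..2*pi} h"
    using hi by (simp add: integrable_circle_measure set_integral_Ico_Icc)
  have z': "integral {0..b} h = 0" if "b \<in> {0..2*pi}" for b
  proof -
    have "set_integrable lborel {0..b} h" by (rule set_integrable_subset[OF si]) (use that in auto)
    then show ?thesis using set_borel_integral_eq_integral(2) z[of b] that by fastforce
  qed
  have n1: "negligible {t \<in> {0<..<2*pi}. \<not> ((\<lambda>y. integral {0..y} h) has_vector_derivative h t) (at t)}"
    by (rule indefinite_integral_differentiable_AE[OF set_borel_integral_eq_integral(1)[OF si]])
  have n2: "h t = 0" if t: "t \<in> {0<..<2*pi}" "((\<lambda>y. integral {0..y} h) has_vector_derivative h t) (at t)" for t
  proof -
    have "((\<lambda>y. 0) has_vector_derivative h t) (at t)"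
      by (rule has_vector_derivative_transform_within_open[OF t(2), of "{0<..<2*pi}"]) (use t z' in auto)
    then show ?thesis using vector_derivative_unique_at[OF _ has_vector_derivative_const] by blast
  qed
  have neg: "negligible {t \<in> {0<..<2*pi}. h t \<noteq> 0}"
    by (rule negligible_subset[OF n1]) (use n2 in blast)
  then have "{t \<in> {0<..<2*pi}. h t \<noteq> 0} \<in> null_sets lebesgue" by (simp add: negligible_iff_null_sets)
  then have "AE t in lebesgue. t \<notin> {t \<in> {0<..<2*pi}. h t \<noteq> 0}" by (rule AE_not_in)
  then have "AE t in lborel. t \<notin> {t \<in> {0<..<2*pi}. h t \<noteq> 0}" unfolding AE_completion_iff .
  with AE_lborel_singleton[of 0] have "AE t in lborel. t \<in> {0..<2*pi} \<longrightarrow> h t = 0"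
    by eventually_elim auto
  then have "AE t in circle_measure. h t = 0" by (simp add: AE_circle_measure)
  then have "AE t in circle_measure. (norm (h t))\<^sup>2 = 0" by eventually_elim simp
  then have "(norm x)\<^sup>2 = 0" unfolding h(2) norm_abs_circle_L2[OF h(1)] by (rule integral_eq_zero_AE)
  then show "x = 0" by simp
qed

section \<open>Multiplication operators and Toeplitz operators\<close>

definition bounded_symbol :: "(real \<Rightarrow> complex) \<Rightarrow> bool" where
  "bounded_symbol a \<longleftrightarrow> a \<in> borel_measurable borel \<and> (\<exists>C. \<forall>t. norm (a t) \<le> C)"

definition symbol_bound :: "(real \<Rightarrow> complex) \<Rightarrow> real" where
  "symbol_bound a = (SUP t. norm (a t))"

lemma bounded_symbol_measurable: "bounded_symbol a \<Longrightarrow> a \<in> borel_measurable borel"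
  by (simp add: bounded_symbol_def)

lemma norm_le_symbol_bound: "bounded_symbol a \<Longrightarrow> norm (a t) \<le> symbol_bound a"
  unfolding symbol_bound_def bounded_symbol_def
  by (intro cSUP_upper) (auto intro: bdd_aboveI2)

lemma symbol_bound_nonneg: "bounded_symbol a \<Longrightarrow> 0 \<le> symbol_bound a"
  using norm_le_symbol_bound[of a 0] norm_ge_zero[of "a 0"] by linarith

lemma measurable_cnj [measurable (raw)]: "a \<in> borel_measurable M \<Longrightarrow> (\<lambda>t. cnj (a t)) \<in> borel_measurable M"
  by (rule measurable_compose[of a M borel cnj borel])
    (auto intro!: borel_measurable_continuous_onI continuous_intros)

lemma bounded_symbol_mult:
  assumes a: "bounded_symbol a" and b: "bounded_symbol b"
  shows "bounded_symbol (\<lambda>t. a t * b t)"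
  unfolding bounded_symbol_def
proof (intro conjI exI allI)
  note [measurable] = bounded_symbol_measurable[OF a] bounded_symbol_measurable[OF b]
  show "(\<lambda>t. a t * b t) \<in> borel_measurable borel" by measurable
  show "norm (a t * b t) \<le> symbol_bound a * symbol_bound b" for t
    unfolding norm_mult by (intro mult_mono norm_le_symbol_bound symbol_bound_nonneg a b) auto
qed

lemma bounded_symbol_cnj: "bounded_symbol a \<Longrightarrow> bounded_symbol (\<lambda>t. cnj (a t))"
  unfolding bounded_symbol_def by (auto intro: measurable_cnj)

lemma sq_integrable_symbol_mult:
  assumes a: "bounded_symbol a" and f: "sq_integrable f"
  shows "sq_integrable (\<lambda>t. a t * f t)"
    "norm (abs_circle_L2 (\<lambda>t. a t * f t)) \<le> symbol_bound a * norm (abs_circle_L2 f)"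
proof -
  note [measurable] = bounded_symbol_measurable[OF a] sq_integrable_measurable[OF f]
  have le: "(norm (a t * f t))\<^sup>2 \<le> (symbol_bound a)\<^sup>2 * (norm (f t))\<^sup>2" for t
    unfolding norm_mult power_mult_distrib
    by (intro mult_right_mono power_mono norm_le_symbol_bound a) auto
  have i: "integrable circle_measure (\<lambda>t. (symbol_bound a)\<^sup>2 * (norm (f t))\<^sup>2)"
    using f by (auto simp: sq_integrable_def)
  show si: "sq_integrable (\<lambda>t. a t * f t)"
    unfolding sq_integrable_def
  proof
    show "integrable circle_measure (\<lambda>t. (norm (a t * f t))\<^sup>2)"
      by (rule Bochner_Integration.integrable_bound[OF i]) (use le in auto)
  qed measurable
  have "(norm (abs_circle_L2 (\<lambda>t. a t * f t)))\<^sup>2 \<le> (symbol_bound a * norm (abs_circle_L2 f))\<^sup>2"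
    unfolding power_mult_distrib norm_abs_circle_L2[OF si] norm_abs_circle_L2[OF f]
    using integral_mono[OF _ i le] si by (simp add: sq_integrable_def)
  then show "norm (abs_circle_L2 (\<lambda>t. a t * f t)) \<le> symbol_bound a * norm (abs_circle_L2 f)"
    by (rule power2_le_imp_le) (intro mult_nonneg_nonneg symbol_bound_nonneg a norm_ge_zero)
qed

lemma abs_circle_L2_eqI:
  assumes "sq_integrable f" "sq_integrable g" "AE t in circle_measure. f t = g t"
  shows "abs_circle_L2 f = abs_circle_L2 g"
proof -
  have "norm (abs_circle_L2 (\<lambda>t. f t - g t)) = 0"
  proof -
    have "AE t in circle_measure. (norm (f t - g t))\<^sup>2 = 0" using assms(3) by eventually_elim simp
    then have "(norm (abs_circle_L2 (\<lambda>t. f t - g t)))\<^sup>2 = 0"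
      unfolding norm_abs_circle_L2[OF sq_integrable_diff[OF assms(1,2)]] by (rule integral_eq_zero_AE)
    then show ?thesis by simp
  qed
  then show ?thesis using abs_circle_L2_diff[OF assms(1,2)] by simp
qed

lemma rep_circle_L2: "sq_integrable (rep_circle_L2 x)" "abs_circle_L2 (rep_circle_L2 x) = x"
  using Quotient3_rep_reflp[OF Quotient3_circle_L2, of x] Quotient3_abs_rep[OF Quotient3_circle_L2, of x]
  by auto

lemma rep_abs_circle_L2:
  assumes "sq_integrable f"
  shows "AE t in circle_measure. rep_circle_L2 (abs_circle_L2 f) t = f t"
  using rep_abs_rsp_left[OF Quotient3_circle_L2, of f f] assms by auto

lemma mult_L2_abs:
  assumes a: "bounded_symbol a" and f: "sq_integrable f"
  shows "mult_L2 a (abs_circle_L2 f) = abs_circle_L2 (\<lambda>t. a t * f t)"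
  unfolding mult_L2_def
proof (rule abs_circle_L2_eqI)
  show "AE t in circle_measure. a t * rep_circle_L2 (abs_circle_L2 f) t = a t * f t"
    using rep_abs_circle_L2[OF f] by eventually_elim simp
qed (intro sq_integrable_symbol_mult a f rep_circle_L2)+

lemma mult_L2_mult:
  assumes "bounded_symbol a" "bounded_symbol b"
  shows "mult_L2 a (mult_L2 b x) = mult_L2 (\<lambda>t. a t * b t) x"
proof -
  obtain f where f: "sq_integrable f" "x = abs_circle_L2 f" using circle_L2_rep by blast
  then show ?thesis
    by (simp add: mult_L2_abs assms bounded_symbol_mult sq_integrable_symbol_mult(1) mult.assoc)
qed

lemma adjoint_pair_mult_L2:
  assumes a: "bounded_symbol a"
  shows "adjoint_pair (mult_L2 a) (mult_L2 (\<lambda>t. cnj (a t))) (symbol_bound a)"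
proof -
  have c: "bounded_symbol (\<lambda>t. cnj (a t))" by (rule bounded_symbol_cnj[OF a])
  have sb: "symbol_bound (\<lambda>t. cnj (a t)) = symbol_bound a" by (simp add: symbol_bound_def)
  have bd: "norm (mult_L2 b x) \<le> symbol_bound b * norm x" if "bounded_symbol b" for b x
  proof -
    obtain f where f: "sq_integrable f" "x = abs_circle_L2 f" using circle_L2_rep by blast
    then show ?thesis using sq_integrable_symbol_mult(2)[OF that f(1)] by (simp add: mult_L2_abs that)
  qed
  show ?thesis
    unfolding adjoint_pair_def
  proof (intro conjI allI)
    fix x y
    obtain f g where f: "sq_integrable f" "x = abs_circle_L2 f" "sq_integrable g" "y = abs_circle_L2 g"
      using circle_L2_rep by metis
    show "cinner (mult_L2 (\<lambda>t. cnj (a t)) x) y = cinner x (mult_L2 a y)"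
      unfolding f mult_L2_abs[OF a f(3)] mult_L2_abs[OF c f(1)]
        cinner_abs_circle_L2[OF sq_integrable_symbol_mult(1)[OF c f(1)] f(3)]
        cinner_abs_circle_L2[OF f(1) sq_integrable_symbol_mult(1)[OF a f(3)]]
      by (simp add: mult_ac)
  qed (use bd[OF a] bd[OF c] symbol_bound_nonneg[OF a] sb in auto)
qed

lemma fourier_coeff_mult_L2:
  assumes a: "bounded_symbol a"
  shows "cinner (fourier_basis j) (mult_L2 a (fourier_basis k)) = fourier_coeff a (j - k)"
proof -
  have "cnj (fourier_mode j t) * (a t * fourier_mode k t) = cnj (fourier_mode (j - k) t) * a t" for t
  proof -
    have "cnj (fourier_mode j t) * (a t * fourier_mode k t) = (fourier_mode (- j) t * fourier_mode k t) * a t"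
      by (simp add: cnj_fourier_mode mult_ac)
    then show ?thesis by (simp add: fourier_mode_mult cnj_fourier_mode)
  qed
  note eq = this
  show ?thesis
    unfolding fourier_basis_def mult_L2_abs[OF a sq_integrable_fourier_mode]
      cinner_abs_circle_L2[OF sq_integrable_fourier_mode sq_integrable_symbol_mult(1)[OF a sq_integrable_fourier_mode]]
      fourier_coeff_eq_integral eq ..
qed

lemma fourier_coeff_cnj: "fourier_coeff (\<lambda>t. cnj (a t)) n = cnj (fourier_coeff a (- n))"
proof -
  have "cnj (fourier_coeff a (- n)) = (\<integral>t. cnj (a t * exp (- (\<i> * of_int (- n) * of_real t))) \<partial>circle_measure)"
    unfolding fourier_coeff_def by (rule Bochner_Integration.integral_cnj[symmetric])
  then show ?thesis by (simp add: fourier_coeff_def exp_cnj)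
qed

lemma hardy_space_iff: "x \<in> hardy_space \<longleftrightarrow> (\<forall>n<0. cinner (fourier_basis n) x = 0)"
  by (simp add: hardy_space_def fourier_coeff_L2_basis)

lemma orth_proj_hardy_unique:
  assumes "p \<in> hardy_space" "\<forall>y\<in>hardy_space. cinner y (x - p) = 0"
  shows "orth_proj hardy_space x = p"
  unfolding orth_proj_def
proof (rule the_equality)
  fix q assume q: "q \<in> hardy_space \<and> (\<forall>y\<in>hardy_space. cinner y (x - q) = 0)"
  have "p - q \<in> hardy_space" using assms q by (simp add: hardy_space_iff cinner_diff_right)
  then have "cinner (p - q) (x - p) = 0" "cinner (p - q) (x - q) = 0" using assms q by auto
  then have "cinner (p - q) ((x - q) - (x - p)) = 0"
    using cinner_diff_right[of "p - q" "x - q" "x - p"] by (simp only: diff_self)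
  then have "cinner (p - q) (p - q) = 0" by simp
  then show "q = p" by (simp add: cinner_self)
qed (use assms in blast)

text \<open>The projection is the sum of the terms of the Fourier expansion with non-negative index.\<close>

lemma orth_proj_hardy:
  "orth_proj hardy_space x \<in> hardy_space" "\<And>y. y \<in> hardy_space \<Longrightarrow> cinner y (x - orth_proj hardy_space x) = 0"
proof -
  define E where "E = fourier_basis ` {0..}"
  have onb: "orthonormal_set (range fourier_basis)" using is_onb_fourier_basis by (simp add: is_onb_iff)
  have E: "orthonormal_set E" by (rule orthonormal_set_subset[OF onb]) (auto simp: E_def)
  define p where "p = (\<Sum>\<^sub>\<infinity>e\<in>E. cinner e x *\<^sub>C e)"
  have coeff: "cinner (fourier_basis n) (x - p) = 0" if "n \<ge> 0" for n
    unfolding p_def by (rule orthonormal_expansion_orthogonal[OF E]) (use that in \<open>auto simp: E_def\<close>)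
  have ph: "p \<in> hardy_space"
    unfolding hardy_space_iff
  proof (intro allI impI)
    fix n :: int assume "n < 0"
    note has_sum_cinner_right[OF has_sum_infsum[OF orthonormal_summable[OF E Bessel(1)[OF E, of x]]],
        of "fourier_basis n", folded p_def]
    moreover have "cinner (fourier_basis n) (cinner e x *\<^sub>C e) = 0" if "e \<in> E" for e
      using that \<open>n < 0\<close> by (auto simp: E_def cinner_scaleC_right cinner_fourier_basis)
    ultimately show "cinner (fourier_basis n) p = 0"
      by (metis (no_types, lifting) has_sum_0 has_sum_unique)
  qed
  have orth: "cinner y (x - p) = 0" if y: "y \<in> hardy_space" for y
  proof -
    note Parseval[OF is_onb_fourier_basis, of y "x - p"]
    moreover have "cinner y e * cinner e (x - p) = 0" if "e \<in> range fourier_basis" for e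
    proof -
      from that obtain n where n: "e = fourier_basis n" by blast
      show ?thesis
      proof (cases "n \<ge> 0")
        case False
        then have "cinner e y = 0" using y n by (simp add: hardy_space_iff)
        then show ?thesis using cinner_commute[of y e] by simp
      qed (simp add: n coeff)
    qed
    ultimately show ?thesis by (metis (no_types, lifting) has_sum_0 has_sum_unique)
  qed
  have "orth_proj hardy_space x = p" using ph orth by (intro orth_proj_hardy_unique) auto
  then show "orth_proj hardy_space x \<in> hardy_space" "\<And>y. y \<in> hardy_space \<Longrightarrow> cinner y (x - orth_proj hardy_space x) = 0"
    using ph orth by auto
qed

definition to_H2 :: "circle_L2 \<Rightarrow> circle_H2" where
  "to_H2 x = Abs_circle_H2 (orth_proj hardy_space x)"

lemma Rep_to_H2: "Rep_circle_H2 (to_H2 x) = orth_proj hardy_space x"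
  unfolding to_H2_def by (rule Abs_circle_H2_inverse[OF orth_proj_hardy(1)])

lemma cinner_to_H2: "cinner h (to_H2 x) = cinner (Rep_circle_H2 h) x"
  using orth_proj_hardy(2)[OF Rep_circle_H2, of h x]
  by (simp add: cinner_circle_H2.rep_eq Rep_to_H2 cinner_diff_right)

lemma norm_to_H2: "norm (to_H2 x) \<le> norm x"
proof -
  have "complex_of_real ((norm (to_H2 x))\<^sup>2) = cinner (Rep_circle_H2 (to_H2 x)) x"
    by (simp only: cinner_self[symmetric] cinner_to_H2)
  then have "(norm (to_H2 x))\<^sup>2 \<le> norm (to_H2 x) * norm x"
    using norm_cinner_le[of "Rep_circle_H2 (to_H2 x)" x]
    by (metis abs_of_nonneg norm_circle_H2.rep_eq norm_of_real zero_le_power2)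
  then show ?thesis
    by (cases "norm (to_H2 x) = 0") (simp_all add: power2_eq_square mult_le_cancel_left)
qed

lemma bounded_linear_to_H2: "bounded_linear to_H2"
proof (rule bounded_linear_intro[where K = 1])
  show "to_H2 (x + y) = to_H2 x + to_H2 y" for x y
    by (rule cinner_eqI) (simp add: cinner_to_H2 cinner_add_right)
  show "to_H2 (r *\<^sub>R x) = r *\<^sub>R to_H2 x" for r x
    by (rule cinner_eqI) (simp add: cinner_to_H2 cinner_scaleR_right)
qed (simp add: norm_to_H2)

lemma to_H2_scaleC: "to_H2 (c *\<^sub>C x) = c *\<^sub>C to_H2 x"
  by (rule cinner_eqI) (simp add: cinner_to_H2 cinner_scaleC_right)

lemma toeplitz_eq: "toeplitz f h = to_H2 (mult_L2 f (Rep_circle_H2 h))"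
  by (simp add: toeplitz_def to_H2_def)

lemma adjoint_pair_toeplitz:
  assumes a: "bounded_symbol a"
  shows "adjoint_pair (toeplitz a) (toeplitz (\<lambda>t. cnj (a t))) (symbol_bound a)"
proof -
  note M = adjoint_pair_mult_L2[OF a]
  have "cinner (toeplitz (\<lambda>t. cnj (a t)) x) y = cinner x (toeplitz a y)" for x y
  proof -
    have "cinner (toeplitz (\<lambda>t. cnj (a t)) x) y = cnj (cinner (Rep_circle_H2 y) (mult_L2 (\<lambda>t. cnj (a t)) (Rep_circle_H2 x)))"
      by (subst cinner_commute) (simp add: toeplitz_eq cinner_to_H2)
    also have "\<dots> = cinner (mult_L2 (\<lambda>t. cnj (a t)) (Rep_circle_H2 x)) (Rep_circle_H2 y)"
      by (rule cinner_commute[symmetric])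
    also have "\<dots> = cinner x (toeplitz a y)"
      using M by (simp add: adjoint_pair_def toeplitz_eq cinner_to_H2)
    finally show ?thesis .
  qed
  moreover have "norm (toeplitz b x) \<le> norm (mult_L2 b (Rep_circle_H2 x))" for b x
    unfolding toeplitz_eq by (rule norm_to_H2)
  ultimately show ?thesis
    using M unfolding adjoint_pair_def norm_circle_H2.rep_eq by (meson order_trans)
qed

definition hardy_basis :: "nat \<Rightarrow> circle_H2" where
  "hardy_basis n = Abs_circle_H2 (fourier_basis (int n))"

lemma Rep_hardy_basis: "Rep_circle_H2 (hardy_basis n) = fourier_basis (int n)"
  unfolding hardy_basis_def
  by (rule Abs_circle_H2_inverse) (auto simp: hardy_space_iff cinner_fourier_basis)

lemma cinner_hardy_basis: "cinner (hardy_basis j) (hardy_basis k) = (if j = k then 1 else 0)"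
  by (simp add: cinner_circle_H2.rep_eq Rep_hardy_basis cinner_fourier_basis)

lemma hardy_basis_inj: "inj hardy_basis"
  by (rule injI) (metis cinner_hardy_basis zero_neq_one)

lemma is_onb_hardy_basis: "is_onb (range hardy_basis)"
  unfolding is_onb_def
proof (intro conjI allI impI)
  show "\<forall>e\<in>range hardy_basis. \<forall>e'\<in>range hardy_basis. cinner e e' = (if e = e' then 1 else 0)"
    using hardy_basis_inj by (auto simp: cinner_hardy_basis inj_def)
  fix x assume x: "\<forall>e\<in>range hardy_basis. cinner e x = 0"
  have "cinner (fourier_basis n) (Rep_circle_H2 x) = 0" for n
  proof (cases "n < 0")
    case True
    then show ?thesis using Rep_circle_H2[of x] by (simp add: hardy_space_iff)
  next
    case False
    have "cinner (hardy_basis (nat n)) x = 0" using x by blast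
    then show ?thesis using False by (simp add: cinner_circle_H2.rep_eq Rep_hardy_basis)
  qed
  then have "Rep_circle_H2 x = 0" using is_onb_fourier_basis by (auto simp: is_onb_def)
  then show "x = 0" by (metis Rep_circle_H2_inject zero_circle_H2.rep_eq)
qed

section \<open>Hankel operators\<close>

text \<open>An enumeration of the monomials of negative degree, which span the complement of the Hardy space.\<close>

definition neg_basis :: "nat \<Rightarrow> circle_L2" where
  "neg_basis n = fourier_basis (- int n - 1)"

definition hardy_compl :: "circle_L2 \<Rightarrow> circle_L2" where
  "hardy_compl x = x - Rep_circle_H2 (to_H2 x)"

lemma cinner_neg_basis_Rep: "cinner (neg_basis n) (Rep_circle_H2 h) = 0"
  using Rep_circle_H2[of h] by (simp add: hardy_space_iff neg_basis_def)

lemma cinner_hardy_compl: "h \<in> hardy_space \<Longrightarrow> cinner h (hardy_compl x) = 0"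
  using orth_proj_hardy(2)[of h x] by (simp add: hardy_compl_def Rep_to_H2)

lemma cinner_neg_basis_compl: "cinner (neg_basis n) (hardy_compl x) = cinner (neg_basis n) x"
  by (simp add: hardy_compl_def cinner_diff_right cinner_neg_basis_Rep)

lemma hardy_compl_expansion:
  "((\<lambda>n. cinner (neg_basis n) x *\<^sub>C neg_basis n) has_sum hardy_compl x) UNIV"
proof -
  let ?h = "\<lambda>e. cinner e (hardy_compl x) *\<^sub>C e"
  have "(?h has_sum hardy_compl x) (range fourier_basis)"
    by (rule onb_expansion[OF is_onb_fourier_basis])
  moreover have "?h e = 0" if "e \<in> range fourier_basis - range neg_basis" for e
  proof -
    from that obtain k where k: "e = fourier_basis k" by blast
    have "k \<ge> 0"
    proof (rule ccontr)
      assume "\<not> k \<ge> 0"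
      then have "e = neg_basis (nat (- k - 1))" by (simp add: k neg_basis_def)
      then show False using that by blast
    qed
    then have "e \<in> hardy_space" by (auto simp: k hardy_space_iff cinner_fourier_basis)
    then show ?thesis by (simp add: cinner_hardy_compl)
  qed
  ultimately have "(?h has_sum hardy_compl x) (range neg_basis)"
    by (rule has_sum_cong_neutral[THEN iffD1, rotated -1], auto simp: neg_basis_def)
  moreover have "inj neg_basis"
    by (rule injI) (simp add: neg_basis_def fourier_basis_inj)
  ultimately show ?thesis
    by (subst (asm) has_sum_reindex) (simp_all add: o_def cinner_neg_basis_compl)
qed

lemma orthonormal_neg_basis: "orthonormal_set (range neg_basis)" and inj_neg_basis: "inj neg_basis"
  by (auto simp: orthonormal_set_def neg_basis_def cinner_fourier_basis fourier_basis_inj inj_def)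

lemma norm_hardy_compl: "((\<lambda>n. (norm (cinner (neg_basis n) x))\<^sup>2) has_sum (norm (hardy_compl x))\<^sup>2) UNIV"
proof -
  have "((\<lambda>n. cinner (hardy_compl x) (cinner (neg_basis n) x *\<^sub>C neg_basis n)) has_sum
      cinner (hardy_compl x) (hardy_compl x)) UNIV"
    by (rule has_sum_cinner_right[OF hardy_compl_expansion])
  moreover have "cinner (hardy_compl x) (cinner (neg_basis n) x *\<^sub>C neg_basis n)
      = complex_of_real ((norm (cinner (neg_basis n) x))\<^sup>2)" for n
    using cinner_commute[of "hardy_compl x" "neg_basis n"]
    by (simp add: cinner_scaleC_right cinner_neg_basis_compl complex_norm_square del: of_real_power)
  ultimately show ?thesis by (simp only: cinner_self has_sum_of_real_iff)
qed

text \<open>The product of the compressions misses exactly the path through the complement of the Hardy space.\<close>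

lemma toeplitz_defect:
  assumes a: "bounded_symbol a" and b: "bounded_symbol b"
  shows "toeplitz (\<lambda>t. a t * b t) h - toeplitz a (toeplitz b h) = to_H2 (mult_L2 a (hardy_compl (mult_L2 b (Rep_circle_H2 h))))"
  using linear_diff[OF bounded_linear.linear[OF bounded_linear_to_H2]]
  by (simp add: toeplitz_eq hardy_compl_def adjoint_pair_clinear(4)[OF adjoint_pair_mult_L2[OF a]] mult_L2_mult[OF a b])

text \<open>The squared Hilbert-Schmidt norm of the Hankel operator with entries
  \<open>\<langle>e m, a e (-n-1)\<rangle>\<close>, where \<open>e k\<close> is the monomial of degree \<open>k\<close>, is finite. Only the coefficients of positive index enter.\<close>

definition hankel_symbol :: "(real \<Rightarrow> complex) \<Rightarrow> bool" where
  "hankel_symbol a \<longleftrightarrow> (\<lambda>(n, m). (norm (fourier_coeff a (int (n + m) + 1)))\<^sup>2) summable_on (UNIV :: (nat \<times> nat) set)"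

definition hankel_column :: "(real \<Rightarrow> complex) \<Rightarrow> nat \<Rightarrow> circle_H2" where
  "hankel_column a n = to_H2 (mult_L2 a (neg_basis n))"

lemma cinner_hankel_column:
  "bounded_symbol a \<Longrightarrow> cinner (hardy_basis m) (hankel_column a n) = fourier_coeff a (int (n + m) + 1)"
  by (simp add: hankel_column_def cinner_to_H2 Rep_hardy_basis neg_basis_def fourier_coeff_mult_L2 algebra_simps)

lemma has_sum_hardy_basis:
  fixes F :: "circle_H2 \<Rightarrow> 'b::{comm_monoid_add,topological_space}"
  shows "(F has_sum s) (range hardy_basis) \<longleftrightarrow> ((\<lambda>m. F (hardy_basis m)) has_sum s) UNIV"
  by (subst has_sum_reindex) (simp_all add: hardy_basis_inj o_def)

lemma norm_hankel_column:
  assumes "bounded_symbol a"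
  shows "((\<lambda>m. (norm (fourier_coeff a (int (n + m) + 1)))\<^sup>2) has_sum (norm (hankel_column a n))\<^sup>2) UNIV"
  using Parseval_norm[OF is_onb_hardy_basis, of "hankel_column a n"]
  by (simp add: has_sum_hardy_basis cinner_hankel_column[OF assms])

lemma summable_hankel_column:
  assumes a: "bounded_symbol a" "hankel_symbol a"
  shows "(\<lambda>n. (norm (hankel_column a n))\<^sup>2) summable_on UNIV"
proof -
  have "(\<lambda>(n, m). (norm (fourier_coeff a (int (n + m) + 1)))\<^sup>2) summable_on UNIV \<times> UNIV"
    using a(2) by (simp add: hankel_symbol_def)
  then obtain s where s: "((\<lambda>(n, m). (norm (fourier_coeff a (int (n + m) + 1)))\<^sup>2) has_sum s) (UNIV \<times> UNIV)"
    by (auto simp: summable_on_def)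
  have "((\<lambda>n. (norm (hankel_column a n))\<^sup>2) has_sum s) UNIV"
    by (rule has_sum_Sigma'[OF s]) (use norm_hankel_column[OF a(1)] in simp)
  then show ?thesis by (auto simp: summable_on_def)
qed

text \<open>The defect is the product of two Hankel operators. Expanding it along the monomials of negative
  degree displays it as a sum of rank one operators built from the columns of these,
  and both families of columns are square summable.\<close>

lemma nuclear_toeplitz_defect:
  assumes a: "bounded_symbol a" "hankel_symbol a"
    and b: "bounded_symbol b" "hankel_symbol (\<lambda>t. cnj (b t))"
  shows "\<exists>c t. nuclear_with (\<lambda>h. toeplitz (\<lambda>t. a t * b t) h - toeplitz a (toeplitz b h)) c t \<and>
    ((\<lambda>(n, m). fourier_coeff a (int (n + m) + 1) * fourier_coeff b (- (int (n + m) + 1))) has_sum t) UNIV"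
proof -
  let ?b = "\<lambda>t. cnj (b t)"
  have cb: "bounded_symbol ?b" by (rule bounded_symbol_cnj[OF b(1)])
  let ?x = "hankel_column a" and ?y = "hankel_column ?b"
  have sxy: "(\<lambda>n. norm (?x n) * norm (?y n)) summable_on UNIV"
    using summable_on_mult_of_squares[of "\<lambda>n. complex_of_real (norm (?x n))" UNIV "\<lambda>n. complex_of_real (norm (?y n))"]
      summable_hankel_column[OF a] summable_hankel_column[OF cb b(2)] by simp
  have "(\<lambda>n. cinner (?y n) (?x n)) summable_on UNIV"
    by (rule abs_summable_summable, rule Infinite_Sum.abs_summable_on_comparison_test'[OF sxy]) (rule norm_cinner_le_swap)
  then obtain t where t: "((\<lambda>n. cinner (?y n) (?x n)) has_sum t) UNIV" by (auto simp: summable_on_def)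
  have "nuclear_with (\<lambda>h. toeplitz (\<lambda>t. a t * b t) h - toeplitz a (toeplitz b h)) (\<Sum>\<^sub>\<infinity>n. norm (?x n) * norm (?y n)) t"
  proof (rule nuclear_withI[OF sxy order_refl _ t])
    fix h
    let ?z = "mult_L2 b (Rep_circle_H2 h)"
    note ca = adjoint_pair_mult_L2[OF a(1)]
    have "((\<lambda>n. to_H2 (mult_L2 a (cinner (neg_basis n) ?z *\<^sub>C neg_basis n))) has_sum to_H2 (mult_L2 a (hardy_compl ?z))) UNIV"
      by (rule has_sum_bounded_linear[OF bounded_linear_to_H2
            has_sum_bounded_linear[OF adjoint_pair_bounded_linear[OF ca] hardy_compl_expansion]])
    moreover have "cinner (neg_basis n) ?z = cinner (?y n) h" for n
    proof -
      have "cinner (?y n) h = cnj (cinner (Rep_circle_H2 h) (mult_L2 ?b (neg_basis n)))"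
        by (subst cinner_commute) (simp add: hankel_column_def cinner_to_H2)
      also have "\<dots> = cinner (mult_L2 ?b (neg_basis n)) (Rep_circle_H2 h)" by (rule cinner_commute[symmetric])
      also have "\<dots> = cinner (neg_basis n) ?z"
        using adjoint_pair_mult_L2[OF b(1)] by (simp add: adjoint_pair_def)
      finally show ?thesis by simp
    qed
    ultimately show "((\<lambda>n. cinner (?y n) h *\<^sub>C ?x n) has_sum toeplitz (\<lambda>t. a t * b t) h - toeplitz a (toeplitz b h)) UNIV"
      by (simp add: toeplitz_defect[OF a(1) b(1)] adjoint_pair_clinear(2)[OF ca] to_H2_scaleC hankel_column_def)
  qed
  moreover have "((\<lambda>(n, m). fourier_coeff a (int (n + m) + 1) * fourier_coeff b (- (int (n + m) + 1))) has_sum t) (UNIV \<times> UNIV)"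
  proof (rule has_sum_SigmaI[OF _ t])
    fix n
    have "((\<lambda>m. cinner (?y n) (hardy_basis m) * cinner (hardy_basis m) (?x n)) has_sum cinner (?y n) (?x n)) UNIV"
      using Parseval[OF is_onb_hardy_basis, of "?y n" "?x n"] by (simp add: has_sum_hardy_basis)
    moreover have "cinner (?y n) (hardy_basis m) = fourier_coeff b (- (int (n + m) + 1))" for m
      using cinner_commute[of "?y n" "hardy_basis m"]
      by (simp add: cinner_hankel_column[OF cb] fourier_coeff_cnj)
    ultimately show "((\<lambda>m. case (n, m) of (n, m) \<Rightarrow> fourier_coeff a (int (n + m) + 1) * fourier_coeff b (- (int (n + m) + 1)))
        has_sum cinner (?y n) (?x n)) UNIV"
      by (simp add: cinner_hankel_column[OF a(1)] mult.commute)
  next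
    let ?F = "\<lambda>p::nat \<times> nat. fourier_coeff a (int (fst p + snd p) + 1)"
      and ?G = "\<lambda>p::nat \<times> nat. fourier_coeff b (- (int (fst p + snd p) + 1))"
    have "(\<lambda>p. norm (?F p) * norm (?G p)) summable_on UNIV"
      using a(2) b(2) by (intro summable_on_mult_of_squares)
        (simp_all add: hankel_symbol_def case_prod_unfold fourier_coeff_cnj)
    then have "(\<lambda>p. norm ((\<lambda>(n, m). fourier_coeff a (int (n + m) + 1) * fourier_coeff b (- (int (n + m) + 1))) p))
        summable_on (UNIV :: (nat \<times> nat) set)"
      by (simp add: norm_mult case_prod_unfold)
    from abs_summable_summable[OF this]
    show "(\<lambda>(n, m). fourier_coeff a (int (n + m) + 1) * fourier_coeff b (- (int (n + m) + 1))) summable_on UNIV \<times> UNIV"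
      by simp
  qed
  ultimately show ?thesis unfolding UNIV_Times_UNIV by blast
qed

text \<open>The entry \<open>\<langle>e m, a b e (-n-1)\<rangle>\<close> is split by projecting \<open>b e (-n-1)\<close> to the Hardy space and to
  its complement; \<open>e k\<close> denotes the monomial of degree \<open>k\<close>. The first part, \<open>F\<close>, is a bounded operator after the Hankel operator of \<open>b\<close>, and the
  second one, \<open>G\<close>, the Hankel operator of \<open>a\<close> after a bounded operator; both are Hilbert-Schmidt.\<close>

lemma hankel_symbol_mult:
  assumes a: "bounded_symbol a" "hankel_symbol a" and b: "bounded_symbol b" "hankel_symbol b"
  shows "hankel_symbol (\<lambda>t. a t * b t)"
proof -
  note ab = bounded_symbol_mult[OF a(1) b(1)]
  note Ma = adjoint_pair_mult_L2[OF a(1)] and Mb = adjoint_pair_mult_L2[OF b(1)]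
  let ?ca = "\<lambda>t. cnj (a t)" and ?cb = "\<lambda>t. cnj (b t)"
  define u where "u n = mult_L2 a (Rep_circle_H2 (hankel_column b n))" for n
  define w where "w m = mult_L2 ?cb (hardy_compl (mult_L2 ?ca (fourier_basis (int m))))" for m
  define F where "F n m = cinner (hardy_basis m) (to_H2 (u n))" for n m
  define G where "G n m = cinner (w m) (neg_basis n)" for n m
  have split: "fourier_coeff (\<lambda>t. a t * b t) (int (n + m) + 1) = F n m + G n m" for n m
  proof -
    have "fourier_coeff (\<lambda>t. a t * b t) (int (n + m) + 1) = cinner (fourier_basis (int m)) (mult_L2 a (mult_L2 b (neg_basis n)))"
      unfolding mult_L2_mult[OF a(1) b(1)] neg_basis_def fourier_coeff_mult_L2[OF ab] by (simp add: algebra_simps)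
    also have "mult_L2 b (neg_basis n) = Rep_circle_H2 (hankel_column b n) + hardy_compl (mult_L2 b (neg_basis n))"
      by (simp add: hardy_compl_def hankel_column_def)
    also have "cinner (fourier_basis (int m)) (mult_L2 a \<dots>) = F n m +
        cinner (mult_L2 ?ca (fourier_basis (int m))) (hardy_compl (mult_L2 b (neg_basis n)))"
      using Ma by (simp add: adjoint_pair_def F_def u_def cinner_to_H2 Rep_hardy_basis adjoint_pair_clinear(1)[OF Ma] cinner_add_right)
    also have "cinner (mult_L2 ?ca (fourier_basis (int m))) (hardy_compl (mult_L2 b (neg_basis n)))
        = cinner (hardy_compl (mult_L2 ?ca (fourier_basis (int m)))) (mult_L2 b (neg_basis n))"
    proof -
      let ?p = "mult_L2 ?ca (fourier_basis (int m))" and ?q = "mult_L2 b (neg_basis n)"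
      have 1: "cinner (Rep_circle_H2 (to_H2 ?p)) (hardy_compl ?q) = 0"
        by (rule cinner_hardy_compl[OF Rep_circle_H2])
      have "cinner (Rep_circle_H2 (to_H2 ?q)) (hardy_compl ?p) = 0"
        by (rule cinner_hardy_compl[OF Rep_circle_H2])
      then have 2: "cinner (hardy_compl ?p) (Rep_circle_H2 (to_H2 ?q)) = 0" by (subst cinner_commute) simp
      have "cinner ?p (hardy_compl ?q) = cinner (hardy_compl ?p) (hardy_compl ?q)"
        using 1 by (simp add: hardy_compl_def[of ?p] cinner_diff_left)
      also have "\<dots> = cinner (hardy_compl ?p) ?q"
        using 2 by (simp add: hardy_compl_def[of ?q] cinner_diff_right)
      finally show ?thesis .
    qed
    also have "\<dots> = G n m" using Mb by (simp add: adjoint_pair_def G_def w_def)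
    finally show ?thesis .
  qed
  have F: "(\<lambda>(n, m). (norm (F n m))\<^sup>2) summable_on UNIV \<times> UNIV"
  proof (rule summable_on_SigmaI)
    show "((\<lambda>m. case (n, m) of (n, m) \<Rightarrow> (norm (F n m))\<^sup>2) has_sum (norm (to_H2 (u n)))\<^sup>2) UNIV" for n
      using Parseval_norm[OF is_onb_hardy_basis, of "to_H2 (u n)"] by (simp add: has_sum_hardy_basis F_def)
    show "(\<lambda>n. (norm (to_H2 (u n)))\<^sup>2) summable_on UNIV"
    proof (rule summable_on_comparison_test[OF summable_on_cmult_right[OF summable_hankel_column[OF b]]])
      fix n
      have "norm (to_H2 (u n)) \<le> symbol_bound a * norm (hankel_column b n)"
        using norm_to_H2[of "u n"] Ma unfolding adjoint_pair_def u_def norm_circle_H2.rep_eq by (meson order_trans)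
      then show "(norm (to_H2 (u n)))\<^sup>2 \<le> (symbol_bound a)\<^sup>2 * (norm (hankel_column b n))\<^sup>2"
        unfolding power_mult_distrib[symmetric] by (intro power_mono) auto
    qed simp
  qed auto
  have w: "(norm (w m))\<^sup>2 \<le> (symbol_bound b)\<^sup>2 * (norm (hardy_compl (mult_L2 ?ca (fourier_basis (int m)))))\<^sup>2" for m
    unfolding power_mult_distrib[symmetric] w_def
    using Mb by (intro power_mono) (auto simp: adjoint_pair_def)
  have compl_sum: "(\<lambda>m. (norm (hardy_compl (mult_L2 ?ca (fourier_basis (int m)))))\<^sup>2) summable_on UNIV"
  proof -
    have rows: "((\<lambda>n. (norm (fourier_coeff a (int (m + n) + 1)))\<^sup>2) has_sum (norm (hardy_compl (mult_L2 ?ca (fourier_basis (int m)))))\<^sup>2) UNIV" for m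
    proof -
      have "norm (cinner (neg_basis n) (mult_L2 ?ca (fourier_basis (int m)))) = norm (fourier_coeff a (int (m + n) + 1))" for n
        unfolding neg_basis_def fourier_coeff_mult_L2[OF bounded_symbol_cnj[OF a(1)]]
        by (simp add: fourier_coeff_cnj algebra_simps)
      then show ?thesis using norm_hardy_compl[of "mult_L2 ?ca (fourier_basis (int m))"] by simp
    qed
    have "(\<lambda>(m, n). (norm (fourier_coeff a (int (m + n) + 1)))\<^sup>2) summable_on UNIV \<times> UNIV"
      using a(2) by (simp add: hankel_symbol_def)
    then obtain s where s: "((\<lambda>(m, n). (norm (fourier_coeff a (int (m + n) + 1)))\<^sup>2) has_sum s) (UNIV \<times> UNIV)"
      by (auto simp: summable_on_def)
    have "((\<lambda>m. (norm (hardy_compl (mult_L2 ?ca (fourier_basis (int m)))))\<^sup>2) has_sum s) UNIV"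
      by (rule has_sum_Sigma'[OF s]) (use rows in simp)
    then show ?thesis by (auto simp: summable_on_def)
  qed
  have G: "(\<lambda>(m, n). (norm (G n m))\<^sup>2) summable_on UNIV \<times> UNIV"
  proof (rule summable_on_SigmaI)
    have B: "(\<lambda>n. (norm (G n m))\<^sup>2) summable_on UNIV" "(\<Sum>\<^sub>\<infinity>n. (norm (G n m))\<^sup>2) \<le> (norm (w m))\<^sup>2" for m
      using Bessel[OF orthonormal_neg_basis, of "w m"] inj_neg_basis
      by (simp_all add: summable_on_reindex infsum_reindex o_def G_def norm_cinner_commute[of "w m"])
    show "((\<lambda>n. case (m, n) of (m, n) \<Rightarrow> (norm (G n m))\<^sup>2) has_sum (\<Sum>\<^sub>\<infinity>n. (norm (G n m))\<^sup>2)) UNIV" for m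
      using B(1)[of m] by simp
    show "(\<lambda>m. \<Sum>\<^sub>\<infinity>n. (norm (G n m))\<^sup>2) summable_on UNIV"
      by (rule summable_on_comparison_test[OF summable_on_cmult_right[OF compl_sum, of "(symbol_bound b)\<^sup>2"]])
        (use B(2) w in \<open>auto intro: order_trans infsum_nonneg\<close>)
  qed auto
  have G': "(\<lambda>(n, m). (norm (G n m))\<^sup>2) summable_on UNIV \<times> UNIV"
    using G summable_on_swap[of "\<lambda>(m, n). (norm (G n m))\<^sup>2" UNIV UNIV] by (simp add: case_prod_unfold)
  have FG: "(\<lambda>p. 2 * (case p of (n, m) \<Rightarrow> (norm (F n m))\<^sup>2) + 2 * (case p of (n, m) \<Rightarrow> (norm (G n m))\<^sup>2)) summable_on UNIV \<times> UNIV"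
    by (intro summable_on_add summable_on_cmult_right F G')
  show ?thesis
    unfolding hankel_symbol_def UNIV_Times_UNIV[symmetric]
  proof (rule summable_on_comparison_test[OF FG])
    fix p :: "nat \<times> nat"
    obtain n m where p: "p = (n, m)" by fastforce
    have "(norm (F n m + G n m))\<^sup>2 \<le> (norm (F n m) + norm (G n m))\<^sup>2"
      by (intro power_mono norm_triangle_ineq) auto
    also have "\<dots> \<le> 2 * (norm (F n m))\<^sup>2 + 2 * (norm (G n m))\<^sup>2"
      using sum_squares_bound[of "norm (F n m)" "norm (G n m)"] by (simp add: power2_sum)
    finally show "(case p of (n, m) \<Rightarrow> (norm (fourier_coeff (\<lambda>t. a t * b t) (int (n + m) + 1)))\<^sup>2)
        \<le> 2 * (case p of (n, m) \<Rightarrow> (norm (F n m))\<^sup>2) + 2 * (case p of (n, m) \<Rightarrow> (norm (G n m))\<^sup>2)"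
      using split[of n m] by (simp add: p)
    show "0 \<le> (case p of (n, m) \<Rightarrow> (norm (fourier_coeff (\<lambda>t. a t * b t) (int (n + m) + 1)))\<^sup>2)"
      by (simp add: p)
  qed
qed

section \<open>Traces of commutators of Toeplitz operators\<close>

lemma bij_betw_diagonal: "bij_betw (\<lambda>(N, k). (k, N - k)) (SIGMA N:UNIV. {..N}) (UNIV :: (nat \<times> nat) set)"
  by (rule bij_betwI[of _ _ _ "\<lambda>(n, m). (n + m, n)"]) auto

lemma has_sum_diagonal:
  fixes F :: "nat \<Rightarrow> complex"
  assumes "((\<lambda>(n, m). F (n + m)) has_sum s) UNIV"
  shows "((\<lambda>N. of_nat (Suc N) * F N) has_sum s) UNIV"
proof -
  have "((\<lambda>p. (\<lambda>(n, m). F (n + m)) ((\<lambda>(N, k). (k, N - k)) p)) has_sum s) (SIGMA N:UNIV. {..N})"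
    using assms by (subst has_sum_reindex_bij_betw[OF bij_betw_diagonal])
  moreover have "(\<lambda>(n, m). F (n + m)) ((\<lambda>(N, k). (k, N - k)) p) = F (fst p)" if "p \<in> (SIGMA N:UNIV. {..N})" for p
    using that by auto
  ultimately have S: "((\<lambda>p. F (fst p)) has_sum s) (SIGMA N:UNIV. {..N})"
    using has_sum_cong by (metis (mono_tags, lifting))
  show ?thesis
    by (rule has_sum_Sigma'[OF S]) (simp add: has_sum_finiteI)
qed

lemma summable_on_diagonal:
  fixes F :: "nat \<Rightarrow> real"
  assumes "(\<lambda>N. real (Suc N) * F N) summable_on UNIV" and F: "\<And>N. F N \<ge> 0"
  shows "(\<lambda>(n, m). F (n + m)) summable_on UNIV"
proof -
  have "(\<lambda>p. F (fst p)) summable_on (SIGMA N:UNIV. {..N})"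
  proof (rule summable_on_SigmaI[OF _ assms(1)])
    show "((\<lambda>k. F (fst (N, k))) has_sum real (Suc N) * F N) {..N}" for N :: nat
      by (simp add: has_sum_finiteI)
  qed (simp add: F)
  moreover have "(\<lambda>(n, m). F (n + m)) ((\<lambda>(N, k). (k, N - k)) p) = F (fst p)" if "p \<in> (SIGMA N:UNIV. {..N})" for p
    using that by auto
  ultimately have "(\<lambda>p. (\<lambda>(n, m). F (n + m)) ((\<lambda>(N, k). (k, N - k)) p)) summable_on (SIGMA N:UNIV. {..N})"
    using summable_on_cong by (metis (mono_tags, lifting))
  then show ?thesis by (subst (asm) summable_on_reindex_bij_betw[OF bij_betw_diagonal])
qed

text \<open>This algebra of symbols contains the bounded functions in the Sobolev space of order \<open>1/2\<close>. It is used
  instead of the latter because its closure under products comes from the Hankel operators alone.\<close>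

definition krein_symbol :: "(real \<Rightarrow> complex) \<Rightarrow> bool" where
  "krein_symbol a \<longleftrightarrow> bounded_symbol a \<and> hankel_symbol a \<and> hankel_symbol (\<lambda>t. cnj (a t))"

lemma krein_symbol_cnj: "krein_symbol a \<Longrightarrow> krein_symbol (\<lambda>t. cnj (a t))"
  by (simp add: krein_symbol_def bounded_symbol_cnj)

lemma krein_symbol_mult: "krein_symbol a \<Longrightarrow> krein_symbol b \<Longrightarrow> krein_symbol (\<lambda>t. a t * b t)"
  unfolding krein_symbol_def complex_cnj_mult
  by (auto intro!: bounded_symbol_mult hankel_symbol_mult bounded_symbol_cnj)

text \<open>A coefficient of index \<open>N + 1\<close> occurs on a diagonal with \<open>N + 1\<close> entries, so the Hilbert-Schmidt norms
  are weighted sums of squares with weights bounded by \<open>1 + \<bar>n\<bar>\<close>.\<close>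

lemma sobolev_half_2_krein:
  assumes f: "f \<in> sobolev_half_2" and b: "bounded_symbol f"
  shows "krein_symbol f"
proof -
  define w where "w n = (1 + \<bar>real_of_int n\<bar>) * (norm (fourier_coeff f n))\<^sup>2" for n :: int
  have w: "w summable_on UNIV" using f by (simp add: sobolev_half_2_def w_def[abs_def])
  have *: "(\<lambda>N. real (Suc N) * (norm (fourier_coeff f (j N)))\<^sup>2) summable_on UNIV"
    if "inj j" "\<And>N. \<bar>j N\<bar> = int N + 1" for j :: "nat \<Rightarrow> int"
  proof (rule summable_on_comparison_test)
    have "w summable_on range j" using w by (rule summable_on_subset_banach) simp
    then show "(\<lambda>N. w (j N)) summable_on UNIV" using that(1) by (simp add: summable_on_reindex o_def)
    fix N
    have "real (Suc N) \<le> 1 + \<bar>real_of_int (j N)\<bar>"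
      using arg_cong[OF that(2)[of N], of real_of_int] by simp
    then show "real (Suc N) * (norm (fourier_coeff f (j N)))\<^sup>2 \<le> w (j N)"
      unfolding w_def by (intro mult_right_mono) auto
  qed simp
  have "hankel_symbol f"
    using summable_on_diagonal[OF *[of "\<lambda>N. int N + 1"]] by (simp add: hankel_symbol_def inj_def)
  moreover have "hankel_symbol (\<lambda>t. cnj (f t))"
    using summable_on_diagonal[OF *[of "\<lambda>N. - (int N + 1)"]]
    by (simp add: hankel_symbol_def inj_def fourier_coeff_cnj)
  ultimately show ?thesis using b by (simp add: krein_symbol_def)
qed

lemma toeplitz_defect_trace:
  assumes a: "krein_symbol a" and b: "krein_symbol b"
  shows "\<exists>c t. nuclear_with (\<lambda>h. toeplitz (\<lambda>t. a t * b t) h - toeplitz a (toeplitz b h)) c t \<and>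
    ((\<lambda>N. of_nat (Suc N) * (fourier_coeff a (int N + 1) * fourier_coeff b (- (int N + 1)))) has_sum t) UNIV"
proof -
  from a b obtain c t where
    "nuclear_with (\<lambda>h. toeplitz (\<lambda>t. a t * b t) h - toeplitz a (toeplitz b h)) c t"
    "((\<lambda>(n, m). fourier_coeff a (int (n + m) + 1) * fourier_coeff b (- (int (n + m) + 1))) has_sum t) UNIV"
    using nuclear_toeplitz_defect[of a b] by (auto simp: krein_symbol_def)
  with has_sum_diagonal[of "\<lambda>N. fourier_coeff a (int N + 1) * fourier_coeff b (- (int N + 1))"]
  show ?thesis by blast
qed

text \<open>The two defects \<open>T\<^sub>a\<^sub>b - T\<^sub>a T\<^sub>b\<close> and \<open>T\<^sub>b\<^sub>a - T\<^sub>b T\<^sub>a\<close> contribute the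
  terms of negative and of positive index, respectively.\<close>

lemma toeplitz_commutator_trace:
  assumes a: "krein_symbol a" and b: "krein_symbol b"
  shows "\<exists>c t. nuclear_with (\<lambda>h. toeplitz a (toeplitz b h) - toeplitz b (toeplitz a h)) c t \<and>
    ((\<lambda>n::int. of_int n * fourier_coeff b n * fourier_coeff a (- n)) has_sum t) UNIV"
proof -
  define g where "g n = of_int n * fourier_coeff b n * fourier_coeff a (- n)" for n :: int
  obtain c1 t1 where 1: "nuclear_with (\<lambda>h. toeplitz (\<lambda>t. a t * b t) h - toeplitz a (toeplitz b h)) c1 t1"
    "((\<lambda>N. of_nat (Suc N) * (fourier_coeff a (int N + 1) * fourier_coeff b (- (int N + 1)))) has_sum t1) UNIV"
    using toeplitz_defect_trace[OF a b] by blast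
  obtain c2 t2 where 2: "nuclear_with (\<lambda>h. toeplitz (\<lambda>t. b t * a t) h - toeplitz b (toeplitz a h)) c2 t2"
    "((\<lambda>N. of_nat (Suc N) * (fourier_coeff b (int N + 1) * fourier_coeff a (- (int N + 1)))) has_sum t2) UNIV"
    using toeplitz_defect_trace[OF b a] by blast
  have "nuclear_with (\<lambda>h. toeplitz a (toeplitz b h) - toeplitz b (toeplitz a h)) (c2 + c1) (t2 - t1)"
    using nuclear_with_diff[OF 2(1) 1(1)] by (simp add: mult.commute)
  moreover have "(g has_sum (t2 - t1)) UNIV"
  proof -
    let ?p = "\<lambda>N. int N + 1" and ?q = "\<lambda>N. - (int N + 1)"
    have inj: "inj ?p" "inj ?q" by (auto simp: inj_def)
    have "((\<lambda>N. g (?p N)) has_sum t2) UNIV"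
      using 2(2) by (simp add: g_def mult.assoc add.commute)
    then have p: "(g has_sum t2) (range ?p)" by (subst has_sum_reindex[OF inj(1)]) (simp add: o_def)
    have "g (?q N) = - (of_nat (Suc N) * (fourier_coeff a (int N + 1) * fourier_coeff b (- (int N + 1))))" for N
      by (simp add: g_def algebra_simps)
    then have "((\<lambda>N. g (?q N)) has_sum (- t1)) UNIV"
      using has_sum_uminusI[OF 1(2)] by simp
    then have q: "(g has_sum (- t1)) (range ?q)" by (subst has_sum_reindex[OF inj(2)]) (simp add: o_def)
    have "(g has_sum (t2 + - t1)) (range ?p \<union> range ?q)"
      by (rule has_sum_Un_disjoint[OF p q]) auto
    moreover have "g n = 0" if "n \<in> UNIV - (range ?p \<union> range ?q)" for n
    proof -
      have "n = 0"
      proof (rule ccontr)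
        assume "n \<noteq> 0"
        then have "n = ?p (nat (n - 1)) \<or> n = ?q (nat (- n - 1))" by auto
        then show False using that by blast
      qed
      then show ?thesis by (simp add: g_def)
    qed
    ultimately have "(g has_sum (t2 + - t1)) UNIV"
      by (rule has_sum_cong_neutral[THEN iffD1, rotated -1], auto)
    then show ?thesis by simp
  qed
  ultimately show ?thesis unfolding g_def by blast
qed

lemma nuclear_toeplitz_product:
  assumes "krein_symbol a" "krein_symbol b"
  shows "nuclear (\<lambda>h. toeplitz a (toeplitz b h) - toeplitz (\<lambda>t. a t * b t) h)"
proof -
  obtain c t where "nuclear_with (\<lambda>h. toeplitz (\<lambda>t. a t * b t) h - toeplitz a (toeplitz b h)) c t"
    using toeplitz_defect_trace[OF assms] by blast
  from nuclear_with_diff[OF nuclear_with_0 this] show ?thesis unfolding nuclear_def by auto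
qed

text \<open>With \<open>T\<close> the Toeplitz operator and \<open>S\<close> its adjoint, \<open>S (T S)^n\<close> is a Toeplitz operator up to a nuclear one, by induction on \<open>n\<close>: each
  multiplication of symbols costs a nuclear defect.\<close>

theorem toeplitz_heat_trace:
  assumes f: "krein_symbol f"
  shows "trace_class (self_commutator (toeplitz f))" "\<And>s. trace_class (heat_difference (toeplitz f) s)"
    "\<exists>d. (\<forall>n. ((\<lambda>k::int. of_int k * fourier_coeff f k *
          fourier_coeff (\<lambda>t. cnj (f t) * (f t * cnj (f t)) ^ n) (- k)) has_sum d n) UNIV) \<and>
       (\<forall>s. ((\<lambda>n. complex_of_real ((- s) ^ Suc n / fact (Suc n)) * d n) has_sum
          trace_op (heat_difference (toeplitz f) s)) UNIV)"
proof -
  let ?T = "toeplitz f" and ?S = "toeplitz (\<lambda>t. cnj (f t))"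
  note cf = krein_symbol_cnj[OF f]
  have bf: "bounded_symbol f" using f by (simp add: krein_symbol_def)
  obtain c t0 where c: "nuclear_with (\<lambda>h. ?S (?T h) - ?T (?S h)) c t0"
    using toeplitz_commutator_trace[OF cf f] by blast
  interpret almost_normal ?T ?S "symbol_bound f" c t0 "range hardy_basis"
    by unfold_locales (rule adjoint_pair_toeplitz[OF bf] c is_onb_hardy_basis)+
  define b where "b n t = cnj (f t) * (f t * cnj (f t)) ^ n" for n t
  have b0: "b 0 = (\<lambda>t. cnj (f t))" and bSuc: "b (Suc n) = (\<lambda>t. (b n t * f t) * cnj (f t))" for n
    by (auto simp: b_def fun_eq_iff)
  have kb: "krein_symbol (b n)" for n
    by (induction n) (simp_all only: b0 bSuc cf krein_symbol_mult f)
  \<comment> \<open>for the step replace \<open>S (T S)^n\<close>, then its product with \<open>T\<close>, then the product of that with \<open>S\<close> by a Toeplitz operator\<close>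
  have R: "nuclear (\<lambda>x. ?S ((B ^^ n) x) - toeplitz (b n) x)" for n
  proof (induction n)
    case 0
    show ?case by (simp add: b0 nuclear_zero)
  next
    case (Suc n)
    let ?N1 = "\<lambda>x. ?S ((B ^^ n) (B x)) - toeplitz (b n) (B x)"
    let ?N2 = "\<lambda>x. toeplitz (b n) (?T (?S x)) - toeplitz (\<lambda>t. b n t * f t) (?S x)"
    let ?N3 = "\<lambda>x. toeplitz (\<lambda>t. b n t * f t) (?S x) - toeplitz (b (Suc n)) x"
    have "nuclear ?N1" by (rule nuclear_compose_right[OF Suc B])
    moreover have "nuclear ?N2" by (rule nuclear_compose_right[OF nuclear_toeplitz_product[OF kb f] S])
    moreover have "nuclear ?N3" unfolding bSuc by (rule nuclear_toeplitz_product[OF krein_symbol_mult[OF kb f] cf])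
    ultimately have "nuclear (\<lambda>x. ?N1 x + (?N2 x + ?N3 x))" by (intro nuclear_add)
    moreover have eq: "?N1 x + (?N2 x + ?N3 x) = ?S ((B ^^ Suc n) x) - toeplitz (b (Suc n)) x" for x
      by (simp only: funpow_Suc_right comp_def) (simp add: B_def)
    ultimately show ?case unfolding eq by (simp only:)
  qed
  have "\<forall>n. \<exists>d k. nuclear_with (\<lambda>x. toeplitz (b n) (?T x) - ?T (toeplitz (b n) x)) k d \<and>
      ((\<lambda>k::int. of_int k * fourier_coeff f k * fourier_coeff (b n) (- k)) has_sum d) UNIV"
    using toeplitz_commutator_trace[OF kb f] by blast
  then obtain d where d: "\<And>n. \<exists>k. nuclear_with (\<lambda>x. toeplitz (b n) (?T x) - ?T (toeplitz (b n) x)) k (d n) \<and>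
      ((\<lambda>k::int. of_int k * fourier_coeff f k * fourier_coeff (b n) (- k)) has_sum d n) UNIV"
    by metis
  have D: "\<exists>k. nuclear_with (D (Suc n)) k (d n)" for n
    using d[of n] nuclear_D_trace[OF R] by blast
  show "trace_class (self_commutator ?T)" by (rule trace_class_self_commutator)
  show "trace_class (heat_difference ?T s)" for s by (rule heat_difference_trace(1)[OF D])
  show "\<exists>d. (\<forall>n. ((\<lambda>k::int. of_int k * fourier_coeff f k *
          fourier_coeff (\<lambda>t. cnj (f t) * (f t * cnj (f t)) ^ n) (- k)) has_sum d n) UNIV) \<and>
       (\<forall>s. ((\<lambda>n. complex_of_real ((- s) ^ Suc n / fact (Suc n)) * d n) has_sum
          trace_op (heat_difference (toeplitz f) s)) UNIV)"
    using d heat_difference_trace(2)[OF D] unfolding b_def by blast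
qed

section \<open>Pairing Fourier coefficients with the derivative\<close>

lemma periodic_add_int:
  fixes \<psi> :: "real \<Rightarrow> 'b"
  assumes "\<And>t. \<psi> (t + p) = \<psi> t"
  shows "\<psi> (t + of_int k * p) = \<psi> t"
proof -
  have nat: "\<psi> (t + real n * p) = \<psi> t" for n t
  proof (induction n)
    case (Suc n)
    have "\<psi> (t + real (Suc n) * p) = \<psi> ((t + real n * p) + p)" by (simp add: algebra_simps)
    with Suc assms show ?case by simp
  qed simp
  show ?thesis
  proof (cases "k \<ge> 0")
    case True
    then show ?thesis using nat[of t "nat k"] by simp
  next
    case False
    then show ?thesis using nat[of "t + of_int k * p" "nat (- k)"] by simp
  qed
qed

lemma periodic_reduce:
  fixes p :: real
  assumes "p > 0"
  obtains k :: int where "0 \<le> a - of_int k * p" "a - of_int k * p < p"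
proof -
  define k where "k = \<lfloor>a / p\<rfloor>"
  have k: "of_int k \<le> a / p" "a / p < of_int k + 1" unfolding k_def by linarith+
  show thesis by (rule that[of k]) (use k assms in \<open>simp_all add: field_simps\<close>)
qed

lemma has_integral_periodic_shift:
  fixes \<psi> :: "real \<Rightarrow> 'b::euclidean_space"
  assumes per: "\<And>t. \<psi> (t + p) = \<psi> t" and p: "p > 0" and I: "(\<psi> has_integral I) {0..p}"
  shows "(\<psi> has_integral I) {a..a + p}"
proof -
  obtain k :: int where k: "0 \<le> a - of_int k * p" "a - of_int k * p < p" using periodic_reduce[OF p] .
  define r where "r = a - of_int k * p"
  have r: "0 \<le> r" "r \<le> p" using k by (auto simp: r_def)
  have int: "\<psi> integrable_on {0..p}" using I by auto
  have 1: "(\<psi> has_integral integral {0..r} \<psi>) {0..r}" "(\<psi> has_integral integral {r..p} \<psi>) {r..p}"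
    using r by (auto intro!: integrable_integral integrable_on_subinterval[OF int])
  have "(\<psi> has_integral (integral {0..r} \<psi> + integral {r..p} \<psi>)) {0..p}"
    by (rule has_integral_combine[OF r 1])
  then have I': "I = integral {r..p} \<psi> + integral {0..r} \<psi>"
    using I by (simp add: has_integral_unique add.commute)
  have sh: "\<psi> (x + - (of_int j * p)) = \<psi> x" for x j
    using periodic_add_int[of \<psi> p "x - of_int j * p" j] per by simp
  have 2: "(\<psi> has_integral integral {r..p} \<psi>) {a..of_int (k + 1) * p}"
    using has_integral_shift_real_ivl[OF 1(2), of "- (of_int k * p)"]
    by (simp only: sh) (simp add: r_def algebra_simps)
  have 3: "(\<psi> has_integral integral {0..r} \<psi>) {of_int (k + 1) * p..a + p}"
    using has_integral_shift_real_ivl[OF 1(1), of "- (of_int (k + 1) * p)"]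
    by (simp only: sh) (simp add: r_def algebra_simps)
  show ?thesis
    unfolding I' by (rule has_integral_combine[OF _ _ 2 3]) (use k in \<open>auto simp: algebra_simps\<close>)
qed

lemma absolutely_integrable_periodic_shift:
  fixes \<psi> :: "real \<Rightarrow> 'b::euclidean_space"
  assumes per: "\<And>t. \<psi> (t + p) = \<psi> t" and p: "p > 0" and I: "\<psi> absolutely_integrable_on {0..p}"
  shows "\<psi> absolutely_integrable_on {a..a + p}" "integral {a..a + p} \<psi> = integral {0..p} \<psi>"
proof -
  have i: "\<psi> integrable_on {0..p}" "(\<lambda>t. norm (\<psi> t)) integrable_on {0..p}"
    using I by (auto simp: absolutely_integrable_on_def)
  have 1: "(\<psi> has_integral integral {0..p} \<psi>) {a..a + p}"
    by (rule has_integral_periodic_shift[where p = p and \<psi> = \<psi>]) (use i per p in auto)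
  moreover have "((\<lambda>t. norm (\<psi> t)) has_integral integral {0..p} (\<lambda>t. norm (\<psi> t))) {a..a + p}"
    by (rule has_integral_periodic_shift[where p = p and \<psi> = "\<lambda>t. norm (\<psi> t)"]) (use i per p in auto)
  ultimately show "\<psi> absolutely_integrable_on {a..a + p}" "integral {a..a + p} \<psi> = integral {0..p} \<psi>"
    by (auto simp: absolutely_integrable_on_def integral_unique)
qed

text \<open>This is dominated convergence for the counting measure on \<open>A\<close>.\<close>

lemma tendsto_infsum_dominated:
  fixes F :: "nat \<Rightarrow> 'i \<Rightarrow> complex"
  assumes G: "G summable_on A" and bound: "\<And>n k. k \<in> A \<Longrightarrow> norm (F n k) \<le> G k"
    and lim: "\<And>k. k \<in> A \<Longrightarrow> (\<lambda>n. F n k) \<longlonglongrightarrow> L k"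
  shows "(\<lambda>n. infsum (F n) A) \<longlonglongrightarrow> infsum L A"
proof -
  have L: "norm (L k) \<le> G k" if "k \<in> A" for k
    by (rule tendsto_upperbound[OF tendsto_norm[OF lim[OF that]]]) (use bound that in auto)
  have G0: "0 \<le> G k" if "k \<in> A" for k using L[OF that] norm_ge_zero order_trans by blast
  have abs: "(\<lambda>k. norm (H k)) summable_on A" if "\<And>k. k \<in> A \<Longrightarrow> norm (H k) \<le> G k" for H :: "'i \<Rightarrow> complex"
    by (rule Infinite_Sum.abs_summable_on_comparison_test'[OF G that])
  have int: "integrable (count_space A) H \<and> infsum H A = integral\<^sup>L (count_space A) H"
    if "\<And>k. k \<in> A \<Longrightarrow> norm (H k) \<le> G k" for H :: "'i \<Rightarrow> complex"
  proof -
    have "Infinite_Set_Sum.abs_summable_on H A" using abs[OF that] by (simp add: abs_summable_equivalent[symmetric])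
    then show ?thesis using infsetsum_infsum[of H A] by (simp add: Infinite_Set_Sum.abs_summable_on_def infsetsum_def)
  qed
  have "(\<lambda>k. norm (G k)) summable_on A"
    using G by (rule summable_on_cong[THEN iffD1, rotated]) (simp add: G0)
  then have Gi: "integrable (count_space A) G"
    by (simp only: abs_summable_equivalent Infinite_Set_Sum.abs_summable_on_def)
  have "(\<lambda>n. integral\<^sup>L (count_space A) (F n)) \<longlonglongrightarrow> integral\<^sup>L (count_space A) L"
    by (rule integral_dominated_convergence[OF _ _ Gi])
      (use lim bound in \<open>auto simp: AE_count_space\<close>)
  then show ?thesis using int[of L, OF L] int[of "F _", OF bound] by simp
qed

lemma absolutely_continuous_on_cmult:
  assumes "absolutely_continuous_on a b f"
  shows "absolutely_continuous_on a b (\<lambda>t. c * f t)"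
  unfolding absolutely_continuous_on_def
proof (intro allI impI)
  fix \<epsilon> :: real assume "\<epsilon> > 0"
  then have e: "\<epsilon> / (norm c + 1) > 0" using norm_ge_zero[of c] by (simp add: add_nonneg_pos)
  obtain \<eta> where \<eta>: "\<eta> > 0"
    "\<forall>(I :: nat set) u v. finite I \<longrightarrow> (\<forall>i\<in>I. a \<le> u i \<and> u i \<le> v i \<and> v i \<le> b) \<longrightarrow>
       (\<forall>i\<in>I. \<forall>j\<in>I. i \<noteq> j \<longrightarrow> {u i<..<v i} \<inter> {u j<..<v j} = {}) \<longrightarrow>
       (\<Sum>i\<in>I. v i - u i) < \<eta> \<longrightarrow> (\<Sum>i\<in>I. norm (f (v i) - f (u i))) < \<epsilon> / (norm c + 1)"
    by (rule absolutely_continuous_on_family[OF assms e, where 'i = nat]) (rule that)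
  have "(\<Sum>i<n. norm (c * f (v i) - c * f (u i))) < \<epsilon>"
    if uv: "\<forall>i<n. a \<le> u i \<and> u i \<le> v i \<and> v i \<le> b"
      "\<forall>i<n. \<forall>j<n. i \<noteq> j \<longrightarrow> {u i<..<v i} \<inter> {u j<..<v j} = {}"
      "(\<Sum>i<n. v i - u i) < \<eta>" for n :: nat and u v
  proof -
    have S: "(\<Sum>i<n. norm (f (v i) - f (u i))) < \<epsilon> / (norm c + 1)"
      using \<eta>(2)[THEN spec[of _ "{..<n}"], THEN spec[of _ u], THEN spec[of _ v]] uv by simp
    have "(\<Sum>i<n. norm (c * f (v i) - c * f (u i))) = norm c * (\<Sum>i<n. norm (f (v i) - f (u i)))"
      by (simp add: sum_distrib_left norm_mult[symmetric] right_diff_distrib)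
    also have "\<dots> \<le> (norm c + 1) * (\<Sum>i<n. norm (f (v i) - f (u i)))"
      by (intro mult_right_mono sum_nonneg) auto
    also have "\<dots> < (norm c + 1) * (\<epsilon> / (norm c + 1))"
      using S by (intro mult_strict_left_mono) (simp_all add: add_nonneg_pos)
    also have "\<dots> = \<epsilon>"
      using e \<open>\<epsilon> > 0\<close> by (metis less_numeral_extra(3) nonzero_mult_div_cancel_left times_divide_eq_right divide_eq_0_iff)
    finally show ?thesis .
  qed
  with \<eta>(1) show "\<exists>\<eta>>0. \<forall>(n::nat) u v. (\<forall>i<n. a \<le> u i \<and> u i \<le> v i \<and> v i \<le> b) \<longrightarrow>
        (\<forall>i<n. \<forall>j<n. i \<noteq> j \<longrightarrow> {u i<..<v i} \<inter> {u j<..<v j} = {}) \<longrightarrow>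
        (\<Sum>i<n. v i - u i) < \<eta> \<longrightarrow> (\<Sum>i<n. norm (c * f (v i) - c * f (u i))) < \<epsilon>"
    by (intro exI[of _ \<eta>]) simp
qed

lemma absolutely_continuous_on_of_real: "absolutely_continuous_on a b complex_of_real"
  unfolding absolutely_continuous_on_def
proof (intro allI impI)
  fix \<epsilon> :: real assume "\<epsilon> > 0"
  moreover have "(\<Sum>i<n. norm (complex_of_real (v i) - complex_of_real (u i))) = (\<Sum>i<n. v i - u i)"
    if "\<forall>i<n. a \<le> u i \<and> u i \<le> v i \<and> v i \<le> b" for n :: nat and u v
    using that by (intro sum.cong refl) (simp flip: of_real_diff add: norm_of_real)
  ultimately show "\<exists>\<eta>>0. \<forall>(n::nat) u v. (\<forall>i<n. a \<le> u i \<and> u i \<le> v i \<and> v i \<le> b) \<longrightarrow>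
        (\<forall>i<n. \<forall>j<n. i \<noteq> j \<longrightarrow> {u i<..<v i} \<inter> {u j<..<v j} = {}) \<longrightarrow>
        (\<Sum>i<n. v i - u i) < \<eta> \<longrightarrow> (\<Sum>i<n. norm (complex_of_real (v i) - complex_of_real (u i))) < \<epsilon>"
    by (intro exI[of _ \<epsilon>]) simp
qed

lemma absolutely_continuous_on_mult_Lipschitz:
  assumes f: "absolutely_continuous_on a b f"
    and C: "\<And>x y. \<lbrakk>x \<in> {a..b}; y \<in> {a..b}\<rbrakk> \<Longrightarrow> norm (C y - C x) \<le> K * \<bar>y - x\<bar>"
  shows "absolutely_continuous_on a b (\<lambda>t. f t * C t)"
proof (cases "a \<le> b")
  case True
  have cf: "continuous_on {a..b} f" by (rule absolutely_continuous_on_imp_continuous_on[OF f])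
  obtain M where "\<forall>z\<in>f ` {a..b}. norm z \<le> M"
    using compact_imp_bounded[OF compact_continuous_image[OF cf compact_Icc]] unfolding bounded_iff by blast
  then have M: "norm (f t) \<le> M" if "t \<in> {a..b}" for t using that by blast
  have K: "0 \<le> K * (b - a)" using C[of a b] True by (intro order_trans[OF norm_ge_zero[of "C b - C a"]]) simp
  have Cb: "norm (C t) \<le> norm (C a) + K * (b - a)" if "t \<in> {a..b}" for t
  proof (cases "a = b")
    case True
    then show ?thesis using that by simp
  next
    case False
    then have "0 \<le> K" using K True by (simp add: zero_le_mult_iff)
    then have "K * \<bar>t - a\<bar> \<le> K * (b - a)" using that by (intro mult_left_mono) auto
    then show ?thesis using C[of a t] that True norm_triangle_sub[of "C t" "C a"] by simp
  qed
  define N where "N = norm (C a) + K * (b - a)"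
  have N: "0 \<le> N" using K by (simp add: N_def)
  have M0: "0 \<le> M" using M[of a] True by (intro order_trans[OF norm_ge_zero[of "f a"]]) simp
  show ?thesis
  proof (rule absolutely_continuous_on_dominated[OF absolutely_continuous_on_cmult[OF f, of "complex_of_real N"]
        absolutely_continuous_on_cmult[OF absolutely_continuous_on_of_real, of _ _ "complex_of_real (M * K)"]])
    fix x y assume xy: "a \<le> x" "x \<le> y" "y \<le> b"
    have K0: "0 \<le> K * \<bar>y - x\<bar>" using C[of x y] xy by (intro order_trans[OF norm_ge_zero[of "C y - C x"]]) simp
    have "f y * C y - f x * C x = (f y - f x) * C y + f x * (C y - C x)" by (simp add: algebra_simps)
    then have "norm (f y * C y - f x * C x) \<le> norm (f y - f x) * norm (C y) + norm (f x) * norm (C y - C x)"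
      by (metis norm_mult norm_triangle_ineq)
    also have "\<dots> \<le> norm (f y - f x) * N + M * (K * \<bar>y - x\<bar>)"
      using Cb[of y] M[of x] C[of x y] xy M0 unfolding N_def by (intro add_mono mult_mono) auto
    also have "norm (f y - f x) * N = norm (complex_of_real N * f y - complex_of_real N * f x)"
      using N by (simp add: norm_mult mult.commute flip: right_diff_distrib)
    also have "M * (K * \<bar>y - x\<bar>) = norm (complex_of_real (M * K) * complex_of_real y - complex_of_real (M * K) * complex_of_real x)"
    proof -
      have "norm (complex_of_real (M * K) * complex_of_real y - complex_of_real (M * K) * complex_of_real x) = \<bar>M * (K * (y - x))\<bar>"
        by (simp only: right_diff_distrib[symmetric] of_real_diff[symmetric] of_real_mult[symmetric] norm_of_real mult.assoc)
      also have "\<dots> = M * (K * (y - x))"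
      proof (rule abs_of_nonneg, rule mult_nonneg_nonneg[OF M0])
        show "0 \<le> K * (y - x)" using K0 xy by simp
      qed
      finally show ?thesis using xy by simp
    qed
    finally show "norm (f y * C y - f x * C x) \<le> norm (complex_of_real N * f y - complex_of_real N * f x) +
        norm (complex_of_real (M * K) * complex_of_real y - complex_of_real (M * K) * complex_of_real x)" .
  qed
next
  case False
  then have "{a..b} = {}" by simp
  show ?thesis unfolding absolutely_continuous_on_def
  proof (intro allI impI exI conjI)
    fix \<epsilon> :: real and n :: nat and u v assume "\<epsilon> > 0" "\<forall>i<n. a \<le> u i \<and> u i \<le> v i \<and> v i \<le> b"
    then have "n = 0" using False by (metis gr0I order_trans)
    then show "(\<Sum>i<n. norm (f (v i) * C (v i) - f (u i) * C (u i))) < \<epsilon>" using \<open>\<epsilon> > 0\<close> by simp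
  qed (rule zero_less_one)
qed

text \<open>The product \<open>f C\<close> is absolutely continuous since \<open>C\<close> is Lipschitz, and at almost every point its
  derivative is given by the product rule.\<close>

lemma absolutely_continuous_integration_by_parts:
  fixes f g C c :: "real \<Rightarrow> complex"
  assumes b: "b > 0" and f: "absolutely_continuous_on 0 b f"
    and g: "negligible {x \<in> {0<..<b}. \<not> (f has_vector_derivative g x) (at x)}"
    and C: "\<And>x. x \<in> {0..b} \<Longrightarrow> (C has_vector_derivative c x) (at x)" and c: "\<And>x. x \<in> {0..b} \<Longrightarrow> norm (c x) \<le> K"
  shows "((\<lambda>t. g t * C t + f t * c t) has_integral (f b * C b - f 0 * C 0)) {0..b}"
proof -
  have Lip: "norm (C y - C x) \<le> K * \<bar>y - x\<bar>" if "x \<in> {0..b}" "y \<in> {0..b}" for x y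
  proof -
    have "norm (C y - C x) \<le> K * norm (y - x)"
    proof (rule differentiable_bound[of "{0..b}" C "\<lambda>x r. r *\<^sub>R c x"])
      fix x assume "x \<in> {0..b}"
      then show "(C has_derivative (\<lambda>r. r *\<^sub>R c x)) (at x within {0..b})"
        using C by (auto simp: has_vector_derivative_def intro: has_derivative_at_withinI)
      show "onorm (\<lambda>r. r *\<^sub>R c x) \<le> K"
      proof (rule onorm_le)
        show "norm (r *\<^sub>R c x) \<le> K * norm r" for r
          using mult_right_mono[OF c[OF \<open>x \<in> {0..b}\<close>], of "\<bar>r\<bar>"] by (simp add: mult.commute)
      qed
    qed (use that in auto)
    then show ?thesis by simp
  qed
  obtain q where q: "\<And>x. x \<in> {0..b} \<Longrightarrow> (q has_integral (f x * C x - f 0 * C 0)) {0..x}"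
    "negligible {x \<in> {0<..<b}. \<not> ((\<lambda>t. f t * C t) has_vector_derivative q x) (at x)}"
    using absolutely_continuous_on_FTC[OF b absolutely_continuous_on_mult_Lipschitz[OF f Lip]] by blast
  let ?N = "{x \<in> {0<..<b}. \<not> (f has_vector_derivative g x) (at x)} \<union>
      {x \<in> {0<..<b}. \<not> ((\<lambda>t. f t * C t) has_vector_derivative q x) (at x)} \<union> {0, b}"
  show ?thesis
  proof (rule has_integral_spike[OF _ _ q(1)])
    show "negligible ?N" by (intro negligible_Un g q(2)) auto
    fix x assume x: "x \<in> {0..b} - ?N"
    then have "x \<in> {0<..<b}" by auto
    then have "(f has_vector_derivative g x) (at x)" "((\<lambda>t. f t * C t) has_vector_derivative q x) (at x)"
      using x by auto
    from has_vector_derivative_mult[OF this(1) C[of x]] this(2)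
    show "g x * C x + f x * c x = q x"
      using x vector_derivative_unique_at by (fastforce simp: add.commute)
  qed (use b in auto)
qed

lemma continuous_periodic_bounded:
  fixes b :: "real \<Rightarrow> complex"
  assumes b: "continuous_on UNIV b" and per: "periodic_2pi b"
  obtains K where "\<And>t. norm (b t) \<le> K"
proof -
  have "bounded (b ` {0..2*pi})"
    by (intro compact_imp_bounded compact_continuous_image compact_Icc continuous_on_subset[OF b]) auto
  then obtain K where "\<forall>z\<in>b ` {0..2*pi}. norm z \<le> K" unfolding bounded_iff by blast
  then have K: "norm (b t) \<le> K" if "t \<in> {0..2*pi}" for t using that by blast
  show thesis
  proof (rule that)
    fix t
    obtain k :: int where k: "0 \<le> t - of_int k * (2 * pi)" "t - of_int k * (2 * pi) < 2 * pi"
      using periodic_reduce[of "2 * pi" t] by auto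
    have "b t = b (t - of_int k * (2 * pi))"
      using periodic_add_int[of b "2 * pi" "t - of_int k * (2 * pi)" k] per by (simp add: periodic_2pi_def)
    then show "norm (b t) \<le> K" using K[of "t - of_int k * (2 * pi)"] k by simp
  qed
qed

lemma periodic_absolutely_continuous_continuous:
  assumes per: "periodic_2pi f" and ac: "absolutely_continuous_on 0 (2 * pi) f"
  shows "continuous_on UNIV f"
proof -
  have c0: "continuous_on {0..2*pi} f" by (rule absolutely_continuous_on_imp_continuous_on[OF ac])
  have shift: "continuous_on {of_int k * (2 * pi)..of_int (k + 1) * (2 * pi)} f" for k :: int
  proof -
    have "continuous_on {of_int k * (2 * pi)..of_int (k + 1) * (2 * pi)} (\<lambda>t. f (t - of_int k * (2 * pi)))"
      by (rule continuous_on_compose2[OF c0]) (auto intro!: continuous_intros simp: algebra_simps)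
    moreover have "f (t - of_int k * (2 * pi)) = f t" for t
      using periodic_add_int[of f "2 * pi" "t - of_int k * (2 * pi)" k] per by (simp add: periodic_2pi_def)
    ultimately show ?thesis by simp
  qed
  have "continuous (at t) f" for t
  proof -
    obtain k :: int where k: "0 \<le> t - of_int k * (2 * pi)" "t - of_int k * (2 * pi) < 2 * pi"
      using periodic_reduce[of "2 * pi" t] by auto
    have "continuous_on ({of_int (k - 1) * (2 * pi)..of_int (k - 1 + 1) * (2 * pi)} \<union> {of_int k * (2 * pi)..of_int (k + 1) * (2 * pi)}) f"
      by (intro continuous_on_closed_Un shift closed_atLeastAtMost)
    then have "continuous_on {of_int (k - 1) * (2 * pi)<..<of_int (k + 1) * (2 * pi)} f"
      by (rule continuous_on_subset) (auto simp: algebra_simps)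
    moreover have "t \<in> {of_int (k - 1) * (2 * pi)<..<of_int (k + 1) * (2 * pi)}"
      using k pi_gt_zero by (simp add: algebra_simps)
    ultimately show ?thesis by (simp add: continuous_on_eq_continuous_at)
  qed
  then show ?thesis by (simp add: continuous_at_imp_continuous_on)
qed

lemma bounded_symbol_continuous_periodic:
  assumes "continuous_on UNIV b" "periodic_2pi b"
  shows "bounded_symbol b"
  using continuous_periodic_bounded[OF assms] borel_measurable_continuous_onI[OF assms(1)]
  unfolding bounded_symbol_def by metis

lemma integral_circle_continuous:
  fixes \<phi> :: "real \<Rightarrow> complex"
  assumes \<phi>: "continuous_on UNIV \<phi>"
  shows "(\<integral>t. \<phi> t \<partial>circle_measure) = (1 / (2 * pi)) *\<^sub>R integral {0..2*pi} \<phi>"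
proof -
  have m: "\<phi> \<in> borel_measurable borel" by (rule borel_measurable_continuous_onI[OF \<phi>])
  have "set_integrable lborel {0..2*pi} \<phi>"
    by (rule borel_integrable_atLeastAtMost'[OF continuous_on_subset[OF \<phi>]]) simp
  then show ?thesis
    unfolding integral_circle_measure[OF m] set_integral_Ico_Icc(1)[OF m]
    by (simp only: set_borel_integral_eq_integral(2))
qed

lemma integral_continuous_periodic_shift:
  fixes b :: "real \<Rightarrow> complex"
  assumes b: "continuous_on UNIV b" and per: "periodic_2pi b"
  shows "integral {a..a + 2 * pi} b = integral {0..2 * pi} b"
proof -
  have "b integrable_on {0..2 * pi}"
    by (rule integrable_continuous_interval[OF continuous_on_subset[OF b]]) simp
  then have "(b has_integral integral {0..2*pi} b) {0..2*pi}" by (rule integrable_integral)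
  from has_integral_periodic_shift[of b "2 * pi" _ a, OF _ _ this] show ?thesis
    using per by (simp add: periodic_2pi_def integral_unique)
qed

lemma fourier_coeff_shift:
  fixes b :: "real \<Rightarrow> complex"
  assumes b: "continuous_on UNIV b" and per: "periodic_2pi b"
  shows "fourier_coeff (\<lambda>t. b (t - h)) k = exp (- (\<i> * of_int k * of_real h)) * fourier_coeff b k"
proof -
  have c1: "continuous_on UNIV (\<lambda>t. cnj (fourier_mode k t) * b t)"
    by (intro continuous_intros continuous_fourier_mode b)
  have c2: "continuous_on UNIV (\<lambda>t. cnj (fourier_mode k t) * b (t - h))"
    by (intro continuous_intros continuous_fourier_mode continuous_on_compose2[OF b]) auto
  have per': "periodic_2pi (\<lambda>t. cnj (fourier_mode k t) * b t)"
  proof -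
    have "fourier_mode k (t + 2 * pi) = fourier_mode k t" for t
      using exp_integer_2pi[of "of_int k"] by (simp add: fourier_mode_def algebra_simps exp_add)
    then show ?thesis using per by (simp add: periodic_2pi_def)
  qed
  have mode: "cnj (fourier_mode k t) = cnj (fourier_mode k h) * cnj (fourier_mode k (t - h))" for t
    by (simp add: fourier_mode_def exp_cnj exp_add[symmetric] algebra_simps)
  have "integral {0..2*pi} (\<lambda>t. cnj (fourier_mode k t) * b (t - h))
      = integral {0..2*pi} (\<lambda>t. cnj (fourier_mode k h) * (cnj (fourier_mode k (t - h)) * b (t - h)))"
    by (subst mode) (simp add: mult.assoc)
  also have "\<dots> = cnj (fourier_mode k h) * integral {0..2*pi} (\<lambda>t. cnj (fourier_mode k (t - h)) * b (t - h))"
    by (rule integral_mult_right)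
  also have "integral {0..2*pi} (\<lambda>t. cnj (fourier_mode k (t - h)) * b (t - h))
      = integral {- h..- h + 2*pi} (\<lambda>t. cnj (fourier_mode k t) * b t)"
    using integral_shift_real_ivl[of "-h" "-h" "- h + 2*pi" "\<lambda>t. cnj (fourier_mode k t) * b t"]
    by (simp add: algebra_simps)
  also have "\<dots> = integral {0..2*pi} (\<lambda>t. cnj (fourier_mode k t) * b t)"
    by (rule integral_continuous_periodic_shift[OF c1 per'])
  finally have "integral {0..2*pi} (\<lambda>t. cnj (fourier_mode k t) * b (t - h))
      = cnj (fourier_mode k h) * integral {0..2*pi} (\<lambda>t. cnj (fourier_mode k t) * b t)" .
  moreover have "cnj (fourier_mode k h) = exp (- (\<i> * of_int k * of_real h))"
    by (simp add: fourier_mode_def exp_cnj)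
  ultimately show ?thesis
    unfolding fourier_coeff_eq_integral integral_circle_continuous[OF c1] integral_circle_continuous[OF c2]
    by (simp add: scaleR_conv_of_real)
qed

lemma Parseval_circle:
  assumes f: "bounded_symbol f" and c: "bounded_symbol c"
  shows "((\<lambda>k. fourier_coeff f (- k) * fourier_coeff c k) has_sum (\<integral>t. f t * c t \<partial>circle_measure)) UNIV"
proof -
  have sq: "sq_integrable a" if "bounded_symbol a" for a
    using sq_integrable_symbol_mult(1)[OF that sq_integrable_fourier_mode[of 0]] by (simp add: fourier_mode_def)
  have cf: "bounded_symbol (\<lambda>t. cnj (f t))" by (rule bounded_symbol_cnj[OF f])
  let ?x = "abs_circle_L2 (\<lambda>t. cnj (f t))" and ?y = "abs_circle_L2 c"
  have "((\<lambda>e. cinner ?x e * cinner e ?y) has_sum cinner ?x ?y) (range fourier_basis)"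
    by (rule Parseval[OF is_onb_fourier_basis])
  then have "((\<lambda>k. cinner ?x (fourier_basis k) * cinner (fourier_basis k) ?y) has_sum cinner ?x ?y) UNIV"
    by (subst (asm) has_sum_reindex) (auto simp: o_def inj_def fourier_basis_inj)
  moreover have "cinner ?x (fourier_basis k) = fourier_coeff f (- k)" for k
    by (simp add: fourier_basis_def cinner_abs_circle_L2 sq cf sq_integrable_fourier_mode fourier_coeff_eq_integral cnj_fourier_mode mult.commute)
  moreover have "cinner (fourier_basis k) ?y = fourier_coeff c k" for k
    by (simp add: fourier_basis_def cinner_abs_circle_L2 sq c sq_integrable_fourier_mode fourier_coeff_eq_integral)
  moreover have "cinner ?x ?y = (\<integral>t. f t * c t \<partial>circle_measure)"
    by (simp add: cinner_abs_circle_L2 sq cf c)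
  ultimately show ?thesis by simp
qed

lemma absolutely_integrable_mult_continuous:
  fixes g c :: "real \<Rightarrow> complex"
  assumes "g absolutely_integrable_on {a..b}" "continuous_on {a..b} c"
  shows "(\<lambda>t. g t * c t) absolutely_integrable_on {a..b}"
proof -
  have "(\<lambda>t. c t * g t) absolutely_integrable_on {a..b}"
  proof (rule absolutely_integrable_bounded_measurable_product[OF bilinear_times])
    show "c \<in> borel_measurable (lebesgue_on {a..b})"
      by (rule continuous_imp_measurable_on_sets_lebesgue[OF assms(2)]) simp
    show "bounded (c ` {a..b})" by (intro compact_imp_bounded compact_continuous_image assms(2) compact_Icc)
  qed (use assms in auto)
  then show ?thesis by (simp add: mult.commute)
qed

text \<open>Parseval's identity for \<open>f'\<close> and \<open>b\<close> is not available, because \<open>f'\<close> is merely integrable. Instead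
  \<open>b\<close> is replaced by its means \<open>C n\<close> over intervals of length \<open>h n\<close>. Their derivatives \<open>c n\<close> are difference
  quotients of \<open>b\<close>, so integration by parts moves the derivative off \<open>f\<close> and Parseval's identity
  applies to \<open>f\<close> and \<open>c n\<close>. As \<open>h n\<close> tends to \<open>0\<close>, the integrals converge because the means converge
  boundedly. The Fourier coefficients of \<open>c n\<close> are those of \<open>b\<close> times \<open>(1 - exp (- \<i> k h)) / h\<close>, a
  factor that is at most \<open>\<bar>k\<bar>\<close> in modulus and tends to \<open>\<i> k\<close>, so the assumed summability dominates.\<close>

lemma fourier_derivative_pairing:
  fixes f g b :: "real \<Rightarrow> complex"
  assumes f: "periodic_2pi f" "absolutely_continuous_on 0 (2 * pi) f"
    and g: "g absolutely_integrable_on {0..2 * pi}"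
      "negligible {x \<in> {0<..<2 * pi}. \<not> (f has_vector_derivative g x) (at x)}"
    and b: "continuous_on UNIV b" "periodic_2pi b"
    and d: "((\<lambda>k::int. of_int k * fourier_coeff f k * fourier_coeff b (- k)) has_sum d) UNIV"
  shows "d = 1 / (2 * of_real pi * \<i>) * integral {0..2 * pi} (\<lambda>t. g t * b t)"
proof -
  have fc: "continuous_on UNIV f" by (rule periodic_absolutely_continuous_continuous[OF f])
  obtain K where K: "\<And>t. norm (b t) \<le> K" using continuous_periodic_bounded[OF b] by blast
  define h where "h n = inverse (real (Suc n))" for n
  have h: "0 < h n" "h n \<le> 1" for n by (simp_all add: h_def divide_simps)
  have h0: "h \<longlonglongrightarrow> 0" unfolding h_def by (rule LIMSEQ_inverse_real_of_nat)
  \<comment> \<open>the base point \<open>-8\<close> keeps \<open>[-1, 2\<pi>]\<close> inside an interval where \<open>B\<close> is a primitive\<close>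
  define B where "B v = integral {-8..v} b" for v
  have pi8: "2 * pi < 8" using pi_less_4 by simp
  have B: "(B has_vector_derivative b v) (at v)" if "v \<in> {-8<..<8}" for v
  proof -
    have "(B has_vector_derivative b v) (at v within {-8..8})"
      unfolding B_def by (rule integral_has_vector_derivative[OF continuous_on_subset[OF b(1)]]) (use that in auto)
    then show ?thesis using that at_within_Icc_at[of "-8" v 8] by simp
  qed
  have Bdiff: "B y - B x = integral {x..y} b" if "-8 \<le> x" "x \<le> y" for x y
  proof -
    have "integral {-8..x} b + integral {x..y} b = integral {-8..y} b"
      using that by (intro Henstock_Kurzweil_Integration.integral_combine integrable_continuous_interval continuous_on_subset[OF b(1)]) auto
    then show ?thesis unfolding B_def by (metis add_diff_cancel_left')
  qed
  define C where "C n v = (B v - B (v - h n)) / of_real (h n)" for n v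
  define c where "c n v = (b v - b (v - h n)) / of_real (h n)" for n v
  have Cderiv: "(C n has_vector_derivative c n v) (at v)" if v: "v \<in> {0..2*pi}" for n v
  proof -
    have "v - h n \<in> {-8<..<8}" "v \<in> {-8<..<8}" using v h[of n] pi8 by auto
    note B1 = B[OF this(1)] and B2 = B[OF this(2)]
    have "((\<lambda>v. v - h n) has_vector_derivative 1) (at v)" by (auto intro!: derivative_eq_intros)
    from vector_diff_chain_at[OF this, of B "b (v - h n)"] B1
    have "((\<lambda>v. B (v - h n)) has_vector_derivative b (v - h n)) (at v)" by (simp add: o_def)
    from has_vector_derivative_diff[OF B2 this]
    have "((\<lambda>v. (1 / of_real (h n)) * (B v - B (v - h n))) has_vector_derivative (1 / of_real (h n)) * (b v - b (v - h n))) (at v)"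
      by (rule has_vector_derivative_mult_right)
    then show ?thesis by (simp add: C_def[abs_def] c_def)
  qed
  have ccont: "continuous_on UNIV (c n)" for n
    unfolding c_def using h(1)[of n] by (intro continuous_intros b(1) continuous_on_compose2[OF b(1)]) auto
  have cper: "periodic_2pi (c n)" for n
    using b(2) unfolding periodic_2pi_def c_def by (metis add_diff_eq diff_add_eq)
  have "\<exists>K. \<forall>t. norm (c n t) \<le> K" for n
  proof -
    obtain K where "\<And>t. norm (c n t) \<le> K"
      using continuous_periodic_bounded[OF ccont[of n] cper[of n]] by blast
    then show ?thesis by blast
  qed
  then obtain Kc where Kc: "\<And>n t. norm (c n t) \<le> Kc n" by metis
  have Ccont: "continuous_on {0..2*pi} (C n)" for n
    using Cderiv by (intro continuous_at_imp_continuous_on ballI) (blast intro: has_vector_derivative_continuous)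
  have ends: "f (2*pi) * C n (2*pi) - f 0 * C n 0 = 0" for n
  proof -
    have "B (2*pi) - B (2*pi - h n) = integral {2*pi - h n..2*pi} b" using h[of n] pi_gt_zero by (intro Bdiff) linarith+
    also have "\<dots> = integral {- h n..0} (\<lambda>t. b (t + 2*pi))"
      using integral_shift_real_ivl[of "2*pi - h n" "2*pi" "2*pi" b] by simp
    also have "\<dots> = integral {- h n..0} b" using b(2) by (simp add: periodic_2pi_def)
    also have "\<dots> = B 0 - B (0 - h n)" using h[of n] Bdiff[of "- h n" 0] by simp
    finally have "C n (2*pi) = C n 0" by (simp add: C_def)
    moreover have "f (2*pi) = f 0" using f(1) by (metis add_0 periodic_2pi_def)
    ultimately show ?thesis by simp
  qed
  have parts: "((\<lambda>t. g t * C n t + f t * c n t) has_integral 0) {0..2*pi}" for n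
    using absolutely_continuous_integration_by_parts[OF _ f(2) g(2) Cderiv Kc, of n] by (simp add: ends)
  have gC: "(\<lambda>t. g t * C n t) integrable_on {0..2*pi}" for n
    using absolutely_integrable_mult_continuous[OF g(1) Ccont] by (simp add: absolutely_integrable_on_def)
  have fcint: "integral {0..2*pi} (\<lambda>t. f t * c n t) = - integral {0..2*pi} (\<lambda>t. g t * C n t)" for n
  proof -
    have "((\<lambda>t. (g t * C n t + f t * c n t) - g t * C n t) has_integral (0 - integral {0..2*pi} (\<lambda>t. g t * C n t))) {0..2*pi}"
      by (intro has_integral_diff parts integrable_integral gC)
    then show ?thesis by (simp add: integral_unique)
  qed
  have Cbound: "norm (C n v) \<le> K" if v: "v \<in> {0..2*pi}" for n v
  proof -
    have "B v - B (v - h n) = integral {v - h n..v} b" using v h[of n] by (intro Bdiff) auto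
    moreover have "(b has_integral integral {v - h n..v} b) {v - h n..v}"
      by (intro integrable_integral integrable_continuous_interval continuous_on_subset[OF b(1)]) auto
    then have "norm (integral {v - h n..v} b) \<le> K * measure lborel {v - h n..v}"
      using K order_trans[OF norm_ge_zero K] by (intro has_integral_bound_real) auto
    ultimately have "norm (B v - B (v - h n)) \<le> K * h n" using h[of n] by simp
    then show ?thesis using h[of n] by (simp add: C_def norm_divide divide_le_eq)
  qed
  have Clim: "(\<lambda>n. C n v) \<longlonglongrightarrow> b v" if v: "v \<in> {0..2*pi}" for v
  proof (rule LIMSEQ_I)
    fix e :: real assume "e > 0"
    have "v \<in> {-8<..<8}" using v pi8 by auto
    from B[OF this] \<open>e > 0\<close> obtain dd where dd: "dd > 0"
      "\<And>y. norm (y - v) < dd \<Longrightarrow> norm (B y - B v - (y - v) *\<^sub>R b v) \<le> e / 2 * norm (y - v)"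
      unfolding has_vector_derivative_def has_derivative_at_alt by (metis half_gt_zero)
    obtain N where N: "\<And>n. n \<ge> N \<Longrightarrow> norm (h n - 0) < dd" using LIMSEQ_D[OF h0 dd(1)] by blast
    have "norm (C n v - b v) < e" if "n \<ge> N" for n
    proof -
      have "norm (B (v - h n) - B v - (- h n) *\<^sub>R b v) \<le> e / 2 * h n"
        using dd(2)[of "v - h n"] N[OF that] h[of n] by simp
      moreover have "norm (C n v - b v) = norm (B (v - h n) - B v - (- h n) *\<^sub>R b v) / h n"
      proof -
        have "C n v - b v = - ((B (v - h n) - B v - (- h n) *\<^sub>R b v) / of_real (h n))"
          using h[of n] by (simp add: C_def field_simps scaleR_conv_of_real)
        then show ?thesis using h[of n] by (simp only: norm_minus_cancel norm_divide norm_of_real abs_of_pos)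
      qed
      ultimately have "norm (C n v - b v) \<le> e / 2"
        using h[of n] by (simp only: divide_le_eq) simp
      then show ?thesis using \<open>e > 0\<close> by simp
    qed
    then show "\<exists>N. \<forall>n\<ge>N. norm (C n v - b v) < e" by blast
  qed
  have "(\<lambda>n. integral {0..2*pi} (\<lambda>t. g t * C n t)) \<longlonglongrightarrow> integral {0..2*pi} (\<lambda>t. g t * b t)"
  proof (rule dominated_convergence(2))
    show "(\<lambda>t. K * norm (g t)) integrable_on {0..2*pi}"
      using g(1) by (intro integrable_on_mult_right) (simp add: absolutely_integrable_on_def)
    show "norm (g t * C n t) \<le> K * norm (g t)" if "t \<in> {0..2*pi}" for t n
      using mult_right_mono[OF Cbound[OF that, of n] norm_ge_zero[of "g t"]] by (simp add: norm_mult mult.commute)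
    show "(\<lambda>n. g t * C n t) \<longlonglongrightarrow> g t * b t" if "t \<in> {0..2*pi}" for t
      by (intro tendsto_intros Clim that)
  qed (rule gC)
  then have lim1: "(\<lambda>n. \<integral>t. f t * c n t \<partial>circle_measure) \<longlonglongrightarrow> (1 / (2 * pi)) *\<^sub>R (- integral {0..2*pi} (\<lambda>t. g t * b t))"
    using fcint by (subst integral_circle_continuous) (auto intro!: tendsto_intros continuous_intros fc ccont)
  have coeff: "fourier_coeff (c n) k = (1 - exp (- (\<i> * of_int k * of_real (h n)))) / of_real (h n) * fourier_coeff b k" for n k
  proof -
    have i1: "integrable circle_measure (\<lambda>t. cnj (fourier_mode k t) * b t)"
      "integrable circle_measure (\<lambda>t. cnj (fourier_mode k t) * b (t - h n))"
    proof -
      have sq: "sq_integrable a" if "bounded_symbol a" for a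
        using sq_integrable_symbol_mult(1)[OF that sq_integrable_fourier_mode[of 0]] by (simp add: fourier_mode_def)
      have "bounded_symbol b" by (rule bounded_symbol_continuous_periodic[OF b])
      moreover have "bounded_symbol (\<lambda>t. b (t - h n))"
        by (rule bounded_symbol_continuous_periodic)
          (use b(2) in \<open>auto intro!: continuous_on_compose2[OF b(1)] continuous_intros simp: periodic_2pi_def diff_add_eq[symmetric]\<close>)
      ultimately show "integrable circle_measure (\<lambda>t. cnj (fourier_mode k t) * b t)"
        "integrable circle_measure (\<lambda>t. cnj (fourier_mode k t) * b (t - h n))"
        by (auto intro!: sq_integrable_mult sq sq_integrable_fourier_mode)
    qed
    have "fourier_coeff (c n) k = (\<integral>t. (cnj (fourier_mode k t) * b t - cnj (fourier_mode k t) * b (t - h n)) / of_real (h n) \<partial>circle_measure)"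
      unfolding fourier_coeff_eq_integral c_def by (simp add: right_diff_distrib)
    also have "\<dots> = (fourier_coeff b k - fourier_coeff (\<lambda>t. b (t - h n)) k) / of_real (h n)"
      using i1 by (simp add: fourier_coeff_eq_integral)
    finally show ?thesis
      unfolding fourier_coeff_shift[OF b] by (simp add: algebra_simps diff_divide_distrib)
  qed
  define G where "G k = norm (of_int (- k) * fourier_coeff f (- k) * fourier_coeff b k)" for k :: int
  define F where "F n k = fourier_coeff f (- k) * fourier_coeff (c n) k" for n k
  define L where "L k = fourier_coeff f (- k) * (\<i> * of_int k * fourier_coeff b k)" for k :: int
  have bij: "bij_betw uminus (UNIV :: int set) UNIV" by (rule bij_betwI[of _ _ _ uminus]) auto
  have d': "((\<lambda>k. of_int (- k) * fourier_coeff f (- k) * fourier_coeff b k) has_sum d) UNIV"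
    using d has_sum_reindex_bij_betw[OF bij, of "\<lambda>k. of_int k * fourier_coeff f k * fourier_coeff b (- k)" d] by simp
  have Gs: "G summable_on UNIV"
    unfolding G_def[abs_def]
    by (rule iffD1[OF summable_on_iff_abs_summable_on_complex has_sum_imp_summable[OF d']])
  have "((\<lambda>k. - \<i> * (of_int (- k) * fourier_coeff f (- k) * fourier_coeff b k)) has_sum (- \<i> * d)) UNIV"
    by (rule has_sum_cmult_right[OF d'])
  then have Lsum: "(L has_sum (- \<i> * d)) UNIV"
    by (rule has_sum_cong[THEN iffD1, rotated]) (simp add: L_def algebra_simps)
  have Fsum: "infsum (F n) UNIV = (\<integral>t. f t * c n t \<partial>circle_measure)" for n
    unfolding F_def[abs_def]
    by (rule infsumI[OF Parseval_circle]) (intro bounded_symbol_continuous_periodic fc f(1) ccont cper)+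
  have "(\<lambda>n. infsum (F n) UNIV) \<longlonglongrightarrow> infsum L UNIV"
  proof (rule tendsto_infsum_dominated[OF Gs])
    fix n k
    have "norm (1 - exp (- (\<i> * of_int k * of_real (h n)))) \<le> \<bar>of_int k\<bar> * h n"
    proof -
      have "norm (exp (\<i> * of_real (- of_int k * h n)) - 1) = 2 * \<bar>sin ((- of_int k * h n) / 2)\<bar>"
        by (rule dist_exp_i_1)
      also have "\<dots> \<le> 2 * \<bar>(- of_int k * h n) / 2\<bar>" by (intro mult_left_mono abs_sin_x_le_abs_x) auto
      also have "\<dots> = \<bar>of_int k\<bar> * h n" using h[of n] by (simp add: abs_mult)
      finally show ?thesis by (simp add: norm_minus_commute mult.assoc)
    qed
    then have "norm ((1 - exp (- (\<i> * of_int k * of_real (h n)))) / of_real (h n)) \<le> \<bar>of_int k\<bar>"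
      using h[of n] by (simp add: norm_divide divide_le_eq)
    from mult_right_mono[OF this, of "norm (fourier_coeff f (- k)) * norm (fourier_coeff b k)"]
    have "norm (fourier_coeff f (- k)) * (norm ((1 - exp (- (\<i> * of_int k * of_real (h n)))) / of_real (h n)) * norm (fourier_coeff b k))
        \<le> \<bar>of_int k\<bar> * norm (fourier_coeff f (- k)) * norm (fourier_coeff b k)"
      by (simp only: mult_ac) simp
    then show "norm (F n k) \<le> G k"
      unfolding F_def G_def coeff norm_mult by simp
  next
    fix k
    have "((\<lambda>z. exp (- (\<i> * of_int k * z))) has_field_derivative - (\<i> * of_int k)) (at 0)"
      by (auto intro!: derivative_eq_intros)
    then have D: "((\<lambda>z. (exp (- (\<i> * of_int k * z)) - 1) / z) \<longlongrightarrow> - (\<i> * of_int k)) (at 0)"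
      by (simp add: has_field_derivative_iff)
    have "filterlim (\<lambda>n. complex_of_real (h n)) (at 0) sequentially"
    proof (rule filterlim_atI)
      show "(\<lambda>n. complex_of_real (h n)) \<longlonglongrightarrow> 0" using tendsto_of_real[OF h0, where 'a = complex] by simp
      show "\<forall>\<^sub>F n in sequentially. complex_of_real (h n) \<noteq> 0" using h by (simp add: less_imp_neq[symmetric])
    qed
    from filterlim_compose[OF D this]
    have "(\<lambda>n. - ((exp (- (\<i> * of_int k * of_real (h n))) - 1) / of_real (h n))) \<longlonglongrightarrow> - (- (\<i> * of_int k))"
      by (rule tendsto_minus)
    then have "(\<lambda>n. (1 - exp (- (\<i> * of_int k * of_real (h n)))) / of_real (h n)) \<longlonglongrightarrow> \<i> * of_int k"
      by (simp add: minus_divide_left)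
    then show "(\<lambda>n. F n k) \<longlonglongrightarrow> L k"
      unfolding F_def L_def coeff by (intro tendsto_intros)
  qed
  then have "(\<lambda>n. \<integral>t. f t * c n t \<partial>circle_measure) \<longlonglongrightarrow> - \<i> * d"
    using Lsum by (simp add: Fsum infsumI)
  then have "- \<i> * d = (1 / (2 * pi)) *\<^sub>R (- integral {0..2*pi} (\<lambda>t. g t * b t))"
    using lim1 LIMSEQ_unique by blast
  then have "\<i> * (- \<i> * d) = \<i> * ((1 / (2 * pi)) *\<^sub>R (- integral {0..2*pi} (\<lambda>t. g t * b t)))" by simp
  then show ?thesis by (simp add: scaleR_conv_of_real field_simps)
qed

section \<open>The heat trace as an integral\<close>

text \<open>The series over \<open>n\<close> is summed under the integral sign, where it is the exponential series for
  \<open>exp (- s \<bar>f\<bar>\<^sup>2) - 1\<close> divided by \<open>f\<close>. At a zero of \<open>f\<close> all terms vanish, in accordance with the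
  value of a quotient by zero.\<close>

lemma heat_trace_integral:
  assumes f: "periodic_2pi f" "absolutely_continuous_on 0 (2 * pi) f" "krein_symbol f"
    and g: "g absolutely_integrable_on {0..2 * pi}"
      "negligible {x \<in> {0<..<2 * pi}. \<not> (f has_vector_derivative g x) (at x)}"
  shows "trace_op (heat_difference (toeplitz f) s) =
    - 1 / (2 * of_real pi * \<i>) * integral {0..2 * pi} (\<lambda>t. of_real (1 - exp (- s * (norm (f t))\<^sup>2)) * (g t / f t))"
proof -
  have fc: "continuous_on UNIV f" by (rule periodic_absolutely_continuous_continuous[OF f(1,2)])
  obtain M0 where M0: "\<And>t. norm (f t) \<le> M0" using continuous_periodic_bounded[OF fc f(1)] by blast
  \<comment> \<open>\<open>M \<ge> 1\<close> allows \<open>\<bar>f\<bar>^(2n+1)\<close> to be bounded by an even power of \<open>M\<close>\<close>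
  define M where "M = max 1 M0"
  have M: "1 \<le> M" "\<And>t. norm (f t) \<le> M" using M0 by (auto simp: M_def intro: max.coboundedI2)
  define b where "b n t = cnj (f t) * (f t * cnj (f t)) ^ n" for n t
  define a where "a n = (- s) ^ Suc n / fact (Suc n)" for n
  obtain d where d1: "\<And>n. ((\<lambda>k::int. of_int k * fourier_coeff f k * fourier_coeff (b n) (- k)) has_sum d n) UNIV"
    and d2: "((\<lambda>n. complex_of_real (a n) * d n) has_sum trace_op (heat_difference (toeplitz f) s)) UNIV"
    using toeplitz_heat_trace(3)[OF f(3)] unfolding a_def b_def by blast
  have bc: "continuous_on S (b n)" for n S
    unfolding b_def by (intro continuous_intros continuous_on_subset[OF fc]) auto
  have bp: "periodic_2pi (b n)" for n using f(1) by (simp add: periodic_2pi_def b_def)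
  have d: "d n = 1 / (2 * of_real pi * \<i>) * integral {0..2 * pi} (\<lambda>t. g t * b n t)" for n
    by (rule fourier_derivative_pairing[OF f(1,2) g bc bp d1])
  have gb: "(\<lambda>t. g t * b n t) absolutely_integrable_on {0..2 * pi}" for n
    by (rule absolutely_integrable_mult_continuous[OF g(1) bc])
  then have gbi: "(\<lambda>t. g t * b n t) integrable_on {0..2 * pi}" for n
    by (rule set_lebesgue_integral_eq_integral(1))
  define S where "S N t = (\<Sum>n<N. complex_of_real (a n) * b n t)" for N t
  have Si: "(\<lambda>t. g t * S N t) integrable_on {0..2 * pi}"
    and Sint: "integral {0..2 * pi} (\<lambda>t. g t * S N t) = (\<Sum>n<N. complex_of_real (a n) * integral {0..2 * pi} (\<lambda>t. g t * b n t))" for N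
  proof -
    have eq: "(\<lambda>t. g t * S N t) = (\<lambda>t. \<Sum>n<N. complex_of_real (a n) * (g t * b n t))"
      by (simp add: S_def sum_distrib_left mult.left_commute)
    show "(\<lambda>t. g t * S N t) integrable_on {0..2 * pi}"
      unfolding eq by (intro integrable_sum integrable_on_mult_right gbi) auto
    show "integral {0..2 * pi} (\<lambda>t. g t * S N t) = (\<Sum>n<N. complex_of_real (a n) * integral {0..2 * pi} (\<lambda>t. g t * b n t))"
      unfolding eq by (subst integral_sum) (auto intro!: integrable_on_mult_right gbi)
  qed
  have exps: "(\<lambda>n. (- (s * r)) ^ Suc n / fact (Suc n)) sums (exp (- (s * r)) - 1)" for r :: real
  proof -
    have "(\<lambda>n. (- (s * r)) ^ n / fact n) sums exp (- (s * r))"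
      using exp_converges[of "- (s * r)"] by (simp add: divide_inverse mult.commute)
    then show ?thesis by (subst sums_Suc_iff) simp
  qed
  have fb: "f t * (complex_of_real (a n) * b n t) = complex_of_real ((- (s * (norm (f t))\<^sup>2)) ^ Suc n / fact (Suc n))" for n t
  proof -
    have "f t * b n t = complex_of_real (((norm (f t))\<^sup>2) ^ Suc n)"
    proof -
      have "f t * b n t = (f t * cnj (f t)) ^ Suc n" by (simp add: b_def)
      then show ?thesis by (simp add: complex_norm_square[symmetric])
    qed
    then have "f t * (complex_of_real (a n) * b n t) = complex_of_real (a n * ((norm (f t))\<^sup>2) ^ Suc n)"
      by (simp add: mult.left_commute)
    also have "a n * ((norm (f t))\<^sup>2) ^ Suc n = (- (s * (norm (f t))\<^sup>2)) ^ Suc n / fact (Suc n)"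
      unfolding a_def minus_mult_left power_mult_distrib by simp
    finally show ?thesis .
  qed
  have Slim: "(\<lambda>N. S N t) \<longlonglongrightarrow> complex_of_real (exp (- (s * (norm (f t))\<^sup>2)) - 1) / f t" for t
  proof (cases "f t = 0")
    case True
    then show ?thesis by (simp add: S_def b_def)
  next
    case False
    have "(\<lambda>N. \<Sum>n<N. complex_of_real ((- (s * (norm (f t))\<^sup>2)) ^ Suc n / fact (Suc n))) \<longlonglongrightarrow> complex_of_real (exp (- (s * (norm (f t))\<^sup>2)) - 1)"
      using sums_of_real[OF exps] unfolding sums_def .
    then have "(\<lambda>N. f t * S N t) \<longlonglongrightarrow> complex_of_real (exp (- (s * (norm (f t))\<^sup>2)) - 1)"
      unfolding S_def sum_distrib_left fb .
    then have "(\<lambda>N. f t * S N t / f t) \<longlonglongrightarrow> complex_of_real (exp (- (s * (norm (f t))\<^sup>2)) - 1) / f t"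
      using False by (rule tendsto_divide[OF _ tendsto_const])
    then show ?thesis using False by simp
  qed
  have Sb: "norm (S N t) \<le> exp (\<bar>s\<bar> * M\<^sup>2)" for N t
  proof -
    have "norm (complex_of_real (a n) * b n t) \<le> (\<bar>s\<bar> * M\<^sup>2) ^ Suc n / fact (Suc n)" for n
    proof -
      have "norm (b n t) = norm (f t) ^ Suc (2 * n)"
        by (simp add: b_def norm_mult norm_power power_mult power2_eq_square)
      also have "\<dots> \<le> M ^ Suc (2 * n)" using M by (intro power_mono) auto
      also have "\<dots> \<le> M ^ (2 * Suc n)" using M(1) by (intro power_increasing) auto
      finally have "norm (b n t) \<le> (M\<^sup>2) ^ Suc n" by (simp only: power_mult)
      then have "\<bar>a n\<bar> * norm (b n t) \<le> \<bar>a n\<bar> * (M\<^sup>2) ^ Suc n" by (intro mult_left_mono) auto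
      also have "\<bar>a n\<bar> * (M\<^sup>2) ^ Suc n = (\<bar>s\<bar> * M\<^sup>2) ^ Suc n / fact (Suc n)"
        unfolding a_def power_mult_distrib by (simp add: power_abs abs_mult)
      finally show ?thesis by (simp only: norm_mult norm_of_real)
    qed
    then have "norm (S N t) \<le> (\<Sum>n<N. (\<bar>s\<bar> * M\<^sup>2) ^ Suc n / fact (Suc n))"
      unfolding S_def by (intro sum_norm_le) auto
    also have "\<dots> \<le> (\<Sum>n<Suc N. (\<bar>s\<bar> * M\<^sup>2) ^ n / fact n)"
      by (subst sum.lessThan_Suc_shift) simp
    also have "\<dots> \<le> exp (\<bar>s\<bar> * M\<^sup>2)"
    proof -
      have e: "(\<lambda>n. (\<bar>s\<bar> * M\<^sup>2) ^ n / fact n) sums exp (\<bar>s\<bar> * M\<^sup>2)"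
        using exp_converges[of "\<bar>s\<bar> * M\<^sup>2"] by (simp add: divide_inverse mult.commute)
      have "(\<Sum>n<Suc N. (\<bar>s\<bar> * M\<^sup>2) ^ n / fact n) \<le> (\<Sum>n. (\<bar>s\<bar> * M\<^sup>2) ^ n / fact n)"
        by (rule sum_le_suminf) (use e in \<open>auto simp: sums_iff\<close>)
      with e show ?thesis by (simp add: sums_iff)
    qed
    finally show ?thesis .
  qed
  have "(\<lambda>N. integral {0..2 * pi} (\<lambda>t. g t * S N t)) \<longlonglongrightarrow>
      integral {0..2 * pi} (\<lambda>t. g t * (complex_of_real (exp (- (s * (norm (f t))\<^sup>2)) - 1) / f t))"
  proof (rule dominated_convergence(2))
    show "(\<lambda>t. exp (\<bar>s\<bar> * M\<^sup>2) * norm (g t)) integrable_on {0..2 * pi}"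
      using g(1) by (intro integrable_on_mult_right) (simp add: absolutely_integrable_on_def)
    show "norm (g t * S N t) \<le> exp (\<bar>s\<bar> * M\<^sup>2) * norm (g t)" for N t
      unfolding norm_mult using mult_left_mono[OF Sb norm_ge_zero[of "g t"], of N t] by (simp only: mult.commute)
    show "(\<lambda>N. g t * S N t) \<longlonglongrightarrow> g t * (complex_of_real (exp (- (s * (norm (f t))\<^sup>2)) - 1) / f t)" for t
      by (intro tendsto_mult tendsto_const Slim)
  qed (rule Si)
  then have "(\<lambda>N. 1 / (2 * of_real pi * \<i>) * integral {0..2 * pi} (\<lambda>t. g t * S N t)) \<longlonglongrightarrow>
      1 / (2 * of_real pi * \<i>) * integral {0..2 * pi} (\<lambda>t. g t * (complex_of_real (exp (- (s * (norm (f t))\<^sup>2)) - 1) / f t))"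
    by (rule tendsto_mult[OF tendsto_const])
  then have "(\<lambda>N. \<Sum>n<N. complex_of_real (a n) * d n) \<longlonglongrightarrow>
      1 / (2 * of_real pi * \<i>) * integral {0..2 * pi} (\<lambda>t. g t * (complex_of_real (exp (- (s * (norm (f t))\<^sup>2)) - 1) / f t))"
    (is "_ \<longlonglongrightarrow> ?L")
  proof -
    have "(\<lambda>N. 1 / (2 * of_real pi * \<i>) * integral {0..2 * pi} (\<lambda>t. g t * S N t)) = (\<lambda>N. \<Sum>n<N. complex_of_real (a n) * d n)"
      unfolding Sint d sum_distrib_left by (simp add: mult.left_commute)
    then show "(\<lambda>N. 1 / (2 * of_real pi * \<i>) * integral {0..2 * pi} (\<lambda>t. g t * S N t)) \<longlonglongrightarrow> ?L \<Longrightarrow> ?thesis" by (simp only:)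
  qed
  moreover have "(\<lambda>N. \<Sum>n<N. complex_of_real (a n) * d n) \<longlonglongrightarrow> trace_op (heat_difference (toeplitz f) s)"
    using has_sum_imp_sums[OF d2] unfolding sums_def .
  ultimately have "trace_op (heat_difference (toeplitz f) s) = 1 / (2 * of_real pi * \<i>) *
      integral {0..2 * pi} (\<lambda>t. g t * (complex_of_real (exp (- (s * (norm (f t))\<^sup>2)) - 1) / f t))"
    by (rule LIMSEQ_unique[rotated])
  also have "(\<lambda>t. g t * (complex_of_real (exp (- (s * (norm (f t))\<^sup>2)) - 1) / f t)) =
      (\<lambda>t. - (of_real (1 - exp (- s * (norm (f t))\<^sup>2)) * (g t / f t)))"
    by (simp add: fun_eq_iff algebra_simps diff_divide_distrib)
  finally show ?thesis by (simp add: integral_neg)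
qed

section \<open>Symmetric cut-offs at a simple pole\<close>

lemma C1_within_Lipschitz:
  fixes h :: "real \<Rightarrow> 'b::real_normed_vector"
  assumes "C1_within h {a..b}"
  obtains K where "\<And>x y. \<lbrakk>x \<in> {a..b}; y \<in> {a..b}\<rbrakk> \<Longrightarrow> norm (h y - h x) \<le> K * \<bar>y - x\<bar>"
proof -
  obtain h' where h': "continuous_on {a..b} h'" "\<And>t. t \<in> {a..b} \<Longrightarrow> (h has_vector_derivative h' t) (at t within {a..b})"
    using assms unfolding C1_within_def by blast
  have "bounded (h' ` {a..b})" by (intro compact_imp_bounded compact_continuous_image h'(1) compact_Icc)
  then obtain K where "\<forall>z\<in>h' ` {a..b}. norm z \<le> K" unfolding bounded_iff by blast
  then have K: "norm (h' t) \<le> K" if "t \<in> {a..b}" for t using that by blast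
  show thesis
  proof (rule that)
    fix x y assume xy: "x \<in> {a..b}" "y \<in> {a..b}"
    have "norm (h y - h x) \<le> K * norm (y - x)"
    proof (rule differentiable_bound[of "{a..b}" h "\<lambda>x r. r *\<^sub>R h' x"])
      fix x assume x: "x \<in> {a..b}"
      then show "(h has_derivative (\<lambda>r. r *\<^sub>R h' x)) (at x within {a..b})"
        using h'(2) by (simp add: has_vector_derivative_def)
      show "onorm (\<lambda>r. r *\<^sub>R h' x) \<le> K"
      proof (rule onorm_le)
        show "norm (r *\<^sub>R h' x) \<le> K * norm r" for r
          using mult_right_mono[OF K[OF x], of "\<bar>r\<bar>"] by (simp add: mult.commute)
      qed
    qed (use xy in auto)
    then show "norm (h y - h x) \<le> K * \<bar>y - x\<bar>" by simp
  qed
qed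

lemma Lipschitz_continuous_on:
  fixes h :: "real \<Rightarrow> 'b::real_normed_vector"
  assumes "\<And>x y. \<lbrakk>x \<in> S; y \<in> S\<rbrakk> \<Longrightarrow> norm (h y - h x) \<le> K * \<bar>y - x\<bar>"
  shows "continuous_on S h"
proof (rule lipschitz_on_continuous_on[of "\<bar>K\<bar>"], rule lipschitz_onI)
  fix x y assume "x \<in> S" "y \<in> S"
  from assms[OF this] have "norm (h y - h x) \<le> K * \<bar>y - x\<bar>" .
  also have "\<dots> \<le> \<bar>K\<bar> * \<bar>y - x\<bar>" by (intro mult_right_mono) auto
  finally show "dist (h x) (h y) \<le> \<bar>K\<bar> * dist x y" by (simp add: dist_norm norm_minus_commute abs_minus_commute)
qed simp

lemma exp_minus_diff_le:
  fixes x y :: real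
  shows "\<bar>exp (- x) - exp (- y)\<bar> \<le> \<bar>x - y\<bar> * exp (- min x y)"
proof -
  have *: "exp (- x) - exp (- y) \<le> (y - x) * exp (- x)" if "x \<le> y" for x y :: real
  proof -
    have "1 + (x - y) \<le> exp (x - y)" by (rule exp_ge_add_one_self)
    then have "exp (- x) * (1 - exp (x - y)) \<le> exp (- x) * (y - x)" using exp_ge_zero[of "- x"] by (intro mult_left_mono) linarith+
    then show ?thesis by (simp add: algebra_simps exp_add[symmetric])
  qed
  show ?thesis
  proof (cases "x \<le> y")
    case True
    then show ?thesis using *[OF True] by (simp add: min_def)
  next
    case False
    then show ?thesis using *[of y x] by (simp add: min_def)
  qed
qed

lemma mult_exp_minus_le:
  fixes c x :: real
  assumes "c > 0"
  shows "x * exp (- (c * x)) \<le> 1 / c"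
proof -
  have "c * x \<le> exp (c * x)" using exp_ge_add_one_self[of "c * x"] by linarith
  then have "c * x * exp (- (c * x)) \<le> exp (c * x) * exp (- (c * x))" by (intro mult_right_mono) auto
  also have "\<dots> = 1" by (simp add: exp_minus)
  finally show ?thesis using assms by (simp add: field_simps)
qed

lemma tendsto_at_top_nonneg_sequentially:
  fixes F :: "real \<Rightarrow> 'b::first_countable_topology"
  assumes "\<And>X :: nat \<Rightarrow> real. (\<And>n. 0 \<le> X n) \<Longrightarrow> filterlim X at_top sequentially \<Longrightarrow> (\<lambda>n. F (X n)) \<longlonglongrightarrow> L"
  shows "(F \<longlongrightarrow> L) at_top"
proof -
  have "((\<lambda>s. F (max 0 s)) \<longlongrightarrow> L) at_top"
  proof (rule tendsto_at_topI_sequentially)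
    fix X :: "nat \<Rightarrow> real" assume X: "filterlim X at_top sequentially"
    have "filterlim (\<lambda>n. max 0 (X n)) at_top sequentially"
      by (rule filterlim_at_top_mono[OF X]) auto
    then show "(\<lambda>n. F (max 0 (X n))) \<longlonglongrightarrow> L" by (intro assms) auto
  qed
  moreover have "\<forall>\<^sub>F s in at_top. F (max 0 s) = F s"
    using eventually_ge_at_top[of "0::real"] by eventually_elim (simp add: max_def)
  ultimately show ?thesis by (rule Lim_transform_eventually)
qed

lemma lmeasurable_Ioc: "{a<..b::real} \<in> lmeasurable"
proof (rule bounded_set_imp_lmeasurable)
  show "bounded {a<..b}" by (rule bounded_subset[OF bounded_closed_interval[of a b]]) auto
qed auto

lemma integrable_on_Ioc_bounded_continuous:
  fixes q :: "real \<Rightarrow> complex"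
  assumes "continuous_on {0<..r} q" "\<And>u. u \<in> {0<..r} \<Longrightarrow> norm (q u) \<le> K"
  shows "q integrable_on {0<..r}"
proof -
  have "q absolutely_integrable_on {0<..r}"
  proof (rule measurable_bounded_by_integrable_imp_absolutely_integrable)
    show "q \<in> borel_measurable (lebesgue_on {0<..r})"
      by (rule continuous_imp_measurable_on_sets_lebesgue[OF assms(1)]) simp
    show "(\<lambda>u. K) integrable_on {0<..r}"
      by (rule integrable_on_const[OF lmeasurable_Ioc])
  qed (use assms in auto)
  then show ?thesis by (simp add: absolutely_integrable_on_def)
qed

lemma integral_Ioc_Icc:
  fixes q :: "real \<Rightarrow> complex"
  shows "integral {0<..r} q = integral {0..r} q" "q integrable_on {0<..r} \<longleftrightarrow> q integrable_on {0..r}"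
proof -
  have "{0<..r} - {0..r} \<union> ({0..r} - {0<..r}) \<subseteq> {0}" by auto
  then have n1: "negligible ({0<..r} - {0..r})" "negligible ({0..r} - {0<..r})"
    using negligible_subset[OF negligible_sing[of "0::real"]] by auto
  show "integral {0<..r} q = integral {0..r} q"
    by (rule integral_spike_set) (auto intro: negligible_subset[OF n1(1)] negligible_subset[OF n1(2)])
  show "q integrable_on {0<..r} \<longleftrightarrow> q integrable_on {0..r}"
    by (rule integrable_spike_set_eq) (simp add: negligible_Un n1 Un_commute)
qed

text \<open>The function \<open>q\<close> is bounded, as \<open>G\<close> is Lipschitz. For the cut-off with weights
  \<open>1 - E1\<close> at \<open>u\<close> and \<open>1 - E2\<close> at \<open>-u\<close> the integrand is \<open>(1 - E1) q u + (E2 - E1) G(-u) / u\<close>. With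
  \<open>x = s (u powr \<beta>)\<close> and a lower bound \<open>c\<close> of \<open>H\<close> the difference of the weights is at most
  \<open>x \<bar>H(u) - H(-u)\<bar> exp (- c x)\<close>. Here \<open>x exp (- c x)\<close> is bounded and the Lipschitz condition on \<open>H\<close>
  provides the factor \<open>u\<close> that cancels the pole. So the bound \<open>K\<close> is uniform in \<open>s\<close>.\<close>

lemma symmetric_cutoff_limit:
  fixes G :: "real \<Rightarrow> complex" and H :: "real \<Rightarrow> real" and \<beta> :: real
  assumes r: "r > 0"
    and G: "\<And>x y. \<lbrakk>x \<in> {-r..r}; y \<in> {-r..r}\<rbrakk> \<Longrightarrow> norm (G y - G x) \<le> KG * \<bar>y - x\<bar>"
    and H: "\<And>x y. \<lbrakk>x \<in> {-r..r}; y \<in> {-r..r}\<rbrakk> \<Longrightarrow> norm (H y - H x) \<le> KH * \<bar>y - x\<bar>"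
    and Hpos: "\<And>x. x \<in> {-r..r} \<Longrightarrow> H x > 0"
  defines "q \<equiv> \<lambda>u. (G u - G (- u)) / complex_of_real u"
    and "Q \<equiv> \<lambda>s u. (complex_of_real (1 - exp (- s * (u powr \<beta> * H u))) * G u -
                    complex_of_real (1 - exp (- s * (u powr \<beta> * H (- u)))) * G (- u)) / complex_of_real u"
  shows "((\<lambda>\<epsilon>. integral {\<epsilon>..r} q) \<longlongrightarrow> integral {0..r} q) (at_right 0)"
    "((\<lambda>s. integral {0..r} (Q s)) \<longlongrightarrow> integral {0..r} q) at_top"
proof -
  have cG: "continuous_on {-r..r} G" and cH: "continuous_on {-r..r} H"
    using Lipschitz_continuous_on[of "{-r..r}" G KG] Lipschitz_continuous_on[of "{-r..r}" H KH] G H by auto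
  have cG': "continuous_on {0<..r} G" "continuous_on {0<..r} (\<lambda>u. G (- u))"
    and cH': "continuous_on {0<..r} H" "continuous_on {0<..r} (\<lambda>u. H (- u))"
    by (auto intro!: continuous_on_compose2[OF cG] continuous_on_compose2[OF cH] continuous_intros
        intro: continuous_on_subset[OF cG] continuous_on_subset[OF cH])
  have "bounded (G ` {-r..r})" by (intro compact_imp_bounded compact_continuous_image cG compact_Icc)
  then obtain M where "\<forall>z\<in>G ` {-r..r}. norm z \<le> M" unfolding bounded_iff by blast
  then have M: "norm (G x) \<le> M" if "x \<in> {-r..r}" for x using that by blast
  obtain x0 where x0: "x0 \<in> {-r..r}" "\<And>x. x \<in> {-r..r} \<Longrightarrow> H x0 \<le> H x"
    using continuous_attains_inf[OF compact_Icc _ cH] r by auto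
  define c where "c = H x0"
  have c: "c > 0" "\<And>x. x \<in> {-r..r} \<Longrightarrow> c \<le> H x" using x0 Hpos by (auto simp: c_def)
  have M0: "0 \<le> M" using order_trans[OF norm_ge_zero M[of 0]] r by simp
  have KG0: "0 \<le> KG" using order_trans[OF norm_ge_zero G[of 0 r]] r by (simp add: zero_le_mult_iff)
  have KH0: "0 \<le> KH" using order_trans[OF norm_ge_zero H[of 0 r]] r by (simp add: zero_le_mult_iff)
  have qb: "norm (q u) \<le> 2 * KG" if "u \<in> {0<..r}" for u
    using G[of "- u" u] that by (simp add: q_def norm_divide divide_le_eq algebra_simps)
  have qc: "continuous_on {0<..r} q"
    unfolding q_def by (intro continuous_intros cG') auto
  have qi: "q integrable_on {0<..r}" by (rule integrable_on_Ioc_bounded_continuous[OF qc qb])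
  then have qi': "q integrable_on {0..r}" by (simp add: integral_Ioc_Icc)
  have "continuous_on {0..r} (\<lambda>x. integral {x..r} q)" by (rule indefinite_integral_continuous_1'[OF qi'])
  then have "((\<lambda>\<epsilon>. integral {\<epsilon>..r} q) \<longlongrightarrow> integral {0..r} q) (at 0 within {0..r})"
    using r by (simp add: continuous_on_def)
  then show "((\<lambda>\<epsilon>. integral {\<epsilon>..r} q) \<longlongrightarrow> integral {0..r} q) (at_right 0)"
    using r by (simp add: at_within_Icc_at_right)
  define K where "K = 4 * KG + M * (2 * KH) / c"
  have Qb: "norm (Q s u) \<le> K" if s: "s \<ge> 0" and u: "u \<in> {0<..r}" for s u
  proof -
    define E1 where "E1 = exp (- (s * (u powr \<beta> * H u)))"
    define E2 where "E2 = exp (- (s * (u powr \<beta> * H (- u))))"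
    define x where "x = s * u powr \<beta>"
    have u': "u > 0" "u \<in> {-r..r}" "- u \<in> {-r..r}" using u by auto
    have x0: "x \<ge> 0" using s by (simp add: x_def)
    have E1: "0 \<le> E1" "E1 \<le> 1" using s Hpos[OF u'(2)] by (auto simp: E1_def intro!: mult_nonneg_nonneg)
    have split: "Q s u = complex_of_real (1 - E1) * q u + complex_of_real (E2 - E1) * (G (- u) / complex_of_real u)"
      using u' by (simp add: Q_def q_def E1_def E2_def field_simps)
    have "norm (complex_of_real (1 - E1) * q u) \<le> 1 * (2 * KG)"
      unfolding norm_mult norm_of_real using E1 qb[OF u] by (intro mult_mono) auto
    moreover have "norm (complex_of_real (E2 - E1) * (G (- u) / complex_of_real u)) \<le> M * (2 * KH) / c"
    proof -
      have "\<bar>E2 - E1\<bar> \<le> \<bar>s * (u powr \<beta> * H (- u)) - s * (u powr \<beta> * H u)\<bar> * exp (- min (s * (u powr \<beta> * H (- u))) (s * (u powr \<beta> * H u)))"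
        unfolding E1_def E2_def by (rule exp_minus_diff_le)
      also have "\<bar>s * (u powr \<beta> * H (- u)) - s * (u powr \<beta> * H u)\<bar> = x * \<bar>H (- u) - H u\<bar>"
        using s by (simp add: x_def right_diff_distrib[symmetric] abs_mult mult.assoc)
      also have "x * \<bar>H (- u) - H u\<bar> * exp (- min (s * (u powr \<beta> * H (- u))) (s * (u powr \<beta> * H u))) \<le> x * (KH * (2 * u)) * exp (- (c * x))"
      proof (intro mult_mono)
        show "\<bar>H (- u) - H u\<bar> \<le> KH * (2 * u)" using H[OF u'(2,3)] u'(1) by simp
        have "c * x \<le> H (- u) * x" "c * x \<le> H u * x" using c(2) u' x0 by (auto intro!: mult_right_mono)
        then show "exp (- min (s * (u powr \<beta> * H (- u))) (s * (u powr \<beta> * H u))) \<le> exp (- (c * x))"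
          by (simp add: x_def mult_ac)
      qed (use x0 KH0 u' in auto)
      also have "\<dots> = (KH * (2 * u)) * (x * exp (- (c * x)))" by simp
      also have "\<dots> \<le> (KH * (2 * u)) * (1 / c)"
        using KH0 u' by (intro mult_left_mono mult_exp_minus_le c(1)) auto
      finally have "\<bar>E2 - E1\<bar> \<le> (KH * (2 * u)) * (1 / c)" .
      moreover have "norm (G (- u) / complex_of_real u) \<le> M / u"
        using M[OF u'(3)] u' by (simp add: norm_divide divide_right_mono)
      ultimately have "\<bar>E2 - E1\<bar> * norm (G (- u) / complex_of_real u) \<le> ((KH * (2 * u)) * (1 / c)) * (M / u)"
        using KH0 u' c(1) by (intro mult_mono) auto
      also have "\<dots> = M * (2 * KH) / c" using u' by simp
      finally show ?thesis by (simp only: norm_mult norm_of_real)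
    qed
    ultimately have "norm (Q s u) \<le> 1 * (2 * KG) + M * (2 * KH) / c"
      unfolding split by (intro norm_triangle_le) linarith
    then show ?thesis using KG0 by (simp add: K_def)
  qed
  have Qc: "continuous_on {0<..r} (Q s)" for s
    unfolding Q_def by (intro continuous_intros cG' cH') auto
  show "((\<lambda>s. integral {0..r} (Q s)) \<longlongrightarrow> integral {0..r} q) at_top"
    unfolding integral_Ioc_Icc(1)[symmetric]
  proof (rule tendsto_at_top_nonneg_sequentially)
    fix X :: "nat \<Rightarrow> real" assume X: "\<And>n. 0 \<le> X n" "filterlim X at_top sequentially"
    show "(\<lambda>n. integral {0<..r} (Q (X n))) \<longlonglongrightarrow> integral {0<..r} q"
    proof (rule dominated_convergence(2))
      show "Q (X n) integrable_on {0<..r}" for n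
        by (rule integrable_on_Ioc_bounded_continuous[OF Qc Qb[OF X(1)]])
      show "(\<lambda>u. K) integrable_on {0<..r}"
        by (rule integrable_on_const[OF lmeasurable_Ioc])
      show "norm (Q (X n) u) \<le> K" if "u \<in> {0<..r}" for n u by (rule Qb[OF X(1) that])
      show "(\<lambda>n. Q (X n) u) \<longlonglongrightarrow> q u" if u: "u \<in> {0<..r}" for u
      proof -
        have e: "(\<lambda>n. exp (- X n * w)) \<longlonglongrightarrow> 0" if "w > 0" for w
        proof -
          have "filterlim (\<lambda>n. X n * w) at_top sequentially"
            by (rule filterlim_at_top_mult_tendsto_pos[OF tendsto_const that X(2)])
          then have "filterlim (\<lambda>n. - (X n * w)) at_bot sequentially" by (simp add: filterlim_uminus_at_top)
          from filterlim_compose[OF exp_at_bot this] show ?thesis by simp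
        qed
        have "u powr \<beta> * H u > 0" "u powr \<beta> * H (- u) > 0" using u Hpos by auto
        note e[OF this(1)] e[OF this(2)]
        then have "(\<lambda>n. Q (X n) u) \<longlonglongrightarrow> (complex_of_real (1 - 0) * G u - complex_of_real (1 - 0) * G (- u)) / complex_of_real u"
          unfolding Q_def using u by (intro tendsto_intros) auto
        then show ?thesis by (simp add: q_def)
      qed
    qed
  qed
qed

section \<open>Arcs around the zeros\<close>

lemma arcs_around_Un: "arcs_around Z \<rho> = (\<Union>z\<in>Z. arcs_around {z} \<rho>)"
  by (auto simp: arcs_around_def)

lemma open_arcs_around: "open (arcs_around Z \<rho>)"
proof -
  have "arcs_around Z \<rho> = (\<Union>z\<in>Z. \<Union>k::int. ball (z + 2 * pi * of_int k) \<rho>)"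
    by (simp add: arcs_around_def set_eq_iff dist_norm abs_minus_commute diff_diff_eq)
  then show ?thesis by auto
qed

lemma arcs_around_mono: "\<rho> \<le> \<rho>' \<Longrightarrow> arcs_around Z \<rho> \<subseteq> arcs_around Z \<rho>'"
  unfolding arcs_around_def by (intro Collect_mono impI) (meson less_le_trans)

lemma arcs_around_periodic: "t + 2 * pi \<in> arcs_around Z \<rho> \<longleftrightarrow> t \<in> arcs_around Z \<rho>"
proof
  assume "t + 2 * pi \<in> arcs_around Z \<rho>"
  then obtain z k where "z \<in> Z" "\<bar>t + 2 * pi - z - 2 * pi * of_int k\<bar> < \<rho>" by (auto simp: arcs_around_def)
  then have "z \<in> Z" "\<bar>t - z - 2 * pi * of_int (k - 1)\<bar> < \<rho>" by (simp_all add: algebra_simps)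
  then show "t \<in> arcs_around Z \<rho>" unfolding arcs_around_def by blast
next
  assume "t \<in> arcs_around Z \<rho>"
  then obtain z k where "z \<in> Z" "\<bar>t - z - 2 * pi * of_int k\<bar> < \<rho>" by (auto simp: arcs_around_def)
  then have "z \<in> Z" "\<bar>t + 2 * pi - z - 2 * pi * of_int (k + 1)\<bar> < \<rho>" by (simp_all add: algebra_simps)
  then show "t + 2 * pi \<in> arcs_around Z \<rho>" unfolding arcs_around_def by blast
qed

lemma mem_arc_iff:
  assumes "\<bar>u\<bar> \<le> pi" "\<rho> \<le> pi"
  shows "z + u \<in> arcs_around {z} \<rho> \<longleftrightarrow> \<bar>u\<bar> < \<rho>"
proof
  assume "z + u \<in> arcs_around {z} \<rho>"
  then obtain k :: int where k: "\<bar>u - 2 * pi * of_int k\<bar> < \<rho>" by (auto simp: arcs_around_def)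
  show "\<bar>u\<bar> < \<rho>"
  proof (cases "k = 0")
    case False
    then have "1 \<le> \<bar>real_of_int k\<bar>" by linarith
    then have "2 * pi * 1 \<le> 2 * pi * \<bar>real_of_int k\<bar>" by (intro mult_left_mono) auto
    then have "2 * pi \<le> \<bar>2 * pi * real_of_int k\<bar>" by (simp add: abs_mult)
    then show ?thesis using k assms by linarith
  qed (use k in simp)
next
  assume "\<bar>u\<bar> < \<rho>"
  then have "\<bar>z + u - z - 2 * pi * of_int 0\<bar> < \<rho>" by simp
  then show "z + u \<in> arcs_around {z} \<rho>" unfolding arcs_around_def by blast
qed

lemma disjoint_arcs_exist:
  assumes Z: "finite Z" "Z \<subseteq> {0..<2 * pi}"
  obtains \<rho> where "\<rho> > 0" "\<And>z w. z \<in> Z \<Longrightarrow> w \<in> Z \<Longrightarrow> z \<noteq> w \<Longrightarrow> arcs_around {z} \<rho> \<inter> arcs_around {w} \<rho> = {}"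
proof -
  define d where "d p = min \<bar>fst p - snd p\<bar> (2 * pi - \<bar>fst p - snd p\<bar>) / 2" for p :: "real \<times> real"
  define P where "P = {p \<in> Z \<times> Z. fst p \<noteq> snd p}"
  have P: "finite P" using Z(1) by (simp add: P_def)
  define \<rho> where "\<rho> = Min (insert 1 (d ` P))"
  have "\<rho> > 0"
  proof -
    have "d p > 0" if "p \<in> P" for p
    proof -
      have "fst p \<in> {0..<2 * pi}" "snd p \<in> {0..<2 * pi}" using that Z(2) by (auto simp: P_def)
      then show ?thesis using that by (auto simp: P_def d_def)
    qed
    then show ?thesis using P by (simp add: \<rho>_def)
  qed
  moreover have "arcs_around {z} \<rho> \<inter> arcs_around {w} \<rho> = {}" if zw: "z \<in> Z" "w \<in> Z" "z \<noteq> w" for z w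
  proof (rule ccontr)
    assume "\<not> ?thesis"
    then obtain t and j k :: int where t: "\<bar>t - z - 2 * pi * of_int j\<bar> < \<rho>" "\<bar>t - w - 2 * pi * of_int k\<bar> < \<rho>"
      by (auto simp: arcs_around_def)
    have "(z, w) \<in> P" using zw by (simp add: P_def)
    then have "\<rho> \<le> d (z, w)" using P by (simp add: \<rho>_def)
    then have d: "2 * \<rho> \<le> \<bar>z - w\<bar>" "2 * \<rho> \<le> 2 * pi - \<bar>z - w\<bar>" by (simp_all add: d_def)
    define l where "l = k - j"
    have l: "\<bar>z - w - 2 * pi * of_int l\<bar> < 2 * \<rho>" using t by (simp add: l_def algebra_simps)
    show False
    proof (cases "l = 0")
      case False
      then have "1 \<le> \<bar>real_of_int l\<bar>" by linarith
      then have "2 * pi * 1 \<le> 2 * pi * \<bar>real_of_int l\<bar>" by (intro mult_left_mono) auto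
      then have "2 * pi \<le> \<bar>2 * pi * real_of_int l\<bar>" by (simp add: abs_mult)
      then show ?thesis using l d by linarith
    qed (use l d in simp)
  qed
  ultimately show thesis by (rule that)
qed

lemma absolutely_integrable_indicator:
  fixes \<Psi> :: "real \<Rightarrow> 'a::euclidean_space"
  assumes "\<Psi> absolutely_integrable_on A" "S \<in> sets borel" "A \<in> sets borel"
  shows "(\<lambda>t. indicator S t *\<^sub>R \<Psi> t) absolutely_integrable_on A"
proof -
  have "set_integrable lebesgue (A \<inter> S) \<Psi>"
    by (rule set_integrable_subset[OF assms(1)]) (use assms in auto)
  then show ?thesis by (simp add: set_integrable_def indicator_inter_arith)
qed

lemma integral_symmetric_fold:
  fixes \<Psi> :: "real \<Rightarrow> complex"
  assumes c: "0 \<le> c" and i: "\<Psi> integrable_on {z - c..z + c}"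
  shows "integral {z - c..z + c} \<Psi> = integral {0..c} (\<lambda>u. \<Psi> (z + u) + \<Psi> (z - u))"
proof -
  have i1: "\<Psi> integrable_on {z - c..z}" and i2: "\<Psi> integrable_on {z..z + c}"
    using c by (auto intro!: integrable_on_subinterval[OF i])
  have 2: "((\<lambda>u. \<Psi> (u + z)) has_integral integral {z..z + c} \<Psi>) {0..c}"
    using has_integral_shift_real_ivl[OF integrable_integral[OF i2], of z] by simp
  have "((\<lambda>u. \<Psi> (u + z)) has_integral integral {z - c..z} \<Psi>) {-c..0}"
    using has_integral_shift_real_ivl[OF integrable_integral[OF i1], of z] by simp
  then have "((\<lambda>u. \<Psi> (- u + z)) has_integral integral {z - c..z} \<Psi>) {0..c}"
    using has_integral_reflect_real[of "\<lambda>u. \<Psi> (- u + z)" _ c 0] c by simp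
  from has_integral_add[OF 2 this]
  have "((\<lambda>u. \<Psi> (z + u) + \<Psi> (z - u)) has_integral integral {z..z + c} \<Psi> + integral {z - c..z} \<Psi>) {0..c}"
    by (simp add: add.commute)
  then have "integral {0..c} (\<lambda>u. \<Psi> (z + u) + \<Psi> (z - u)) = integral {z..z + c} \<Psi> + integral {z - c..z} \<Psi>"
    by (rule integral_unique)
  moreover have "integral {z - c..z} \<Psi> + integral {z..z + c} \<Psi> = integral {z - c..z + c} \<Psi>"
    by (rule Henstock_Kurzweil_Integration.integral_combine) (use c i in auto)
  ultimately show ?thesis by (simp add: add.commute)
qed

lemma integral_arc:
  fixes \<Psi> :: "real \<Rightarrow> complex"
  assumes per: "\<And>t. \<Psi> (t + 2 * pi) = \<Psi> t" and \<Psi>: "\<Psi> absolutely_integrable_on {0..2 * pi}"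
    and \<rho>: "0 \<le> \<rho>" "\<rho> \<le> pi"
  shows "integral {0..2 * pi} (\<lambda>t. indicator (arcs_around {z} \<rho>) t *\<^sub>R \<Psi> t) =
    integral {0..\<rho>} (\<lambda>u. \<Psi> (z + u) + \<Psi> (z - u))"
proof -
  let ?F = "\<lambda>t. indicator (arcs_around {z} \<rho>) t *\<^sub>R \<Psi> t"
  have perF: "?F (t + 2 * pi) = ?F t" for t by (simp add: per indicator_def arcs_around_periodic)
  have F: "?F absolutely_integrable_on {0..2 * pi}"
    by (rule absolutely_integrable_indicator[OF \<Psi>]) (auto simp: open_arcs_around)
  have "integral {0..2 * pi} ?F = integral {z - pi..z - pi + 2 * pi} ?F"
    by (rule absolutely_integrable_periodic_shift(2)[symmetric, OF perF _ F]) simp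
  also have "z - pi + 2 * pi = z + pi" by simp
  also have "integral {z - pi..z + pi} ?F = integral {z - pi..z + pi} (\<lambda>t. if t \<in> {z - \<rho><..<z + \<rho>} then \<Psi> t else 0)"
  proof (rule integral_cong)
    fix t assume t: "t \<in> {z - pi..z + pi}"
    have "t \<in> arcs_around {z} \<rho> \<longleftrightarrow> \<bar>t - z\<bar> < \<rho>"
    proof -
      have "\<bar>t - z\<bar> \<le> pi" using t by (auto simp: abs_le_iff)
      from mem_arc_iff[OF this \<rho>(2), of z] show ?thesis by simp
    qed
    then show "?F t = (if t \<in> {z - \<rho><..<z + \<rho>} then \<Psi> t else 0)"
      by (auto simp: indicator_def abs_less_iff)
  qed
  also have "\<dots> = integral ({z - \<rho><..<z + \<rho>} \<inter> {z - pi..z + pi}) \<Psi>"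
    by (rule integral_restrict_Int)
  also have "\<dots> = integral {z - \<rho><..<z + \<rho>} \<Psi>"
    using \<rho> by (intro arg_cong2[where f = integral]) auto
  also have "\<dots> = integral {z - \<rho>..z + \<rho>} \<Psi>" by (rule integral_open_interval_real[symmetric])
  also have "\<dots> = integral {0..\<rho>} (\<lambda>u. \<Psi> (z + u) + \<Psi> (z - u))"
  proof (rule integral_symmetric_fold[OF \<rho>(1)])
    have "\<Psi> absolutely_integrable_on {z - pi..z - pi + 2 * pi}"
      by (rule absolutely_integrable_periodic_shift(1)[OF per _ \<Psi>]) simp
    then have "\<Psi> integrable_on {z - pi..z - pi + 2 * pi}" by (rule set_lebesgue_integral_eq_integral(1))
    then show "\<Psi> integrable_on {z - \<rho>..z + \<rho>}" by (rule integrable_on_subinterval) (use \<rho> in auto)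
  qed
  finally show ?thesis .
qed

text \<open>The regularized and the truncated integral are both split in this way into an outer
  part and folded integrals over half an arc at each zero.\<close>

lemma integral_circle_arcs:
  fixes \<Psi> :: "real \<Rightarrow> complex"
  assumes per: "\<And>t. \<Psi> (t + 2 * pi) = \<Psi> t" and \<Psi>: "\<Psi> absolutely_integrable_on {0..2 * pi}"
    and \<rho>: "0 \<le> \<rho>" "\<rho> \<le> pi" and Z: "finite Z"
    and disj: "\<And>z w. z \<in> Z \<Longrightarrow> w \<in> Z \<Longrightarrow> z \<noteq> w \<Longrightarrow> arcs_around {z} \<rho> \<inter> arcs_around {w} \<rho> = {}"
  shows "integral {0..2 * pi} \<Psi> = integral {0..2 * pi} (\<lambda>t. indicator (- arcs_around Z \<rho>) t *\<^sub>R \<Psi> t) +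
    (\<Sum>z\<in>Z. integral {0..\<rho>} (\<lambda>u. \<Psi> (z + u) + \<Psi> (z - u)))"
proof -
  have ind: "indicator (arcs_around Z \<rho>) t = (\<Sum>z\<in>Z. indicator (arcs_around {z} \<rho>) t :: real)" for t
    unfolding arcs_around_Un[of Z] by (rule indicator_UN_disjoint) (use Z disj in \<open>auto simp: disjoint_family_on_def\<close>)
  have split: "\<Psi> t = indicator (- arcs_around Z \<rho>) t *\<^sub>R \<Psi> t + (\<Sum>z\<in>Z. indicator (arcs_around {z} \<rho>) t *\<^sub>R \<Psi> t)" for t
  proof -
    have "indicator (- arcs_around Z \<rho>) t + indicator (arcs_around Z \<rho>) t = (1::real)" by (simp add: indicator_def)
    then have "\<Psi> t = (indicator (- arcs_around Z \<rho>) t + indicator (arcs_around Z \<rho>) t) *\<^sub>R \<Psi> t" by simp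
    then show ?thesis by (simp only: scaleR_add_left ind scaleR_sum_left)
  qed
  have i: "(\<lambda>t. indicator S t *\<^sub>R \<Psi> t) integrable_on {0..2 * pi}" if "S \<in> sets borel" for S
    by (rule set_lebesgue_integral_eq_integral(1)[OF absolutely_integrable_indicator[OF \<Psi> that]]) simp
  have b: "arcs_around {z} \<rho> \<in> sets borel" "- arcs_around Z \<rho> \<in> sets borel" for z
    by (auto simp: open_arcs_around)
  have "integral {0..2 * pi} \<Psi> = integral {0..2 * pi} (\<lambda>t. indicator (- arcs_around Z \<rho>) t *\<^sub>R \<Psi> t + (\<Sum>z\<in>Z. indicator (arcs_around {z} \<rho>) t *\<^sub>R \<Psi> t))"
    using split by (simp only: )
  also have "\<dots> = integral {0..2 * pi} (\<lambda>t. indicator (- arcs_around Z \<rho>) t *\<^sub>R \<Psi> t) +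
      integral {0..2 * pi} (\<lambda>t. \<Sum>z\<in>Z. indicator (arcs_around {z} \<rho>) t *\<^sub>R \<Psi> t)"
    by (intro Henstock_Kurzweil_Integration.integral_add integrable_sum i b Z)
  also have "integral {0..2 * pi} (\<lambda>t. \<Sum>z\<in>Z. indicator (arcs_around {z} \<rho>) t *\<^sub>R \<Psi> t) =
      (\<Sum>z\<in>Z. integral {0..2 * pi} (\<lambda>t. indicator (arcs_around {z} \<rho>) t *\<^sub>R \<Psi> t))"
    by (intro integral_sum Z i b)
  finally show ?thesis by (simp only: integral_arc[OF per \<Psi> \<rho>])
qed

lemma has_vector_derivative_shift:
  fixes f :: "real \<Rightarrow> 'a::real_normed_vector"
  shows "((\<lambda>x. f (x + p)) has_vector_derivative D) (at t) \<longleftrightarrow> (f has_vector_derivative D) (at (t + p))"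
proof -
  have *: "((\<lambda>x. f (x + p)) has_vector_derivative D) (at t)" if "(f has_vector_derivative D) (at (t + p))" for f :: "real \<Rightarrow> 'a" and p t
  proof -
    have "((f \<circ> (\<lambda>x. x + p)) has_vector_derivative (1 *\<^sub>R D)) (at t)"
      by (rule vector_diff_chain_at) (use that in \<open>auto intro!: derivative_eq_intros\<close>)
    then show ?thesis by (simp add: o_def)
  qed
  show ?thesis using *[of f t p] *[of "\<lambda>x. f (x + p)" "t + p" "- p"] by auto
qed

lemma periodic_vector_derivative:
  fixes f :: "real \<Rightarrow> 'a::real_normed_vector"
  assumes "\<And>t. f (t + p) = f t"
  shows "vector_derivative f (at (t + p)) = vector_derivative f (at t)"
proof -
  have "(f has_vector_derivative D) (at (t + p)) \<longleftrightarrow> (f has_vector_derivative D) (at t)" for D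
    using has_vector_derivative_shift[of f p D t] assms by simp
  then show ?thesis by (simp add: vector_derivative_def)
qed

text \<open>The density from the fundamental theorem may be taken to be the derivative itself, with its
  arbitrary values at the points where the function is not differentiable.\<close>

lemma absolutely_continuous_vector_derivative:
  assumes "0 < b" "absolutely_continuous_on 0 b f"
  shows "(\<lambda>t. vector_derivative f (at t)) absolutely_integrable_on {0..b}"
    "negligible {x \<in> {0<..<b}. \<not> (f has_vector_derivative vector_derivative f (at x)) (at x)}"
proof -
  obtain g where g: "g absolutely_integrable_on {0..b}"
    "negligible {x \<in> {0<..<b}. \<not> (f has_vector_derivative g x) (at x)}" (is "negligible ?N")
    using absolutely_continuous_on_FTC[OF assms] by blast
  show "(\<lambda>t. vector_derivative f (at t)) absolutely_integrable_on {0..b}"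
  proof (rule absolutely_integrable_spike[OF g(1)])
    show "negligible (?N \<union> {0, b})" using g(2) by (simp add: negligible_Un)
    show "vector_derivative f (at x) = g x" if "x \<in> {0..b} - (?N \<union> {0, b})" for x
      using that by (intro vector_derivative_at) auto
  qed
  show "negligible {x \<in> {0<..<b}. \<not> (f has_vector_derivative vector_derivative f (at x)) (at x)}"
    by (rule negligible_subset[OF g(2)]) (auto simp: vector_derivative_works[symmetric] differentiableI_vector)
qed

section \<open>Principal value and Witten index\<close>

lemma integrable_bounded_borel_mult:
  fixes c v :: "real \<Rightarrow> complex"
  assumes c: "c \<in> borel_measurable borel" and b: "\<And>t. t \<in> S \<Longrightarrow> norm (c t) \<le> B"
    and v: "v absolutely_integrable_on S" and S: "S \<in> sets borel"
  shows "(\<lambda>t. c t * v t) absolutely_integrable_on S"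
proof (rule absolutely_integrable_bounded_measurable_product[OF bilinear_times _ _ _ v])
  show "c \<in> borel_measurable (lebesgue_on S)"
    by (rule measurable_restrict_space1) (rule measurable_completion, use c in simp)
  show "S \<in> sets lebesgue" using S by simp
  show "bounded (c ` S)" using b by (auto simp: bounded_iff)
qed

text \<open>On the complement of fixed disjoint arcs around the zeros \<open>\<bar>f\<bar>\<close> is bounded below, so nothing
  depends on \<open>\<epsilon>\<close> there and the regularized integrals converge by dominated convergence. On each
  arc both limits are those of \<open>symmetric_cutoff_limit\<close>.\<close>

theorem regularized_log_derivative_limit:
  fixes f :: "real \<Rightarrow> complex" and \<delta> :: real
  assumes f: "periodic_2pi f" "absolutely_continuous_on 0 (2 * pi) f"
    and fin: "finite (circle_zeros f)"
    and \<delta>: "0 < \<delta>" "\<delta> < pi"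
    and g: "\<forall>z\<in>circle_zeros f. \<exists>g :: real \<Rightarrow> complex. C1_within g {z - \<delta>..z + \<delta>} \<and>
           (\<forall>t\<in>{z - \<delta>..z + \<delta>} - {z}.
              vector_derivative f (at t) / f t = g t / complex_of_real (t - z))"
    and h: "\<forall>z\<in>circle_zeros f. \<exists>\<beta>>0. \<exists>h :: real \<Rightarrow> real. C1_within h {z - \<delta>..z + \<delta>} \<and>
           (\<forall>t\<in>{z - \<delta>..z + \<delta>}.
              (norm (f t))\<^sup>2 = \<bar>t - z\<bar> powr \<beta> * h t \<and> h t > 0)"
  shows "\<exists>I. has_pv_integral (\<lambda>t. vector_derivative f (at t) / f t) (circle_zeros f) I \<and>
    ((\<lambda>s. integral {0..2 * pi} (\<lambda>t. of_real (1 - exp (- s * (norm (f t))\<^sup>2)) *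
        (vector_derivative f (at t) / f t))) \<longlongrightarrow> I) at_top"
proof -
  define Z where "Z = circle_zeros f"
  define \<phi> where "\<phi> t = vector_derivative f (at t) / f t" for t
  define W where "W s t = complex_of_real (1 - exp (- s * (norm (f t))\<^sup>2))" for s t
  have fc: "continuous_on UNIV f" by (rule periodic_absolutely_continuous_continuous[OF f])
  have fm [measurable]: "f \<in> borel_measurable borel" by (rule borel_measurable_continuous_onI[OF fc])
  have fp: "f (t + 2 * pi) = f t" for t using f(1) by (simp add: periodic_2pi_def)
  obtain M where M: "\<And>t. norm (f t) \<le> M" using continuous_periodic_bounded[OF fc f(1)] by blast
  have M0: "0 \<le> M" by (rule order_trans[OF norm_ge_zero M])
  have \<phi>p: "\<phi> (t + 2 * pi) = \<phi> t" for t
    using periodic_vector_derivative[of f "2 * pi" t] fp by (simp add: \<phi>_def)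
  have Wp: "W s (t + 2 * pi) = W s t" for s t by (simp add: W_def fp)
  have v: "(\<lambda>t. vector_derivative f (at t)) absolutely_integrable_on {0..2 * pi}"
    by (rule absolutely_continuous_vector_derivative(1)[OF _ f(2)]) simp
  have finZ: "finite Z" and Zsub: "Z \<subseteq> {0..<2 * pi}" using fin by (auto simp: Z_def circle_zeros_def)
  obtain \<rho>0 where \<rho>0: "\<rho>0 > 0"
    "\<And>z w. z \<in> Z \<Longrightarrow> w \<in> Z \<Longrightarrow> z \<noteq> w \<Longrightarrow> arcs_around {z} \<rho>0 \<inter> arcs_around {w} \<rho>0 = {}"
    using disjoint_arcs_exist[OF finZ Zsub] by blast
  define \<rho> where "\<rho> = min \<rho>0 \<delta>"
  have \<rho>: "0 < \<rho>" "\<rho> \<le> \<delta>" "\<rho> \<le> pi" "0 \<le> \<rho>" using \<rho>0(1) \<delta> by (auto simp: \<rho>_def)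
  have disj: "arcs_around {z} \<rho> \<inter> arcs_around {w} \<rho> = {}" if "z \<in> Z" "w \<in> Z" "z \<noteq> w" for z w
    using \<rho>0(2)[OF that] arcs_around_mono[of \<rho> \<rho>0] by (fastforce simp: \<rho>_def)
  define A where "A = arcs_around Z \<rho>"

  have nz: "f t \<noteq> 0" if t: "t \<in> {0..2 * pi}" "t \<notin> arcs_around Z \<epsilon>" "\<epsilon> > 0" for t \<epsilon>
  proof
    assume ft: "f t = 0"
    have arc: "z \<in> Z \<Longrightarrow> \<bar>t - z - 2 * pi * of_int k\<bar> < \<epsilon> \<Longrightarrow> False" for z and k :: int
      using t(2) unfolding arcs_around_def by blast
    show False
    proof (cases "t = 2 * pi")
      case True
      then have "0 \<in> Z" using ft fp[of 0] by (simp add: Z_def circle_zeros_def)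
      from arc[OF this, of 1] True t(3) show ?thesis by simp
    next
      case False
      then have "t \<in> Z" using ft t(1) by (simp add: Z_def circle_zeros_def)
      from arc[OF this, of 0] t(3) show ?thesis by simp
    qed
  qed
  \<comment> \<open>away from the zeros \<open>1 / f\<close> is bounded\<close>
  have off: "(\<lambda>t. indicator (- arcs_around Z \<epsilon>) t *\<^sub>R \<phi> t) absolutely_integrable_on {0..2 * pi}" if "\<epsilon> > 0" for \<epsilon>
  proof -
    let ?K = "{0..2 * pi} \<inter> - arcs_around Z \<epsilon>"
    have "compact ?K" by (intro compact_Int_closed compact_Icc) (simp add: closed_def open_arcs_around)
    moreover have "continuous_on ?K (\<lambda>t. inverse (f t))"
      by (intro continuous_on_inverse continuous_on_subset[OF fc]) (use nz that in auto)
    ultimately have "bounded ((\<lambda>t. inverse (f t)) ` ?K)" by (intro compact_imp_bounded compact_continuous_image)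
    then obtain B where B: "\<And>t. t \<in> ?K \<Longrightarrow> norm (inverse (f t)) \<le> B" unfolding bounded_iff by blast
    have "(\<lambda>t. (indicator (- arcs_around Z \<epsilon>) t *\<^sub>R inverse (f t)) * vector_derivative f (at t)) absolutely_integrable_on {0..2 * pi}"
    proof (rule integrable_bounded_borel_mult[OF _ _ v])
      have [measurable]: "- arcs_around Z \<epsilon> \<in> sets borel" by (auto simp: open_arcs_around)
      show "(\<lambda>t. indicator (- arcs_around Z \<epsilon>) t *\<^sub>R inverse (f t)) \<in> borel_measurable borel" by measurable
      show "norm (indicator (- arcs_around Z \<epsilon>) t *\<^sub>R inverse (f t)) \<le> \<bar>B\<bar>" if "t \<in> {0..2 * pi}" for t
        using B[of t] that by (cases "t \<in> arcs_around Z \<epsilon>") auto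
    qed simp
    then show ?thesis by (simp add: \<phi>_def divide_inverse mult.commute)
  qed
  \<comment> \<open>\<open>1 - exp (- x) \<le> x\<close> shows that \<open>W s / f\<close> is bounded by \<open>s \<bar>f\<bar>\<close>\<close>
  have heat: "(\<lambda>t. W s t * \<phi> t) absolutely_integrable_on {0..2 * pi}" if s: "s \<ge> 0" for s
  proof -
    have "(\<lambda>t. (W s t / f t) * vector_derivative f (at t)) absolutely_integrable_on {0..2 * pi}"
    proof (rule integrable_bounded_borel_mult[OF _ _ v])
      show "(\<lambda>t. W s t / f t) \<in> borel_measurable borel" unfolding W_def by measurable
      show "norm (W s t / f t) \<le> s * M" for t
      proof (cases "f t = 0")
        case False
        have "1 - exp (- (s * (norm (f t))\<^sup>2)) \<le> s * (norm (f t))\<^sup>2"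
          using exp_ge_add_one_self[of "- (s * (norm (f t))\<^sup>2)"] by linarith
        moreover have "0 \<le> 1 - exp (- (s * (norm (f t))\<^sup>2))" using s by simp
        ultimately have "norm (W s t / f t) \<le> s * (norm (f t))\<^sup>2 / norm (f t)"
          by (simp add: W_def norm_divide divide_right_mono del: of_real_diff)
        also have "\<dots> = s * norm (f t)" by (simp add: power2_eq_square)
        also have "\<dots> \<le> s * M" by (intro mult_left_mono M s)
        finally show ?thesis .
      qed (use s M0 in simp)
    qed simp
    then show ?thesis by (simp add: \<phi>_def)
  qed

  obtain G where GC: "\<And>z. z \<in> Z \<Longrightarrow> C1_within (G z) {z - \<delta>..z + \<delta>}"
    and G\<phi>: "\<And>z t. \<lbrakk>z \<in> Z; t \<in> {z - \<delta>..z + \<delta>} - {z}\<rbrakk> \<Longrightarrow> \<phi> t = G z t / complex_of_real (t - z)"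
    using bchoice[OF g] unfolding Z_def \<phi>_def by blast
  from h have "\<forall>z\<in>Z. \<exists>\<beta>. \<exists>h :: real \<Rightarrow> real. C1_within h {z - \<delta>..z + \<delta>} \<and>
      (\<forall>t\<in>{z - \<delta>..z + \<delta>}. (norm (f t))\<^sup>2 = \<bar>t - z\<bar> powr \<beta> * h t \<and> h t > 0)" unfolding Z_def by blast
  from bchoice[OF this] obtain \<beta> where "\<forall>z\<in>Z. \<exists>h :: real \<Rightarrow> real. C1_within h {z - \<delta>..z + \<delta>} \<and>
      (\<forall>t\<in>{z - \<delta>..z + \<delta>}. (norm (f t))\<^sup>2 = \<bar>t - z\<bar> powr \<beta> z * h t \<and> h t > 0)" by blast
  from bchoice[OF this] obtain H where HC: "\<And>z. z \<in> Z \<Longrightarrow> C1_within (H z) {z - \<delta>..z + \<delta>}"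
    and Hf: "\<And>z t. \<lbrakk>z \<in> Z; t \<in> {z - \<delta>..z + \<delta>}\<rbrakk> \<Longrightarrow> (norm (f t))\<^sup>2 = \<bar>t - z\<bar> powr \<beta> z * H z t"
    and Hpos: "\<And>z t. \<lbrakk>z \<in> Z; t \<in> {z - \<delta>..z + \<delta>}\<rbrakk> \<Longrightarrow> H z t > 0" by blast
  define q where "q z u = (G z (z + u) - G z (z + - u)) / complex_of_real u" for z u
  define Q where "Q z s u = (complex_of_real (1 - exp (- s * (u powr \<beta> z * H z (z + u)))) * G z (z + u) -
      complex_of_real (1 - exp (- s * (u powr \<beta> z * H z (z + - u)))) * G z (z + - u)) / complex_of_real u" for z s u
  have loc: "((\<lambda>\<epsilon>. integral {\<epsilon>..\<rho>} (q z)) \<longlongrightarrow> integral {0..\<rho>} (q z)) (at_right 0)"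
    "((\<lambda>s. integral {0..\<rho>} (Q z s)) \<longlongrightarrow> integral {0..\<rho>} (q z)) at_top" if z: "z \<in> Z" for z
  proof -
    obtain KG where KG: "\<And>x y. x \<in> {z - \<delta>..z + \<delta>} \<Longrightarrow> y \<in> {z - \<delta>..z + \<delta>} \<Longrightarrow> norm (G z y - G z x) \<le> KG * \<bar>y - x\<bar>"
      using C1_within_Lipschitz[OF GC[OF z]] by blast
    obtain KH where KH: "\<And>x y. x \<in> {z - \<delta>..z + \<delta>} \<Longrightarrow> y \<in> {z - \<delta>..z + \<delta>} \<Longrightarrow> norm (H z y - H z x) \<le> KH * \<bar>y - x\<bar>"
      using C1_within_Lipschitz[OF HC[OF z]] by blast
    have in\<delta>: "z + x \<in> {z - \<delta>..z + \<delta>}" if "x \<in> {-\<rho>..\<rho>}" for x using that \<rho> by auto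
    have Glip: "norm (G z (z + y) - G z (z + x)) \<le> KG * \<bar>y - x\<bar>" if "x \<in> {-\<rho>..\<rho>}" "y \<in> {-\<rho>..\<rho>}" for x y
      using KG[OF in\<delta>[OF that(1)] in\<delta>[OF that(2)]] by simp
    have Hlip: "norm (H z (z + y) - H z (z + x)) \<le> KH * \<bar>y - x\<bar>" if "x \<in> {-\<rho>..\<rho>}" "y \<in> {-\<rho>..\<rho>}" for x y
      using KH[OF in\<delta>[OF that(1)] in\<delta>[OF that(2)]] by simp
    have pos: "H z (z + x) > 0" if "x \<in> {-\<rho>..\<rho>}" for x using Hpos[OF z in\<delta>[OF that]] .
    note lip = \<rho>(1) Glip Hlip pos
    show "((\<lambda>\<epsilon>. integral {\<epsilon>..\<rho>} (q z)) \<longlongrightarrow> integral {0..\<rho>} (q z)) (at_right 0)"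
      using symmetric_cutoff_limit(1)[where G = "\<lambda>u. G z (z + u)" and H = "\<lambda>u. H z (z + u)", OF lip]
      unfolding q_def[abs_def] by simp
    show "((\<lambda>s. integral {0..\<rho>} (Q z s)) \<longlongrightarrow> integral {0..\<rho>} (q z)) at_top"
      using symmetric_cutoff_limit(2)[where G = "\<lambda>u. G z (z + u)" and H = "\<lambda>u. H z (z + u)" and \<beta> = "\<beta> z", OF lip]
      unfolding q_def[abs_def] Q_def[abs_def] by simp
  qed
  have \<phi>loc: "\<phi> (z + u) = G z (z + u) / complex_of_real u" "\<phi> (z - u) = - (G z (z + - u) / complex_of_real u)"
    if "z \<in> Z" "0 < u" "u \<le> \<rho>" for z u
    using G\<phi>[OF that(1), of "z + u"] G\<phi>[OF that(1), of "z - u"] that(2,3) \<rho>(2) by auto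
  have Wloc: "W s (z + u) = complex_of_real (1 - exp (- s * (u powr \<beta> z * H z (z + u))))"
    "W s (z - u) = complex_of_real (1 - exp (- s * (u powr \<beta> z * H z (z + - u))))"
    if "z \<in> Z" "0 < u" "u \<le> \<rho>" for z u s
    using Hf[OF that(1), of "z + u"] Hf[OF that(1), of "z - u"] that(2,3) \<rho>(2) by (auto simp: W_def)
  define I where "I = integral {0..2 * pi} (\<lambda>t. indicator (- A) t *\<^sub>R \<phi> t) + (\<Sum>z\<in>Z. integral {0..\<rho>} (q z))"

  have trunc: "set_integrable lebesgue ({0..<2 * pi} - arcs_around Z \<epsilon>) \<phi>"
    "(LINT t:{0..<2 * pi} - arcs_around Z \<epsilon>|lebesgue. \<phi> t) =
      integral {0..2 * pi} (\<lambda>t. indicator (- A) t *\<^sub>R \<phi> t) + (\<Sum>z\<in>Z. integral {\<epsilon>..\<rho>} (q z))"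
    if \<epsilon>: "0 < \<epsilon>" "\<epsilon> < \<rho>" for \<epsilon>
  proof -
    define \<Psi> where "\<Psi> t = indicator (- arcs_around Z \<epsilon>) t *\<^sub>R \<phi> t" for t
    have \<Psi>: "\<Psi> absolutely_integrable_on {0..2 * pi}" unfolding \<Psi>_def[abs_def] by (rule off[OF \<epsilon>(1)])
    have \<Psi>p: "\<Psi> (t + 2 * pi) = \<Psi> t" for t by (simp add: \<Psi>_def \<phi>p indicator_def arcs_around_periodic)
    have "set_integrable lebesgue ({0..2 * pi} - arcs_around Z \<epsilon>) \<phi>"
      using \<Psi> by (simp add: set_integrable_def \<Psi>_def indicator_inter_arith[symmetric] Diff_eq)
    then show si: "set_integrable lebesgue ({0..<2 * pi} - arcs_around Z \<epsilon>) \<phi>"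
      by (rule set_integrable_subset) (auto simp: open_arcs_around)
    have "(LINT t:{0..<2 * pi} - arcs_around Z \<epsilon>|lebesgue. \<phi> t) = integral ({0..<2 * pi} - arcs_around Z \<epsilon>) \<phi>"
      by (rule set_lebesgue_integral_eq_integral(2)[OF si])
    also have "\<dots> = integral ((- arcs_around Z \<epsilon>) \<inter> {0..2 * pi}) \<phi>"
      by (rule integral_spike_set) (auto intro: negligible_subset[OF negligible_sing[of "2 * pi"]])
    also have "\<dots> = integral {0..2 * pi} \<Psi>"
      unfolding integral_restrict_Int[symmetric] by (rule integral_cong) (simp add: \<Psi>_def indicator_def)
    also have "\<dots> = integral {0..2 * pi} (\<lambda>t. indicator (- A) t *\<^sub>R \<Psi> t) + (\<Sum>z\<in>Z. integral {0..\<rho>} (\<lambda>u. \<Psi> (z + u) + \<Psi> (z - u)))"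
      unfolding A_def by (rule integral_circle_arcs[OF \<Psi>p \<Psi> \<rho>(4,3) finZ disj])
    also have "(\<lambda>t. indicator (- A) t *\<^sub>R \<Psi> t) = (\<lambda>t. indicator (- A) t *\<^sub>R \<phi> t)"
      using arcs_around_mono[of \<epsilon> \<rho> Z] \<epsilon> by (auto simp: fun_eq_iff \<Psi>_def A_def indicator_def)
    also have "(\<Sum>z\<in>Z. integral {0..\<rho>} (\<lambda>u. \<Psi> (z + u) + \<Psi> (z - u))) = (\<Sum>z\<in>Z. integral {\<epsilon>..\<rho>} (q z))"
    proof (rule sum.cong[OF refl])
      fix z assume z: "z \<in> Z"
      have "integral {0..\<rho>} (\<lambda>u. \<Psi> (z + u) + \<Psi> (z - u)) = integral {0..\<rho>} (\<lambda>u. if u \<in> {\<epsilon>..\<rho>} then q z u else 0)"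
      proof (rule integral_spike[of "{0, \<rho>}"])
        fix u assume "u \<in> {0..\<rho>} - {0, \<rho>}"
        then have u: "0 < u" "u < \<rho>" by auto
        have mem: "z + x \<in> arcs_around Z \<epsilon> \<longleftrightarrow> \<bar>x\<bar> < \<epsilon>" if "\<bar>x\<bar> < \<rho>" for x
        proof -
          have own: "z + x \<in> arcs_around {z} \<rho>" using mem_arc_iff[of x \<rho> z] that \<rho> by auto
          have "z + x \<in> arcs_around Z \<epsilon> \<longleftrightarrow> z + x \<in> arcs_around {z} \<epsilon>"
          proof
            assume "z + x \<in> arcs_around Z \<epsilon>"
            then obtain w where w: "w \<in> Z" "z + x \<in> arcs_around {w} \<epsilon>" unfolding arcs_around_Un[of Z] by blast
            then have "z + x \<in> arcs_around {w} \<rho>" using arcs_around_mono[of \<epsilon> \<rho> "{w}"] \<epsilon> by auto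
            then have "w = z" using disj[OF z w(1)] own by blast
            then show "z + x \<in> arcs_around {z} \<epsilon>" using w(2) by simp
          qed (use z in \<open>auto simp: arcs_around_Un[of Z]\<close>)
          then show ?thesis using mem_arc_iff[of x \<epsilon> z] that \<rho> \<epsilon> by auto
        qed
        have "z + u \<in> arcs_around Z \<epsilon> \<longleftrightarrow> u < \<epsilon>" "z - u \<in> arcs_around Z \<epsilon> \<longleftrightarrow> u < \<epsilon>"
          using mem[of u] mem[of "- u"] u by auto
        then show "(if u \<in> {\<epsilon>..\<rho>} then q z u else 0) = \<Psi> (z + u) + \<Psi> (z - u)"
          using \<phi>loc[OF z u(1)] u by (auto simp: \<Psi>_def indicator_def q_def diff_divide_distrib)
      qed simp
      also have "\<dots> = integral ({\<epsilon>..\<rho>} \<inter> {0..\<rho>}) (q z)" by (rule integral_restrict_Int)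
      also have "{\<epsilon>..\<rho>} \<inter> {0..\<rho>} = {\<epsilon>..\<rho>}" using \<epsilon> by auto
      finally show "integral {0..\<rho>} (\<lambda>u. \<Psi> (z + u) + \<Psi> (z - u)) = integral {\<epsilon>..\<rho>} (q z)" .
    qed
    finally show "(LINT t:{0..<2 * pi} - arcs_around Z \<epsilon>|lebesgue. \<phi> t) =
      integral {0..2 * pi} (\<lambda>t. indicator (- A) t *\<^sub>R \<phi> t) + (\<Sum>z\<in>Z. integral {\<epsilon>..\<rho>} (q z))" .
  qed
  have small: "\<forall>\<^sub>F \<epsilon> in at_right 0. 0 < \<epsilon> \<and> \<epsilon> < \<rho>"
    using eventually_at_right_real[OF \<rho>(1)] by eventually_elim simp
  have pv: "has_pv_integral \<phi> Z I"
    unfolding has_pv_integral_def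
  proof
    show "\<forall>\<^sub>F \<epsilon> in at_right 0. set_integrable lebesgue ({0..<2 * pi} - arcs_around Z \<epsilon>) \<phi>"
      using small by eventually_elim (simp add: trunc(1))
    have "((\<lambda>\<epsilon>. integral {0..2 * pi} (\<lambda>t. indicator (- A) t *\<^sub>R \<phi> t) + (\<Sum>z\<in>Z. integral {\<epsilon>..\<rho>} (q z))) \<longlongrightarrow> I) (at_right 0)"
      unfolding I_def by (intro tendsto_add tendsto_const tendsto_sum loc(1))
    then show "((\<lambda>\<epsilon>. LINT t:{0..<2 * pi} - arcs_around Z \<epsilon>|lebesgue. \<phi> t) \<longlongrightarrow> I) (at_right 0)"
      by (rule Lim_transform_eventually) (use small in eventually_elim, simp add: trunc(2))
  qed

  have reg: "integral {0..2 * pi} (\<lambda>t. W s t * \<phi> t) =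
      integral {0..2 * pi} (\<lambda>t. indicator (- A) t *\<^sub>R (W s t * \<phi> t)) + (\<Sum>z\<in>Z. integral {0..\<rho>} (Q z s))"
    if s: "s \<ge> 0" for s
  proof -
    have p: "W s (t + 2 * pi) * \<phi> (t + 2 * pi) = W s t * \<phi> t" for t by (simp add: Wp \<phi>p)
    have "integral {0..2 * pi} (\<lambda>t. W s t * \<phi> t) = integral {0..2 * pi} (\<lambda>t. indicator (- A) t *\<^sub>R (W s t * \<phi> t)) +
        (\<Sum>z\<in>Z. integral {0..\<rho>} (\<lambda>u. W s (z + u) * \<phi> (z + u) + W s (z - u) * \<phi> (z - u)))"
      unfolding A_def by (rule integral_circle_arcs[where \<Psi> = "\<lambda>t. W s t * \<phi> t", OF p heat[OF s] \<rho>(4,3) finZ disj])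
    also have "(\<Sum>z\<in>Z. integral {0..\<rho>} (\<lambda>u. W s (z + u) * \<phi> (z + u) + W s (z - u) * \<phi> (z - u))) = (\<Sum>z\<in>Z. integral {0..\<rho>} (Q z s))"
    proof (rule sum.cong[OF refl], rule integral_spike[of "{0}"])
      fix z u assume "z \<in> Z" and u: "u \<in> {0..\<rho>} - {0}"
      then have z: "z \<in> Z" "0 < u" "u \<le> \<rho>" by auto
      show "Q z s u = W s (z + u) * \<phi> (z + u) + W s (z - u) * \<phi> (z - u)"
        unfolding \<phi>loc[OF z] Wloc[OF z] Q_def by (simp only: diff_divide_distrib times_divide_eq_right mult_minus_right add_uminus_conv_diff)
    qed simp
    finally show ?thesis .
  qed
  have outer: "((\<lambda>s. integral {0..2 * pi} (\<lambda>t. indicator (- A) t *\<^sub>R (W s t * \<phi> t))) \<longlongrightarrow>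
      integral {0..2 * pi} (\<lambda>t. indicator (- A) t *\<^sub>R \<phi> t)) at_top"
  proof (rule tendsto_at_top_nonneg_sequentially)
    fix X :: "nat \<Rightarrow> real" assume X: "\<And>n. 0 \<le> X n" "filterlim X at_top sequentially"
    have offA: "(\<lambda>t. indicator (- A) t *\<^sub>R \<phi> t) absolutely_integrable_on {0..2 * pi}"
      unfolding A_def by (rule off[OF \<rho>(1)])
    show "(\<lambda>n. integral {0..2 * pi} (\<lambda>t. indicator (- A) t *\<^sub>R (W (X n) t * \<phi> t))) \<longlonglongrightarrow>
        integral {0..2 * pi} (\<lambda>t. indicator (- A) t *\<^sub>R \<phi> t)"
    proof (rule dominated_convergence(2))
      show "(\<lambda>t. norm (indicator (- A) t *\<^sub>R \<phi> t)) integrable_on {0..2 * pi}"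
        using offA unfolding absolutely_integrable_on_def by blast
      show "(\<lambda>t. indicator (- A) t *\<^sub>R (W (X n) t * \<phi> t)) integrable_on {0..2 * pi}" for n
        by (rule set_lebesgue_integral_eq_integral(1)[OF absolutely_integrable_indicator[OF heat[OF X(1)]]])
          (auto simp: A_def open_arcs_around)
      show "norm (indicator (- A) t *\<^sub>R (W (X n) t * \<phi> t)) \<le> norm (indicator (- A) t *\<^sub>R \<phi> t)" for n t
      proof -
        have "0 \<le> exp (- X n * (norm (f t))\<^sup>2)" "exp (- X n * (norm (f t))\<^sup>2) \<le> 1" using X(1)[of n] by auto
        then have "norm (W (X n) t) \<le> 1" unfolding W_def norm_of_real by linarith
        then have "norm (W (X n) t) * norm (\<phi> t) \<le> 1 * norm (\<phi> t)" by (intro mult_right_mono) auto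
        then show ?thesis by (simp add: norm_mult mult_left_mono)
      qed
      show "(\<lambda>n. indicator (- A) t *\<^sub>R (W (X n) t * \<phi> t)) \<longlonglongrightarrow> indicator (- A) t *\<^sub>R \<phi> t" if t: "t \<in> {0..2 * pi}" for t
      proof (cases "t \<in> A")
        case False
        then have "(norm (f t))\<^sup>2 > 0" using nz[OF t _ \<rho>(1)] by (simp add: A_def)
        from filterlim_at_top_mult_tendsto_pos[OF tendsto_const this X(2)]
        have "filterlim (\<lambda>n. - (X n * (norm (f t))\<^sup>2)) at_bot sequentially" by (simp add: filterlim_uminus_at_top)
        from filterlim_compose[OF exp_at_bot this] have "(\<lambda>n. exp (- X n * (norm (f t))\<^sup>2)) \<longlonglongrightarrow> 0" by simp
        then have "(\<lambda>n. W (X n) t * \<phi> t) \<longlonglongrightarrow> complex_of_real (1 - 0) * \<phi> t"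
          unfolding W_def by (intro tendsto_intros)
        then have "(\<lambda>n. W (X n) t * \<phi> t) \<longlonglongrightarrow> \<phi> t" by simp
        then show ?thesis by (intro tendsto_intros)
      qed simp
    qed
  qed
  have "((\<lambda>s. integral {0..2 * pi} (\<lambda>t. indicator (- A) t *\<^sub>R (W s t * \<phi> t)) + (\<Sum>z\<in>Z. integral {0..\<rho>} (Q z s))) \<longlongrightarrow> I) at_top"
    unfolding I_def by (intro tendsto_add outer tendsto_sum loc(2))
  then have "((\<lambda>s. integral {0..2 * pi} (\<lambda>t. W s t * \<phi> t)) \<longlongrightarrow> I) at_top"
    by (rule Lim_transform_eventually)
      (use eventually_ge_at_top[of "0::real"] in eventually_elim, simp add: reg)
  with pv show ?thesis unfolding W_def \<phi>_def[abs_def] Z_def by blast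
qed

theorem theorem3p2:
  fixes f :: "real \<Rightarrow> complex" and \<delta> :: real
  assumes "f \<in> sobolev_half_2 \<inter> sobolev_1_1"
    and "finite (circle_zeros f)"
    and "0 < \<delta>" and "\<delta> < pi"
    and "\<forall>z\<in>circle_zeros f. \<forall>t\<in>{z - \<delta>..z + \<delta>} - {z}. f differentiable (at t)"
    and "\<forall>z\<in>circle_zeros f. \<exists>g :: real \<Rightarrow> complex. C1_within g {z - \<delta>..z + \<delta>} \<and>
           (\<forall>t\<in>{z - \<delta>..z + \<delta>} - {z}.
              vector_derivative f (at t) / f t = g t / complex_of_real (t - z))"
    and "\<forall>z\<in>circle_zeros f. \<exists>\<beta>>0. \<exists>h :: real \<Rightarrow> real. C1_within h {z - \<delta>..z + \<delta>} \<and>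
           (\<forall>t\<in>{z - \<delta>..z + \<delta>}.
              (norm (f t))\<^sup>2 = \<bar>t - z\<bar> powr \<beta> * h t \<and> h t > 0)"
  shows "\<exists>I. has_pv_integral (\<lambda>t. vector_derivative f (at t) / f t) (circle_zeros f) I \<and>
             has_witten_index (toeplitz f) (- 1 / (2 * complex_of_real pi * \<i>) * I)"
proof -
  have f: "f \<in> sobolev_half_2" "periodic_2pi f" "absolutely_continuous_on 0 (2 * pi) f"
    using assms(1) by (auto simp: sobolev_1_1_def)
  have fb: "bounded_symbol f"
    by (rule bounded_symbol_continuous_periodic[OF periodic_absolutely_continuous_continuous[OF f(2,3)] f(2)])
  have fk: "krein_symbol f" by (rule sobolev_half_2_krein[OF f(1) fb])
  obtain I where I: "has_pv_integral (\<lambda>t. vector_derivative f (at t) / f t) (circle_zeros f) I"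
    "((\<lambda>s. integral {0..2 * pi} (\<lambda>t. of_real (1 - exp (- s * (norm (f t))\<^sup>2)) *
        (vector_derivative f (at t) / f t))) \<longlongrightarrow> I) at_top"
    using regularized_log_derivative_limit[OF f(2,3) assms(2,3,4,6,7)] by blast
  have "0 < 2 * pi" by simp
  note v = absolutely_continuous_vector_derivative[OF this f(3)]
  have "((\<lambda>s. trace_op (heat_difference (toeplitz f) s)) \<longlongrightarrow> - 1 / (2 * complex_of_real pi * \<i>) * I) at_top"
    unfolding heat_trace_integral[OF f(2,3) fk v] by (intro tendsto_mult tendsto_const I(2))
  then have "has_witten_index (toeplitz f) (- 1 / (2 * complex_of_real pi * \<i>) * I)"
    unfolding has_witten_index_def
    using adjoint_pair_bounded_clinear[OF adjoint_pair_toeplitz[OF fb]] toeplitz_heat_trace(1,2)[OF fk] by blast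
  with I(1) show ?thesis by blast
qed

end
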